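(* Let $H\in(\frac12,1)$, $\theta,\rho>0$, $\theta\neq\rho$, let $X$ solve $X_0=0$, $dX_t=-\theta X_t\,dt+dV_t$, where $V_0=0$, $dV_t=-\rho V_t\,dt+dB^H_t$, $B^H$ a fractional Brownian motion of Hurst index $H$. Let $\Delta_n>0$, $t_i=i\Delta_n$, $T_n=n\Delta_n\to\infty$, $Q_n(X)=\frac1n\sum_{i=1}^n X_{t_{i-1}}^2$, and $$\widetilde\theta_n=-\frac{\frac1{T_n}\int_0^{T_n}X_t\,\delta X_t}{Q_n(X)}.$$ If $\Delta_n\le n^\alpha$ for some $\alpha\in(-\infty,1/H)$, then $\widetilde\theta_n\to\theta^*:=\theta+\rho$ almost surely as $n\to\infty$.
   Context: $B^H$ is a centered Gaussian process with $E(B^H_tB^H_s)=\frac12(t^{2H}+s^{2H}-|t-s|^{2H})$, on a complete probability space whose sigma-field is generated by $B^H$. The symbol $\int_0^T u_t\,\delta B^H_t$ denotes the Skorohod integral (divergence operator of Malliavin calculus with respect to $B^H$); for the processes considered here it equals the Young integral $\int_0^T u_t\,dB^H_t$ minus $H(2H-1)\int_0^T\int_0^T D_su_t|t-s|^{2H-2}\,ds\,dt$, with $D$ the Malliavin derivative. The integral against $X$ is understood as $\int_0^T X_t\,\delta X_t:=-\theta\int_0^T X_t^2\,dt-\rho\int_0^T X_tV_t\,dt+\int_0^T X_t\,\delta B^H_t$. *)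

theory Defs
  imports "HOL-Probability.Probability"
begin

definition centered_gaussian :: "'a measure \<Rightarrow> ('a \<Rightarrow> real) \<Rightarrow> bool" where
  "centered_gaussian M Y \<longleftrightarrow> Y \<in> borel_measurable M \<and>
     ((AE \<omega> in M. Y \<omega> = 0) \<or> (\<exists>\<sigma>>0. distributed M lborel Y (normal_density 0 \<sigma>)))"

text \<open>Time is the half-line: processes are functions on the reals of which only the values at
  nonnegative times matter. As usual, a fractional Brownian motion is a version with almost surely
  continuous paths.\<close>

definition fractional_brownian_motion ::
    "'a measure \<Rightarrow> real \<Rightarrow> (real \<Rightarrow> 'a \<Rightarrow> real) \<Rightarrow> bool" where
  "fractional_brownian_motion M H B \<longleftrightarrow>
     (\<forall>J c. finite J \<and> J \<subseteq> {0..} \<longrightarrow> centered_gaussian M (\<lambda>\<omega>. \<Sum>t\<in>J. c t * B t \<omega>)) \<and>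
     (\<forall>t\<ge>0. \<forall>s\<ge>0. (\<integral>\<omega>. B t \<omega> * B s \<omega> \<partial>M)
        = (t powr (2 * H) + s powr (2 * H) - \<bar>t - s\<bar> powr (2 * H)) / 2) \<and>
     (AE \<omega> in M. continuous_on {0..} (\<lambda>t. B t \<omega>))"

text \<open>On a complete probability space, ``generated by the process'' means generated up to null
  sets.\<close>

definition generated_by_process :: "'a measure \<Rightarrow> (real \<Rightarrow> 'a \<Rightarrow> real) \<Rightarrow> bool" where
  "generated_by_process M B \<longleftrightarrow>
     sets M = sets (completion (restr_to_subalg M
       (sigma (space M) {B t -` A \<inter> space M | t A. 0 \<le> t \<and> A \<in> sets borel})))"

text \<open>The equation \<open>dY = - \<kappa> Y dt + dZ\<close>, \<open>Y\<^sub>0 = 0\<close>, \<open>Z\<^sub>0 = 0\<close>, in integrated form,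
  almost surely for all times simultaneously.\<close>

definition solves_langevin ::
    "'a measure \<Rightarrow> real \<Rightarrow> (real \<Rightarrow> 'a \<Rightarrow> real) \<Rightarrow> (real \<Rightarrow> 'a \<Rightarrow> real) \<Rightarrow> bool" where
  "solves_langevin M \<kappa> Z Y \<longleftrightarrow>
     (AE \<omega> in M. Y 0 \<omega> = 0 \<and>
        (\<forall>t\<ge>0. (\<lambda>s. Y s \<omega>) integrable_on {0..t} \<and>
               Y t \<omega> = - \<kappa> * integral {0..t} (\<lambda>s. Y s \<omega>) + Z t \<omega>))"

text \<open>A function on \<open>\<real>\<^sup>m\<close> is encoded as a function of sequences that depends only on the
  coordinates below \<open>m\<close>; \<open>Cb_smooth m\<close> is the class of such functions that are bounded, smooth and
  have bounded partial derivatives of all orders.\<close>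

definition partial_deriv ::
    "nat \<Rightarrow> ((nat \<Rightarrow> real) \<Rightarrow> real) \<Rightarrow> (nat \<Rightarrow> real) \<Rightarrow> real" where
  "partial_deriv i f x = deriv (\<lambda>h. f (x(i := h))) (x i)"

definition Cb_smooth :: "nat \<Rightarrow> ((nat \<Rightarrow> real) \<Rightarrow> real) \<Rightarrow> bool" where
  "Cb_smooth m f \<longleftrightarrow>
     (\<forall>x y. (\<forall>i<m. x i = y i) \<longrightarrow> f x = f y) \<and>
     (\<forall>is \<in> lists {..<m}. let g = foldr partial_deriv is f in
        continuous_on UNIV g \<and> bounded (range g) \<and>
        (\<forall>i<m. \<forall>x. (\<lambda>h. g (x(i := h))) differentiable at (x i)))"

text \<open>The inner product of the reproducing Hilbert space \<open>\<H>\<close> of fractional Brownian motion for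
  \<open>H > 1/2\<close>, on the subspace \<open>|\<H>|\<close> of functions on which the defining integral converges
  absolutely. It extends \<open>\<langle>1\<^bsub>[0,t]\<^esub>, 1\<^bsub>[0,s]\<^esub>\<rangle> = E(B\<^sub>t B\<^sub>s)\<close>.\<close>

definition H_inner :: "real \<Rightarrow> (real \<Rightarrow> real) \<Rightarrow> (real \<Rightarrow> real) \<Rightarrow> real" where
  "H_inner H \<phi> \<psi> = H * (2 * H - 1) *
     (LBINT t:{0..}. LBINT s:{0..}. \<phi> s * \<psi> t * \<bar>t - s\<bar> powr (2 * H - 2))"

definition abs_H_norm_sq :: "real \<Rightarrow> (real \<Rightarrow> real) \<Rightarrow> ennreal" where
  "abs_H_norm_sq H \<phi> = ennreal (H * (2 * H - 1)) *
     (\<integral>\<^sup>+ t\<in>{0..}. (\<integral>\<^sup>+ s\<in>{0..}. ennreal (\<bar>\<phi> s\<bar> * \<bar>\<phi> t\<bar> * \<bar>t - s\<bar> powr (2 * H - 2)) \<partial>lborel) \<partial>lborel)"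

text \<open>Membership in \<open>L\<^sup>2(\<Omega>; |\<H>|)\<close>, for processes having a jointly measurable version.\<close>

definition L2_abs_H :: "'a measure \<Rightarrow> real \<Rightarrow> (real \<Rightarrow> 'a \<Rightarrow> real) \<Rightarrow> bool" where
  "L2_abs_H M H u \<longleftrightarrow>
     (\<exists>w. (\<lambda>(t, \<omega>). w t \<omega>) \<in> borel_measurable (lborel \<Otimes>\<^sub>M M) \<and>
          (AE \<omega> in M. AE t in lborel. 0 \<le> t \<longrightarrow> w t \<omega> = u t \<omega>) \<and>
          (\<integral>\<^sup>+ \<omega>. abs_H_norm_sq H (\<lambda>t. w t \<omega>) \<partial>M) < \<infinity>)"

text \<open>The Malliavin derivative \<open>D\<^sub>s F\<close> of the smooth cylindrical random variable
  \<open>F = f (B\<^bsub>\<tau> 0\<^esub>, \<dots>, B\<^bsub>\<tau> (m - 1)\<^esub>)\<close>.\<close>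

definition cylindrical ::
    "(real \<Rightarrow> 'a \<Rightarrow> real) \<Rightarrow> ((nat \<Rightarrow> real) \<Rightarrow> real) \<Rightarrow> (nat \<Rightarrow> real) \<Rightarrow> 'a \<Rightarrow> real" where
  "cylindrical B f \<tau> \<omega> = f (\<lambda>i. B (\<tau> i) \<omega>)"

definition malliavin_deriv ::
    "(real \<Rightarrow> 'a \<Rightarrow> real) \<Rightarrow> nat \<Rightarrow> ((nat \<Rightarrow> real) \<Rightarrow> real) \<Rightarrow> (nat \<Rightarrow> real) \<Rightarrow> real \<Rightarrow> 'a \<Rightarrow> real" where
  "malliavin_deriv B m f \<tau> s \<omega> =
     (\<Sum>i<m. cylindrical B (partial_deriv i f) \<tau> \<omega> * indicator {0..\<tau> i} s)"

text \<open>The divergence operator as the adjoint of the Malliavin derivative: \<open>\<delta>(u) = G\<close> means that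
  \<open>G\<close> is square integrable and \<open>E(F G) = E\<langle>DF, u\<rangle>\<close> for all smooth cylindrical \<open>F\<close>. Since
  these are a core of the closed operator \<open>D\<close>, no further test variables are needed. Such a \<open>G\<close> is
  unique up to almost sure equality when the sigma-field is generated by \<open>B\<close>.\<close>

definition is_divergence ::
    "'a measure \<Rightarrow> real \<Rightarrow> (real \<Rightarrow> 'a \<Rightarrow> real) \<Rightarrow> (real \<Rightarrow> 'a \<Rightarrow> real) \<Rightarrow> ('a \<Rightarrow> real) \<Rightarrow> bool" where
  "is_divergence M H B u G \<longleftrightarrow>
     L2_abs_H M H u \<and> G \<in> borel_measurable M \<and> integrable M (\<lambda>\<omega>. (G \<omega>)\<^sup>2) \<and>
     (\<forall>m f \<tau>. Cb_smooth m f \<and> (\<forall>i<m. 0 \<le> \<tau> i) \<longrightarrow>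
        (\<integral>\<omega>. cylindrical B f \<tau> \<omega> * G \<omega> \<partial>M) =
        (\<integral>\<omega>. H_inner H (\<lambda>s. malliavin_deriv B m f \<tau> s \<omega>) (\<lambda>t. u t \<omega>) \<partial>M))"

definition skorohod_integral ::
    "'a measure \<Rightarrow> real \<Rightarrow> (real \<Rightarrow> 'a \<Rightarrow> real) \<Rightarrow> real \<Rightarrow> (real \<Rightarrow> 'a \<Rightarrow> real) \<Rightarrow> 'a \<Rightarrow> real" where
  "skorohod_integral M H B T u =
     (SOME G. is_divergence M H B (\<lambda>t \<omega>. indicator {0..T} t * u t \<omega>) G)"

text \<open>The integral \<open>\<integral>\<^sub>0\<^sup>T X\<^sub>t \<delta>X\<^sub>t\<close>, where \<open>dX = (- \<theta> X - \<rho> V) dt + dB\<close>.\<close>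

definition skorohod_integral_X where
  "skorohod_integral_X M H B \<theta> \<rho> V X T \<omega> =
     - \<theta> * integral {0..T} (\<lambda>t. (X t \<omega>)\<^sup>2) - \<rho> * integral {0..T} (\<lambda>t. X t \<omega> * V t \<omega>)
     + skorohod_integral M H B T X (\<omega> :: 'a)"

definition Q_stat :: "(nat \<Rightarrow> real) \<Rightarrow> (real \<Rightarrow> 'a \<Rightarrow> real) \<Rightarrow> nat \<Rightarrow> 'a \<Rightarrow> real" where
  "Q_stat \<Delta> X n \<omega> = (1 / real n) * (\<Sum>i=1..n. (X (real (i - 1) * \<Delta> n) \<omega>)\<^sup>2)"

definition theta_tilde where
  "theta_tilde M H B \<theta> \<rho> V X \<Delta> n \<omega> =
     - ((1 / (real n * \<Delta> n)) * skorohod_integral_X M H B \<theta> \<rho> V X (real n * \<Delta> n) \<omega>)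
       / Q_stat \<Delta> X n \<omega>"

end

theory Submission imports Defs begin

text \<open>Since \<open>V = X + \<theta> \<integral>X\<close>, the chain rule of Young integration suggests that the Skorohod integral of \<open>X\<close>
  with respect to \<open>B\<close> is the quadratic functional \<open>X\<^sub>T\<^sup>2/2 + \<theta> \<integral>X\<^sup>2 + \<rho> \<integral>XV\<close> minus its mean. Gaussian integration
  by parts shows that this variable indeed satisfies the duality defining the divergence, and the divergence is
  unique because functions of \<open>B\<close> at finitely many times are dense in \<open>L\<^sup>2\<close>. Hence
  \<open>\<integral>X \<delta>X = X\<^sub>T\<^sup>2/2 - D\<^sub>T\<close> with a deterministic \<open>D\<^sub>T \<sim> (\<theta> + \<rho>) \<eta> T\<close>, where \<open>\<eta> = lim E X\<^sub>t\<^sup>2 > 0\<close>. It remains to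
  see that \<open>X\<^sub>T\<^sup>2/T \<longlonglongrightarrow> 0\<close> and \<open>Q\<^sub>n \<longlonglongrightarrow> \<eta>\<close> almost surely. Up to a boundary term, the covariance of \<open>X\<close> decays at
  least like \<open>1/\<bar>t - s\<bar>\<close>, even for \<open>H > 3/4\<close>, since the kernel of the second-order process has integral zero; so the
  fourth moments of the centred averages are of order \<open>(1/n + 1/T\<^sub>n)\<^sup>2\<close>. When \<open>T\<^sub>n\<close> is too small for
  Borel-Cantelli, the grid is so fine that \<open>Q\<^sub>n\<close> is compared pathwise with the time average of \<open>X\<^sup>2\<close>.\<close>

section \<open>Gaussian spaces\<close>

text \<open>The chain rule is never applied to a path of B. A statement about X is tested against an
  arbitrary element Z of the Gaussian space: the covariances of Z with B, V and X are deterministic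
  functions of time that solve the same two linear equations, so that L2 estimates and the chain
  rule behind the Skorohod integral become calculus on the half-line. A norm is recovered by
  choosing Z to be the variable itself. The nonlinear Gaussian calculus comes from expectations of
  exp (i Z) F: differentiating them in Z yields integration by parts, fourth moments and the duality
  for trigonometric test functions. The test functions of the definition are bounded and smooth
  instead, and Gaussian smoothing passes from one class to the other, coordinate by coordinate. The
  variance of X converges because B has stationary increments; the limit is positive because second
  differences of B, of variance 4 - 2^(2H) > 0, can be recovered from X. Path regularity is used
  with Hoelder exponent 1/4 and growth exponent 1/24, which the 96th moment provides.\<close>

definition gaussian_rv :: "'a measure \<Rightarrow> ('a \<Rightarrow> real) \<Rightarrow> bool" where
  "gaussian_rv M Y \<longleftrightarrow> Y \<in> borel_measurable M \<and> integrable M (\<lambda>\<omega>. (Y \<omega>)\<^sup>2) \<and>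
     (\<forall>u. (CLINT \<omega>|M. iexp (u * Y \<omega>)) = of_real (exp (- (u\<^sup>2 * (\<integral>\<omega>. (Y \<omega>)\<^sup>2 \<partial>M)) / 2)))"

lemma (in prob_space) gaussian_rv_AE_zero:
  assumes [measurable]: "Y \<in> borel_measurable M" and "AE \<omega> in M. Y \<omega> = 0"
  shows "gaussian_rv M Y"
proof -
  have "AE \<omega> in M. (Y \<omega>)\<^sup>2 = 0" using assms(2) by auto
  then have 1: "integrable M (\<lambda>\<omega>. (Y \<omega>)\<^sup>2)" "(\<integral>\<omega>. (Y \<omega>)\<^sup>2 \<partial>M) = 0"
    using integrable_cong_AE[of "\<lambda>\<omega>. (Y \<omega>)\<^sup>2" M "\<lambda>_. 0"] integral_cong_AE[of "\<lambda>\<omega>. (Y \<omega>)\<^sup>2" M "\<lambda>_. 0"]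
    by simp_all
  have "(CLINT \<omega>|M. iexp (u * Y \<omega>)) = (CLINT \<omega>|M. 1)" for u
    by (rule integral_cong_AE) (use assms(2) in \<open>auto\<close>)
  then show ?thesis unfolding gaussian_rv_def using 1 assms(1) by (simp add: prob_space)
qed

lemma (in prob_space) std_normal_moments:
  assumes [measurable]: "Y \<in> borel_measurable M"
    and d: "distr M borel Y = std_normal_distribution"
  shows "integrable M (\<lambda>\<omega>. (Y \<omega>) ^ k)"
    and "(\<integral>\<omega>. (Y \<omega>) ^ (2 * k) \<partial>M) = fact (2 * k) / (2 ^ k * fact k)"
proof -
  have "integrable (distr M borel Y) (\<lambda>x. x ^ k)"
    unfolding d by (rule integrable_std_normal_distribution_moment)
  then show "integrable M (\<lambda>\<omega>. (Y \<omega>) ^ k)"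
    by (subst (asm) integrable_distr_eq) auto
  have "(\<integral>\<omega>. (Y \<omega>) ^ (2 * k) \<partial>M) = (\<integral>x. x ^ (2 * k) \<partial>distr M borel Y)"
    by (subst integral_distr) auto
  then show "(\<integral>\<omega>. (Y \<omega>) ^ (2 * k) \<partial>M) = fact (2 * k) / (2 ^ k * fact k)"
    unfolding d using std_normal_distribution_even_moments(1)[of k] by simp
qed

lemma (in prob_space) centered_gaussian_gaussian_rv:
  assumes "centered_gaussian M Y"
  shows "gaussian_rv M Y"
proof (cases "AE \<omega> in M. Y \<omega> = 0")
  case True
  then show ?thesis using assms gaussian_rv_AE_zero by (simp add: centered_gaussian_def)
next
  case False
  then obtain \<sigma> where s: "\<sigma> > 0" "distributed M lborel Y (normal_density 0 \<sigma>)"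
    and Y[measurable]: "Y \<in> borel_measurable M"
    using assms by (auto simp: centered_gaussian_def)
  define Z where "Z = (\<lambda>\<omega>. Y \<omega> / \<sigma>)"
  have [measurable]: "Z \<in> borel_measurable M" unfolding Z_def by simp
  have "distributed M lborel Z std_normal_density"
    using s normal_standard_normal_convert[OF s(1), of Y 0] unfolding Z_def by simp
  then have d: "distr M borel Z = std_normal_distribution"
    by (simp add: distributed_def cong: distr_cong)
  have YZ: "Y \<omega> = \<sigma> * Z \<omega>" for \<omega> using s by (simp add: Z_def)
  have c: "(CLINT \<omega>|M. iexp (u * Z \<omega>)) = exp (- (u\<^sup>2) / 2)" for u
  proof -
    have "(CLINT \<omega>|M. iexp (u * Z \<omega>)) = char (distr M borel Z) u"
      unfolding char_def by (subst integral_distr) auto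
    then show ?thesis unfolding d char_std_normal_distribution by (simp add: exp_of_real)
  qed
  have m: "integrable M (\<lambda>\<omega>. (Z \<omega>) ^ 2)" "(\<integral>\<omega>. (Z \<omega>) ^ 2 \<partial>M) = 1"
    using std_normal_moments[of Z 2] std_normal_moments(2)[of Z 1] d by auto
  have "(CLINT \<omega>|M. iexp (u * Y \<omega>)) = exp (- (u * \<sigma>)\<^sup>2 / 2)" for u
    using c[of "u * \<sigma>"] by (simp add: YZ mult.assoc)
  moreover have "(\<integral>\<omega>. (Y \<omega>) ^ 2 \<partial>M) = \<sigma>\<^sup>2" "integrable M (\<lambda>\<omega>. (Y \<omega>) ^ 2)"
    using m by (simp_all add: YZ power_mult_distrib)
  ultimately show ?thesis unfolding gaussian_rv_def using Y
    by (auto simp: power_mult_distrib)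
qed

text \<open>\<open>gaussian_rv\<close> prescribes only the variance and the characteristic function,
  a form that covers variance zero and survives limits. Levy's uniqueness theorem identifies the
  normalised variable as standard normal; in the degenerate case the variable vanishes almost
  surely.\<close>

lemma (in prob_space) gaussian_rv_moments:
  assumes "gaussian_rv M Y"
  shows "integrable M (\<lambda>\<omega>. (Y \<omega>) ^ k)"
    and "(\<integral>\<omega>. (Y \<omega>) ^ (2 * k) \<partial>M) = fact (2 * k) / (2 ^ k * fact k) * (\<integral>\<omega>. (Y \<omega>)\<^sup>2 \<partial>M) ^ k"
proof -
  note Y = assms[unfolded gaussian_rv_def]
  have [measurable]: "Y \<in> borel_measurable M" using Y by simp
  define v where "v = (\<integral>\<omega>. (Y \<omega>)\<^sup>2 \<partial>M)"
  have v0: "v \<ge> 0" unfolding v_def by simp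
  have "integrable M (\<lambda>\<omega>. (Y \<omega>) ^ k) \<and>
      (\<integral>\<omega>. (Y \<omega>) ^ (2 * k) \<partial>M) = fact (2 * k) / (2 ^ k * fact k) * v ^ k"
  proof (cases "v = 0")
    case True
    then have "AE \<omega> in M. (Y \<omega>)\<^sup>2 = 0"
      using Y unfolding v_def by (subst (asm) integral_nonneg_eq_0_iff_AE) auto
    then have a: "AE \<omega> in M. Y \<omega> = 0" by simp
    have i: "integrable M (\<lambda>\<omega>. (Y \<omega>) ^ k)"
      by (subst integrable_cong_AE[of _ _ "\<lambda>_. 0 ^ k"]) (use a in auto)
    have "(\<integral>\<omega>. (Y \<omega>) ^ (2 * k) \<partial>M) = (\<integral>\<omega>. 0 ^ (2 * k) \<partial>M)"
      by (rule integral_cong_AE) (use a in auto)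
    then show ?thesis using i True by (cases k) (auto simp: prob_space)
  next
    case False
    define s where "s = sqrt v"
    have s: "s > 0" "s\<^sup>2 = v" using v0 False unfolding s_def by auto
    define Z where "Z = (\<lambda>\<omega>. Y \<omega> / s)"
    have [measurable]: "Z \<in> borel_measurable M" unfolding Z_def by simp
    have YZ: "Y \<omega> = s * Z \<omega>" for \<omega> using s by (simp add: Z_def)
    have "char (distr M borel Z) = char std_normal_distribution"
    proof
      fix t
      have "char (distr M borel Z) t = (CLINT \<omega>|M. iexp ((t / s) * Y \<omega>))"
        unfolding char_def Z_def by (subst integral_distr) auto
      also have "\<dots> = exp (- (t\<^sup>2) / 2)"
        using Y s False spec[of _ "t / s"] by (simp only: v_def[symmetric] power_divide) simp
      finally show "char (distr M borel Z) t = char std_normal_distribution t"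
        unfolding char_std_normal_distribution by (simp add: exp_of_real)
    qed
    then have d: "distr M borel Z = std_normal_distribution"
      by (intro Levy_uniqueness real_distribution_distr real_dist_normal_dist) auto
    show ?thesis using std_normal_moments[of Z k] d
      by (simp add: YZ power_mult_distrib s(2)[symmetric] power_mult)
  qed
  then show "integrable M (\<lambda>\<omega>. (Y \<omega>) ^ k)"
    and "(\<integral>\<omega>. (Y \<omega>) ^ (2 * k) \<partial>M) = fact (2 * k) / (2 ^ k * fact k) * (\<integral>\<omega>. (Y \<omega>)\<^sup>2 \<partial>M) ^ k"
    by (simp_all add: v_def)
qed

lemma (in prob_space) square_integrable_mult:
  fixes Y Z :: "'a \<Rightarrow> real"
  assumes [measurable]: "Y \<in> borel_measurable M" "Z \<in> borel_measurable M"
    and "integrable M (\<lambda>\<omega>. (Y \<omega>)\<^sup>2)" "integrable M (\<lambda>\<omega>. (Z \<omega>)\<^sup>2)"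
  shows "integrable M (\<lambda>\<omega>. Y \<omega> * Z \<omega>)"
proof (rule Bochner_Integration.integrable_bound)
  show "integrable M (\<lambda>\<omega>. (Y \<omega>)\<^sup>2 + (Z \<omega>)\<^sup>2)" using assms by simp
  have "\<bar>y * z\<bar> \<le> y\<^sup>2 + z\<^sup>2" for y z :: real
    using sum_squares_bound[of "\<bar>y\<bar>" "\<bar>z\<bar>"] zero_le_power2[of y] zero_le_power2[of z]
    unfolding power2_abs abs_mult by linarith
  then show "AE x in M. norm (Y x * Z x) \<le> norm ((Y x)\<^sup>2 + (Z x)\<^sup>2)" by simp
qed auto

lemma (in prob_space) Cauchy_Schwarz_expectation:
  fixes Y Z :: "'a \<Rightarrow> real"
  assumes [measurable]: "Y \<in> borel_measurable M" "Z \<in> borel_measurable M"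
    and "integrable M (\<lambda>\<omega>. (Y \<omega>)\<^sup>2)" "integrable M (\<lambda>\<omega>. (Z \<omega>)\<^sup>2)"
  shows "\<bar>expectation (\<lambda>\<omega>. Y \<omega> * Z \<omega>)\<bar> \<le> sqrt (expectation (\<lambda>\<omega>. (Y \<omega>)\<^sup>2)) * sqrt (expectation (\<lambda>\<omega>. (Z \<omega>)\<^sup>2))"
proof -
  let ?a = "expectation (\<lambda>\<omega>. (Y \<omega>)\<^sup>2)" and ?b = "expectation (\<lambda>\<omega>. (Z \<omega>)\<^sup>2)"
    and ?c = "expectation (\<lambda>\<omega>. Y \<omega> * Z \<omega>)"
  have i: "integrable M (\<lambda>\<omega>. Y \<omega> * Z \<omega>)" using assms by (rule square_integrable_mult)
  have q: "0 \<le> s\<^sup>2 * ?a + 2 * s * t * ?c + t\<^sup>2 * ?b" for s t :: real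
  proof -
    have "0 \<le> expectation (\<lambda>\<omega>. (s * Y \<omega> + t * Z \<omega>)\<^sup>2)" by simp
    also have "\<dots> = expectation (\<lambda>\<omega>. s\<^sup>2 * (Y \<omega>)\<^sup>2 + 2 * s * t * (Y \<omega> * Z \<omega>) + t\<^sup>2 * (Z \<omega>)\<^sup>2)"
      by (intro Bochner_Integration.integral_cong) (auto simp: power2_eq_square algebra_simps)
    also have "\<dots> = s\<^sup>2 * ?a + 2 * s * t * ?c + t\<^sup>2 * ?b"
      using assms i by simp
    finally show ?thesis .
  qed
  have a0: "?a \<ge> 0" and b0: "?b \<ge> 0" by simp_all
  have "?c\<^sup>2 \<le> ?a * ?b"
  proof (cases "?a = 0")
    case True
    show ?thesis
    proof (rule ccontr)
      assume n: "\<not> ?thesis"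
      then have c: "?c \<noteq> 0" using True by auto
      \<comment> \<open>With \<open>?a = 0\<close> the quadratic form is linear in \<open>s\<close>;
        this \<open>s\<close> makes its value -1.\<close>
      have "0 \<le> 2 * (- (?b + 1) / (2 * ?c)) * 1 * ?c + ?b"
        using q[of "- (?b + 1) / (2 * ?c)" 1] True by simp
      then show False using c by (simp add: field_simps)
    qed
  next
    case False
    have "0 \<le> ?a * (?a * ?b - ?c\<^sup>2)"
      using q[of "- ?c" "?a"] by (simp add: power2_eq_square algebra_simps)
    then show ?thesis using False a0 by (simp add: zero_le_mult_iff)
  qed
  then have "sqrt (?c\<^sup>2) \<le> sqrt (?a * ?b)" by (rule real_sqrt_le_mono)
  then show ?thesis unfolding real_sqrt_mult real_sqrt_abs .
qed

lemma norm_iexp_diff_le: "cmod (iexp x - iexp y) \<le> \<bar>x - y\<bar>"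
proof -
  have "iexp x - iexp y = iexp y * (iexp (x - y) - 1)"
    by (simp add: exp_diff[symmetric] exp_add[symmetric] algebra_simps)
  then have "cmod (iexp x - iexp y) = cmod (iexp (x - y) - 1)" by (simp add: norm_mult)
  also have "\<dots> \<le> \<bar>x - y\<bar>" using iexp_approx1[of "x - y" 0] by simp
  finally show ?thesis .
qed

text \<open>Both sides of the identity for the characteristic function are continuous in the L2
  distance: \<open>norm_iexp_diff_le\<close> controls the left one and convergence of the variances
  the right one.\<close>

lemma (in prob_space) gaussian_rv_L2_limit:
  assumes Y[measurable]: "Y \<in> borel_measurable M" and iY: "integrable M (\<lambda>\<omega>. (Y \<omega>)\<^sup>2)"
    and ap: "\<And>e. e > 0 \<Longrightarrow> \<exists>Z. gaussian_rv M Z \<and> expectation (\<lambda>\<omega>. (Y \<omega> - Z \<omega>)\<^sup>2) < e"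
  shows "gaussian_rv M Y"
proof -
  have "\<exists>Z. \<forall>n. gaussian_rv M (Z n) \<and> expectation (\<lambda>\<omega>. (Y \<omega> - Z n \<omega>)\<^sup>2) < inverse (real (Suc n))"
    using ap[of "inverse (real (Suc n))" for n] by (intro choice allI) auto
  then obtain Z where Z: "\<And>n. gaussian_rv M (Z n)"
    and Zl: "\<And>n. expectation (\<lambda>\<omega>. (Y \<omega> - Z n \<omega>)\<^sup>2) < inverse (real (Suc n))" by auto
  have [measurable]: "Z n \<in> borel_measurable M" for n using Z by (simp add: gaussian_rv_def)
  have iZ: "integrable M (\<lambda>\<omega>. (Z n \<omega>)\<^sup>2)" for n using Z by (simp add: gaussian_rv_def)
  have iYZ: "integrable M (\<lambda>\<omega>. Y \<omega> * Z n \<omega>)" for n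
    using iY iZ by (intro square_integrable_mult) auto
  have iD: "integrable M (\<lambda>\<omega>. (Y \<omega> - Z n \<omega>)\<^sup>2)" for n
    unfolding power2_diff using iY iZ iYZ by (auto simp: mult.assoc)
  define d where "d n = expectation (\<lambda>\<omega>. (Y \<omega> - Z n \<omega>)\<^sup>2)" for n
  have d: "d \<longlonglongrightarrow> 0"
    by (rule tendsto_sandwich[of "\<lambda>_. 0" _ _ "\<lambda>n. inverse (real (Suc n))"])
      (use Zl in \<open>auto simp: d_def less_imp_le simp del: of_nat_Suc intro!: LIMSEQ_inverse_real_of_nat\<close>)
  let ?v = "expectation (\<lambda>\<omega>. (Y \<omega>)\<^sup>2)"
  have sq: "expectation (\<lambda>\<omega>. \<bar>Y \<omega> - Z n \<omega>\<bar>) \<le> sqrt (d n)" for n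
    using Cauchy_Schwarz_expectation[of "\<lambda>\<omega>. 1" "\<lambda>\<omega>. \<bar>Y \<omega> - Z n \<omega>\<bar>"] iD
    by (simp add: d_def prob_space)
  have sd: "(\<lambda>n. sqrt (d n)) \<longlonglongrightarrow> 0" using tendsto_real_sqrt[OF d] by simp
  have v: "(\<lambda>n. expectation (\<lambda>\<omega>. (Z n \<omega>)\<^sup>2)) \<longlonglongrightarrow> ?v"
  proof -
    have i2: "integrable M (\<lambda>\<omega>. Y \<omega> * (Y \<omega> - Z n \<omega>))" for n
      using iY iYZ by (simp add: right_diff_distrib power2_eq_square)
    have e: "expectation (\<lambda>\<omega>. (Z n \<omega>)\<^sup>2) = ?v - 2 * expectation (\<lambda>\<omega>. Y \<omega> * (Y \<omega> - Z n \<omega>)) + d n" for n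
    proof -
      have "expectation (\<lambda>\<omega>. (Z n \<omega>)\<^sup>2)
          = expectation (\<lambda>\<omega>. (Y \<omega>)\<^sup>2 - 2 * (Y \<omega> * (Y \<omega> - Z n \<omega>)) + (Y \<omega> - Z n \<omega>)\<^sup>2)"
        by (intro Bochner_Integration.integral_cong) (auto simp: power2_eq_square algebra_simps)
      also have "\<dots> = ?v - 2 * expectation (\<lambda>\<omega>. Y \<omega> * (Y \<omega> - Z n \<omega>)) + d n"
        unfolding d_def using iY i2 iD by simp
      finally show ?thesis .
    qed
    have "(\<lambda>n. expectation (\<lambda>\<omega>. Y \<omega> * (Y \<omega> - Z n \<omega>))) \<longlonglongrightarrow> 0"
    proof (rule Lim_null_comparison[of _ "\<lambda>n. sqrt ?v * sqrt (d n)"])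
      show "\<forall>\<^sub>F n in sequentially. norm (expectation (\<lambda>\<omega>. Y \<omega> * (Y \<omega> - Z n \<omega>))) \<le> sqrt ?v * sqrt (d n)"
        unfolding d_def using Cauchy_Schwarz_expectation[of Y "\<lambda>\<omega>. Y \<omega> - Z n \<omega>" for n] iY iD by simp
      show "(\<lambda>n. sqrt ?v * sqrt (d n)) \<longlonglongrightarrow> 0" using tendsto_mult_right_zero[OF sd] .
    qed
    from tendsto_add[OF tendsto_diff[OF tendsto_const[of ?v] tendsto_mult_left[OF this, of 2]] d]
    show ?thesis unfolding e by simp
  qed
  have "(CLINT \<omega>|M. iexp (u * Y \<omega>)) = of_real (exp (- (u\<^sup>2 * ?v) / 2))" for u
  proof (rule LIMSEQ_unique)
    have "(\<lambda>n. of_real (exp (- (u\<^sup>2 * expectation (\<lambda>\<omega>. (Z n \<omega>)\<^sup>2)) / 2)) :: complex)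
       \<longlonglongrightarrow> of_real (exp (- (u\<^sup>2 * ?v) / 2))"
      by (intro tendsto_of_real tendsto_intros v) auto
    then show "(\<lambda>n. CLINT \<omega>|M. iexp (u * Z n \<omega>)) \<longlonglongrightarrow> of_real (exp (- (u\<^sup>2 * ?v) / 2))"
      using Z by (simp add: gaussian_rv_def)
    have ii: "integrable M (\<lambda>\<omega>. iexp (f \<omega>))" if "f \<in> borel_measurable M" for f :: "'a \<Rightarrow> real"
      using that by (intro integrable_const_bound[of _ 1]) auto
    have "(\<lambda>n. (CLINT \<omega>|M. iexp (u * Z n \<omega>)) - (CLINT \<omega>|M. iexp (u * Y \<omega>))) \<longlonglongrightarrow> 0"
    proof (rule Lim_null_comparison[of _ "\<lambda>n. \<bar>u\<bar> * sqrt (d n)"])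
      have "cmod ((CLINT \<omega>|M. iexp (u * Z n \<omega>)) - (CLINT \<omega>|M. iexp (u * Y \<omega>))) \<le> \<bar>u\<bar> * sqrt (d n)" for n
      proof -
        have "(CLINT \<omega>|M. iexp (u * Z n \<omega>)) - (CLINT \<omega>|M. iexp (u * Y \<omega>)) =
           (CLINT \<omega>|M. iexp (u * Z n \<omega>) - iexp (u * Y \<omega>))"
          by (rule Bochner_Integration.integral_diff[symmetric]; rule ii; measurable)
        also have "cmod \<dots> \<le> (\<integral>\<omega>. cmod (iexp (u * Z n \<omega>) - iexp (u * Y \<omega>)) \<partial>M)"
          by (rule integral_norm_bound)
        also have "\<dots> \<le> (\<integral>\<omega>. \<bar>u\<bar> * \<bar>Y \<omega> - Z n \<omega>\<bar> \<partial>M)"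
        proof (rule integral_mono)
          show "integrable M (\<lambda>\<omega>. cmod (iexp (u * Z n \<omega>) - iexp (u * Y \<omega>)))"
            by (intro integrable_norm Bochner_Integration.integrable_diff ii) measurable
          have "integrable M (\<lambda>\<omega>. Y \<omega> - Z n \<omega>)"
            using square_integrable_mult[of "\<lambda>\<omega>. 1" "\<lambda>\<omega>. Y \<omega> - Z n \<omega>"] iD by simp
          then show "integrable M (\<lambda>\<omega>. \<bar>u\<bar> * \<bar>Y \<omega> - Z n \<omega>\<bar>)" by auto
          show "cmod (iexp (u * Z n \<omega>) - iexp (u * Y \<omega>)) \<le> \<bar>u\<bar> * \<bar>Y \<omega> - Z n \<omega>\<bar>" for \<omega>
            using norm_iexp_diff_le[of "u * Z n \<omega>" "u * Y \<omega>"]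
            by (metis abs_minus_commute abs_mult right_diff_distrib)
        qed
        also have "\<dots> \<le> \<bar>u\<bar> * sqrt (d n)" using sq[of n] by (simp add: mult_left_mono)
        finally show ?thesis .
      qed
      then show "\<forall>\<^sub>F n in sequentially. cmod ((CLINT \<omega>|M. iexp (u * Z n \<omega>)) - (CLINT \<omega>|M. iexp (u * Y \<omega>))) \<le> \<bar>u\<bar> * sqrt (d n)"
        by simp
      show "(\<lambda>n. \<bar>u\<bar> * sqrt (d n)) \<longlonglongrightarrow> 0" using tendsto_mult_right_zero[OF sd] .
    qed
    then show "(\<lambda>n. CLINT \<omega>|M. iexp (u * Z n \<omega>)) \<longlonglongrightarrow> (CLINT \<omega>|M. iexp (u * Y \<omega>))"
      by (rule LIM_zero_cancel)
  qed
  then show ?thesis using iY unfolding gaussian_rv_def by auto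
qed

text \<open>Dominated convergence sends the characteristic functions at 1 to 1. They equal exp (- v
  / 2) with v the variance, so v tends to 0: for Gaussian variables almost sure convergence is
  already convergence in L2.\<close>

lemma (in prob_space) gaussian_rv_AE_null_imp_L2_null:
  assumes Z: "\<And>n. gaussian_rv M (Z n)" and l: "AE \<omega> in M. (\<lambda>n. Z n \<omega>) \<longlonglongrightarrow> 0"
  shows "(\<lambda>n. expectation (\<lambda>\<omega>. (Z n \<omega>)\<^sup>2)) \<longlonglongrightarrow> 0"
proof -
  have [measurable]: "Z n \<in> borel_measurable M" for n using Z by (simp add: gaussian_rv_def)
  have "(\<lambda>n. CLINT \<omega>|M. iexp (Z n \<omega>)) \<longlonglongrightarrow> (CLINT \<omega>|M. 1)"
  proof (rule integral_dominated_convergence[where w="\<lambda>_. 1"])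
    show "AE \<omega> in M. (\<lambda>n. iexp (Z n \<omega>)) \<longlonglongrightarrow> 1"
      using l
    proof eventually_elim
      case (elim \<omega>)
      have "(\<lambda>n. iexp (Z n \<omega>)) \<longlonglongrightarrow> iexp 0" by (intro tendsto_intros elim)
      then show ?case by simp
    qed
  qed auto
  moreover have c1: "(CLINT \<omega>|M. iexp (Z n \<omega>)) = of_real (exp (- (expectation (\<lambda>\<omega>. (Z n \<omega>)\<^sup>2)) / 2))" for n
  proof -
    have "(CLINT \<omega>|M. iexp (1 * Z n \<omega>)) = of_real (exp (- (1\<^sup>2 * (expectation (\<lambda>\<omega>. (Z n \<omega>)\<^sup>2))) / 2))"
      using Z[of n] unfolding gaussian_rv_def by blast
    then show ?thesis by simp
  qed
  ultimately have "(\<lambda>n. of_real (exp (- (expectation (\<lambda>\<omega>. (Z n \<omega>)\<^sup>2)) / 2)) :: complex) \<longlonglongrightarrow> of_real 1"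
    using c1 by (simp add: prob_space)
  then have e: "(\<lambda>n. exp (- (expectation (\<lambda>\<omega>. (Z n \<omega>)\<^sup>2)) / 2)) \<longlonglongrightarrow> 1"
    by (simp only: tendsto_of_real_iff)
  have "(\<lambda>n. - 2 * ln (exp (- (expectation (\<lambda>\<omega>. (Z n \<omega>)\<^sup>2)) / 2))) \<longlonglongrightarrow> - 2 * ln 1"
    by (intro tendsto_intros e) auto
  then show ?thesis by simp
qed

text \<open>Closure under almost sure limits is part of the locale because time integrals of paths
  enter the space as pointwise limits of Riemann sums.\<close>

locale gaussian_space = prob_space M for M :: "'a measure" +
  fixes S :: "('a \<Rightarrow> real) set"
  assumes gaussian: "Y \<in> S \<Longrightarrow> gaussian_rv M Y"
    and zero: "(\<lambda>_. 0) \<in> S"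
    and add: "Y \<in> S \<Longrightarrow> Z \<in> S \<Longrightarrow> (\<lambda>\<omega>. Y \<omega> + Z \<omega>) \<in> S"
    and scale: "Y \<in> S \<Longrightarrow> (\<lambda>\<omega>. c * Y \<omega>) \<in> S"
    and AE_limit: "(\<And>n :: nat. Zs n \<in> S) \<Longrightarrow> Y \<in> borel_measurable M \<Longrightarrow>
       (AE \<omega> in M. (\<lambda>n. Zs n \<omega>) \<longlonglongrightarrow> Y \<omega>) \<Longrightarrow> Y \<in> S"
begin

lemma meas: "Y \<in> S \<Longrightarrow> Y \<in> borel_measurable M"
  using gaussian gaussian_rv_def by blast

lemma square_integrable: "Y \<in> S \<Longrightarrow> integrable M (\<lambda>\<omega>. (Y \<omega>)\<^sup>2)"
  using gaussian gaussian_rv_def by blast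

lemma prod_integrable: "Y \<in> S \<Longrightarrow> Z \<in> S \<Longrightarrow> integrable M (\<lambda>\<omega>. Y \<omega> * Z \<omega>)"
  using square_integrable_mult meas square_integrable by blast

lemma integrable: "Y \<in> S \<Longrightarrow> integrable M Y"
  using square_integrable_mult[of "\<lambda>_. 1" Y] meas square_integrable by simp

lemma minus: "Y \<in> S \<Longrightarrow> (\<lambda>\<omega>. - Y \<omega>) \<in> S"
  using scale[of Y "-1"] by simp

lemma diff: "Y \<in> S \<Longrightarrow> Z \<in> S \<Longrightarrow> (\<lambda>\<omega>. Y \<omega> - Z \<omega>) \<in> S"
  using add[OF _ minus, of Y Z] by simp

lemma sum: "(\<And>i. i \<in> I \<Longrightarrow> Y i \<in> S) \<Longrightarrow> (\<lambda>\<omega>. \<Sum>i\<in>I. Y i \<omega>) \<in> S"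
  by (induction I rule: infinite_finite_induct) (auto intro: zero add)

lemma AE_limit_L2:
  assumes Z: "\<And>n. Z n \<in> S" and Y: "Y \<in> S"
    and l: "AE \<omega> in M. (\<lambda>n. Z n \<omega>) \<longlonglongrightarrow> Y \<omega>"
  shows "(\<lambda>n. expectation (\<lambda>\<omega>. (Z n \<omega> - Y \<omega>)\<^sup>2)) \<longlonglongrightarrow> 0"
proof (rule gaussian_rv_AE_null_imp_L2_null)
  show "gaussian_rv M (\<lambda>\<omega>. Z n \<omega> - Y \<omega>)" for n by (intro gaussian diff Z Y)
  show "AE \<omega> in M. (\<lambda>n. Z n \<omega> - Y \<omega>) \<longlonglongrightarrow> 0"
    using l by eventually_elim (rule LIM_zero)
qed

lemma AE_limit_cov:
  assumes Z: "\<And>n. Z n \<in> S" and Y: "Y \<in> S" and U: "U \<in> S"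
    and l: "AE \<omega> in M. (\<lambda>n. Z n \<omega>) \<longlonglongrightarrow> Y \<omega>"
  shows "(\<lambda>n. expectation (\<lambda>\<omega>. U \<omega> * Z n \<omega>)) \<longlonglongrightarrow> expectation (\<lambda>\<omega>. U \<omega> * Y \<omega>)"
proof -
  have [measurable]: "Z n \<in> borel_measurable M" "Y \<in> borel_measurable M" "U \<in> borel_measurable M" for n
    using Z Y U meas by auto
  have "(\<lambda>n. expectation (\<lambda>\<omega>. U \<omega> * Z n \<omega>) - expectation (\<lambda>\<omega>. U \<omega> * Y \<omega>)) \<longlonglongrightarrow> 0"
  proof (rule Lim_null_comparison)
    have "norm (expectation (\<lambda>\<omega>. U \<omega> * Z n \<omega>) - expectation (\<lambda>\<omega>. U \<omega> * Y \<omega>))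
       \<le> sqrt (expectation (\<lambda>\<omega>. (U \<omega>)\<^sup>2)) * sqrt (expectation (\<lambda>\<omega>. (Z n \<omega> - Y \<omega>)\<^sup>2))" for n
    proof -
      have "expectation (\<lambda>\<omega>. U \<omega> * Z n \<omega>) - expectation (\<lambda>\<omega>. U \<omega> * Y \<omega>)
        = expectation (\<lambda>\<omega>. U \<omega> * (Z n \<omega> - Y \<omega>))"
        using prod_integrable[OF U Z] prod_integrable[OF U Y] by (simp add: right_diff_distrib)
      then show ?thesis
        using Cauchy_Schwarz_expectation[of U "\<lambda>\<omega>. Z n \<omega> - Y \<omega>"] square_integrable[OF U]
          square_integrable[OF diff[OF Z Y]] by simp
    qed
    then show "\<forall>\<^sub>F n in sequentially. norm (expectation (\<lambda>\<omega>. U \<omega> * Z n \<omega>) - expectation (\<lambda>\<omega>. U \<omega> * Y \<omega>))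
       \<le> sqrt (expectation (\<lambda>\<omega>. (U \<omega>)\<^sup>2)) * sqrt (expectation (\<lambda>\<omega>. (Z n \<omega> - Y \<omega>)\<^sup>2))" by simp
    show "(\<lambda>n. sqrt (expectation (\<lambda>\<omega>. (U \<omega>)\<^sup>2)) * sqrt (expectation (\<lambda>\<omega>. (Z n \<omega> - Y \<omega>)\<^sup>2))) \<longlonglongrightarrow> 0"
      using tendsto_mult_left[OF tendsto_real_sqrt[OF AE_limit_L2[OF Z Y l]]] by simp
  qed
  then show ?thesis by (rule LIM_zero_cancel)
qed

end

text \<open>The Gaussian space generated by a process: the \<open>L\<^sup>2\<close>-closure of its linear span. A sequence
  in it that converges almost surely is Cauchy in \<open>L\<^sup>2\<close>, since the characteristic functions of the
  differences tend to one.\<close>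

definition gaussian_closure :: "'a measure \<Rightarrow> (real \<Rightarrow> 'a \<Rightarrow> real) \<Rightarrow> ('a \<Rightarrow> real) set" where
  "gaussian_closure M W = {Y. Y \<in> borel_measurable M \<and> integrable M (\<lambda>\<omega>. (Y \<omega>)\<^sup>2) \<and>
     (\<forall>e>0. \<exists>J c. finite J \<and> (\<integral>\<omega>. (Y \<omega> - (\<Sum>t\<in>J. c t * W t \<omega>))\<^sup>2 \<partial>M) < e)}"

lemma (in prob_space) gaussian_closure_base:
  assumes "\<And>J c. finite J \<Longrightarrow> centered_gaussian M (\<lambda>\<omega>. \<Sum>t\<in>J. c t * W t \<omega>)"
  shows "W t \<in> gaussian_closure M W"
proof -
  have "gaussian_rv M (W t)" using centered_gaussian_gaussian_rv[OF assms[of "{t}" "\<lambda>_. 1"]] by simp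
  moreover have "\<exists>J c. finite J \<and> (\<integral>\<omega>. (W t \<omega> - (\<Sum>s\<in>J. c s * W s \<omega>))\<^sup>2 \<partial>M) < e" if "e > 0" for e
    by (rule exI[of _ "{t}"], rule exI[of _ "\<lambda>_. 1"]) (use that in simp)
  ultimately show ?thesis
    unfolding gaussian_closure_def gaussian_rv_def by simp
qed

lemma (in prob_space) second_moment_add_le:
  fixes Y Z :: "'a \<Rightarrow> real"
  assumes [measurable]: "Y \<in> borel_measurable M" "Z \<in> borel_measurable M"
    and "integrable M (\<lambda>\<omega>. (Y \<omega>)\<^sup>2)" "integrable M (\<lambda>\<omega>. (Z \<omega>)\<^sup>2)"
  shows "expectation (\<lambda>\<omega>. (Y \<omega> + Z \<omega>)\<^sup>2) \<le> 2 * expectation (\<lambda>\<omega>. (Y \<omega>)\<^sup>2) + 2 * expectation (\<lambda>\<omega>. (Z \<omega>)\<^sup>2)"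
    and "integrable M (\<lambda>\<omega>. (Y \<omega> + Z \<omega>)\<^sup>2)"
proof -
  have i: "integrable M (\<lambda>\<omega>. Y \<omega> * Z \<omega>)" using square_integrable_mult[OF assms] .
  then have j: "integrable M (\<lambda>\<omega>. 2 * Y \<omega> * Z \<omega>)" by (simp add: mult.assoc)
  show k: "integrable M (\<lambda>\<omega>. (Y \<omega> + Z \<omega>)\<^sup>2)" unfolding power2_sum using assms j by simp
  have "(y + z)\<^sup>2 \<le> 2 * y\<^sup>2 + 2 * z\<^sup>2" for y z :: real
    using zero_le_power2[of "y - z"] by (simp add: power2_eq_square algebra_simps)
  then have "expectation (\<lambda>\<omega>. (Y \<omega> + Z \<omega>)\<^sup>2) \<le> expectation (\<lambda>\<omega>. 2 * (Y \<omega>)\<^sup>2 + 2 * (Z \<omega>)\<^sup>2)"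
    using assms k by (intro integral_mono) auto
  then show "expectation (\<lambda>\<omega>. (Y \<omega> + Z \<omega>)\<^sup>2) \<le> 2 * expectation (\<lambda>\<omega>. (Y \<omega>)\<^sup>2) + 2 * expectation (\<lambda>\<omega>. (Z \<omega>)\<^sup>2)"
    using assms by simp
qed

lemma (in prob_space) gaussian_space_gaussian_closure:
  assumes lin: "\<And>J c. finite J \<Longrightarrow> centered_gaussian M (\<lambda>\<omega>. \<Sum>t\<in>J. c t * W t \<omega>)"
  shows "gaussian_space M (gaussian_closure M W)"
proof -
  let ?S = "gaussian_closure M W"
  have gl: "gaussian_rv M (\<lambda>\<omega>. \<Sum>t\<in>J. c t * W t \<omega>)" if "finite J" for J c
    using centered_gaussian_gaussian_rv[OF lin[OF that]] .
  have m[measurable]: "(\<lambda>\<omega>. \<Sum>t\<in>J. c t * W t \<omega>) \<in> borel_measurable M" if "finite J" for J c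
    using gl[OF that] gaussian_rv_def by blast
  have SD: "Y \<in> borel_measurable M" "integrable M (\<lambda>\<omega>. (Y \<omega>)\<^sup>2)" if "Y \<in> ?S" for Y
    using that by (auto simp: gaussian_closure_def)
  have SE: "\<exists>J c. finite J \<and> (\<integral>\<omega>. (Y \<omega> - (\<Sum>t\<in>J. c t * W t \<omega>))\<^sup>2 \<partial>M) < e" if "Y \<in> ?S" "e > 0" for Y e
    using that unfolding gaussian_closure_def by blast
  have iD: "integrable M (\<lambda>\<omega>. (Y \<omega> - Z \<omega>)\<^sup>2)" if "Y \<in> borel_measurable M" "integrable M (\<lambda>\<omega>. (Y \<omega>)\<^sup>2)"
    "Z \<in> borel_measurable M" "integrable M (\<lambda>\<omega>. (Z \<omega>)\<^sup>2)" for Y Z :: "'a \<Rightarrow> real"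
    using second_moment_add_le(2)[of Y "\<lambda>\<omega>. - Z \<omega>"] that by simp
  have gS: "gaussian_rv M Y" if Y: "Y \<in> ?S" for Y
  proof (rule gaussian_rv_L2_limit)
    fix e :: real assume "e > 0"
    then show "\<exists>Z. gaussian_rv M Z \<and> expectation (\<lambda>\<omega>. (Y \<omega> - Z \<omega>)\<^sup>2) < e"
      using SE[OF Y] gl by blast
  qed (use SD[OF Y] in auto)
  have addS: "(\<lambda>\<omega>. Y \<omega> + Z \<omega>) \<in> ?S" if Y: "Y \<in> ?S" and Z: "Z \<in> ?S" for Y Z
  proof -
    note [measurable] = SD(1)[OF Y] SD(1)[OF Z]
    have "\<exists>J c. finite J \<and> (\<integral>\<omega>. (Y \<omega> + Z \<omega> - (\<Sum>t\<in>J. c t * W t \<omega>))\<^sup>2 \<partial>M) < e" if e: "e > 0" for e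
    proof -
      obtain J c where 1: "finite J" "(\<integral>\<omega>. (Y \<omega> - (\<Sum>t\<in>J. c t * W t \<omega>))\<^sup>2 \<partial>M) < e / 4"
        using SE[OF Y, of "e / 4"] e by auto
      obtain K d where 2: "finite K" "(\<integral>\<omega>. (Z \<omega> - (\<Sum>t\<in>K. d t * W t \<omega>))\<^sup>2 \<partial>M) < e / 4"
        using SE[OF Z, of "e / 4"] e by auto
      \<comment> \<open>The two approximating sums may share times, so their coefficients are
        added.\<close>
      define g where "g t = (if t \<in> J then c t else 0) + (if t \<in> K then d t else 0)" for t
      have g: "(\<Sum>t\<in>J \<union> K. g t * W t \<omega>) = (\<Sum>t\<in>J. c t * W t \<omega>) + (\<Sum>t\<in>K. d t * W t \<omega>)" for \<omega>
      proof -
        have "(\<Sum>t\<in>J \<union> K. g t * W t \<omega>) = (\<Sum>t\<in>J \<union> K. (if t \<in> J then c t else 0) * W t \<omega>)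
           + (\<Sum>t\<in>J \<union> K. (if t \<in> K then d t else 0) * W t \<omega>)"
          unfolding g_def by (simp add: distrib_right sum.distrib)
        also have "(\<Sum>t\<in>J \<union> K. (if t \<in> J then c t else 0) * W t \<omega>) = (\<Sum>t\<in>J. c t * W t \<omega>)"
          by (rule sum.mono_neutral_cong_right) (use 1 2 in auto)
        also have "(\<Sum>t\<in>J \<union> K. (if t \<in> K then d t else 0) * W t \<omega>) = (\<Sum>t\<in>K. d t * W t \<omega>)"
          by (rule sum.mono_neutral_cong_right) (use 1 2 in auto)
        finally show ?thesis .
      qed
      have "(\<integral>\<omega>. (Y \<omega> + Z \<omega> - (\<Sum>t\<in>J \<union> K. g t * W t \<omega>))\<^sup>2 \<partial>M)
        = (\<integral>\<omega>. ((Y \<omega> - (\<Sum>t\<in>J. c t * W t \<omega>)) + (Z \<omega> - (\<Sum>t\<in>K. d t * W t \<omega>)))\<^sup>2 \<partial>M)"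
        unfolding g by (simp add: algebra_simps)
      also have "\<dots> \<le> 2 * (\<integral>\<omega>. (Y \<omega> - (\<Sum>t\<in>J. c t * W t \<omega>))\<^sup>2 \<partial>M) + 2 * (\<integral>\<omega>. (Z \<omega> - (\<Sum>t\<in>K. d t * W t \<omega>))\<^sup>2 \<partial>M)"
        using m[OF 1(1)] m[OF 2(1)] iD[OF SD[OF Y]] iD[OF SD[OF Z]] gl[OF 1(1)] gl[OF 2(1)]
        by (intro second_moment_add_le(1)) (auto simp: gaussian_rv_def)
      also have "\<dots> < e" using 1(2) 2(2) by linarith
      finally have "(\<integral>\<omega>. (Y \<omega> + Z \<omega> - (\<Sum>t\<in>J \<union> K. g t * W t \<omega>))\<^sup>2 \<partial>M) < e" .
      then show ?thesis using 1(1) 2(1) by (intro exI[of _ "J \<union> K"] exI[of _ g]) simp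
    qed
    then show ?thesis unfolding gaussian_closure_def
      using second_moment_add_le(2)[OF SD(1)[OF Y] SD(1)[OF Z] SD(2)[OF Y] SD(2)[OF Z]] by auto
  qed
  have scaleS: "(\<lambda>\<omega>. c * Y \<omega>) \<in> ?S" if Y: "Y \<in> ?S" for Y c
  proof -
    note [measurable] = SD(1)[OF Y]
    have "\<exists>J d. finite J \<and> (\<integral>\<omega>. (c * Y \<omega> - (\<Sum>t\<in>J. d t * W t \<omega>))\<^sup>2 \<partial>M) < e" if e: "e > 0" for e
    proof -
      obtain J d where 1: "finite J" "(\<integral>\<omega>. (Y \<omega> - (\<Sum>t\<in>J. d t * W t \<omega>))\<^sup>2 \<partial>M) < e / (c\<^sup>2 + 1)"
        using SE[OF Y, of "e / (c\<^sup>2 + 1)"] e by (auto simp: add_nonneg_pos)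
      have "(\<integral>\<omega>. (c * Y \<omega> - (\<Sum>t\<in>J. (c * d t) * W t \<omega>))\<^sup>2 \<partial>M) = c\<^sup>2 * (\<integral>\<omega>. (Y \<omega> - (\<Sum>t\<in>J. d t * W t \<omega>))\<^sup>2 \<partial>M)"
        by (simp add: mult.assoc sum_distrib_left[symmetric] right_diff_distrib[symmetric] power_mult_distrib)
      also have "\<dots> \<le> c\<^sup>2 * (e / (c\<^sup>2 + 1))" using 1 by (intro mult_left_mono) auto
      also have "\<dots> < e"
        using e by (simp add: divide_less_eq add_nonneg_pos algebra_simps not_less)
      finally have "(\<integral>\<omega>. (c * Y \<omega> - (\<Sum>t\<in>J. (c * d t) * W t \<omega>))\<^sup>2 \<partial>M) < e" .
      then show ?thesis using 1(1) by (intro exI[of _ J] exI[of _ "\<lambda>t. c * d t"]) simp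
    qed
    then show ?thesis unfolding gaussian_closure_def using SD[OF Y] by (auto simp: power_mult_distrib)
  qed
  have zeroS: "(\<lambda>_. 0) \<in> ?S"
    unfolding gaussian_closure_def by (auto intro!: exI[of _ "{}"])
  have limS: "Y \<in> ?S" if Z: "\<And>n :: nat. Z n \<in> ?S" and Y[measurable]: "Y \<in> borel_measurable M" and
       l: "AE \<omega> in M. (\<lambda>n. Z n \<omega>) \<longlonglongrightarrow> Y \<omega>" for Y Z
  proof -
    note Zm[measurable] = SD(1)[OF Z]
    have dS: "(\<lambda>\<omega>. Z n \<omega> - Z m \<omega>) \<in> ?S" for n m
      using addS[OF Z[of n] scaleS[OF Z[of m], of "-1"]] by simp
    \<comment> \<open>The limit criterion concerns sequences, so a failure of the Cauchy property is
      encoded as a sequence of index pairs \<open>p N\<close> beyond \<open>N\<close>, whose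
      differences still tend to 0 almost surely.\<close>
    have cauchy: "\<exists>N. \<forall>n\<ge>N. \<forall>m\<ge>N. expectation (\<lambda>\<omega>. (Z n \<omega> - Z m \<omega>)\<^sup>2) \<le> e" if e: "e > 0" for e
    proof (rule ccontr)
      assume "\<not> ?thesis"
      then have "\<forall>N. \<exists>p. fst p \<ge> N \<and> snd p \<ge> N \<and> expectation (\<lambda>\<omega>. (Z (fst p) \<omega> - Z (snd p) \<omega>)\<^sup>2) > e"
        by (auto simp: not_le)
      from choice[OF this] obtain p where p0: "\<forall>N. fst (p N) \<ge> N \<and> snd (p N) \<ge> N \<and>
          expectation (\<lambda>\<omega>. (Z (fst (p N)) \<omega> - Z (snd (p N)) \<omega>)\<^sup>2) > e" by blast
      have p: "\<And>N. fst (p N) \<ge> N" "\<And>N. snd (p N) \<ge> N"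
        "\<And>N. expectation (\<lambda>\<omega>. (Z (fst (p N)) \<omega> - Z (snd (p N)) \<omega>)\<^sup>2) > e"
        using p0 by simp_all
      have fl: "filterlim (\<lambda>N. fst (p N)) sequentially sequentially" "filterlim (\<lambda>N. snd (p N)) sequentially sequentially"
        using p by (auto intro!: filterlim_at_top_mono[OF filterlim_ident])
      have "(\<lambda>N. expectation (\<lambda>\<omega>. (Z (fst (p N)) \<omega> - Z (snd (p N)) \<omega>)\<^sup>2)) \<longlonglongrightarrow> 0"
      proof (rule gaussian_rv_AE_null_imp_L2_null[OF gS[OF dS]])
        show "AE \<omega> in M. (\<lambda>N. Z (fst (p N)) \<omega> - Z (snd (p N)) \<omega>) \<longlonglongrightarrow> 0"
          using l
        proof eventually_elim
          case (elim \<omega>)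
          show ?case
            using tendsto_diff[OF filterlim_compose[OF elim fl(1)] filterlim_compose[OF elim fl(2)]] by simp
        qed
      qed
      then have "eventually (\<lambda>N. expectation (\<lambda>\<omega>. (Z (fst (p N)) \<omega> - Z (snd (p N)) \<omega>)\<^sup>2) < e) sequentially"
        using e by (rule order_tendstoD)
      then obtain N where "expectation (\<lambda>\<omega>. (Z (fst (p N)) \<omega> - Z (snd (p N)) \<omega>)\<^sup>2) < e"
        unfolding eventually_sequentially by blast
      then show False using p(3)[of N] by simp
    qed
    \<comment> \<open>Fatou's lemma lets the second index tend to infinity, so \<open>Z n\<close> is
      L2-close to \<open>Y\<close> before \<open>Y\<close> itself is known to be square
      integrable.\<close>
    have fatou: "integrable M (\<lambda>\<omega>. (Y \<omega> - Z n \<omega>)\<^sup>2) \<and> expectation (\<lambda>\<omega>. (Y \<omega> - Z n \<omega>)\<^sup>2) \<le> e"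
      if b: "\<And>m. m \<ge> N \<Longrightarrow> expectation (\<lambda>\<omega>. (Z n \<omega> - Z m \<omega>)\<^sup>2) \<le> e" and e: "e \<ge> 0" for n N e
    proof -
      have "(\<integral>\<^sup>+\<omega>. ennreal ((Y \<omega> - Z n \<omega>)\<^sup>2) \<partial>M) = (\<integral>\<^sup>+\<omega>. liminf (\<lambda>m. ennreal ((Z n \<omega> - Z m \<omega>)\<^sup>2)) \<partial>M)"
      proof (rule nn_integral_cong_AE)
        show "AE \<omega> in M. ennreal ((Y \<omega> - Z n \<omega>)\<^sup>2) = liminf (\<lambda>m. ennreal ((Z n \<omega> - Z m \<omega>)\<^sup>2))"
          using l
        proof eventually_elim
          case (elim \<omega>)
          have "(\<lambda>m. (Z n \<omega> - Z m \<omega>)\<^sup>2) \<longlonglongrightarrow> (Z n \<omega> - Y \<omega>)\<^sup>2" by (intro tendsto_intros elim)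
          then have "(\<lambda>m. ennreal ((Z n \<omega> - Z m \<omega>)\<^sup>2)) \<longlonglongrightarrow> ennreal ((Z n \<omega> - Y \<omega>)\<^sup>2)"
            by (intro tendsto_ennrealI)
          from lim_imp_Liminf[OF _ this] show ?case
            by (simp add: power2_commute)
        qed
      qed
      also have "\<dots> \<le> liminf (\<lambda>m. \<integral>\<^sup>+\<omega>. ennreal ((Z n \<omega> - Z m \<omega>)\<^sup>2) \<partial>M)"
        by (rule nn_integral_liminf) simp
      also have "\<dots> = liminf (\<lambda>m. ennreal (expectation (\<lambda>\<omega>. (Z n \<omega> - Z m \<omega>)\<^sup>2)))"
        using SD(2)[OF dS] by (simp add: nn_integral_eq_integral)
      also have "\<dots> \<le> ennreal e"
      proof -
        have "liminf (\<lambda>m. ennreal (expectation (\<lambda>\<omega>. (Z n \<omega> - Z m \<omega>)\<^sup>2))) \<le> limsup (\<lambda>m. ennreal (expectation (\<lambda>\<omega>. (Z n \<omega> - Z m \<omega>)\<^sup>2)))"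
          by (rule Liminf_le_Limsup) simp
        also have "\<dots> \<le> ennreal e"
          by (rule Limsup_bounded) (auto simp: eventually_sequentially intro!: exI[of _ N] ennreal_leI b)
        finally show ?thesis .
      qed
      finally have *: "(\<integral>\<^sup>+\<omega>. ennreal ((Y \<omega> - Z n \<omega>)\<^sup>2) \<partial>M) \<le> ennreal e" .
      have i: "integrable M (\<lambda>\<omega>. (Y \<omega> - Z n \<omega>)\<^sup>2)"
        by (rule integrableI_nonneg) (use * in \<open>auto simp: top_unique intro: le_less_trans\<close>)
      then show ?thesis using * e by (simp add: nn_integral_eq_integral)
    qed
    obtain N where N: "\<forall>n\<ge>N. \<forall>m\<ge>N. expectation (\<lambda>\<omega>. (Z n \<omega> - Z m \<omega>)\<^sup>2) \<le> 1" using cauchy[of 1] by auto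
    have "integrable M (\<lambda>\<omega>. (Y \<omega> - Z N \<omega>)\<^sup>2)" using fatou[of N N 1] N by auto
    from second_moment_add_le(2)[of "\<lambda>\<omega>. Y \<omega> - Z N \<omega>" "Z N", OF _ _ this SD(2)[OF Z]]
    have iY: "integrable M (\<lambda>\<omega>. (Y \<omega>)\<^sup>2)" by simp
    have "\<exists>J d. finite J \<and> (\<integral>\<omega>. (Y \<omega> - (\<Sum>t\<in>J. d t * W t \<omega>))\<^sup>2 \<partial>M) < e" if e: "e > 0" for e
    proof -
      obtain N where N: "\<forall>n\<ge>N. \<forall>m\<ge>N. expectation (\<lambda>\<omega>. (Z n \<omega> - Z m \<omega>)\<^sup>2) \<le> e / 8" using cauchy[of "e / 8"] e by auto
      have f: "integrable M (\<lambda>\<omega>. (Y \<omega> - Z N \<omega>)\<^sup>2)" "expectation (\<lambda>\<omega>. (Y \<omega> - Z N \<omega>)\<^sup>2) \<le> e / 8"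
        using fatou[of N N "e / 8"] N e by auto
      obtain J c where 1: "finite J" "(\<integral>\<omega>. (Z N \<omega> - (\<Sum>t\<in>J. c t * W t \<omega>))\<^sup>2 \<partial>M) < e / 4"
        using SE[OF Z[of N], of "e / 4"] e by auto
      have "(\<integral>\<omega>. (Y \<omega> - (\<Sum>t\<in>J. c t * W t \<omega>))\<^sup>2 \<partial>M) = (\<integral>\<omega>. ((Y \<omega> - Z N \<omega>) + (Z N \<omega> - (\<Sum>t\<in>J. c t * W t \<omega>)))\<^sup>2 \<partial>M)"
        by simp
      also have "\<dots> \<le> 2 * (\<integral>\<omega>. (Y \<omega> - Z N \<omega>)\<^sup>2 \<partial>M) + 2 * (\<integral>\<omega>. (Z N \<omega> - (\<Sum>t\<in>J. c t * W t \<omega>))\<^sup>2 \<partial>M)"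
        using m[OF 1(1)] f(1) iD[OF SD[OF Z]] gl[OF 1(1)]
        by (intro second_moment_add_le(1)) (auto simp: gaussian_rv_def)
      also have "\<dots> < e" using 1(2) f(2) e by linarith
      finally have "(\<integral>\<omega>. (Y \<omega> - (\<Sum>t\<in>J. c t * W t \<omega>))\<^sup>2 \<partial>M) < e" .
      then show ?thesis using 1(1) by (intro exI[of _ J] exI[of _ c]) simp
    qed
    then show ?thesis unfolding gaussian_closure_def using iY by auto
  qed
  show ?thesis
    by unfold_locales (fact gS, fact zeroS, fact addS, fact scaleS, fact limS)
qed

section \<open>Gaussian integration by parts\<close>

text \<open>Derivatives are taken along the steps 1/(n + 1) because dominated convergence is applied
  to sequences.\<close>

lemma DERIV_sequence:
  fixes f :: "real \<Rightarrow> real"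
  assumes "DERIV f 0 :> D"
  shows "(\<lambda>n. real (Suc n) * (f (inverse (real (Suc n))) - f 0)) \<longlonglongrightarrow> D"
proof -
  have "filterlim (\<lambda>n. inverse (real (Suc n))) (at 0) sequentially"
    using LIMSEQ_inverse_real_of_nat by (simp add: filterlim_at del: of_nat_Suc)
  from filterlim_compose[OF assms[unfolded DERIV_def] this]
  show ?thesis by (simp add: divide_inverse mult.commute del: of_nat_Suc)
qed

section \<open>Expectations against a character\<close>

context prob_space
begin

text \<open>An algebra that contains the Gaussian variables; membership settles the integrability of
  the products in the Gaussian calculus.\<close>

definition all_moments :: "('a \<Rightarrow> real) set" where
  "all_moments = {F. F \<in> borel_measurable M \<and> (\<forall>k::nat. integrable M (\<lambda>\<omega>. \<bar>F \<omega>\<bar> ^ k))}"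

lemma all_moments_measurable: "F \<in> all_moments \<Longrightarrow> F \<in> borel_measurable M"
  by (simp add: all_moments_def)

lemma all_moments_power: "F \<in> all_moments \<Longrightarrow> integrable M (\<lambda>\<omega>. F \<omega> ^ k)"
  by (rule Bochner_Integration.integrable_bound[of _ "\<lambda>\<omega>. \<bar>F \<omega>\<bar> ^ k"])
    (auto simp: all_moments_def power_abs)

lemma all_moments_integrable: "F \<in> all_moments \<Longrightarrow> integrable M F"
  using all_moments_power[of F 1] by simp

lemma all_moments_const: "(\<lambda>_. c) \<in> all_moments"
  by (simp add: all_moments_def)

lemma all_moments_add:
  assumes "F \<in> all_moments" "G \<in> all_moments"
  shows "(\<lambda>\<omega>. F \<omega> + G \<omega>) \<in> all_moments"
proof -
  note [measurable] = assms[THEN all_moments_measurable]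
  have b: "\<bar>x + y\<bar> ^ k \<le> 2 ^ k * (\<bar>x\<bar> ^ k + \<bar>y\<bar> ^ k)" for x y :: real and k
  proof -
    have "\<bar>x + y\<bar> ^ k \<le> (2 * max \<bar>x\<bar> \<bar>y\<bar>) ^ k" by (intro power_mono) auto
    also have "\<dots> = 2 ^ k * max \<bar>x\<bar> \<bar>y\<bar> ^ k" by (simp add: power_mult_distrib)
    also have "\<dots> \<le> 2 ^ k * (\<bar>x\<bar> ^ k + \<bar>y\<bar> ^ k)"
      by (intro mult_left_mono) (auto simp: max_def)
    finally show ?thesis .
  qed
  have "integrable M (\<lambda>\<omega>. \<bar>F \<omega> + G \<omega>\<bar> ^ k)" for k
  proof (rule Bochner_Integration.integrable_bound)
    show "integrable M (\<lambda>\<omega>. 2 ^ k * (\<bar>F \<omega>\<bar> ^ k + \<bar>G \<omega>\<bar> ^ k))"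
      using assms by (simp add: all_moments_def)
    show "AE \<omega> in M. norm (\<bar>F \<omega> + G \<omega>\<bar> ^ k) \<le> norm (2 ^ k * (\<bar>F \<omega>\<bar> ^ k + \<bar>G \<omega>\<bar> ^ k))"
      using b by (simp add: abs_mult)
  qed auto
  then show ?thesis by (simp add: all_moments_def)
qed

lemma all_moments_mult:
  assumes "F \<in> all_moments" "G \<in> all_moments"
  shows "(\<lambda>\<omega>. F \<omega> * G \<omega>) \<in> all_moments"
proof -
  note [measurable] = assms[THEN all_moments_measurable]
  have b: "a * b \<le> a\<^sup>2 + b\<^sup>2" if "a \<ge> 0" "b \<ge> 0" for a b :: real
    using sum_squares_bound[of a b] that mult_nonneg_nonneg[of a b] zero_le_power2[of a] zero_le_power2[of b] by linarith
  have "integrable M (\<lambda>\<omega>. \<bar>F \<omega> * G \<omega>\<bar> ^ k)" for k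
  proof (rule Bochner_Integration.integrable_bound)
    show "integrable M (\<lambda>\<omega>. \<bar>F \<omega>\<bar> ^ (k * 2) + \<bar>G \<omega>\<bar> ^ (k * 2))"
      using assms by (simp add: all_moments_def)
    show "AE \<omega> in M. norm (\<bar>F \<omega> * G \<omega>\<bar> ^ k) \<le> norm (\<bar>F \<omega>\<bar> ^ (k * 2) + \<bar>G \<omega>\<bar> ^ (k * 2))"
      using b[of "\<bar>F \<omega>\<bar> ^ k" "\<bar>G \<omega>\<bar> ^ k" for \<omega>] by (simp add: power_mult abs_mult power_mult_distrib)
  qed auto
  then show ?thesis by (simp add: all_moments_def)
qed

lemma all_moments_sum:
  "(\<And>i. i \<in> I \<Longrightarrow> F i \<in> all_moments) \<Longrightarrow> (\<lambda>\<omega>. \<Sum>i\<in>I. F i \<omega>) \<in> all_moments"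
  by (induction I rule: infinite_finite_induct) (auto intro: all_moments_const all_moments_add)

lemma all_moments_pow:
  "F \<in> all_moments \<Longrightarrow> (\<lambda>\<omega>. F \<omega> ^ k) \<in> all_moments"
  by (induction k) (auto intro: all_moments_const all_moments_mult)

text \<open>The mean of \<open>F\<close> under the complex weight exp (i Z). As a function of
  \<open>Z\<close> it is a generating functional: a derivative in the direction \<open>Y\<close>
  multiplies \<open>F\<close> by i Y.\<close>

definition iexp_mean :: "('a \<Rightarrow> real) \<Rightarrow> ('a \<Rightarrow> real) \<Rightarrow> complex" where
  "iexp_mean Z F = (CLINT \<omega>|M. iexp (Z \<omega>) * of_real (F \<omega>))"

lemma iexp_integrable:
  assumes [measurable]: "Z \<in> borel_measurable M" and F: "integrable M F"
  shows "integrable M (\<lambda>\<omega>. iexp (Z \<omega>) * complex_of_real (F \<omega>))"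
proof (rule Bochner_Integration.integrable_bound[OF F])
  have [measurable]: "F \<in> borel_measurable M" using F by auto
  show "(\<lambda>\<omega>. iexp (Z \<omega>) * complex_of_real (F \<omega>)) \<in> borel_measurable M" by measurable
qed (auto simp: norm_mult)

lemma iexp_mean_add:
  assumes "Z \<in> borel_measurable M" "integrable M F" "integrable M G"
  shows "iexp_mean Z (\<lambda>\<omega>. F \<omega> + G \<omega>) = iexp_mean Z F + iexp_mean Z G"
  unfolding iexp_mean_def using iexp_integrable[OF assms(1)] assms
  by (simp add: distrib_left)

lemma iexp_mean_scale: "iexp_mean Z (\<lambda>\<omega>. c * F \<omega>) = of_real c * iexp_mean Z F"
proof -
  have "iexp_mean Z (\<lambda>\<omega>. c * F \<omega>) = (CLINT \<omega>|M. of_real c * (iexp (Z \<omega>) * of_real (F \<omega>)))"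
    unfolding iexp_mean_def by (simp add: algebra_simps)
  then show ?thesis unfolding iexp_mean_def by simp
qed

text \<open>Differentiation under the expectation: the character is Lipschitz, so the difference
  quotients are dominated by |Y F|.\<close>

lemma iexp_mean_diff_quotient:
  assumes [measurable]: "Z \<in> borel_measurable M" "Y \<in> borel_measurable M"
    and F: "integrable M F" and YF: "integrable M (\<lambda>\<omega>. Y \<omega> * F \<omega>)"
  shows "(\<lambda>n. of_nat (Suc n) * (iexp_mean (\<lambda>\<omega>. Z \<omega> + inverse (real (Suc n)) * Y \<omega>) F - iexp_mean Z F))
     \<longlonglongrightarrow> \<i> * iexp_mean Z (\<lambda>\<omega>. Y \<omega> * F \<omega>)"
proof -
  have [measurable]: "F \<in> borel_measurable M" using F by auto
  define r where "r n = inverse (real (Suc n))" for n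
  have rn: "r n > 0" "real (Suc n) = inverse (r n)" for n by (simp_all add: r_def)
  let ?g = "\<lambda>n \<omega>. of_nat (Suc n) * (iexp (Z \<omega> + r n * Y \<omega>) - iexp (Z \<omega>)) * complex_of_real (F \<omega>)"
  have "(\<lambda>n. CLINT \<omega>|M. ?g n \<omega>) \<longlonglongrightarrow> (CLINT \<omega>|M. \<i> * (iexp (Z \<omega>) * of_real (Y \<omega> * F \<omega>)))"
  proof (rule integral_dominated_convergence[where w="\<lambda>\<omega>. \<bar>Y \<omega> * F \<omega>\<bar>"])
    show "AE \<omega> in M. (\<lambda>n. ?g n \<omega>) \<longlonglongrightarrow> \<i> * (iexp (Z \<omega>) * of_real (Y \<omega> * F \<omega>))"
    proof (rule AE_I2)
      fix \<omega>
      have "((\<lambda>z. exp (\<i> * (of_real (Z \<omega>) + z * of_real (Y \<omega>)))) has_field_derivative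
          \<i> * of_real (Y \<omega>) * iexp (Z \<omega>)) (at 0)"
        by (auto intro!: derivative_eq_intros)
      then have d: "((\<lambda>h. (exp (\<i> * (of_real (Z \<omega>) + h * of_real (Y \<omega>))) - iexp (Z \<omega>)) / h) \<longlongrightarrow>
          \<i> * of_real (Y \<omega>) * iexp (Z \<omega>)) (at 0)"
        by (simp add: DERIV_def)
      have f: "filterlim (\<lambda>n. complex_of_real (r n)) (at 0) sequentially"
        unfolding filterlim_at
      proof
        show "\<forall>\<^sub>F x in sequentially. complex_of_real (r x) \<in> UNIV \<and> complex_of_real (r x) \<noteq> 0"
          using rn(1) by (simp add: less_imp_neq[symmetric])
        have "(\<lambda>n. complex_of_real (r n)) \<longlonglongrightarrow> of_real 0"
          unfolding r_def by (intro tendsto_of_real LIMSEQ_inverse_real_of_nat)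
        then show "(\<lambda>n. complex_of_real (r n)) \<longlonglongrightarrow> 0" by simp
      qed
      have q: "x / complex_of_real (r n) = of_nat (Suc n) * x" for x n
        by (simp add: r_def divide_inverse mult.commute)
      have "(\<lambda>n. of_nat (Suc n) * (iexp (Z \<omega> + r n * Y \<omega>) - iexp (Z \<omega>))) \<longlonglongrightarrow> \<i> * of_real (Y \<omega>) * iexp (Z \<omega>)"
        using filterlim_compose[OF d f] unfolding q by (simp del: of_nat_Suc)
      from tendsto_mult_right[OF this, of "of_real (F \<omega>)"]
      show "(\<lambda>n. ?g n \<omega>) \<longlonglongrightarrow> \<i> * (iexp (Z \<omega>) * of_real (Y \<omega> * F \<omega>))"
        by (simp add: mult_ac del: of_nat_Suc)
    qed
    show "AE \<omega> in M. norm (?g n \<omega>) \<le> \<bar>Y \<omega> * F \<omega>\<bar>" for n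
    proof (rule AE_I2)
      fix \<omega>
      have "norm (?g n \<omega>) = real (Suc n) * cmod (iexp (Z \<omega> + r n * Y \<omega>) - iexp (Z \<omega>)) * \<bar>F \<omega>\<bar>"
        unfolding norm_mult norm_of_nat by simp
      also have "\<dots> \<le> real (Suc n) * \<bar>r n * Y \<omega>\<bar> * \<bar>F \<omega>\<bar>"
        using norm_iexp_diff_le[of "Z \<omega> + r n * Y \<omega>" "Z \<omega>"]
        by (intro mult_right_mono mult_left_mono) auto
      also have "\<dots> = \<bar>Y \<omega> * F \<omega>\<bar>" unfolding rn(2) using rn(1)[of n] by (simp add: abs_mult)
      finally show "norm (?g n \<omega>) \<le> \<bar>Y \<omega> * F \<omega>\<bar>" .
    qed
    show "(\<lambda>\<omega>. ?g n \<omega>) \<in> borel_measurable M" for n by measurable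
    show "integrable M (\<lambda>\<omega>. \<bar>Y \<omega> * F \<omega>\<bar>)" using YF by auto
  qed measurable
  moreover have "(CLINT \<omega>|M. ?g n \<omega>) = of_nat (Suc n) * (iexp_mean (\<lambda>\<omega>. Z \<omega> + r n * Y \<omega>) F - iexp_mean Z F)" for n
    unfolding iexp_mean_def left_diff_distrib right_diff_distrib mult.assoc
    using iexp_integrable[of "\<lambda>\<omega>. Z \<omega> + r n * Y \<omega>" F] iexp_integrable[of Z F] F
    by (subst Bochner_Integration.integral_diff) (auto simp del: of_nat_Suc)
  ultimately show ?thesis unfolding r_def iexp_mean_def by simp
qed

lemma iexp_mean_tendsto:
  assumes [measurable]: "Z \<in> borel_measurable M" "Y \<in> borel_measurable M" and F: "integrable M F"
  shows "(\<lambda>n. iexp_mean (\<lambda>\<omega>. Z \<omega> + inverse (real (Suc n)) * Y \<omega>) F) \<longlonglongrightarrow> iexp_mean Z F"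
  unfolding iexp_mean_def
proof (rule integral_dominated_convergence[where w="\<lambda>\<omega>. \<bar>F \<omega>\<bar>"])
  have [measurable]: "F \<in> borel_measurable M" using F by auto
  show "(\<lambda>\<omega>. iexp (Z \<omega>) * complex_of_real (F \<omega>)) \<in> borel_measurable M"
    "\<And>n. (\<lambda>\<omega>. iexp (Z \<omega> + inverse (real (Suc n)) * Y \<omega>) * complex_of_real (F \<omega>)) \<in> borel_measurable M"
    by measurable
  show "AE \<omega> in M. (\<lambda>n. iexp (Z \<omega> + inverse (real (Suc n)) * Y \<omega>) * complex_of_real (F \<omega>))
      \<longlonglongrightarrow> iexp (Z \<omega>) * complex_of_real (F \<omega>)"
  proof (rule AE_I2)
    fix \<omega>
    have "(\<lambda>n. iexp (Z \<omega> + inverse (real (Suc n)) * Y \<omega>) * complex_of_real (F \<omega>))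
      \<longlonglongrightarrow> iexp (Z \<omega> + 0 * Y \<omega>) * complex_of_real (F \<omega>)"
      by (intro tendsto_intros LIMSEQ_inverse_real_of_nat)
    then show "(\<lambda>n. iexp (Z \<omega> + inverse (real (Suc n)) * Y \<omega>) * complex_of_real (F \<omega>))
      \<longlonglongrightarrow> iexp (Z \<omega>) * complex_of_real (F \<omega>)" by simp
  qed
qed (use F in \<open>auto simp: norm_mult\<close>)

end

context gaussian_space
begin

lemma moments: "Y \<in> S \<Longrightarrow> Y \<in> all_moments"
  using gaussian_rv_moments(1)[OF gaussian, of Y] meas[of Y]
  by (auto simp: all_moments_def power_abs[symmetric])

text \<open>\<open>D Y\<close> plays the role of the Malliavin derivative of \<open>F\<close> in the
  direction \<open>Y\<close>. The character exp (i Z) stays in the identity so that further factors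
  can be produced by differentiating in \<open>Z\<close>; at \<open>Z = 0\<close> the usual
  integration by parts remains.\<close>

definition ibp :: "('a \<Rightarrow> real) \<Rightarrow> (('a \<Rightarrow> real) \<Rightarrow> 'a \<Rightarrow> real) \<Rightarrow> bool" where
  "ibp F D \<longleftrightarrow> F \<in> all_moments \<and> (\<forall>Y\<in>S. D Y \<in> all_moments) \<and>
     (\<forall>Y\<in>S. \<forall>Z\<in>S. iexp_mean Z (\<lambda>\<omega>. Y \<omega> * F \<omega>) =
        \<i> * of_real (expectation (\<lambda>\<omega>. Y \<omega> * Z \<omega>)) * iexp_mean Z F + iexp_mean Z (D Y))"

text \<open>The expectation of exp (i (Z + t Y)) is exp (- E (Z + t Y)^2 / 2); its derivative at t =
  0 is computed from both forms.\<close>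

lemma ibp_one: "ibp (\<lambda>_. 1) (\<lambda>_ _. 0)"
proof -
  have "iexp_mean Z Y = \<i> * of_real (expectation (\<lambda>\<omega>. Y \<omega> * Z \<omega>)) * iexp_mean Z (\<lambda>_. 1)"
    if Y: "Y \<in> S" and Z: "Z \<in> S" for Y Z
  proof -
    have g: "iexp_mean U (\<lambda>_. 1) = of_real (exp (- expectation (\<lambda>\<omega>. (U \<omega>)\<^sup>2) / 2))" if "U \<in> S" for U
    proof -
      have "(CLINT \<omega>|M. iexp (1 * U \<omega>)) = of_real (exp (- (1\<^sup>2 * (expectation (\<lambda>\<omega>. (U \<omega>)\<^sup>2))) / 2))"
        using gaussian[OF that] unfolding gaussian_rv_def by blast
      then show ?thesis unfolding iexp_mean_def by simp
    qed
    let ?a = "expectation (\<lambda>\<omega>. (Z \<omega>)\<^sup>2)" and ?b = "expectation (\<lambda>\<omega>. Y \<omega> * Z \<omega>)"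
      and ?c = "expectation (\<lambda>\<omega>. (Y \<omega>)\<^sup>2)"
    have v: "expectation (\<lambda>\<omega>. (Z \<omega> + t * Y \<omega>)\<^sup>2) = ?a + 2 * t * ?b + t\<^sup>2 * ?c" for t
    proof -
      have "expectation (\<lambda>\<omega>. (Z \<omega> + t * Y \<omega>)\<^sup>2)
         = expectation (\<lambda>\<omega>. (Z \<omega>)\<^sup>2 + 2 * t * (Y \<omega> * Z \<omega>) + t\<^sup>2 * (Y \<omega>)\<^sup>2)"
        by (intro Bochner_Integration.integral_cong) (auto simp: power2_eq_square algebra_simps)
      then show ?thesis using square_integrable[OF Z] square_integrable[OF Y] prod_integrable[OF Y Z] by simp
    qed
    define f where "f t = exp (- (?a + 2 * t * ?b + t\<^sup>2 * ?c) / 2)" for t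
    have "DERIV f 0 :> - ?b * exp (- ?a / 2)"
      unfolding f_def by (auto intro!: derivative_eq_intros)
    note tendsto_of_real[OF DERIV_sequence[OF this], where 'a=complex]
    moreover have "complex_of_real (f t) = iexp_mean (\<lambda>\<omega>. Z \<omega> + t * Y \<omega>) (\<lambda>_. 1)" for t
      using g[OF add[OF Z scale[OF Y, of t]]] v[of t] by (simp add: f_def)
    moreover have "f 0 = exp (- ?a / 2)" by (simp add: f_def)
    ultimately have "(\<lambda>n. of_nat (Suc n) * (iexp_mean (\<lambda>\<omega>. Z \<omega> + inverse (real (Suc n)) * Y \<omega>) (\<lambda>_. 1) - iexp_mean Z (\<lambda>_. 1)))
      \<longlonglongrightarrow> - of_real ?b * iexp_mean Z (\<lambda>_. 1)"
      using g[OF Z] by (simp del: of_nat_Suc)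
    moreover have "(\<lambda>n. of_nat (Suc n) * (iexp_mean (\<lambda>\<omega>. Z \<omega> + inverse (real (Suc n)) * Y \<omega>) (\<lambda>_. 1) - iexp_mean Z (\<lambda>_. 1)))
      \<longlonglongrightarrow> \<i> * iexp_mean Z (\<lambda>\<omega>. Y \<omega> * 1)"
      using iexp_mean_diff_quotient[OF meas[OF Z] meas[OF Y], of "\<lambda>_. 1"] integrable[OF Y] by simp
    ultimately have "- of_real ?b * iexp_mean Z (\<lambda>_. 1) = \<i> * iexp_mean Z Y"
      using LIMSEQ_unique by fastforce
    then have "\<i> * (- of_real ?b * iexp_mean Z (\<lambda>_. 1)) = \<i> * (\<i> * iexp_mean Z Y)" by simp
    then show ?thesis by (simp add: algebra_simps)
  qed
  then show ?thesis unfolding ibp_def by (auto intro: all_moments_const simp: iexp_mean_def[of _ "\<lambda>_. 0"])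
qed

lemma ibp_add:
  assumes F: "ibp F D" and G: "ibp G E"
  shows "ibp (\<lambda>\<omega>. F \<omega> + G \<omega>) (\<lambda>Y \<omega>. D Y \<omega> + E Y \<omega>)"
  using assms unfolding ibp_def
  by (auto intro!: all_moments_add simp: distrib_left iexp_mean_add meas all_moments_integrable all_moments_mult moments)

lemma ibp_scale:
  assumes F: "ibp F D"
  shows "ibp (\<lambda>\<omega>. c * F \<omega>) (\<lambda>Y \<omega>. c * D Y \<omega>)"
  using assms unfolding ibp_def
  by (auto intro!: all_moments_mult all_moments_const simp: iexp_mean_scale mult.left_commute[of _ c] algebra_simps)

text \<open>A Leibniz rule, obtained by differentiating the identity for \<open>F\<close> in
  \<open>Z\<close> along \<open>U\<close>. The coefficient i E (Y Z) contributes the new term E (Y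
  U) F; the rest reproduces the identity with the factor \<open>U\<close>.\<close>

lemma ibp_mult:
  assumes F: "ibp F D" and U: "U \<in> S"
  shows "ibp (\<lambda>\<omega>. U \<omega> * F \<omega>) (\<lambda>Y \<omega>. expectation (\<lambda>\<omega>. Y \<omega> * U \<omega>) * F \<omega> + U \<omega> * D Y \<omega>)"
proof -
  have Fm: "F \<in> all_moments" and Dm: "\<And>Y. Y \<in> S \<Longrightarrow> D Y \<in> all_moments"
    and id: "\<And>Y Z. Y \<in> S \<Longrightarrow> Z \<in> S \<Longrightarrow> iexp_mean Z (\<lambda>\<omega>. Y \<omega> * F \<omega>) =
        \<i> * of_real (expectation (\<lambda>\<omega>. Y \<omega> * Z \<omega>)) * iexp_mean Z F + iexp_mean Z (D Y)"
    using F by (auto simp: ibp_def)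
  have "iexp_mean Z (\<lambda>\<omega>. Y \<omega> * (U \<omega> * F \<omega>)) =
        \<i> * of_real (expectation (\<lambda>\<omega>. Y \<omega> * Z \<omega>)) * iexp_mean Z (\<lambda>\<omega>. U \<omega> * F \<omega>) +
        iexp_mean Z (\<lambda>\<omega>. expectation (\<lambda>\<omega>. Y \<omega> * U \<omega>) * F \<omega> + U \<omega> * D Y \<omega>)"
    if Y: "Y \<in> S" and Z: "Z \<in> S" for Y Z
  proof -
    define r where "r n = inverse (real (Suc n))" for n
    define Zn where "Zn n = (\<lambda>\<omega>. Z \<omega> + r n * U \<omega>)" for n
    have ZnS: "Zn n \<in> S" for n unfolding Zn_def by (intro add scale Z U)
    let ?b = "complex_of_real (expectation (\<lambda>\<omega>. Y \<omega> * Z \<omega>))" and ?c = "complex_of_real (expectation (\<lambda>\<omega>. Y \<omega> * U \<omega>))"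
    have bn: "complex_of_real (expectation (\<lambda>\<omega>. Y \<omega> * Zn n \<omega>)) = ?b + of_real (r n) * ?c" for n
      unfolding Zn_def distrib_left mult.left_commute[of _ "r n"]
      using prod_integrable[OF Y Z] prod_integrable[OF Y U] by simp
    let ?dq = "\<lambda>n G. of_nat (Suc n) * (iexp_mean (Zn n) G - iexp_mean Z G)"
    have rs: "of_nat (Suc n) * complex_of_real (r n) = 1" for n
    proof -
      have "complex_of_real (real (Suc n) * r n) = 1" unfolding r_def by (simp del: of_nat_Suc)
      then show ?thesis by (simp only: of_real_mult of_real_of_nat_eq)
    qed
    have eq: "?dq n (\<lambda>\<omega>. Y \<omega> * F \<omega>) = \<i> * ?b * ?dq n F + \<i> * ?c * iexp_mean (Zn n) F + ?dq n (D Y)" for n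
    proof -
      have "?dq n (\<lambda>\<omega>. Y \<omega> * F \<omega>) = \<i> * ?b * ?dq n F + \<i> * ?c * iexp_mean (Zn n) F * (of_nat (Suc n) * complex_of_real (r n)) + ?dq n (D Y)"
        unfolding id[OF Y ZnS] id[OF Y Z] bn by (simp add: algebra_simps del: of_nat_Suc)
      then show ?thesis unfolding rs by simp
    qed
    have dql: "(\<lambda>n. ?dq n G) \<longlonglongrightarrow> \<i> * iexp_mean Z (\<lambda>\<omega>. U \<omega> * G \<omega>)" if "G \<in> all_moments" for G
      unfolding Zn_def r_def
      using that moments[OF U] by (intro iexp_mean_diff_quotient meas Z U all_moments_integrable all_moments_mult)
    have cl: "(\<lambda>n. iexp_mean (Zn n) F) \<longlonglongrightarrow> iexp_mean Z F"
      unfolding Zn_def r_def by (intro iexp_mean_tendsto meas Z U all_moments_integrable Fm)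
    have "(\<lambda>n. \<i> * ?b * ?dq n F + \<i> * ?c * iexp_mean (Zn n) F + ?dq n (D Y)) \<longlonglongrightarrow>
      \<i> * ?b * (\<i> * iexp_mean Z (\<lambda>\<omega>. U \<omega> * F \<omega>)) + \<i> * ?c * iexp_mean Z F + \<i> * iexp_mean Z (\<lambda>\<omega>. U \<omega> * D Y \<omega>)"
      by (intro tendsto_add tendsto_mult_left dql cl Fm Dm Y)
    moreover have "(\<lambda>n. ?dq n (\<lambda>\<omega>. Y \<omega> * F \<omega>)) \<longlonglongrightarrow> \<i> * iexp_mean Z (\<lambda>\<omega>. U \<omega> * (Y \<omega> * F \<omega>))"
      by (intro dql all_moments_mult moments Y Fm)
    ultimately have "\<i> * iexp_mean Z (\<lambda>\<omega>. U \<omega> * (Y \<omega> * F \<omega>)) =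
      \<i> * ?b * (\<i> * iexp_mean Z (\<lambda>\<omega>. U \<omega> * F \<omega>)) + \<i> * ?c * iexp_mean Z F + \<i> * iexp_mean Z (\<lambda>\<omega>. U \<omega> * D Y \<omega>)"
      unfolding eq by (rule LIMSEQ_unique[symmetric])
    also have "\<dots> = \<i> * (\<i> * ?b * iexp_mean Z (\<lambda>\<omega>. U \<omega> * F \<omega>) + ?c * iexp_mean Z F + iexp_mean Z (\<lambda>\<omega>. U \<omega> * D Y \<omega>))"
      by (simp add: algebra_simps)
    finally have "iexp_mean Z (\<lambda>\<omega>. U \<omega> * (Y \<omega> * F \<omega>)) =
      \<i> * ?b * iexp_mean Z (\<lambda>\<omega>. U \<omega> * F \<omega>) + ?c * iexp_mean Z F + iexp_mean Z (\<lambda>\<omega>. U \<omega> * D Y \<omega>)"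
      by (simp only: mult_cancel_left complex_i_not_zero) simp
    moreover have "iexp_mean Z (\<lambda>\<omega>. expectation (\<lambda>\<omega>. Y \<omega> * U \<omega>) * F \<omega> + U \<omega> * D Y \<omega>) = ?c * iexp_mean Z F + iexp_mean Z (\<lambda>\<omega>. U \<omega> * D Y \<omega>)"
      by (subst iexp_mean_add)
        (auto intro!: meas Z all_moments_integrable all_moments_mult all_moments_const Fm Dm[OF Y] moments[OF U] simp: iexp_mean_scale)
    ultimately show ?thesis by (simp add: mult_ac)
  qed
  then show ?thesis unfolding ibp_def
    using Fm Dm moments[OF U] by (auto intro!: all_moments_add all_moments_mult all_moments_const)
qed

lemma ibp_sum:
  assumes "\<And>i. i \<in> I \<Longrightarrow> ibp (F i) (D i)"
  shows "ibp (\<lambda>\<omega>. \<Sum>i\<in>I. F i \<omega>) (\<lambda>Y \<omega>. \<Sum>i\<in>I. D i Y \<omega>)"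
proof -
  have 0: "ibp (\<lambda>_. 0) (\<lambda>_ _. 0)" using ibp_scale[OF ibp_one, of 0] by simp
  show ?thesis using assms
    by (induction I rule: infinite_finite_induct) (auto intro: 0 ibp_add)
qed

lemma ibp_expectation:
  assumes "ibp F D" "Y \<in> S"
  shows "expectation (\<lambda>\<omega>. Y \<omega> * F \<omega>) = expectation (D Y)"
proof -
  have e: "iexp_mean (\<lambda>_. 0) G = of_real (expectation G)" if "G \<in> all_moments" for G
    unfolding iexp_mean_def using all_moments_integrable[OF that] by simp
  have "iexp_mean (\<lambda>_. 0) (\<lambda>\<omega>. Y \<omega> * F \<omega>) = iexp_mean (\<lambda>_. 0) (D Y)"
    using assms zero unfolding ibp_def by simp
  then show ?thesis using assms unfolding ibp_def
    by (simp add: e all_moments_mult moments)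
qed

lemma iexp_mean_linear:
  assumes "Y \<in> S" "Z \<in> S"
  shows "iexp_mean Z Y = \<i> * of_real (expectation (\<lambda>\<omega>. Y \<omega> * Z \<omega>)) * iexp_mean Z (\<lambda>_. 1)"
proof -
  have "iexp_mean Z (\<lambda>\<omega>. Y \<omega> * 1) = \<i> * of_real (expectation (\<lambda>\<omega>. Y \<omega> * Z \<omega>)) * iexp_mean Z (\<lambda>_. 1) + iexp_mean Z (\<lambda>_. 0)"
    using ibp_one assms unfolding ibp_def by blast
  then show ?thesis by (simp add: iexp_mean_def[of _ "\<lambda>_. 0"])
qed

lemma iexp_mean_product:
  assumes "U \<in> S" "Y \<in> S" "Z \<in> S"
  shows "iexp_mean Z (\<lambda>\<omega>. U \<omega> * Y \<omega>) = of_real (expectation (\<lambda>\<omega>. U \<omega> * Y \<omega>)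
    - expectation (\<lambda>\<omega>. U \<omega> * Z \<omega>) * expectation (\<lambda>\<omega>. Y \<omega> * Z \<omega>)) * iexp_mean Z (\<lambda>_. 1)"
proof -
  have "iexp_mean Z (\<lambda>\<omega>. U \<omega> * (Y \<omega> * 1)) = \<i> * of_real (expectation (\<lambda>\<omega>. U \<omega> * Z \<omega>)) * iexp_mean Z (\<lambda>\<omega>. Y \<omega> * 1)
      + iexp_mean Z (\<lambda>\<omega>. expectation (\<lambda>\<omega>. U \<omega> * Y \<omega>) * 1 + Y \<omega> * 0)"
    using ibp_mult[OF ibp_one assms(2)] assms unfolding ibp_def by blast
  then show ?thesis
    using iexp_mean_scale[of Z "expectation (\<lambda>\<omega>. U \<omega> * Y \<omega>)" "\<lambda>_. 1"] iexp_mean_linear[OF assms(2,3)]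
    by (simp add: algebra_simps)
qed

end

section \<open>Sums of centred squares\<close>

context gaussian_space
begin

lemma ibp_cong:
  assumes "ibp F D" "\<And>\<omega>. F \<omega> = G \<omega>" "\<And>Y \<omega>. D Y \<omega> = E Y \<omega>"
  shows "ibp G E"
proof -
  have "F = G" "D = E" by (intro ext; simp add: assms)+
  then show ?thesis using assms(1) by simp
qed

definition wick_square_sum :: "'i set \<Rightarrow> ('i \<Rightarrow> 'a \<Rightarrow> real) \<Rightarrow> 'a \<Rightarrow> real" where
  "wick_square_sum I Y \<omega> = (\<Sum>i\<in>I. (Y i \<omega>)\<^sup>2 - expectation (\<lambda>\<omega>. (Y i \<omega>)\<^sup>2))"

lemma ibp_all_moments: "ibp F D \<Longrightarrow> F \<in> all_moments" "ibp F D \<Longrightarrow> Y \<in> S \<Longrightarrow> D Y \<in> all_moments"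
  by (auto simp: ibp_def)

lemma expectation_mult_ibp:
  assumes F: "ibp F D" and U: "U \<in> S" and Y: "Y \<in> S"
  shows "expectation (\<lambda>\<omega>. Y \<omega> * (U \<omega> * F \<omega>)) =
    expectation (\<lambda>\<omega>. Y \<omega> * U \<omega>) * expectation F + expectation (\<lambda>\<omega>. U \<omega> * D Y \<omega>)"
  unfolding ibp_expectation[OF ibp_mult[OF F U] Y]
  using ibp_all_moments[OF F] moments[OF U] Y
  by (subst Bochner_Integration.integral_add) (auto intro!: all_moments_integrable all_moments_mult all_moments_const)

lemma all_moments_diff: "F \<in> all_moments \<Longrightarrow> G \<in> all_moments \<Longrightarrow> (\<lambda>\<omega>. F \<omega> - G \<omega>) \<in> all_moments"
  using all_moments_add[of F "\<lambda>\<omega>. -1 * G \<omega>"] all_moments_mult[OF all_moments_const[of "-1"], of G] by simp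

lemma wick_square_sum_moments:
  assumes "\<And>i. i \<in> I \<Longrightarrow> Y i \<in> S"
  shows "wick_square_sum I Y \<in> all_moments"
  unfolding wick_square_sum_def power2_eq_square
  using assms by (intro all_moments_sum all_moments_diff all_moments_mult all_moments_const moments) auto

text \<open>Integration by parts with respect to one factor of (Y i)^2 produces E (Y i)^2 E F, which
  the subtracted mean cancels; only the derivative of \<open>F\<close> remains.\<close>

lemma expectation_wick_square_sum_mult:
  assumes I: "finite I" and Y: "\<And>i. i \<in> I \<Longrightarrow> Y i \<in> S" and F: "ibp F D"
  shows "expectation (\<lambda>\<omega>. wick_square_sum I Y \<omega> * F \<omega>) = (\<Sum>i\<in>I. expectation (\<lambda>\<omega>. Y i \<omega> * D (Y i) \<omega>))"
proof -
  have Fm: "F \<in> all_moments" using ibp_all_moments[OF F] by simp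
  have i1: "integrable M (\<lambda>\<omega>. Y i \<omega> * (Y i \<omega> * F \<omega>))" if "i \<in> I" for i
    using that by (intro all_moments_integrable all_moments_mult moments Y Fm)
  have i2: "integrable M (\<lambda>\<omega>. expectation (\<lambda>\<omega>. (Y i \<omega>)\<^sup>2) * F \<omega>)" for i
    by (intro all_moments_integrable all_moments_mult all_moments_const Fm)
  have "expectation (\<lambda>\<omega>. wick_square_sum I Y \<omega> * F \<omega>) =
    expectation (\<lambda>\<omega>. \<Sum>i\<in>I. Y i \<omega> * (Y i \<omega> * F \<omega>) - expectation (\<lambda>\<omega>. (Y i \<omega>)\<^sup>2) * F \<omega>)"
    unfolding wick_square_sum_def sum_distrib_right by (simp add: power2_eq_square algebra_simps)
  also have "\<dots> = (\<Sum>i\<in>I. expectation (\<lambda>\<omega>. Y i \<omega> * (Y i \<omega> * F \<omega>)) - expectation (\<lambda>\<omega>. (Y i \<omega>)\<^sup>2) * expectation F)"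
    using i1 i2 by (subst Bochner_Integration.integral_sum) auto
  also have "\<dots> = (\<Sum>i\<in>I. expectation (\<lambda>\<omega>. Y i \<omega> * D (Y i) \<omega>))"
    by (intro sum.cong) (auto simp: expectation_mult_ibp[OF F Y Y] power2_eq_square)
  finally show ?thesis .
qed

lemma ibp_wick_square_sum_mult:
  assumes Y: "\<And>i. i \<in> I \<Longrightarrow> Y i \<in> S" and F: "ibp F D"
  shows "ibp (\<lambda>\<omega>. wick_square_sum I Y \<omega> * F \<omega>)
    (\<lambda>Z \<omega>. 2 * (\<Sum>i\<in>I. expectation (\<lambda>\<omega>. Z \<omega> * Y i \<omega>) * Y i \<omega>) * F \<omega> + wick_square_sum I Y \<omega> * D Z \<omega>)"
proof -
  have 1: "ibp (\<lambda>\<omega>. Y i \<omega> * (Y i \<omega> * F \<omega>))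
    (\<lambda>Z \<omega>. expectation (\<lambda>\<omega>. Z \<omega> * Y i \<omega>) * (Y i \<omega> * F \<omega>)
       + Y i \<omega> * (expectation (\<lambda>\<omega>. Z \<omega> * Y i \<omega>) * F \<omega> + Y i \<omega> * D Z \<omega>))" if "i \<in> I" for i
    by (intro ibp_mult F Y that)
  note 2 = ibp_sum[of I, OF ibp_add[OF 1 ibp_scale[OF F, of "- expectation (\<lambda>\<omega>. (Y i \<omega>)\<^sup>2)" for i]]]
  show ?thesis
    by (rule ibp_cong[OF 2])
      (simp_all add: wick_square_sum_def sum_distrib_right sum_distrib_left sum.distrib[symmetric] power2_eq_square algebra_simps)
qed

lemma ibp_wick_square_sum_power:
  assumes Y: "\<And>i. i \<in> I \<Longrightarrow> Y i \<in> S"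
  shows "ibp (\<lambda>\<omega>. wick_square_sum I Y \<omega> ^ Suc k)
    (\<lambda>Z \<omega>. 2 * real (Suc k) * wick_square_sum I Y \<omega> ^ k * (\<Sum>i\<in>I. expectation (\<lambda>\<omega>. Z \<omega> * Y i \<omega>) * Y i \<omega>))"
proof (induction k)
  case 0
  show ?case by (rule ibp_cong[OF ibp_wick_square_sum_mult[OF Y ibp_one]]) auto
next
  case (Suc k)
  show ?case by (rule ibp_cong[OF ibp_wick_square_sum_mult[OF Y Suc.IH]]) (auto simp: algebra_simps)
qed

lemma expectation_sum_mult:
  assumes "\<And>j. j \<in> I \<Longrightarrow> G j \<in> all_moments"
  shows "expectation (\<lambda>\<omega>. \<Sum>j\<in>I. c j * G j \<omega>) = (\<Sum>j\<in>I. c j * expectation (G j))"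
  using assms all_moments_integrable by (subst Bochner_Integration.integral_sum) auto

text \<open>Repeated integration by parts expresses the moment through the covariance matrix K as 12
  s^2 + 48 tr K^4, where s is the sum of the squared entries, and tr K^4 \<le> s^2 by
  Cauchy-Schwarz.\<close>

lemma fourth_moment_wick_square_sum:
  assumes I: "finite I" and Y: "\<And>i. i \<in> I \<Longrightarrow> Y i \<in> S"
  shows "expectation (\<lambda>\<omega>. wick_square_sum I Y \<omega> ^ 4)
    \<le> 60 * (\<Sum>i\<in>I. \<Sum>j\<in>I. (expectation (\<lambda>\<omega>. Y i \<omega> * Y j \<omega>))\<^sup>2)\<^sup>2"
proof -
  define K where "K i j = expectation (\<lambda>\<omega>. Y i \<omega> * Y j \<omega>)" for i j
  define Q where "Q = wick_square_sum I Y"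
  have Qm: "Q \<in> all_moments" unfolding Q_def by (rule wick_square_sum_moments[OF Y])
  note Ym = moments[OF Y]
  have ibpk: "ibp (\<lambda>\<omega>. Q \<omega> ^ Suc k)
    (\<lambda>Z \<omega>. 2 * real (Suc k) * Q \<omega> ^ k * (\<Sum>i\<in>I. expectation (\<lambda>\<omega>. Z \<omega> * Y i \<omega>) * Y i \<omega>))" for k
    unfolding Q_def by (rule ibp_wick_square_sum_power[OF Y])
  have Ksym: "K i j = K j i" for i j unfolding K_def by (simp add: mult.commute)
  \<comment> \<open>One factor \<open>Q\<close> is expanded and integrated by parts; alternating
    with \<open>EYQ\<close>, this lowers the degree until only \<open>K\<close> is left.\<close>
  have EQ: "expectation (\<lambda>\<omega>. Q \<omega> ^ Suc (Suc k)) =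
     2 * real (Suc k) * (\<Sum>i\<in>I. \<Sum>j\<in>I. K i j * expectation (\<lambda>\<omega>. Y i \<omega> * (Y j \<omega> * Q \<omega> ^ k)))" for k
  proof -
    have "expectation (\<lambda>\<omega>. Q \<omega> ^ Suc (Suc k)) = expectation (\<lambda>\<omega>. Q \<omega> * Q \<omega> ^ Suc k)" by simp
    also have "\<dots> = (\<Sum>i\<in>I. expectation (\<lambda>\<omega>. Y i \<omega> * (2 * real (Suc k) * Q \<omega> ^ k * (\<Sum>j\<in>I. K i j * Y j \<omega>))))"
      unfolding Q_def K_def by (rule expectation_wick_square_sum_mult[OF I Y ibp_wick_square_sum_power[OF Y]])
    also have "\<dots> = (\<Sum>i\<in>I. expectation (\<lambda>\<omega>. \<Sum>j\<in>I. (2 * real (Suc k) * K i j) * (Y i \<omega> * (Y j \<omega> * Q \<omega> ^ k))))"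
      by (simp add: sum_distrib_left mult_ac)
    also have "\<dots> = (\<Sum>i\<in>I. \<Sum>j\<in>I. (2 * real (Suc k) * K i j) * expectation (\<lambda>\<omega>. Y i \<omega> * (Y j \<omega> * Q \<omega> ^ k)))"
      by (intro sum.cong expectation_sum_mult) (auto intro!: all_moments_mult Ym all_moments_pow Qm)
    finally show ?thesis by (simp add: sum_distrib_left mult_ac)
  qed
  have EYQ: "expectation (\<lambda>\<omega>. Y i \<omega> * (Y j \<omega> * Q \<omega> ^ Suc k)) = K i j * expectation (\<lambda>\<omega>. Q \<omega> ^ Suc k)
     + 2 * real (Suc k) * (\<Sum>l\<in>I. K i l * expectation (\<lambda>\<omega>. Y j \<omega> * (Y l \<omega> * Q \<omega> ^ k)))"
    if i: "i \<in> I" and j: "j \<in> I" for i j k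
  proof -
    have "expectation (\<lambda>\<omega>. Y i \<omega> * (Y j \<omega> * Q \<omega> ^ Suc k)) = K i j * expectation (\<lambda>\<omega>. Q \<omega> ^ Suc k)
      + expectation (\<lambda>\<omega>. Y j \<omega> * (2 * real (Suc k) * Q \<omega> ^ k * (\<Sum>l\<in>I. K i l * Y l \<omega>)))"
      unfolding K_def by (rule expectation_mult_ibp[OF ibpk Y[OF j] Y[OF i]])
    also have "expectation (\<lambda>\<omega>. Y j \<omega> * (2 * real (Suc k) * Q \<omega> ^ k * (\<Sum>l\<in>I. K i l * Y l \<omega>)))
      = expectation (\<lambda>\<omega>. \<Sum>l\<in>I. (2 * real (Suc k) * K i l) * (Y j \<omega> * (Y l \<omega> * Q \<omega> ^ k)))"
      by (simp add: sum_distrib_left mult_ac)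
    also have "\<dots> = (\<Sum>l\<in>I. (2 * real (Suc k) * K i l) * expectation (\<lambda>\<omega>. Y j \<omega> * (Y l \<omega> * Q \<omega> ^ k)))"
      by (intro expectation_sum_mult) (auto intro!: all_moments_mult Ym j all_moments_pow Qm)
    finally show ?thesis by (simp add: sum_distrib_left mult_ac)
  qed
  have EQ1: "expectation Q = 0"
    using expectation_wick_square_sum_mult[OF I Y ibp_one] by (simp add: Q_def)
  define s where "s = (\<Sum>i\<in>I. \<Sum>j\<in>I. (K i j)\<^sup>2)"
  have EQ2: "expectation (\<lambda>\<omega>. Q \<omega> ^ 2) = 2 * s"
    using EQ[of 0] by (simp add: K_def[symmetric] s_def power2_eq_square)
  have EYQ1: "expectation (\<lambda>\<omega>. Y i \<omega> * (Y j \<omega> * Q \<omega>)) = 2 * (\<Sum>l\<in>I. K i l * K l j)" if "i \<in> I" "j \<in> I" for i j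
    using EYQ[OF that, of 0] EQ1 Ksym by (simp add: K_def[symmetric])
  \<comment> \<open>The entries of the matrix square of \<open>K\<close>, so that the sum of all (A
    j l)^2 is the trace of the fourth power.\<close>
  define A where "A i j = (\<Sum>l\<in>I. K i l * K l j)" for i j
  have EYQ2: "expectation (\<lambda>\<omega>. Y i \<omega> * (Y j \<omega> * Q \<omega> ^ 2)) = 2 * K i j * s + 8 * (\<Sum>l\<in>I. K i l * A j l)" if "i \<in> I" "j \<in> I" for i j
  proof -
    have "(\<Sum>l\<in>I. K i l * expectation (\<lambda>\<omega>. Y j \<omega> * (Y l \<omega> * Q \<omega> ^ 1))) = 2 * (\<Sum>l\<in>I. K i l * A j l)"
      unfolding sum_distrib_left by (intro sum.cong refl) (simp add: EYQ1[OF that(2)] A_def)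
    then show ?thesis
      using EYQ[OF that, of 1] EQ2 by (simp only: Suc_1[symmetric] One_nat_def[symmetric]) (simp add: Suc_1)
  qed
  have "expectation (\<lambda>\<omega>. Q \<omega> ^ 4) = 6 * (\<Sum>i\<in>I. \<Sum>j\<in>I. K i j * expectation (\<lambda>\<omega>. Y i \<omega> * (Y j \<omega> * Q \<omega> ^ 2)))"
    using EQ[of 2] by (simp add: numeral_eq_Suc)
  also have "\<dots> = 6 * (\<Sum>i\<in>I. \<Sum>j\<in>I. K i j * (2 * K i j * s + 8 * (\<Sum>l\<in>I. K i l * A j l)))"
    by (simp add: EYQ2)
  also have "\<dots> = 12 * s\<^sup>2 + 48 * (\<Sum>i\<in>I. \<Sum>j\<in>I. \<Sum>l\<in>I. K i j * K i l * A j l)"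
  proof -
    have "K i j * (2 * K i j * s + 8 * (\<Sum>l\<in>I. K i l * A j l)) = 2 * s * (K i j)\<^sup>2 + 8 * (\<Sum>l\<in>I. K i j * K i l * A j l)" for i j
      by (simp add: distrib_left power2_eq_square sum_distrib_left mult_ac)
    then show ?thesis
      by (simp add: sum.distrib sum_distrib_left[symmetric] s_def[symmetric]) (simp add: power2_eq_square)
  qed
  also have "(\<Sum>i\<in>I. \<Sum>j\<in>I. \<Sum>l\<in>I. K i j * K i l * A j l) = (\<Sum>j\<in>I. \<Sum>i\<in>I. \<Sum>l\<in>I. K i j * K i l * A j l)"
    by (rule sum.swap)
  also have "\<dots> = (\<Sum>j\<in>I. \<Sum>l\<in>I. \<Sum>i\<in>I. K i j * K i l * A j l)"
    by (rule sum.cong[OF refl]) (rule sum.swap)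
  also have "\<dots> = (\<Sum>j\<in>I. \<Sum>l\<in>I. (A j l)\<^sup>2)"
    unfolding power2_eq_square
    by (intro sum.cong refl) (simp add: A_def sum_distrib_right[symmetric] Ksym)
  also have "\<dots> \<le> s\<^sup>2"
  proof -
    have "(A j l)\<^sup>2 \<le> (\<Sum>i\<in>I. (K j i)\<^sup>2) * (\<Sum>i\<in>I. (K l i)\<^sup>2)" for j l
      unfolding A_def using Cauchy_Schwarz_ineq_sum[of "\<lambda>i. K j i" "\<lambda>i. K i l" I] by (simp add: Ksym[of _ l])
    then have "(\<Sum>j\<in>I. \<Sum>l\<in>I. (A j l)\<^sup>2) \<le> (\<Sum>j\<in>I. \<Sum>l\<in>I. (\<Sum>i\<in>I. (K j i)\<^sup>2) * (\<Sum>i\<in>I. (K l i)\<^sup>2))"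
      by (intro sum_mono)
    also have "\<dots> = s\<^sup>2" unfolding s_def power2_eq_square by (simp add: sum_product)
    finally show ?thesis .
  qed
  finally show ?thesis unfolding s_def K_def Q_def by simp
qed

end

section \<open>Riemann sums and Fubini for processes with continuous paths\<close>

lemma integral_sum_steps:
  fixes f :: "real \<Rightarrow> real"
  assumes "h \<ge> 0" "continuous_on {0..real n * h} f"
  shows "integral {0..real n * h} f = (\<Sum>i<n. integral {real i * h..real (Suc i) * h} f)"
  using assms(2)
proof (induction n)
  case (Suc n)
  have "real n * h \<le> real (Suc n) * h" using assms(1) by (simp add: algebra_simps)
  moreover have "continuous_on {0..real n * h} f"
    by (rule continuous_on_subset[OF Suc.prems]) (use calculation in auto)
  moreover have "f integrable_on {0..real (Suc n) * h}"
    using Suc.prems by (rule integrable_continuous_real)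
  ultimately show ?case
    using Suc.IH assms(1)
      Henstock_Kurzweil_Integration.integral_combine[of 0 "real n * h" "real (Suc n) * h" f]
    by simp
qed simp

lemma riemann_sum_limit:
  fixes f :: "real \<Rightarrow> real"
  assumes T: "T \<ge> 0" and f: "continuous_on {0..T} f"
  shows "(\<lambda>n. \<Sum>i<n. (T / real n) * f (real i * (T / real n))) \<longlonglongrightarrow> integral {0..T} f"
proof (rule LIMSEQ_I)
  fix r :: real assume r: "r > 0"
  have "uniformly_continuous_on {0..T} f" using f compact_uniformly_continuous by blast
  \<comment> \<open>\<open>T + 1\<close> in place of \<open>T\<close> covers \<open>T = 0\<close>;
    the total error is then \<open>T * (r / (T + 1)) < r\<close>.\<close>
  then obtain d where d: "d > 0" "\<And>x y. x \<in> {0..T} \<Longrightarrow> y \<in> {0..T} \<Longrightarrow> dist x y < d \<Longrightarrow> dist (f x) (f y) < r / (T + 1)"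
    unfolding uniformly_continuous_on_def using r T by (metis add_nonneg_pos divide_pos_pos zero_less_one)
  obtain N :: nat where N: "real N > T / d" using reals_Archimedean2 by blast
  show "\<exists>no. \<forall>n\<ge>no. norm ((\<Sum>i<n. (T / real n) * f (real i * (T / real n))) - integral {0..T} f) < r"
  proof (intro exI[of _ "Suc N"] allI impI)
    fix n assume n: "n \<ge> Suc N"
    define h where "h = T / real n"
    have h: "h \<ge> 0" "real n * h = T" "h < d"
    proof -
      show "h \<ge> 0" "real n * h = T" using T n by (auto simp: h_def)
      have "T / d < real n" using N n by linarith
      then show "h < d" using d(1) n unfolding h_def by (simp add: field_simps)
    qed
    have le: "real (Suc i) * h \<le> T" if "i < n" for i
    proof -
      have "real (Suc i) * h \<le> real n * h" using that h(1) by (intro mult_right_mono) auto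
      then show ?thesis using h by simp
    qed
    have i: "f integrable_on {real i * h..real (Suc i) * h}" if "i < n" for i
      using le[OF that] h(1) by (intro integrable_continuous_real continuous_on_subset[OF f]) auto
    have e: "\<bar>h * f (real i * h) - integral {real i * h..real (Suc i) * h} f\<bar> \<le> h * (r / (T + 1))" if "i < n" for i
    proof -
      have "norm (integral {real i * h..real (Suc i) * h} (\<lambda>x. f (real i * h) - f x)) \<le> (r / (T + 1)) * (real (Suc i) * h - real i * h)"
      proof (rule integral_bound)
        show "real i * h \<le> real (Suc i) * h" using h(1) by (simp add: algebra_simps)
        show "continuous_on {real i * h..real (Suc i) * h} (\<lambda>x. f (real i * h) - f x)"
          using le[OF that] h(1) by (intro continuous_intros continuous_on_subset[OF f]) auto
        fix x assume x: "x \<in> {real i * h..real (Suc i) * h}"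
        then have b: "0 \<le> real i * h" "real i * h \<le> x" "x \<le> T" "\<bar>real i * h - x\<bar> \<le> h"
          using le[OF that] h(1) by (auto simp: algebra_simps)
        have "0 \<le> x" using b(1,2) by linarith
        with b have "real i * h \<in> {0..T}" "x \<in> {0..T}" "\<bar>real i * h - x\<bar> < d"
          using h(3) by auto
        then have "dist (f (real i * h)) (f x) < r / (T + 1)"
          using d(2)[of "real i * h" x] by (simp add: dist_real_def)
        then show "norm (f (real i * h) - f x) \<le> r / (T + 1)" by (simp add: dist_real_def)
      qed
      moreover have "integral {real i * h..real (Suc i) * h} (\<lambda>x. f (real i * h) - f x) =
        h * f (real i * h) - integral {real i * h..real (Suc i) * h} f"
        using i[OF that] h(1) by (subst Henstock_Kurzweil_Integration.integral_diff) (auto simp: algebra_simps)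
      ultimately show ?thesis by (simp add: algebra_simps)
    qed
    have "(\<Sum>i<n. h * f (real i * h)) - integral {0..T} f = (\<Sum>i<n. h * f (real i * h) - integral {real i * h..real (Suc i) * h} f)"
      using integral_sum_steps[of h n f] h f by (simp add: sum_subtractf)
    also have "\<bar>\<dots>\<bar> \<le> (\<Sum>i<n. h * (r / (T + 1)))"
      by (rule order_trans[OF sum_abs]) (intro sum_mono e, simp)
    also have "\<dots> = T * (r / (T + 1))" using h(2) by simp
    also have "\<dots> < r" using r T by (simp add: divide_less_eq algebra_simps)
    finally show "norm ((\<Sum>i<n. (T / real n) * f (real i * (T / real n))) - integral {0..T} f) < r"
      by (simp add: h_def)
  qed
qed

text \<open>The process is the pointwise limit of step functions in time, each measurable as a
  countable case distinction. \<open>max 0 t\<close> extends a process on the half-line to all real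
  times.\<close>

lemma measurable_continuous_process:
  fixes Y :: "real \<Rightarrow> 'a \<Rightarrow> 'b::{metric_space, second_countable_topology}"
  assumes c: "\<And>\<omega>. continuous_on {0..} (\<lambda>t. Y t \<omega>)"
    and m: "\<And>t. t \<ge> 0 \<Longrightarrow> Y t \<in> borel_measurable M"
  shows "(\<lambda>(t, \<omega>). Y (max 0 t) \<omega>) \<in> borel_measurable (lborel \<Otimes>\<^sub>M M)"
proof (rule borel_measurable_LIMSEQ_metric)
  define k where "k n t = nat \<lfloor>max 0 t * real (Suc n)\<rfloor>" for n :: nat and t
  show "(\<lambda>(t, \<omega>). Y (real (k n t) / real (Suc n)) \<omega>) \<in> borel_measurable (lborel \<Otimes>\<^sub>M M)" for n
  proof -
    have [measurable]: "Y (real i / real (Suc n)) \<in> borel_measurable M" for i by (rule m) simp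
    have "(\<lambda>x. Y (real (k n (fst x)) / real (Suc n)) (snd x)) \<in> borel_measurable (lborel \<Otimes>\<^sub>M M)"
    proof (rule measurable_compose_countable[where f="\<lambda>i x. Y (real i / real (Suc n)) (snd x)" and g="\<lambda>x. k n (fst x)"])
      show "(\<lambda>x. k n (fst x)) \<in> lborel \<Otimes>\<^sub>M M \<rightarrow>\<^sub>M count_space UNIV"
        unfolding k_def by measurable
    qed measurable
    then show ?thesis by (simp add: case_prod_beta)
  qed
  fix x :: "real \<times> 'a" assume "x \<in> space (lborel \<Otimes>\<^sub>M M)"
  obtain t \<omega> where x: "x = (t, \<omega>)" by (cases x)
  have kl: "\<bar>real (k n t) / real (Suc n) - max 0 t\<bar> \<le> inverse (real (Suc n))" for n
  proof -
    have "real (k n t) = of_int \<lfloor>max 0 t * real (Suc n)\<rfloor>" unfolding k_def by simp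
    then have "\<bar>real (k n t) - max 0 t * real (Suc n)\<bar> \<le> 1" by linarith
    then have "\<bar>real (k n t) - max 0 t * real (Suc n)\<bar> / real (Suc n) \<le> 1 / real (Suc n)"
      by (rule divide_right_mono) simp
    moreover have "\<bar>real (k n t) - max 0 t * real (Suc n)\<bar> / real (Suc n) = \<bar>real (k n t) / real (Suc n) - max 0 t\<bar>"
    proof -
      have "(real (k n t) - max 0 t * real (Suc n)) / real (Suc n) = real (k n t) / real (Suc n) - max 0 t"
        by (simp add: diff_divide_distrib del: of_nat_Suc)
      then show ?thesis using abs_divide[of "real (k n t) - max 0 t * real (Suc n)" "real (Suc n)"] by simp
    qed
    ultimately show ?thesis by (simp add: inverse_eq_divide del: of_nat_Suc)
  qed
  have "(\<lambda>n. real (k n t) / real (Suc n)) \<longlonglongrightarrow> max 0 t"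
    by (rule LIM_zero_cancel, rule Lim_null_comparison[OF _ LIMSEQ_inverse_real_of_nat])
      (use kl in \<open>simp del: of_nat_Suc\<close>)
  then have "(\<lambda>n. Y (real (k n t) / real (Suc n)) \<omega>) \<longlonglongrightarrow> Y (max 0 t) \<omega>"
    by (intro continuous_on_tendsto_compose[OF c[of \<omega>]]) auto
  then show "(\<lambda>n. case x of (t, \<omega>) \<Rightarrow> Y (real (k n t) / real (Suc n)) \<omega>) \<longlonglongrightarrow> (case x of (t, \<omega>) \<Rightarrow> Y (max 0 t) \<omega>)"
    by (simp add: x)
qed

lemma integral_eq_set_lebesgue:
  fixes f :: "real \<Rightarrow> 'b::euclidean_space"
  assumes "continuous_on {a..b} f"
  shows "integral {a..b} f = (\<integral>t. indicator {a..b} t *\<^sub>R f t \<partial>lborel)" "integrable lborel (\<lambda>t. indicator {a..b} t *\<^sub>R f t)"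
proof -
  have "set_integrable lborel {a..b} f"
    unfolding set_integrable_def using assms by (intro borel_integrable_compact) auto
  from set_borel_integral_eq_integral(2)[OF this] this
  show "integral {a..b} f = (\<integral>t. indicator {a..b} t *\<^sub>R f t \<partial>lborel)" "integrable lborel (\<lambda>t. indicator {a..b} t *\<^sub>R f t)"
    by (simp_all add: set_lebesgue_integral_def set_integrable_def)
qed

text \<open>Values in a Euclidean space, because Fubini is applied both to powers of X and to the
  complex process exp (i Z) X^2.\<close>

lemma (in prob_space) expectation_integral_process:
  fixes Y :: "real \<Rightarrow> 'a \<Rightarrow> 'b::euclidean_space"
  assumes c: "\<And>\<omega>. continuous_on {0..} (\<lambda>t. Y t \<omega>)"
    and m: "\<And>t. t \<ge> 0 \<Longrightarrow> Y t \<in> borel_measurable M"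
    and i: "\<And>t. 0 \<le> t \<Longrightarrow> t \<le> T \<Longrightarrow> integrable M (Y t)"
    and b: "\<And>t. 0 \<le> t \<Longrightarrow> t \<le> T \<Longrightarrow> expectation (\<lambda>\<omega>. norm (Y t \<omega>)) \<le> C"
  shows "integrable M (\<lambda>\<omega>. integral {0..T} (\<lambda>t. Y t \<omega>))"
    and "(\<lambda>t. expectation (Y t)) integrable_on {0..T}"
    and "expectation (\<lambda>\<omega>. integral {0..T} (\<lambda>t. Y t \<omega>)) = integral {0..T} (\<lambda>t. expectation (Y t))"
proof -
  interpret P: pair_sigma_finite lborel M ..
  define F where "F t \<omega> = indicator {0..T} t *\<^sub>R Y (max 0 t) \<omega>" for t \<omega>
  note [measurable] = measurable_continuous_process[OF c m]
  have Fm[measurable]: "(\<lambda>(t, \<omega>). F t \<omega>) \<in> borel_measurable (lborel \<Otimes>\<^sub>M M)"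
    unfolding F_def by measurable
  have Fe: "F t = (\<lambda>\<omega>. indicator {0..T} t *\<^sub>R Y t \<omega>)" for t
    unfolding F_def by (auto simp: indicator_def fun_eq_iff max_def)
  have Fi: "integrable M (F t)" for t
    unfolding Fe using i[of t] by (cases "t \<in> {0..T}") (auto simp: indicator_def)
  have I: "integrable (lborel \<Otimes>\<^sub>M M) (\<lambda>(t, \<omega>). F t \<omega>)"
  proof (rule P.Fubini_integrable[OF Fm])
    show "AE t in lborel. integrable M (\<lambda>\<omega>. case (t, \<omega>) of (t, \<omega>) \<Rightarrow> F t \<omega>)" using Fi by simp
    have "integrable lborel (\<lambda>t. indicator {0..T} t *\<^sub>R C)"
      by (intro integrable_real_indicator integrable_scaleR_left) (auto simp: emeasure_lborel_Icc_eq)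
    then show "integrable lborel (\<lambda>t. \<integral>\<omega>. norm (case (t, \<omega>) of (t, \<omega>) \<Rightarrow> F t \<omega>) \<partial>M)"
    proof (rule Bochner_Integration.integrable_bound)
      show "AE t in lborel. norm (\<integral>\<omega>. norm (case (t, \<omega>) of (t, \<omega>) \<Rightarrow> F t \<omega>) \<partial>M) \<le> norm (indicator {0..T} t *\<^sub>R C)"
      proof (rule AE_I2)
        fix t
        show "norm (\<integral>\<omega>. norm (case (t, \<omega>) of (t, \<omega>) \<Rightarrow> F t \<omega>) \<partial>M) \<le> norm (indicator {0..T} t *\<^sub>R C)"
        proof (cases "t \<in> {0..T}")
          case True
          then have "expectation (\<lambda>\<omega>. norm (Y t \<omega>)) \<le> C" using b by auto
          then have "\<bar>expectation (\<lambda>\<omega>. norm (Y t \<omega>))\<bar> \<le> \<bar>C\<bar>"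
            using integral_nonneg_AE[of "\<lambda>\<omega>. norm (Y t \<omega>)" M] by simp
          then show ?thesis using True unfolding Fe by simp
        qed (simp add: Fe)
      qed
      show "(\<lambda>t. \<integral>\<omega>. norm (case (t, \<omega>) of (t, \<omega>) \<Rightarrow> F t \<omega>) \<partial>M) \<in> borel_measurable lborel" by measurable
    qed
  qed
  have pc: "continuous_on {0..T} (\<lambda>t. Y t \<omega>)" for \<omega> by (rule continuous_on_subset[OF c]) auto
  have e: "integral {0..T} (\<lambda>t. Y t \<omega>) = (\<integral>t. F t \<omega> \<partial>lborel)" for \<omega>
    unfolding integral_eq_set_lebesgue(1)[OF pc] Fe ..
  show "integrable M (\<lambda>\<omega>. integral {0..T} (\<lambda>t. Y t \<omega>))"
    unfolding e using P.integrable_snd[OF I] .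
  have e2: "(\<integral>\<omega>. F t \<omega> \<partial>M) = indicator {0..T} t *\<^sub>R expectation (Y t)" for t
    unfolding Fe by simp
  have "integrable lborel (\<lambda>t. \<integral>\<omega>. F t \<omega> \<partial>M)" using P.integrable_fst[OF I] .
  then have s: "set_integrable lborel {0..T} (\<lambda>t. expectation (Y t))"
    unfolding e2 set_integrable_def .
  show "(\<lambda>t. expectation (Y t)) integrable_on {0..T}"
    by (rule set_borel_integral_eq_integral(1)[OF s])
  have "expectation (\<lambda>\<omega>. integral {0..T} (\<lambda>t. Y t \<omega>)) = (\<integral>t. (\<integral>\<omega>. F t \<omega> \<partial>M) \<partial>lborel)"
    unfolding e by (rule P.Fubini_integral[OF I])
  also have "\<dots> = integral {0..T} (\<lambda>t. expectation (Y t))"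
    unfolding e2 set_borel_integral_eq_integral(2)[OF s, symmetric] set_lebesgue_integral_def ..
  finally show "expectation (\<lambda>\<omega>. integral {0..T} (\<lambda>t. Y t \<omega>)) = integral {0..T} (\<lambda>t. expectation (Y t))" .
qed

context gaussian_space
begin

text \<open>Every path is continuous, not only almost every one, so that integrals along paths can
  be formed for each \<omega>; the theorem first passes to such a version.\<close>

definition process :: "(real \<Rightarrow> 'a \<Rightarrow> real) \<Rightarrow> bool" where
  "process Y \<longleftrightarrow> (\<forall>t\<ge>0. Y t \<in> S) \<and> (\<forall>\<omega>. continuous_on {0..} (\<lambda>t. Y t \<omega>))"

lemma processD: "process Y \<Longrightarrow> t \<ge> 0 \<Longrightarrow> Y t \<in> S" "process Y \<Longrightarrow> continuous_on {0..} (\<lambda>t. Y t \<omega>)"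
  by (auto simp: process_def)

lemma cov_continuous:
  assumes Y: "process Y" and U: "U \<in> S"
  shows "continuous_on {0..} (\<lambda>t. expectation (\<lambda>\<omega>. U \<omega> * Y t \<omega>))"
proof (rule continuous_on_sequentiallyI)
  fix u :: "nat \<Rightarrow> real" and a assume u: "\<forall>n. u n \<in> {0..}" "a \<in> {0..}" "u \<longlonglongrightarrow> a"
  show "(\<lambda>n. expectation (\<lambda>\<omega>. U \<omega> * Y (u n) \<omega>)) \<longlonglongrightarrow> expectation (\<lambda>\<omega>. U \<omega> * Y a \<omega>)"
  proof (rule AE_limit_cov[OF _ _ U])
    show "Y (u n) \<in> S" for n using u processD(1)[OF Y] by auto
    show "Y a \<in> S" using u processD(1)[OF Y] by auto
    show "AE \<omega> in M. (\<lambda>n. Y (u n) \<omega>) \<longlonglongrightarrow> Y a \<omega>"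
      using u by (intro AE_I2 continuous_on_tendsto_compose[OF processD(2)[OF Y]]) auto
  qed
qed

text \<open>Riemann sums belong to \<open>S\<close> and converge for every \<omega>, so the integral
  belongs to \<open>S\<close> as an almost sure limit; the covariances of the Riemann sums are
  Riemann sums of the covariance.\<close>

lemma process_integral:
  assumes Y: "process Y" and T: "T \<ge> 0" and g: "continuous_on {0..T} g"
  shows "(\<lambda>\<omega>. integral {0..T} (\<lambda>t. g t * Y t \<omega>)) \<in> S"
    and "U \<in> S \<Longrightarrow> expectation (\<lambda>\<omega>. U \<omega> * integral {0..T} (\<lambda>t. g t * Y t \<omega>))
      = integral {0..T} (\<lambda>t. g t * expectation (\<lambda>\<omega>. U \<omega> * Y t \<omega>))"
proof -
  define Z where "Z n \<omega> = (\<Sum>i<n. (T / real n) * (g (real i * (T / real n)) * Y (real i * (T / real n)) \<omega>))" for n \<omega>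
  have ZS: "Z n \<in> S" for n
    unfolding Z_def using T by (intro sum scale processD(1)[OF Y]) auto
  have c: "continuous_on {0..T} (\<lambda>t. g t * Y t \<omega>)" for \<omega>
    by (intro continuous_intros g continuous_on_subset[OF processD(2)[OF Y]]) auto
  have l: "(\<lambda>n. Z n \<omega>) \<longlonglongrightarrow> integral {0..T} (\<lambda>t. g t * Y t \<omega>)" for \<omega>
    unfolding Z_def using riemann_sum_limit[OF T c] by simp
  show I: "(\<lambda>\<omega>. integral {0..T} (\<lambda>t. g t * Y t \<omega>)) \<in> S"
  proof (rule AE_limit[OF ZS])
    show "(\<lambda>\<omega>. integral {0..T} (\<lambda>t. g t * Y t \<omega>)) \<in> borel_measurable M"
      by (rule borel_measurable_LIMSEQ_real[OF l meas[OF ZS]])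
    show "AE \<omega> in M. (\<lambda>n. Z n \<omega>) \<longlonglongrightarrow> integral {0..T} (\<lambda>t. g t * Y t \<omega>)" using l by simp
  qed
  assume U: "U \<in> S"
  have c2: "continuous_on {0..T} (\<lambda>t. g t * expectation (\<lambda>\<omega>. U \<omega> * Y t \<omega>))"
    by (intro continuous_intros g continuous_on_subset[OF cov_continuous[OF Y U]]) auto
  have "expectation (\<lambda>\<omega>. U \<omega> * Z n \<omega>) = (\<Sum>i<n. (T / real n) * (g (real i * (T / real n)) * expectation (\<lambda>\<omega>. U \<omega> * Y (real i * (T / real n)) \<omega>)))" for n
  proof -
    have "integrable M (\<lambda>\<omega>. U \<omega> * Y (real i * (T / real n)) \<omega>)" for i
      using T by (intro prod_integrable U processD(1)[OF Y]) auto
    then show ?thesis unfolding Z_def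
      by (simp add: sum_distrib_left mult.left_commute[of "U _"])
  qed
  then have "(\<lambda>n. expectation (\<lambda>\<omega>. U \<omega> * Z n \<omega>)) \<longlonglongrightarrow> integral {0..T} (\<lambda>t. g t * expectation (\<lambda>\<omega>. U \<omega> * Y t \<omega>))"
    using riemann_sum_limit[OF T c2] by simp
  moreover have "(\<lambda>n. expectation (\<lambda>\<omega>. U \<omega> * Z n \<omega>)) \<longlonglongrightarrow> expectation (\<lambda>\<omega>. U \<omega> * integral {0..T} (\<lambda>t. g t * Y t \<omega>))"
    by (rule AE_limit_cov[OF ZS I U]) (use l in auto)
  ultimately show "expectation (\<lambda>\<omega>. U \<omega> * integral {0..T} (\<lambda>t. g t * Y t \<omega>))
      = integral {0..T} (\<lambda>t. g t * expectation (\<lambda>\<omega>. U \<omega> * Y t \<omega>))"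
    by (rule LIMSEQ_unique[rotated])
qed

end

section \<open>The Ornstein-Uhlenbeck map\<close>

lemma integral_deriv_within:
  fixes g :: "real \<Rightarrow> real"
  assumes g: "continuous_on {0..} g" and t: "t \<ge> 0"
  shows "((\<lambda>x. integral {0..x} g) has_real_derivative g t) (at t within {0..})"
proof -
  have "((\<lambda>x. integral {0..x} g) has_real_derivative g t) (at t within {0..t+1})"
    by (rule integral_has_real_derivative) (use t in \<open>auto intro: continuous_on_subset[OF g]\<close>)
  moreover have "at t within {0..t+1} = at t within {0..}"
    by (rule at_within_nhd[of t "{..<t+1}"]) auto
  ultimately show ?thesis by simp
qed

lemma deriv_within_at:
  fixes f :: "real \<Rightarrow> real"
  assumes "(f has_real_derivative D) (at t within {0..})" "t > 0"
  shows "(f has_real_derivative D) (at t)"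
proof -
  have "at t within {0..} = at t" by (rule at_within_interior) (use assms(2) in auto)
  then show ?thesis using assms by simp
qed

lemma integral_continuous:
  fixes g :: "real \<Rightarrow> real"
  assumes g: "continuous_on {0..} g"
  shows "continuous_on {0..} (\<lambda>x. integral {0..x} g)"
proof (rule DERIV_continuous_on)
  fix x :: real assume "x \<in> {0..}"
  then show "((\<lambda>x. integral {0..x} g) has_real_derivative g x) (at x within {0..})"
    using integral_deriv_within[OF g] by simp
qed

lemma FTC_halfline:
  fixes F :: "real \<Rightarrow> real"
  assumes "\<And>x. x \<ge> 0 \<Longrightarrow> (F has_real_derivative f x) (at x within {0..})" "t \<ge> 0"
  shows "integral {0..t} f = F t - F 0"
proof (rule integral_unique, rule fundamental_theorem_of_calculus[OF assms(2)])
  fix x assume "x \<in> {0..t}"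
  then have "(F has_real_derivative f x) (at x within {0..t})"
    by (intro DERIV_subset[OF assms(1)]) auto
  then show "(F has_vector_derivative f x) (at x within {0..t})"
    by (simp add: has_real_derivative_iff_has_vector_derivative)
qed

text \<open>For a path with w 0 = 0 this is the integral of exp (- \<kappa> (t - s)) against dw
  after integration by parts. In this form it makes sense for every continuous path and is linear in
  it, so it applies alike to paths of B and to covariance functions.\<close>

definition ou :: "real \<Rightarrow> (real \<Rightarrow> real) \<Rightarrow> real \<Rightarrow> real" where
  "ou \<kappa> w t = w t - \<kappa> * integral {0..t} (\<lambda>s. exp (- (\<kappa> * (t - s))) * w s)"

lemma ou_alt: "ou \<kappa> w t = w t - \<kappa> * exp (- \<kappa> * t) * integral {0..t} (\<lambda>s. exp (\<kappa> * s) * w s)"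
proof -
  have "exp (- (\<kappa> * (t - s))) = exp (- \<kappa> * t) * exp (\<kappa> * s)" for s
    unfolding exp_add[symmetric] by (simp add: algebra_simps)
  then show ?thesis unfolding ou_def by (simp add: mult.assoc)
qed

lemma ou_zero [simp]: "ou \<kappa> w 0 = w 0"
  by (simp add: ou_def)

lemma ou_cong: "(\<And>s. 0 \<le> s \<Longrightarrow> s \<le> t \<Longrightarrow> w s = w' s) \<Longrightarrow> t \<ge> 0 \<Longrightarrow> ou \<kappa> w t = ou \<kappa> w' t"
proof -
  assume a: "\<And>s. 0 \<le> s \<Longrightarrow> s \<le> t \<Longrightarrow> w s = w' s" and t: "t \<ge> 0"
  have "integral {0..t} (\<lambda>s. exp (- (\<kappa> * (t - s))) * w s) = integral {0..t} (\<lambda>s. exp (- (\<kappa> * (t - s))) * w' s)"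
    by (rule integral_cong) (simp add: a)
  then show ?thesis unfolding ou_def using a[OF t] by simp
qed

lemma ou_continuous:
  assumes w: "continuous_on {0..} w"
  shows "continuous_on {0..} (ou \<kappa> w)"
  unfolding ou_alt by (intro continuous_intros integral_continuous w)

lemma ou_primitive:
  assumes w: "continuous_on {0..} w" and t: "t \<ge> 0"
  shows "((\<lambda>t. exp (- \<kappa> * t) * integral {0..t} (\<lambda>s. exp (\<kappa> * s) * w s)) has_real_derivative ou \<kappa> w t) (at t within {0..})"
proof -
  have c: "continuous_on {0..} (\<lambda>s. exp (\<kappa> * s) * w s)" by (intro continuous_intros w)
  show ?thesis unfolding ou_alt
    by (rule derivative_eq_intros integral_deriv_within[OF c t] refl)+
      (simp add: algebra_simps exp_minus)
qed

lemma ou_eq: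
  assumes w: "continuous_on {0..} w" and t: "t \<ge> 0"
  shows "ou \<kappa> w t + \<kappa> * integral {0..t} (ou \<kappa> w) = w t"
  using FTC_halfline[OF ou_primitive[OF w] t, of \<kappa>] ou_alt[of \<kappa> w t] by (simp add: mult.assoc)

text \<open>Multiplication by exp (\<kappa> t) turns the equation into an exact derivative. The
  hypothesis names a primitive \<open>A\<close> of \<open>y\<close> because in
  \<open>ou_flow\<close> a primitive is known explicitly.\<close>

lemma ou_unique:
  assumes w: "continuous_on {0..} w"
    and A: "\<And>t. t \<ge> 0 \<Longrightarrow> (A has_real_derivative y t) (at t within {0..})"
    and e: "\<And>t. t \<ge> 0 \<Longrightarrow> y t + \<kappa> * (A t - A 0) = w t" and t: "t \<ge> 0"
  shows "y t = ou \<kappa> w t"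
proof -
  have "((\<lambda>t. exp (\<kappa> * t) * (A t - A 0)) has_real_derivative exp (\<kappa> * s) * w s) (at s within {0..})" if s: "s \<ge> 0" for s
    unfolding e[OF s, symmetric]
    by (rule derivative_eq_intros A[OF s] refl)+ (simp add: algebra_simps)
  from FTC_halfline[OF this t]
  have "integral {0..t} (\<lambda>s. exp (\<kappa> * s) * w s) = exp (\<kappa> * t) * (A t - A 0)" by simp
  then have "exp (- \<kappa> * t) * integral {0..t} (\<lambda>s. exp (\<kappa> * s) * w s) = A t - A 0"
    by (simp add: exp_minus)
  then show ?thesis unfolding ou_alt using e[OF t] by (simp add: mult.assoc)
qed

lemma ou_unique_integral:
  assumes w: "continuous_on {0..} w" and y: "continuous_on {0..} y"
    and e: "\<And>t. t \<ge> 0 \<Longrightarrow> y t + \<kappa> * integral {0..t} y = w t" and t: "t \<ge> 0"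
  shows "y t = ou \<kappa> w t"
  using ou_unique[OF w integral_deriv_within[OF y], of \<kappa>] e t by simp

text \<open>A partial fraction decomposition; here \<theta> \<noteq> \<rho> enters. It exhibits the
  kernel of the second-order process as \<rho> exp (- \<rho> t) - \<theta> exp (- \<theta> t)
  divided by \<rho> - \<theta>, whose integral over the half-line is 0.\<close>

lemma ou_comp:
  assumes w: "continuous_on {0..} w" and n: "\<theta> \<noteq> \<rho>" and t: "t \<ge> 0"
  shows "ou \<theta> (ou \<rho> w) t = (\<rho> * ou \<rho> w t - \<theta> * ou \<theta> w t) / (\<rho> - \<theta>)"
proof (rule ou_unique_integral[symmetric, where y="\<lambda>t. (\<rho> * ou \<rho> w t - \<theta> * ou \<theta> w t) / (\<rho> - \<theta>)"])
  note c = ou_continuous[OF w]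
  show "continuous_on {0..} (ou \<rho> w)" by (rule c)
  show "continuous_on {0..} (\<lambda>t. (\<rho> * ou \<rho> w t - \<theta> * ou \<theta> w t) / (\<rho> - \<theta>))"
    using n by (intro continuous_intros c) auto
  fix t :: real assume t: "t \<ge> 0"
  have i: "ou \<kappa> w integrable_on {0..t}" for \<kappa>
    by (intro integrable_continuous_real continuous_on_subset[OF c]) auto
  have I: "integral {0..t} (\<lambda>t. (\<rho> * ou \<rho> w t - \<theta> * ou \<theta> w t) / (\<rho> - \<theta>))
     = (\<rho> * integral {0..t} (ou \<rho> w) - \<theta> * integral {0..t} (ou \<theta> w)) / (\<rho> - \<theta>)"
  proof -
    have "integral {0..t} (\<lambda>t. (\<rho> * ou \<rho> w t - \<theta> * ou \<theta> w t) / (\<rho> - \<theta>)) = integral {0..t} (\<lambda>t. \<rho> * ou \<rho> w t - \<theta> * ou \<theta> w t) / (\<rho> - \<theta>)"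
      by simp
    also have "integral {0..t} (\<lambda>t. \<rho> * ou \<rho> w t - \<theta> * ou \<theta> w t)
      = integral {0..t} (\<lambda>t. \<rho> * ou \<rho> w t) - integral {0..t} (\<lambda>t. \<theta> * ou \<theta> w t)"
      by (intro Henstock_Kurzweil_Integration.integral_diff integrable_on_mult_right i)
    finally show ?thesis by simp
  qed
  have "\<rho> * integral {0..t} (ou \<rho> w) = w t - ou \<rho> w t" "\<theta> * integral {0..t} (ou \<theta> w) = w t - ou \<theta> w t"
    using ou_eq[OF w t, of \<rho>] ou_eq[OF w t, of \<theta>] by simp_all
  then show "(\<rho> * ou \<rho> w t - \<theta> * ou \<theta> w t) / (\<rho> - \<theta>) + \<theta> * integral {0..t} (\<lambda>t. (\<rho> * ou \<rho> w t - \<theta> * ou \<theta> w t) / (\<rho> - \<theta>)) = ou \<rho> w t"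
    unfolding I times_divide_eq_right add_divide_distrib[symmetric]
    using n by (simp add: nonzero_divide_eq_eq) (simp add: algebra_simps)
qed (rule t)

text \<open>Restarting at time \<open>u\<close>: the past enters only through the value at
  \<open>u\<close>, damped by exp (- \<kappa> t), and the rest is driven by the increments after
  \<open>u\<close>.\<close>

lemma ou_flow:
  assumes w: "continuous_on {0..} w" and k: "\<kappa> \<noteq> 0" and u: "u \<ge> 0" and t: "t \<ge> 0"
  shows "ou \<kappa> w (u + t) = ou \<kappa> (\<lambda>s. w (u + s) - w u) t + exp (- \<kappa> * t) * ou \<kappa> w u"
proof -
  define P where "P = (\<lambda>t. exp (- \<kappa> * t) * integral {0..t} (\<lambda>s. exp (\<kappa> * s) * w s))"
  have P: "(P has_real_derivative ou \<kappa> w t) (at t within {0..})" if "t \<ge> 0" for t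
    unfolding P_def by (rule ou_primitive[OF w that])
  have oP: "ou \<kappa> w t = w t - \<kappa> * P t" for t by (simp add: P_def ou_alt)
  have wc: "continuous_on {0..} (\<lambda>s. w (u + s) - w u)"
    by (intro continuous_intros continuous_on_compose2[OF w]) (use u in auto)
  have "ou \<kappa> w (u + t) - exp (- \<kappa> * t) * ou \<kappa> w u = ou \<kappa> (\<lambda>s. w (u + s) - w u) t"
  proof (rule ou_unique[OF wc _ _ t, where A="\<lambda>t. P (u + t) + exp (- \<kappa> * t) * ou \<kappa> w u / \<kappa>"
        and y="\<lambda>t. ou \<kappa> w (u + t) - exp (- \<kappa> * t) * ou \<kappa> w u"])
    fix t :: real assume t: "t \<ge> 0"
    have "(P has_real_derivative ou \<kappa> w (u + t)) (at (u + t) within (\<lambda>t. u + t) ` {0..})"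
      by (rule DERIV_subset[OF P]) (use u t in auto)
    moreover have "((\<lambda>t. u + t) has_real_derivative 1) (at t within {0..})"
      by (auto intro!: derivative_eq_intros)
    ultimately have d: "((\<lambda>t. P (u + t)) has_real_derivative ou \<kappa> w (u + t)) (at t within {0..})"
      using DERIV_image_chain[of P "ou \<kappa> w (u + t)" "\<lambda>t. u + t" t "{0..}" 1] by (simp add: o_def)
    show "((\<lambda>t. P (u + t) + exp (- \<kappa> * t) * ou \<kappa> w u / \<kappa>) has_real_derivative
          ou \<kappa> w (u + t) - exp (- \<kappa> * t) * ou \<kappa> w u) (at t within {0..})"
      using k by (auto intro!: derivative_eq_intros d)
    show "ou \<kappa> w (u + t) - exp (- \<kappa> * t) * ou \<kappa> w u + \<kappa> *
       (P (u + t) + exp (- \<kappa> * t) * ou \<kappa> w u / \<kappa> - (P (u + 0) + exp (- \<kappa> * 0) * ou \<kappa> w u / \<kappa>)) = w (u + t) - w u"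
      using k unfolding oP by (simp add: field_simps)
  qed
  then show ?thesis by simp
qed

text \<open>One more integration by parts. The term \<open>g' t\<close> does not depend on \<kappa>,
  so it drops out when two rates are subtracted, and only the responses
  \<open>ou \<kappa> g'\<close> to the derivative remain.\<close>

lemma ou_deriv:
  assumes g': "continuous_on {0..} g'" and g: "\<And>t. t \<ge> 0 \<Longrightarrow> (g has_real_derivative g' t) (at t within {0..})"
    and g0: "g 0 = 0" and k: "\<kappa> \<noteq> 0" and t: "t \<ge> 0"
  shows "\<kappa> * ou \<kappa> g t = g' t - ou \<kappa> g' t"
proof -
  have gc: "continuous_on {0..} g" by (rule DERIV_continuous_on[OF g]) auto
  have c: "continuous_on {0..} (\<lambda>t. (g' t - ou \<kappa> g' t) / \<kappa>)"
    using k by (intro continuous_intros g' ou_continuous) auto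
  have "(g' t - ou \<kappa> g' t) / \<kappa> = ou \<kappa> g t"
  proof (rule ou_unique_integral[OF gc c _ t])
    fix t :: real assume t: "t \<ge> 0"
    have i: "g' integrable_on {0..t}" "ou \<kappa> g' integrable_on {0..t}"
      by (intro integrable_continuous_real continuous_on_subset[OF g'] continuous_on_subset[OF ou_continuous[OF g']]; simp)+
    have I: "integral {0..t} (\<lambda>t. (g' t - ou \<kappa> g' t) / \<kappa>) = (integral {0..t} g' - integral {0..t} (ou \<kappa> g')) / \<kappa>"
      using i by (simp add: Henstock_Kurzweil_Integration.integral_diff)
    have "integral {0..t} g' = g t" using FTC_halfline[OF g t] g0 by simp
    moreover have "\<kappa> * integral {0..t} (ou \<kappa> g') = g' t - ou \<kappa> g' t" using ou_eq[OF g' t, of \<kappa>] by simp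
    ultimately show "(g' t - ou \<kappa> g' t) / \<kappa> + \<kappa> * integral {0..t} (\<lambda>t. (g' t - ou \<kappa> g' t) / \<kappa>) = g t"
      unfolding I using k by (simp add: nonzero_divide_eq_eq mult.commute)
  qed
  then show ?thesis using k by (simp add: field_simps)
qed

text \<open>\<open>P - G\<close> and \<open>P + G\<close> are increasing. Derivatives are required
  only inside the interval, where one-sided derivatives on the half-line become two-sided.\<close>

lemma abs_diff_le_deriv:
  fixes G P :: "real \<Rightarrow> real"
  assumes ab: "a \<le> b" and G: "continuous_on {a..b} G" and P: "continuous_on {a..b} P"
    and dG: "\<And>x. a < x \<Longrightarrow> x < b \<Longrightarrow> (G has_real_derivative G' x) (at x)"
    and dP: "\<And>x. a < x \<Longrightarrow> x < b \<Longrightarrow> (P has_real_derivative P' x) (at x)"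
    and le: "\<And>x. a < x \<Longrightarrow> x < b \<Longrightarrow> \<bar>G' x\<bar> \<le> P' x"
  shows "\<bar>G b - G a\<bar> \<le> P b - P a"
proof -
  have "P a - G a \<le> P b - G b"
  proof (rule DERIV_nonneg_imp_increasing_open[OF ab])
    show "\<exists>y. ((\<lambda>x. P x - G x) has_real_derivative y) (at x) \<and> 0 \<le> y" if "a < x" "x < b" for x
      using DERIV_diff[OF dP[OF that] dG[OF that]] le[OF that] by (intro exI conjI) auto
  qed (intro continuous_intros G P)
  moreover have "P a + G a \<le> P b + G b"
  proof (rule DERIV_nonneg_imp_increasing_open[OF ab])
    show "\<exists>y. ((\<lambda>x. P x + G x) has_real_derivative y) (at x) \<and> 0 \<le> y" if "a < x" "x < b" for x
      using DERIV_add[OF dP[OF that] dG[OF that]] le[OF that] by (intro exI conjI) auto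
  qed (intro continuous_intros G P)
  ultimately show ?thesis by linarith
qed

text \<open>Variation of constants from \<open>r0\<close>: what happened before is damped
  exponentially. \<open>L0\<close> takes up increments that are not Lipschitz at small distances,
  and the Lipschitz part costs L/\<kappa>, the mean of L times an exponential waiting time of rate
  \<kappa>.\<close>

lemma ou_bound:
  assumes w: "continuous_on {0..} w" and k: "\<kappa> > 0" and r0: "0 \<le> r0" "r0 \<le> t" and L: "L \<ge> 0"
    and lip: "\<And>r. r0 \<le> r \<Longrightarrow> r \<le> t \<Longrightarrow> \<bar>w t - w r\<bar> \<le> L0 + L * (t - r)"
  shows "\<bar>ou \<kappa> w t\<bar> \<le> exp (- \<kappa> * (t - r0)) * \<bar>ou \<kappa> w r0\<bar> + L0 + L / \<kappa>"
proof -
  define Y where "Y = (\<lambda>t. exp (- \<kappa> * t) * integral {0..t} (\<lambda>s. exp (\<kappa> * s) * w s))"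
  have Y: "(Y has_real_derivative ou \<kappa> w t) (at t within {0..})" if "t \<ge> 0" for t
    unfolding Y_def by (rule ou_primitive[OF w that])
  have oY: "ou \<kappa> w t = w t - \<kappa> * Y t" for t by (simp add: Y_def ou_alt)
  define G where "G r = exp (\<kappa> * r) * (\<kappa> * Y r - w t)" for r
  \<comment> \<open>The summand \<open>L / \<kappa>\<close> is chosen so that the derivative of
    \<open>P\<close> is exactly the bound for that of \<open>G\<close>.\<close>
  define P where "P r = exp (\<kappa> * r) * (L0 + L * (t - r) + L / \<kappa>)" for r
  have Yc: "continuous_on {0..} Y" by (rule DERIV_continuous_on[OF Y]) auto
  have "\<bar>G t - G r0\<bar> \<le> P t - P r0"
  proof (rule abs_diff_le_deriv[OF r0(2)])
    show "continuous_on {r0..t} G" unfolding G_def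
      by (intro continuous_intros continuous_on_subset[OF Yc]) (use r0 in auto)
    show "continuous_on {r0..t} P" unfolding P_def by (intro continuous_intros)
    fix x assume x: "r0 < x" "x < t"
    then have x0: "x > 0" using r0 by simp
    show "(G has_real_derivative \<kappa> * exp (\<kappa> * x) * (w x - w t)) (at x)"
      unfolding G_def
      by (rule derivative_eq_intros deriv_within_at[OF Y x0] refl less_imp_le[OF x0])+ (simp add: oY algebra_simps)
    show "(P has_real_derivative \<kappa> * exp (\<kappa> * x) * (L0 + L * (t - x))) (at x)"
      unfolding P_def using k by (auto intro!: derivative_eq_intros simp: field_simps)
    show "\<bar>\<kappa> * exp (\<kappa> * x) * (w x - w t)\<bar> \<le> \<kappa> * exp (\<kappa> * x) * (L0 + L * (t - x))"
      using lip[of x] x k by (auto simp: abs_mult abs_minus_commute)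
  qed
  moreover have "\<bar>G r0\<bar> \<le> exp (\<kappa> * r0) * (\<bar>ou \<kappa> w r0\<bar> + (L0 + L * (t - r0)))"
  proof -
    have "G r0 = exp (\<kappa> * r0) * ((w r0 - w t) - ou \<kappa> w r0)" by (simp add: G_def oY algebra_simps)
    moreover have "\<bar>(w r0 - w t) - ou \<kappa> w r0\<bar> \<le> \<bar>ou \<kappa> w r0\<bar> + (L0 + L * (t - r0))" using lip[of r0] r0 by linarith
    ultimately show ?thesis by (simp add: abs_mult)
  qed
  ultimately have "\<bar>G t\<bar> \<le> exp (\<kappa> * r0) * \<bar>ou \<kappa> w r0\<bar> + exp (\<kappa> * r0) * (L0 + L * (t - r0)) + P t - P r0"
    by (simp add: distrib_left)
  also have "\<dots> = exp (\<kappa> * r0) * \<bar>ou \<kappa> w r0\<bar> + exp (\<kappa> * t) * (L0 + L / \<kappa>) - exp (\<kappa> * r0) * (L / \<kappa>)"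
    by (simp add: P_def algebra_simps)
  also have "\<dots> \<le> exp (\<kappa> * r0) * \<bar>ou \<kappa> w r0\<bar> + exp (\<kappa> * t) * (L0 + L / \<kappa>)"
    using L k by simp
  finally have "\<bar>ou \<kappa> w t\<bar> * exp (\<kappa> * t) \<le> (exp (- \<kappa> * (t - r0)) * \<bar>ou \<kappa> w r0\<bar> + L0 + L / \<kappa>) * exp (\<kappa> * t)"
  proof -
    assume a: "\<bar>G t\<bar> \<le> exp (\<kappa> * r0) * \<bar>ou \<kappa> w r0\<bar> + exp (\<kappa> * t) * (L0 + L / \<kappa>)"
    have "\<bar>G t\<bar> = \<bar>ou \<kappa> w t\<bar> * exp (\<kappa> * t)" by (simp add: G_def oY abs_mult abs_minus_commute)
    moreover have "exp (\<kappa> * r0) = exp (- \<kappa> * (t - r0)) * exp (\<kappa> * t)"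
      unfolding exp_add[symmetric] by (simp add: algebra_simps)
    ultimately show ?thesis using a by (simp add: algebra_simps)
  qed
  then show ?thesis by simp
qed

section \<open>Norms by duality\<close>

definition (in prob_space) L2norm :: "('a \<Rightarrow> real) \<Rightarrow> real" where
  "L2norm Z = sqrt (expectation (\<lambda>\<omega>. (Z \<omega>)\<^sup>2))"

context gaussian_space
begin

lemma L2norm_nonneg: "L2norm Z \<ge> 0" by (simp add: L2norm_def)

lemma L2norm_square: "(L2norm Z)\<^sup>2 = expectation (\<lambda>\<omega>. (Z \<omega>)\<^sup>2)" by (simp add: L2norm_def)

lemma Cauchy_Schwarz_L2norm:
  "Y \<in> S \<Longrightarrow> Z \<in> S \<Longrightarrow> \<bar>expectation (\<lambda>\<omega>. Y \<omega> * Z \<omega>)\<bar> \<le> L2norm Y * L2norm Z"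
  unfolding L2norm_def by (intro Cauchy_Schwarz_expectation meas square_integrable)

lemma L2norm_leI:
  assumes "expectation (\<lambda>\<omega>. Z \<omega> * Z \<omega>) \<le> L2norm Z * C" "C \<ge> 0"
  shows "L2norm Z \<le> C"
proof -
  have "L2norm Z * L2norm Z \<le> L2norm Z * C"
    using assms(1) L2norm_square[of Z] by (simp add: power2_eq_square)
  then show ?thesis using L2norm_nonneg[of Z] assms(2) by (cases "L2norm Z = 0") auto
qed

lemma expectation_diff_right:
  assumes "Z \<in> S" "A \<in> S" "B \<in> S"
  shows "expectation (\<lambda>\<omega>. Z \<omega> * (A \<omega> - B \<omega>)) = expectation (\<lambda>\<omega>. Z \<omega> * A \<omega>) - expectation (\<lambda>\<omega>. Z \<omega> * B \<omega>)"
  using prod_integrable[OF assms(1,2)] prod_integrable[OF assms(1,3)] by (simp add: right_diff_distrib)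

lemma expectation_diff_left:
  assumes "Z \<in> S" "A \<in> S" "B \<in> S"
  shows "expectation (\<lambda>\<omega>. (A \<omega> - B \<omega>) * Z \<omega>) = expectation (\<lambda>\<omega>. A \<omega> * Z \<omega>) - expectation (\<lambda>\<omega>. B \<omega> * Z \<omega>)"
  using expectation_diff_right[OF assms] by (simp add: mult.commute)

text \<open>The choice \<open>Z = A - B\<close> turns a bound on covariances into one on the norm.
  Pairings are estimated first because, for fixed \<open>Z\<close>, they are deterministic functions
  of time.\<close>

lemma L2norm_dual:
  assumes "A \<in> S" "B \<in> S" "C \<ge> 0"
    and "\<And>Z. Z \<in> S \<Longrightarrow> \<bar>expectation (\<lambda>\<omega>. Z \<omega> * A \<omega>) - expectation (\<lambda>\<omega>. Z \<omega> * B \<omega>)\<bar> \<le> L2norm Z * C"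
  shows "L2norm (\<lambda>\<omega>. A \<omega> - B \<omega>) \<le> C"
  using assms(4)[OF diff[OF assms(1,2)]] expectation_diff_right[OF diff[OF assms(1,2)] assms(1,2)]
  by (intro L2norm_leI assms(3)) simp

lemma L2norm_dual':
  assumes "A \<in> S" "C \<ge> 0" "\<And>Z. Z \<in> S \<Longrightarrow> \<bar>expectation (\<lambda>\<omega>. Z \<omega> * A \<omega>)\<bar> \<le> L2norm Z * C"
  shows "L2norm A \<le> C"
  using L2norm_dual[OF assms(1) zero assms(2)] assms(3) by simp

lemma process_ou:
  assumes Y: "process Y"
  shows "process (\<lambda>t \<omega>. ou \<kappa> (\<lambda>s. Y s \<omega>) t)"
proof -
  have "(\<lambda>\<omega>. ou \<kappa> (\<lambda>s. Y s \<omega>) t) \<in> S" if "t \<ge> 0" for t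
    unfolding ou_def by (intro diff scale process_integral(1) Y processD(1)[OF Y] that continuous_intros)
  then show ?thesis using ou_continuous[OF processD(2)[OF Y]] by (auto simp: process_def)
qed

lemma cov_ou:
  assumes Y: "process Y" and U: "U \<in> S" and t: "t \<ge> 0"
  shows "expectation (\<lambda>\<omega>. U \<omega> * ou \<kappa> (\<lambda>s. Y s \<omega>) t) = ou \<kappa> (\<lambda>s. expectation (\<lambda>\<omega>. U \<omega> * Y s \<omega>)) t"
proof -
  have "(\<lambda>\<omega>. integral {0..t} (\<lambda>s. exp (- (\<kappa> * (t - s))) * Y s \<omega>)) \<in> S"
    by (intro process_integral(1) Y t continuous_intros)
  then show ?thesis
    unfolding ou_def
    by (subst expectation_diff_right[OF U processD(1)[OF Y t] scale])
      (auto simp: mult.left_commute[of _ \<kappa>] process_integral(2)[OF Y t _ U] continuous_intros)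
qed

end

section \<open>The covariance of fractional Brownian motion\<close>

lemma has_deriv_abs_powr:
  fixes p :: real
  assumes p: "p > 1"
  shows "((\<lambda>x. \<bar>x\<bar> powr p) has_real_derivative p * (sgn x * \<bar>x\<bar> powr (p - 1))) (at x)"
proof -
  consider "x > 0" | "x < 0" | "x = 0" by linarith
  then show ?thesis
  proof cases
    case 1
    have "((\<lambda>x. x powr p) has_real_derivative p * x powr (p - 1)) (at x)"
      using 1 by (intro has_real_derivative_powr)
    moreover have "eventually (\<lambda>y. y powr p = \<bar>y\<bar> powr p) (nhds x)"
      using eventually_nhds_in_open[of "{0<..}" x] 1 by (auto elim!: eventually_mono)
    ultimately show ?thesis using 1 by (subst DERIV_cong_ev[OF refl _ refl, symmetric]) auto
  next
    case 2
    have "((\<lambda>x. (- x) powr p) has_real_derivative p * - ((- x) powr (p - 1))) (at x)"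
      using 2 by (auto intro!: derivative_eq_intros simp: powr_diff)
    moreover have "eventually (\<lambda>y. (- y) powr p = \<bar>y\<bar> powr p) (nhds x)"
      using eventually_nhds_in_open[of "{..<0}" x] 2 by (auto elim!: eventually_mono)
    ultimately show ?thesis using 2 by (subst DERIV_cong_ev[OF refl _ refl, symmetric]) auto
  next
    case 3
    have "((\<lambda>h. \<bar>h\<bar> powr p / h) \<longlongrightarrow> 0) (at 0)"
    proof (rule Lim_null_comparison)
      have "norm (\<bar>h\<bar> powr p / h) \<le> \<bar>h\<bar> powr (p - 1)" for h :: real
        by (cases "h = 0") (auto simp: powr_diff)
      then show "\<forall>\<^sub>F h in at 0. norm (\<bar>h\<bar> powr p / h) \<le> \<bar>h\<bar> powr (p - 1)" by simp
      have "((\<lambda>h :: real. \<bar>h\<bar> powr (p - 1)) \<longlongrightarrow> \<bar>0\<bar> powr (p - 1)) (at 0)"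
        using p by (intro tendsto_powr' tendsto_intros) auto
      then show "((\<lambda>h :: real. \<bar>h\<bar> powr (p - 1)) \<longlongrightarrow> 0) (at 0)" using p by simp
    qed
    then show ?thesis using 3 p by (simp add: DERIV_def)
  qed
qed

lemma continuous_sgn_abs_powr:
  fixes p :: real
  assumes p: "p > 1"
  shows "continuous_on A (\<lambda>x. sgn x * \<bar>x\<bar> powr (p - 1))"
proof -
  have "isCont (\<lambda>x. sgn x * \<bar>x\<bar> powr (p - 1)) x" for x :: real
  proof (cases "x = 0")
    case True
    have "((\<lambda>h :: real. \<bar>h\<bar> powr (p - 1)) \<longlongrightarrow> \<bar>0\<bar> powr (p - 1)) (at 0)"
      using p by (intro tendsto_powr' tendsto_intros) auto
    then have "((\<lambda>h :: real. \<bar>h\<bar> powr (p - 1)) \<longlongrightarrow> 0) (at 0)" using p by simp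
    then have "((\<lambda>h :: real. sgn h * \<bar>h\<bar> powr (p - 1)) \<longlongrightarrow> 0) (at 0)"
      by (rule Lim_null_comparison[rotated]) (auto simp: abs_mult abs_sgn_eq)
    then show ?thesis using True p by (simp add: isCont_def)
  next
    case False
    then show ?thesis by (intro continuous_intros) auto
  qed
  then show ?thesis by (simp add: continuous_at_imp_continuous_on)
qed

definition fbm_cov :: "real \<Rightarrow> real \<Rightarrow> real \<Rightarrow> real" where
  "fbm_cov H t s = (t powr (2 * H) + s powr (2 * H) - \<bar>t - s\<bar> powr (2 * H)) / 2"

text \<open>The derivative of \<open>fbm_cov H r\<close> on the half-line, continuous because 2 H -
  1 > 0. For nonnegative \<open>r\<close> it is, up to a constant, also the Riesz potential of the
  indicator of \<open>{0..r}\<close>, which is how \<open>H_inner\<close> gets evaluated.\<close>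

definition fbm_cov' :: "real \<Rightarrow> real \<Rightarrow> real \<Rightarrow> real" where
  "fbm_cov' H r t = H * (sgn t * \<bar>t\<bar> powr (2 * H - 1) + sgn (r - t) * \<bar>r - t\<bar> powr (2 * H - 1))"

lemma fbm_cov_deriv:
  assumes H: "1/2 < H" and q: "q \<ge> 0"
  shows "(fbm_cov H r has_real_derivative fbm_cov' H r q) (at q within {0..})"
proof -
  have p: "2 * H > 1" using H by simp
  have "((\<lambda>q. (r powr (2 * H) + \<bar>q\<bar> powr (2 * H) - \<bar>r - q\<bar> powr (2 * H)) / 2) has_real_derivative fbm_cov' H r q) (at q within {0..})"
  proof -
    have d1: "((\<lambda>q. \<bar>q\<bar> powr (2 * H)) has_real_derivative 2 * H * (sgn q * \<bar>q\<bar> powr (2 * H - 1))) (at q within {0..})"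
      by (rule DERIV_subset[OF has_deriv_abs_powr[OF p]]) simp
    have "((\<lambda>q. r - q) has_real_derivative -1) (at q within {0..})" by (auto intro!: derivative_eq_intros)
    from DERIV_chain2[OF has_deriv_abs_powr[OF p] this]
    have d2: "((\<lambda>q. \<bar>r - q\<bar> powr (2 * H)) has_real_derivative 2 * H * (sgn (r - q) * \<bar>r - q\<bar> powr (2 * H - 1)) * -1) (at q within {0..})" .
    show ?thesis
      by (rule DERIV_cong[OF DERIV_cdivide[OF DERIV_diff[OF DERIV_add[OF DERIV_const d1] d2]]])
        (simp add: fbm_cov'_def algebra_simps)
  qed
  moreover have "fbm_cov H r s = (r powr (2 * H) + \<bar>s\<bar> powr (2 * H) - \<bar>r - s\<bar> powr (2 * H)) / 2" if "s \<ge> 0" for s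
    using that by (simp add: fbm_cov_def)
  ultimately show ?thesis
    using q by (elim has_field_derivative_transform_within[where d=1]) auto
qed

lemma fbm_cov'_continuous: "1/2 < H \<Longrightarrow> continuous_on A (fbm_cov' H r)"
  unfolding fbm_cov'_def
  by (intro continuous_intros continuous_sgn_abs_powr continuous_on_compose2[OF continuous_sgn_abs_powr[of _ UNIV]]) auto

section \<open>The second-order process\<close>

locale fbm = gaussian_space M S for M :: "'a measure" and S +
  fixes H :: real and W :: "real \<Rightarrow> 'a \<Rightarrow> real"
  assumes H: "1/2 < H" "H < 1" and W: "process W" and W0: "W 0 \<omega> = 0"
    and W_cov: "t \<ge> 0 \<Longrightarrow> s \<ge> 0 \<Longrightarrow> expectation (\<lambda>\<omega>. W t \<omega> * W s \<omega>) = fbm_cov H t s"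
begin

lemma WS: "t \<ge> 0 \<Longrightarrow> W t \<in> S" using processD(1)[OF W] .

lemma W_increment:
  assumes "t \<ge> 0" "s \<ge> 0"
  shows "L2norm (\<lambda>\<omega>. W t \<omega> - W s \<omega>) = \<bar>t - s\<bar> powr H"
proof -
  have "expectation (\<lambda>\<omega>. (W t \<omega> - W s \<omega>)\<^sup>2) = expectation (\<lambda>\<omega>. (W t \<omega> - W s \<omega>) * (W t \<omega> - W s \<omega>))"
    by (simp add: power2_eq_square)
  also have "\<dots> = fbm_cov H t t - fbm_cov H s t - (fbm_cov H t s - fbm_cov H s s)"
    using assms by (subst expectation_diff_right) (auto intro!: diff WS simp: expectation_diff_left WS W_cov)
  also have "\<dots> = \<bar>t - s\<bar> powr (2 * H)"
    by (simp add: fbm_cov_def abs_minus_commute field_simps)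
  also have "\<dots> = (\<bar>t - s\<bar> powr H)\<^sup>2" by (simp add: power2_eq_square powr_add[symmetric])
  finally show ?thesis by (simp add: L2norm_def)
qed

lemma cov_W_holder:
  assumes "Z \<in> S" "t \<ge> 0" "s \<ge> 0"
  shows "\<bar>expectation (\<lambda>\<omega>. Z \<omega> * W t \<omega>) - expectation (\<lambda>\<omega>. Z \<omega> * W s \<omega>)\<bar> \<le> L2norm Z * \<bar>t - s\<bar> powr H"
  using Cauchy_Schwarz_L2norm[OF assms(1) diff[OF WS[OF assms(2)] WS[OF assms(3)]]]
    expectation_diff_right[OF assms(1) WS[OF assms(2)] WS[OF assms(3)]]
  by (simp add: W_increment assms)

lemma powr_H_le: "x \<ge> 0 \<Longrightarrow> x powr H \<le> 1 + x"
proof -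
  assume x: "x \<ge> 0"
  have "x powr H \<le> (1 + x) powr H" using x H by (intro powr_mono2) auto
  also have "\<dots> \<le> (1 + x) powr 1" using x H by (intro powr_mono) auto
  finally show ?thesis using x by simp
qed

text \<open>An increment of W over a distance x has norm x^H \<le> 1 + x since H < 1, and the
  exponential kernel turns this into a bound that does not depend on time.\<close>

lemma cov_ou_W_bound:
  assumes Z: "Z \<in> S" and k: "\<kappa> > 0" and t: "t \<ge> 0"
  shows "\<bar>expectation (\<lambda>\<omega>. Z \<omega> * ou \<kappa> (\<lambda>s. W s \<omega>) t)\<bar> \<le> L2norm Z * (1 + 1 / \<kappa>)"
proof -
  let ?w = "\<lambda>s. expectation (\<lambda>\<omega>. Z \<omega> * W s \<omega>)"
  have "\<bar>ou \<kappa> ?w t\<bar> \<le> exp (- \<kappa> * (t - 0)) * \<bar>ou \<kappa> ?w 0\<bar> + L2norm Z + L2norm Z / \<kappa>"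
  proof (rule ou_bound[OF cov_continuous[OF W Z] k])
    fix r assume r: "0 \<le> r" "r \<le> t"
    have "\<bar>?w t - ?w r\<bar> \<le> L2norm Z * \<bar>t - r\<bar> powr H" using cov_W_holder[OF Z, of t r] r t by simp
    also have "\<dots> \<le> L2norm Z * (1 + (t - r))"
      using r powr_H_le[of "t - r"] by (intro mult_left_mono L2norm_nonneg) auto
    finally show "\<bar>?w t - ?w r\<bar> \<le> L2norm Z + L2norm Z * (t - r)" by (simp add: distrib_left)
  qed (use t L2norm_nonneg in auto)
  also have "ou \<kappa> ?w 0 = 0" by (simp add: W0)
  finally show ?thesis using cov_ou[OF W Z t] by (simp add: distrib_left)
qed

lemma cov_ou_W:
  assumes "Z \<in> S" "t \<ge> 0"
  shows "expectation (\<lambda>\<omega>. Z \<omega> * ou \<kappa> (\<lambda>s. W s \<omega>) t) = ou \<kappa> (\<lambda>s. expectation (\<lambda>\<omega>. Z \<omega> * W s \<omega>)) t"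
  using cov_ou[OF W] assms .

text \<open>The integration by parts that produces the derivative of the covariance is what exploits
  the cancellation in the kernel of the second-order process.\<close>

lemma cov_ou_W_increment_diff:
  assumes k: "\<kappa> > 0" and m: "\<mu> > 0" and s: "s \<ge> 0" and r: "s + 1 \<le> r1" "r1 \<le> r2"
  shows "\<bar>\<kappa> * expectation (\<lambda>\<omega>. (W r2 \<omega> - W r1 \<omega>) * ou \<kappa> (\<lambda>s. W s \<omega>) s)
     - \<mu> * expectation (\<lambda>\<omega>. (W r2 \<omega> - W r1 \<omega>) * ou \<mu> (\<lambda>s. W s \<omega>) s)\<bar>
    \<le> (r2 - r1) * ((exp (- \<kappa> * s) + exp (- \<mu> * s)) + (1 / \<kappa> + 1 / \<mu>) / (r1 - s))"
proof -
  define g where "g q = fbm_cov H r2 q - fbm_cov H r1 q" for q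
  define g' where "g' q = fbm_cov' H r2 q - fbm_cov' H r1 q" for q
  define p where "p = 2 * H"
  have p: "1 < p" "p < 2" using H by (auto simp: p_def)
  have gd: "(g has_real_derivative g' q) (at q within {0..})" if "q \<ge> 0" for q
    unfolding g_def g'_def by (intro DERIV_diff fbm_cov_deriv H that)
  have g'c: "continuous_on {0..} g'" unfolding g'_def by (intro continuous_intros fbm_cov'_continuous H)
  have g0: "g 0 = 0" using r s by (simp add: g_def fbm_cov_def)
  have r0: "r1 \<ge> 0" "r2 \<ge> 0" using r s by auto
  have D: "(\<lambda>\<omega>. W r2 \<omega> - W r1 \<omega>) \<in> S" using r0 by (intro diff WS)
  have E: "ou \<nu> (\<lambda>q. expectation (\<lambda>\<omega>. (W r2 \<omega> - W r1 \<omega>) * W q \<omega>)) s = ou \<nu> g s" for \<nu>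
    by (rule ou_cong[OF _ s]) (use r0 in \<open>simp add: g_def expectation_diff_left WS W_cov\<close>)
  \<comment> \<open>Both rates produce the same \<open>g' s\<close>, so only the responses to
    \<open>g'\<close> survive in the difference. This is the cancellation.\<close>
  have eq: "\<nu> * expectation (\<lambda>\<omega>. (W r2 \<omega> - W r1 \<omega>) * ou \<nu> (\<lambda>s. W s \<omega>) s) = g' s - ou \<nu> g' s" if "\<nu> > 0" for \<nu>
    using ou_deriv[OF g'c gd g0 _ s, of \<nu>] that unfolding cov_ou_W[OF D s] E by simp
  have g'e: "g' q = H * ((r2 - q) powr (p - 1) - (r1 - q) powr (p - 1))" if "0 \<le> q" "q \<le> s" for q
    using that r by (simp add: g'_def fbm_cov'_def p_def algebra_simps)
  define L where "L = (r2 - r1) / (r1 - s)"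
  have L0: "L \<ge> 0" using r by (simp add: L_def)
  have mvt: "\<bar>(r2 - q) powr a - (r1 - q) powr a\<bar> \<le> (r2 - r1) * c"
    if q: "0 \<le> q" "q \<le> s" and c: "\<And>x. r1 - q \<le> x \<Longrightarrow> \<bar>a * x powr (a - 1)\<bar> \<le> c" for a c q
  proof -
    have "\<bar>(r2 - q) powr a - (r1 - q) powr a\<bar> \<le> c * (r2 - q) - c * (r1 - q)"
    proof (rule abs_diff_le_deriv)
      show "continuous_on {r1 - q..r2 - q} (\<lambda>x. x powr a)" using q r by (intro continuous_intros) auto
      fix x assume x: "r1 - q < x"
      then have "x > 0" using q r by linarith
      then show "((\<lambda>x. x powr a) has_real_derivative a * x powr (a - 1)) (at x)" by (rule has_real_derivative_powr)
      show "((\<lambda>x. c * x) has_real_derivative c) (at x)" by (auto intro!: derivative_eq_intros)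
      show "\<bar>a * x powr (a - 1)\<bar> \<le> c" using c x by auto
    qed (use r in \<open>auto intro!: continuous_intros\<close>)
    then show ?thesis by (simp add: algebra_simps)
  qed
  have x1: "x powr a \<le> 1" if "x \<ge> 1" "a \<le> 0" for x a :: real
    using powr_mono[of a 0 x] that by simp
  \<comment> \<open>As p < 2, the exponent p - 3 is below -1. Hence the slope of \<open>g'\<close>
    per unit of \<open>r2 - r1\<close> is at most the inverse distance, for every H < 1.\<close>
  have x2: "x powr (p - 3) \<le> 1 / (r1 - s)" if "x \<ge> r1 - s" for x :: real
  proof -
    have "x powr (p - 3) \<le> x powr (-1)" using that r p by (intro powr_mono) auto
    also have "\<dots> = 1 / x" using that r by (simp add: powr_minus_divide)
    also have "\<dots> \<le> 1 / (r1 - s)" using that r by (intro divide_left_mono) auto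
    finally show ?thesis .
  qed
  have Hp: "0 \<le> H" "H \<le> 1" using H by auto
  \<comment> \<open>\<open>g'\<close> need not vanish at time 0. Its initial value is damped by exp
    (- \<nu> s) and is the source of the boundary term in the covariance of X.\<close>
  have g'0: "\<bar>g' 0\<bar> \<le> r2 - r1"
  proof -
    have "\<bar>(r2 - 0) powr (p - 1) - (r1 - 0) powr (p - 1)\<bar> \<le> (r2 - r1) * 1"
    proof (rule mvt)
      fix x assume "r1 - 0 \<le> x"
      then have "x \<ge> 1" using r s by simp
      then have "x powr (p - 1 - 1) \<le> 1" using p by (intro x1) auto
      then show "\<bar>(p - 1) * x powr (p - 1 - 1)\<bar> \<le> 1"
        using p by (auto simp: abs_mult intro!: mult_le_one)
    qed (use s in auto)
    then have "H * \<bar>(r2 - 0) powr (p - 1) - (r1 - 0) powr (p - 1)\<bar> \<le> 1 * (r2 - r1)"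
      using Hp by (intro mult_mono) auto
    then show ?thesis using g'e[of 0] s Hp by (simp add: abs_mult)
  qed
  have lip: "\<bar>g' s - g' q\<bar> \<le> 0 + L * (s - q)" if q: "0 \<le> q" "q \<le> s" for q
  proof -
    let ?f = "\<lambda>q. H * ((r2 - q) powr (p - 1) - (r1 - q) powr (p - 1))"
    have "\<bar>?f s - ?f q\<bar> \<le> L * s - L * q"
    proof (rule abs_diff_le_deriv[OF q(2)])
      show "continuous_on {q..s} ?f" using q r by (intro continuous_intros) auto
      fix x assume x: "q < x" "x < s"
      have pos: "r2 - x > 0" "r1 - x > 0" using x q r by auto
      show "(?f has_real_derivative H * ((p - 1) * (r1 - x) powr (p - 2) - (p - 1) * (r2 - x) powr (p - 2))) (at x)"
      proof -
        have d: "((\<lambda>x. (c - x) powr (p - 1)) has_real_derivative - ((p - 1) * (c - x) powr (p - 2))) (at x)" if "c - x > 0" for c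
        proof -
          have "((\<lambda>x. c - x) has_real_derivative -1) (at x)" by (auto intro!: derivative_eq_intros)
          from DERIV_chain2[OF has_real_derivative_powr[OF that, of "p - 1"] this] show ?thesis by simp
        qed
        show ?thesis
          by (rule DERIV_cong[OF DERIV_cmult[OF DERIV_diff[OF d[OF pos(1)] d[OF pos(2)]]]]) simp
      qed
      show "((*) L has_real_derivative L) (at x)" by (auto intro!: derivative_eq_intros)
      have "\<bar>(r2 - x) powr (p - 2) - (r1 - x) powr (p - 2)\<bar> \<le> (r2 - r1) * (1 / (r1 - s))"
      proof (rule mvt)
        fix y assume y: "r1 - x \<le> y"
        have "y powr (p - 2 - 1) \<le> 1 / (r1 - s)" using x2[of y] x y by simp
        then have "\<bar>p - 2\<bar> * y powr (p - 2 - 1) \<le> 1 * (1 / (r1 - s))" using p by (intro mult_mono) auto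
        then show "\<bar>(p - 2) * y powr (p - 2 - 1)\<bar> \<le> 1 / (r1 - s)" by (simp add: abs_mult)
      qed (use x q in auto)
      then have b: "\<bar>(r2 - x) powr (p - 2) - (r1 - x) powr (p - 2)\<bar> \<le> L" by (simp add: L_def)
      have "\<bar>H * ((p - 1) * (r1 - x) powr (p - 2) - (p - 1) * (r2 - x) powr (p - 2))\<bar>
         = (H * (p - 1)) * \<bar>(r2 - x) powr (p - 2) - (r1 - x) powr (p - 2)\<bar>"
        using Hp p by (simp add: abs_mult right_diff_distrib[symmetric] abs_minus_commute)
      also have "\<dots> \<le> 1 * L" using b Hp p by (intro mult_mono) (auto intro: mult_le_one)
      finally show "\<bar>H * ((p - 1) * (r1 - x) powr (p - 2) - (p - 1) * (r2 - x) powr (p - 2))\<bar> \<le> L" by simp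
    qed (intro continuous_intros)
    then show ?thesis using g'e[of s] g'e[of q] q s by (simp add: algebra_simps)
  qed
  have b: "\<bar>ou \<nu> g' s\<bar> \<le> exp (- \<nu> * s) * (r2 - r1) + L / \<nu>" if n: "\<nu> > 0" for \<nu>
  proof -
    have "\<bar>ou \<nu> g' s\<bar> \<le> exp (- \<nu> * (s - 0)) * \<bar>ou \<nu> g' 0\<bar> + 0 + L / \<nu>"
      by (rule ou_bound[OF g'c n _ s L0 lip]) auto
    also have "\<dots> \<le> exp (- \<nu> * s) * (r2 - r1) + L / \<nu>" using g'0 by simp
    finally show ?thesis .
  qed
  have "\<bar>(g' s - ou \<kappa> g' s) - (g' s - ou \<mu> g' s)\<bar> \<le> \<bar>ou \<kappa> g' s\<bar> + \<bar>ou \<mu> g' s\<bar>" by linarith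
  also have "\<dots> \<le> (exp (- \<kappa> * s) * (r2 - r1) + L / \<kappa>) + (exp (- \<mu> * s) * (r2 - r1) + L / \<mu>)"
    using b[OF k] b[OF m] by linarith
  also have "\<dots> = (r2 - r1) * ((exp (- \<kappa> * s) + exp (- \<mu> * s)) + (1 / \<kappa> + 1 / \<mu>) / (r1 - s))"
    by (simp add: L_def add_divide_distrib distrib_left mult.commute)
  finally show ?thesis using eq[OF k] eq[OF m] by simp
qed

end

context gaussian_space
begin

lemma L2norm_add_le:
  assumes A: "A \<in> S" and B: "B \<in> S"
  shows "L2norm (\<lambda>\<omega>. A \<omega> + B \<omega>) \<le> L2norm A + L2norm B"
proof (rule L2norm_dual')
  show "(\<lambda>\<omega>. A \<omega> + B \<omega>) \<in> S" by (rule add[OF A B])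
  fix Z assume Z: "Z \<in> S"
  have "expectation (\<lambda>\<omega>. Z \<omega> * (A \<omega> + B \<omega>)) = expectation (\<lambda>\<omega>. Z \<omega> * A \<omega>) + expectation (\<lambda>\<omega>. Z \<omega> * B \<omega>)"
    using prod_integrable[OF Z A] prod_integrable[OF Z B] by (simp add: distrib_left)
  then show "\<bar>expectation (\<lambda>\<omega>. Z \<omega> * (A \<omega> + B \<omega>))\<bar> \<le> L2norm Z * (L2norm A + L2norm B)"
    using Cauchy_Schwarz_L2norm[OF Z A] Cauchy_Schwarz_L2norm[OF Z B] by (simp add: distrib_left)
qed (simp add: L2norm_nonneg)

lemma L2norm_scale: "L2norm (\<lambda>\<omega>. c * A \<omega>) = \<bar>c\<bar> * L2norm A"
  by (simp add: L2norm_def power_mult_distrib real_sqrt_mult)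

lemma cov_ou_ou:
  assumes Y: "process Y" and t: "t \<ge> 0"
  shows "expectation (\<lambda>\<omega>. ou \<kappa> (\<lambda>s. Y s \<omega>) t * ou \<mu> (\<lambda>s. Y s \<omega>) t)
    = ou \<mu> (\<lambda>q. ou \<kappa> (\<lambda>s. expectation (\<lambda>\<omega>. Y q \<omega> * Y s \<omega>)) t) t"
proof -
  have "expectation (\<lambda>\<omega>. ou \<kappa> (\<lambda>s. Y s \<omega>) t * ou \<mu> (\<lambda>s. Y s \<omega>) t)
     = ou \<mu> (\<lambda>q. expectation (\<lambda>\<omega>. ou \<kappa> (\<lambda>s. Y s \<omega>) t * Y q \<omega>)) t"
    by (rule cov_ou[OF Y processD(1)[OF process_ou[OF Y] t] t])
  also have "\<dots> = ou \<mu> (\<lambda>q. ou \<kappa> (\<lambda>s. expectation (\<lambda>\<omega>. Y q \<omega> * Y s \<omega>)) t) t"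
    by (rule ou_cong[OF _ t]) (simp add: mult.commute[of "ou _ _ _"] cov_ou[OF Y processD(1)[OF Y] t])
  finally show ?thesis .
qed

end

section \<open>Covariances of V and X\<close>

locale fbm_ou = fbm M S H W for M :: "'a measure" and S H W +
  fixes \<theta> \<rho> :: real
  assumes \<theta>: "\<theta> > 0" and \<rho>: "\<rho> > 0" and \<theta>\<rho>: "\<theta> \<noteq> \<rho>"
begin

definition V :: "real \<Rightarrow> 'a \<Rightarrow> real" where "V t \<omega> = ou \<rho> (\<lambda>s. W s \<omega>) t"
definition X :: "real \<Rightarrow> 'a \<Rightarrow> real" where "X t \<omega> = ou \<theta> (\<lambda>s. V s \<omega>) t"

lemma process_V: "process V" using process_ou[OF W, of \<rho>] by (simp add: V_def[abs_def])
lemma process_X: "process X" using process_ou[OF process_V, of \<theta>] by (simp add: X_def[abs_def])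
lemma VS: "t \<ge> 0 \<Longrightarrow> V t \<in> S" and XS: "t \<ge> 0 \<Longrightarrow> X t \<in> S"
  using processD(1)[OF process_V] processD(1)[OF process_X] by auto

lemma X_decomp:
  assumes t: "t \<ge> 0"
  shows "X t \<omega> = (\<rho> * ou \<rho> (\<lambda>s. W s \<omega>) t - \<theta> * ou \<theta> (\<lambda>s. W s \<omega>) t) / (\<rho> - \<theta>)"
  unfolding X_def V_def by (rule ou_comp[OF processD(2)[OF W] \<theta>\<rho> t])

text \<open>For fixed \<open>Z\<close> in \<open>S\<close> these functions of time solve the same
  equations as the paths of W, V and X, and the estimates are proved for them.\<close>

definition covW where "covW Z t = expectation (\<lambda>\<omega>. Z \<omega> * W t \<omega>)"
definition covV where "covV Z t = expectation (\<lambda>\<omega>. Z \<omega> * V t \<omega>)"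
definition covX where "covX Z t = expectation (\<lambda>\<omega>. Z \<omega> * X t \<omega>)"

lemma cov_cont: "Z \<in> S \<Longrightarrow> continuous_on {0..} (covW Z)" "Z \<in> S \<Longrightarrow> continuous_on {0..} (covV Z)" "Z \<in> S \<Longrightarrow> continuous_on {0..} (covX Z)"
  unfolding covW_def covV_def covX_def using cov_continuous W process_V process_X by auto

lemma covV_ou: "Z \<in> S \<Longrightarrow> t \<ge> 0 \<Longrightarrow> covV Z t = ou \<rho> (covW Z) t"
  unfolding covV_def covW_def V_def by (rule cov_ou[OF W])

lemma covX_ou: "Z \<in> S \<Longrightarrow> t \<ge> 0 \<Longrightarrow> covX Z t = ou \<theta> (covV Z) t"
  unfolding covX_def covV_def X_def by (rule cov_ou[OF process_V])

lemma covV_eq: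
  assumes Z: "Z \<in> S" and t: "t \<ge> 0"
  shows "covV Z t + \<rho> * integral {0..t} (covV Z) = covW Z t"
proof -
  have "integral {0..t} (covV Z) = integral {0..t} (ou \<rho> (covW Z))"
    by (rule integral_cong) (simp add: covV_ou[OF Z])
  then show ?thesis using ou_eq[OF cov_cont(1)[OF Z] t, of \<rho>] covV_ou[OF Z t] by simp
qed

lemma covX_eq:
  assumes Z: "Z \<in> S" and t: "t \<ge> 0"
  shows "covX Z t + \<theta> * integral {0..t} (covX Z) = covV Z t"
proof -
  have "integral {0..t} (covX Z) = integral {0..t} (ou \<theta> (covV Z))"
    by (rule integral_cong) (simp add: covX_ou[OF Z])
  then show ?thesis using ou_eq[OF cov_cont(2)[OF Z] t, of \<theta>] covX_ou[OF Z t] by simp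
qed

lemma covX_decomp:
  assumes Z: "Z \<in> S" and t: "t \<ge> 0"
  shows "covX Z t = (\<rho> * ou \<rho> (covW Z) t - \<theta> * ou \<theta> (covW Z) t) / (\<rho> - \<theta>)"
proof -
  have "covX Z t = ou \<theta> (ou \<rho> (covW Z)) t"
    unfolding covX_ou[OF Z t] by (rule ou_cong[OF _ t]) (simp add: covV_ou[OF Z])
  then show ?thesis using ou_comp[OF cov_cont(1)[OF Z] \<theta>\<rho> t] by simp
qed

lemma ou_covW_bound:
  assumes "Z \<in> S" "\<kappa> > 0" "t \<ge> 0"
  shows "\<bar>ou \<kappa> (covW Z) t\<bar> \<le> L2norm Z * (1 + 1 / \<kappa>)"
  using cov_ou_W_bound[OF assms] unfolding covW_def cov_ou_W[OF assms(1,3)] .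

text \<open>Bounds on the norms of V and X that are uniform in time, from 1 + 1/\<kappa> in
  \<open>ou_covW_bound\<close>. In \<open>cX\<close> the two rates contribute \<rho> (1 + 1/\<rho>)
  + \<theta> (1 + 1/\<theta>).\<close>

definition cV where "cV = 1 + 1 / \<rho>"
definition cX where "cX = (\<rho> + \<theta> + 2) / \<bar>\<rho> - \<theta>\<bar>"

lemma cV: "cV \<ge> 0" and cX: "cX \<ge> 0" using \<theta> \<rho> by (auto simp: cV_def cX_def)

lemma covV_bound: "Z \<in> S \<Longrightarrow> t \<ge> 0 \<Longrightarrow> \<bar>covV Z t\<bar> \<le> L2norm Z * cV"
  using ou_covW_bound[of Z \<rho> t] \<rho> by (simp add: covV_ou cV_def)

lemma covX_bound:
  assumes Z: "Z \<in> S" and t: "t \<ge> 0"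
  shows "\<bar>covX Z t\<bar> \<le> L2norm Z * cX"
proof -
  have "\<bar>covX Z t\<bar> = \<bar>\<rho> * ou \<rho> (covW Z) t - \<theta> * ou \<theta> (covW Z) t\<bar> / \<bar>\<rho> - \<theta>\<bar>"
    unfolding covX_decomp[OF Z t] by simp
  also have "\<bar>\<rho> * ou \<rho> (covW Z) t - \<theta> * ou \<theta> (covW Z) t\<bar> \<le> \<rho> * (L2norm Z * (1 + 1 / \<rho>)) + \<theta> * (L2norm Z * (1 + 1 / \<theta>))"
  proof -
    have "\<rho> * \<bar>ou \<rho> (covW Z) t\<bar> \<le> \<rho> * (L2norm Z * (1 + 1 / \<rho>))" "\<theta> * \<bar>ou \<theta> (covW Z) t\<bar> \<le> \<theta> * (L2norm Z * (1 + 1 / \<theta>))"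
      using \<theta> \<rho> by (intro mult_left_mono ou_covW_bound Z t; simp)+
    moreover have "\<bar>\<rho> * ou \<rho> (covW Z) t - \<theta> * ou \<theta> (covW Z) t\<bar> \<le> \<rho> * \<bar>ou \<rho> (covW Z) t\<bar> + \<theta> * \<bar>ou \<theta> (covW Z) t\<bar>"
      using \<theta> \<rho> abs_triangle_ineq4[of "\<rho> * ou \<rho> (covW Z) t" "\<theta> * ou \<theta> (covW Z) t"] by (simp add: abs_mult)
    ultimately show ?thesis by linarith
  qed
  also have "\<dots> = L2norm Z * (\<rho> + \<theta> + 2)" using \<theta> \<rho> by (simp add: field_simps)
  finally show ?thesis by (simp add: cX_def divide_right_mono)
qed

lemma L2norm_V: "t \<ge> 0 \<Longrightarrow> L2norm (V t) \<le> cV"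
  by (rule L2norm_dual'[OF VS cV]) (use covV_bound in \<open>auto simp: covV_def\<close>)

lemma L2norm_X: "t \<ge> 0 \<Longrightarrow> L2norm (X t) \<le> cX"
  by (rule L2norm_dual'[OF XS cX]) (use covX_bound in \<open>auto simp: covX_def\<close>)

lemma integral_diff_bound:
  fixes f :: "real \<Rightarrow> real"
  assumes f: "continuous_on {0..} f" and st: "0 \<le> s" "s \<le> t" and b: "\<And>r. s \<le> r \<Longrightarrow> r \<le> t \<Longrightarrow> \<bar>f r\<bar> \<le> C"
  shows "\<bar>integral {0..t} f - integral {0..s} f\<bar> \<le> C * (t - s)"
proof -
  have "\<bar>integral {0..t} f - integral {0..s} f\<bar> \<le> C * t - C * s"
  proof (rule abs_diff_le_deriv[OF st(2)])
    show "continuous_on {s..t} (\<lambda>t. integral {0..t} f)"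
      by (rule continuous_on_subset[OF integral_continuous[OF f]]) (use st in auto)
    fix r assume r: "s < r" "r < t"
    then show "((\<lambda>t. integral {0..t} f) has_real_derivative f r) (at r)"
      using st by (intro deriv_within_at integral_deriv_within f) auto
    show "((*) C has_real_derivative C) (at r)" by (auto intro!: derivative_eq_intros)
    show "\<bar>f r\<bar> \<le> C" using r b by simp
  qed (intro continuous_intros)
  then show ?thesis by (simp add: algebra_simps)
qed

definition cI where "cI = 1 + \<rho> * cV + \<theta> * cX"

lemma cI: "cI \<ge> 0" using \<theta> \<rho> cV cX by (simp add: cI_def)

text \<open>By the two equations an increment of X is one of W plus drift terms of order t - s;
  within unit distance these are absorbed by (t - s)^H.\<close>

lemma X_increment:
  assumes s: "0 \<le> s" "s \<le> t" "t \<le> s + 1"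
  shows "L2norm (\<lambda>\<omega>. X t \<omega> - X s \<omega>) \<le> cI * (t - s) powr H"
proof (rule L2norm_dual)
  fix Z assume Z: "Z \<in> S"
  let ?n = "L2norm Z"
  have t: "t \<ge> 0" using s by simp
  have 1: "\<bar>integral {0..t} (covX Z) - integral {0..s} (covX Z)\<bar> \<le> ?n * cX * (t - s)"
    by (rule integral_diff_bound[OF cov_cont(3)[OF Z] s(1,2)]) (use s covX_bound[OF Z] in auto)
  have 2: "\<bar>integral {0..t} (covV Z) - integral {0..s} (covV Z)\<bar> \<le> ?n * cV * (t - s)"
    by (rule integral_diff_bound[OF cov_cont(2)[OF Z] s(1,2)]) (use s covV_bound[OF Z] in auto)
  have 3: "\<bar>covW Z t - covW Z s\<bar> \<le> ?n * (t - s) powr H"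
    using cov_W_holder[OF Z t s(1)] s(2) by (simp add: covW_def)
  have eq: "covX Z t - covX Z s = (covW Z t - covW Z s) - \<rho> * (integral {0..t} (covV Z) - integral {0..s} (covV Z))
     - \<theta> * (integral {0..t} (covX Z) - integral {0..s} (covX Z))"
    using covX_eq[OF Z t] covX_eq[OF Z s(1)] covV_eq[OF Z t] covV_eq[OF Z s(1)] by (simp add: algebra_simps)
  have "\<bar>covX Z t - covX Z s\<bar> \<le> \<bar>covW Z t - covW Z s\<bar> + \<rho> * \<bar>integral {0..t} (covV Z) - integral {0..s} (covV Z)\<bar>
     + \<theta> * \<bar>integral {0..t} (covX Z) - integral {0..s} (covX Z)\<bar>"
  proof -
    have tri: "\<bar>a - b - c\<bar> \<le> \<bar>a\<bar> + \<bar>b\<bar> + \<bar>c\<bar>" for a b c :: real by linarith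
    have a: "\<bar>\<rho> * b\<bar> = \<rho> * \<bar>b\<bar>" "\<bar>\<theta> * b\<bar> = \<theta> * \<bar>b\<bar>" for b using \<theta> \<rho> by (simp_all add: abs_mult)
    show ?thesis unfolding eq a[symmetric] by (rule tri)
  qed
  also have "\<dots> \<le> ?n * (t - s) powr H + \<rho> * (?n * cV * (t - s)) + \<theta> * (?n * cX * (t - s))"
    using 1 2 3 \<theta> \<rho> by (intro add_mono mult_left_mono) auto
  also have "\<dots> = ?n * ((t - s) powr H + (\<rho> * cV + \<theta> * cX) * (t - s))" by (simp add: algebra_simps)
  also have "\<dots> \<le> ?n * ((t - s) powr H + (\<rho> * cV + \<theta> * cX) * (t - s) powr H)"
  proof -
    have "t - s \<le> (t - s) powr H"
      using s H powr_mono'[of H 1 "t - s"] by (cases "t = s") auto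
    then show ?thesis using \<theta> \<rho> cV cX
      by (intro mult_left_mono add_left_mono L2norm_nonneg) auto
  qed
  also have "\<dots> = ?n * (cI * (t - s) powr H)" by (simp add: cI_def algebra_simps)
  finally show "\<bar>expectation (\<lambda>\<omega>. Z \<omega> * X t \<omega>) - expectation (\<lambda>\<omega>. Z \<omega> * X s \<omega>)\<bar> \<le> ?n * (cI * (t - s) powr H)"
    by (simp add: covX_def)
qed (use s cI XS in auto)

text \<open>Exponential errors are weakened to this form so that they can be added to errors of the
  order of an inverse distance.\<close>

lemma exp_le_inverse:
  fixes a y :: real
  shows "a > 0 \<Longrightarrow> y \<ge> 0 \<Longrightarrow> exp (- a * y) \<le> (1 + 1 / a) * (1 / (1 + y))"
proof -
  assume a: "a > 0" and y: "y \<ge> 0"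
  have "exp (- a * y) = 1 / exp (a * y)" by (simp only: exp_minus inverse_eq_divide mult_minus_left)
  also have "\<dots> \<le> 1 / (1 + a * y)"
    using a y by (intro divide_left_mono exp_ge_add_one_self mult_pos_pos) (auto intro: add_pos_nonneg)
  also have "\<dots> \<le> (1 + 1 / a) * (1 / (1 + y))"
    using a y by (simp add: field_simps add_pos_nonneg)
  finally show ?thesis .
qed

text \<open>The increments of W beyond s + 1 are nearly uncorrelated with X s: the covariance of W
  with X s is Lipschitz there, with a small constant (\<open>wlip\<close>). Passing from W to X t
  costs a multiple of that constant, apart from the memory of times close to s, which is damped
  exponentially. The summand 1/(1 + s) is the effect of starting at time 0.\<close>

lemma cov_X_decay: "\<exists>C\<ge>0. \<forall>s t. 0 \<le> s \<longrightarrow> s \<le> t \<longrightarrow>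
   \<bar>expectation (\<lambda>\<omega>. X s \<omega> * X t \<omega>)\<bar> \<le> C * (1 / (1 + s) + 1 / (1 + (t - s)))"
proof -
  define d where "d = \<bar>\<rho> - \<theta>\<bar>"
  have d0: "d > 0" using \<theta>\<rho> by (simp add: d_def)
  define C1 where "C1 = (2 + 1 / \<rho> + 1 / \<theta>) / d"
  have C1: "C1 \<ge> 0" using \<theta> \<rho> d0 by (simp add: C1_def)
  have wlip: "\<bar>covW (X s) r2 - covW (X s) r1\<bar> \<le> (r2 - r1) * (C1 * (1 / (1 + s) + 1 / (r1 - s)))"
    if s: "s \<ge> 0" and r: "s + 1 \<le> r1" "r1 \<le> r2" for s r1 r2
  proof -
    have r0: "r1 \<ge> 0" "r2 \<ge> 0" using s r by auto
    define D where "D \<omega> = W r2 \<omega> - W r1 \<omega>" for \<omega>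
    have D: "D \<in> S" unfolding D_def[abs_def] using r0 by (intro diff WS)
    have U: "(\<lambda>\<omega>. ou \<kappa> (\<lambda>s. W s \<omega>) s) \<in> S" for \<kappa> by (rule processD(1)[OF process_ou[OF W] s])
    have "covW (X s) r2 - covW (X s) r1 = expectation (\<lambda>\<omega>. D \<omega> * X s \<omega>)"
      unfolding covW_def D_def using expectation_diff_right[OF XS WS WS, of s r2 r1] s r0 by (simp add: mult.commute)
    also have "\<dots> = expectation (\<lambda>\<omega>. (\<rho> * (D \<omega> * ou \<rho> (\<lambda>s. W s \<omega>) s) - \<theta> * (D \<omega> * ou \<theta> (\<lambda>s. W s \<omega>) s)) / (\<rho> - \<theta>))"
      unfolding X_decomp[OF s] by (intro Bochner_Integration.integral_cong) (auto simp: algebra_simps)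
    also have "\<dots> = (\<rho> * expectation (\<lambda>\<omega>. D \<omega> * ou \<rho> (\<lambda>s. W s \<omega>) s) - \<theta> * expectation (\<lambda>\<omega>. D \<omega> * ou \<theta> (\<lambda>s. W s \<omega>) s)) / (\<rho> - \<theta>)"
      using prod_integrable[OF D U] by simp
    finally have "\<bar>covW (X s) r2 - covW (X s) r1\<bar> = \<bar>\<rho> * expectation (\<lambda>\<omega>. D \<omega> * ou \<rho> (\<lambda>s. W s \<omega>) s) - \<theta> * expectation (\<lambda>\<omega>. D \<omega> * ou \<theta> (\<lambda>s. W s \<omega>) s)\<bar> / d"
      by (simp add: d_def)
    also have "\<dots> \<le> ((r2 - r1) * ((exp (- \<rho> * s) + exp (- \<theta> * s)) + (1 / \<rho> + 1 / \<theta>) / (r1 - s))) / d"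
      unfolding D_def using d0 by (intro divide_right_mono cov_ou_W_increment_diff \<theta> \<rho> s r) auto
    also have "\<dots> \<le> ((r2 - r1) * ((2 + 1 / \<rho> + 1 / \<theta>) * (1 / (1 + s) + 1 / (r1 - s)))) / d"
    proof (intro divide_right_mono mult_left_mono)
      have "exp (- \<rho> * s) + exp (- \<theta> * s) \<le> (2 + 1 / \<rho> + 1 / \<theta>) * (1 / (1 + s))"
        using exp_le_inverse[OF \<rho> s] exp_le_inverse[OF \<theta> s] by (simp add: algebra_simps add_divide_distrib)
      moreover have "(1 / \<rho> + 1 / \<theta>) / (r1 - s) \<le> (2 + 1 / \<rho> + 1 / \<theta>) * (1 / (r1 - s))"
        using r by (simp add: divide_right_mono)
      ultimately show "(exp (- \<rho> * s) + exp (- \<theta> * s)) + (1 / \<rho> + 1 / \<theta>) / (r1 - s) \<le> (2 + 1 / \<rho> + 1 / \<theta>) * (1 / (1 + s) + 1 / (r1 - s))"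
        unfolding distrib_left[of "2 + 1 / \<rho> + 1 / \<theta>" "1 / (1 + s)"] by linarith
    qed (use r d0 in auto)
    also have "\<dots> = (r2 - r1) * (C1 * (1 / (1 + s) + 1 / (r1 - s)))" by (simp add: C1_def)
    finally show ?thesis .
  qed
  define K where "K \<kappa> = 3 * (cX * (1 + 1 / \<kappa>) * (1 + 2 / \<kappa>) + C1 / \<kappa>)" for \<kappa>
  have K: "K \<kappa> \<ge> 0" if "\<kappa> > 0" for \<kappa> using that cX C1 by (simp add: K_def)
  have oub: "\<bar>ou \<kappa> (covW (X s)) t\<bar> \<le> K \<kappa> * (1 / (1 + s) + 1 / (1 + (t - s)))"
    if k: "\<kappa> > 0" and s: "0 \<le> s" "s + 2 \<le> t" for \<kappa> s t
  proof -
    \<comment> \<open>The midpoint s + h separates the two effects: damping acts over the distance h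
      after it, and beyond it the slope of the covariance is at most \<open>e\<close>.\<close>
    define h where "h = (t - s) / 2"
    have h: "h \<ge> 1" "t = s + h + h" using s by (auto simp: h_def field_simps)
    define e where "e = C1 * (1 / (1 + s) + 1 / h)"
    have e: "e \<ge> 0" using C1 s h by (simp add: e_def)
    have "\<bar>ou \<kappa> (covW (X s)) t\<bar> \<le> exp (- \<kappa> * (t - (s + h))) * \<bar>ou \<kappa> (covW (X s)) (s + h)\<bar> + 0 + e / \<kappa>"
    proof (rule ou_bound[OF cov_cont(1)[OF XS[OF s(1)]] k _ _ e])
      fix r assume r: "s + h \<le> r" "r \<le> t"
      have "\<bar>covW (X s) t - covW (X s) r\<bar> \<le> (t - r) * (C1 * (1 / (1 + s) + 1 / (r - s)))"
        using r s h by (intro wlip) auto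
      also have "\<dots> \<le> (t - r) * e" unfolding e_def
        using r s h C1 by (intro mult_left_mono add_left_mono divide_left_mono) auto
      finally show "\<bar>covW (X s) t - covW (X s) r\<bar> \<le> 0 + e * (t - r)" by (simp add: mult.commute)
    qed (use s h in auto)
    also have "\<dots> \<le> ((1 + 2 / \<kappa>) * (1 / (1 + (t - s)))) * (cX * (1 + 1 / \<kappa>)) + e / \<kappa>"
    proof -
      have "exp (- \<kappa> * (t - (s + h))) = exp (- (\<kappa> / 2) * (t - s))" using h(2) by (simp add: algebra_simps)
      also have "\<dots> \<le> (1 + 2 / \<kappa>) * (1 / (1 + (t - s)))" using exp_le_inverse[of "\<kappa> / 2" "t - s"] k s by simp
      finally have 1: "exp (- \<kappa> * (t - (s + h))) \<le> (1 + 2 / \<kappa>) * (1 / (1 + (t - s)))" .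
      have "\<bar>ou \<kappa> (covW (X s)) (s + h)\<bar> \<le> L2norm (X s) * (1 + 1 / \<kappa>)" using s h by (intro ou_covW_bound XS k) auto
      also have "\<dots> \<le> cX * (1 + 1 / \<kappa>)" using k by (intro mult_right_mono L2norm_X s) auto
      finally have 2: "\<bar>ou \<kappa> (covW (X s)) (s + h)\<bar> \<le> cX * (1 + 1 / \<kappa>)" .
      have "exp (- \<kappa> * (t - (s + h))) * \<bar>ou \<kappa> (covW (X s)) (s + h)\<bar> \<le> ((1 + 2 / \<kappa>) * (1 / (1 + (t - s)))) * (cX * (1 + 1 / \<kappa>))"
        using 1 2 k s by (intro mult_mono) auto
      then show ?thesis by simp
    qed
    also have "\<dots> \<le> K \<kappa> * (1 / (1 + s) + 1 / (1 + (t - s)))"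
    proof -
      define a where "a = 1 / (1 + s)"
      define b where "b = 1 / (1 + (t - s))"
      define c where "c = cX * (1 + 1 / \<kappa>) * (1 + 2 / \<kappa>)"
      have ab: "a \<ge> 0" "b \<ge> 0" using s by (auto simp: a_def b_def)
      have c: "c \<ge> 0" using k cX by (simp add: c_def)
      have "1 / h \<le> 3 * b" using h by (simp add: b_def field_simps)
      then have "e \<le> C1 * (a + 3 * b)" unfolding e_def a_def using C1 by (intro mult_left_mono) auto
      then have "e / \<kappa> \<le> C1 * (a + 3 * b) / \<kappa>" using k by (intro divide_right_mono) auto
      also have "\<dots> = (C1 / \<kappa>) * (a + 3 * b)" by simp
      also have "\<dots> \<le> (C1 / \<kappa>) * (3 * (a + b))" using ab C1 k by (intro mult_left_mono) auto
      finally have 1: "e / \<kappa> \<le> 3 * (C1 / \<kappa>) * (a + b)" by (simp add: mult_ac)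
      have 2: "b * c \<le> 3 * c * (a + b)" using ab c mult_nonneg_nonneg[of b c] mult_nonneg_nonneg[of c a] by (simp add: algebra_simps)
      have "K \<kappa> * (a + b) = 3 * c * (a + b) + 3 * (C1 / \<kappa>) * (a + b)"
        unfolding K_def c_def[symmetric] by (simp only: distrib_left distrib_right mult.assoc)
      then have "b * c + e / \<kappa> \<le> K \<kappa> * (a + b)" using 1 2 by linarith
      then show ?thesis by (simp add: a_def b_def c_def mult_ac)
    qed
    finally show ?thesis .
  qed
  define C where "C = 3 * cX\<^sup>2 + (\<rho> * K \<rho> + \<theta> * K \<theta>) / d"
  have C': "(\<rho> * K \<rho> + \<theta> * K \<theta>) / d \<ge> 0" using K \<theta> \<rho> d0 by simp
  show ?thesis
  proof (intro exI[of _ C] conjI allI impI)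
    show "C \<ge> 0" using C' by (simp add: C_def)
    fix s t :: real assume s: "0 \<le> s" "s \<le> t"
    let ?a = "1 / (1 + s) + 1 / (1 + (t - s))"
    have a0: "?a \<ge> 0" using s by simp
    have xx: "expectation (\<lambda>\<omega>. X s \<omega> * X t \<omega>) = covX (X s) t" by (simp add: covX_def)
    show "\<bar>expectation (\<lambda>\<omega>. X s \<omega> * X t \<omega>)\<bar> \<le> C * ?a"
    proof (cases "s + 2 \<le> t")
      case True
      have "\<bar>covX (X s) t\<bar> = \<bar>\<rho> * ou \<rho> (covW (X s)) t - \<theta> * ou \<theta> (covW (X s)) t\<bar> / d"
        using s by (subst covX_decomp) (auto simp: XS d_def)
      also have "\<dots> \<le> (\<rho> * \<bar>ou \<rho> (covW (X s)) t\<bar> + \<theta> * \<bar>ou \<theta> (covW (X s)) t\<bar>) / d"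
        using \<theta> \<rho> d0 abs_triangle_ineq4[of "\<rho> * ou \<rho> (covW (X s)) t" "\<theta> * ou \<theta> (covW (X s)) t"]
        by (intro divide_right_mono) (auto simp: abs_mult)
      also have "\<dots> \<le> (\<rho> * (K \<rho> * ?a) + \<theta> * (K \<theta> * ?a)) / d"
        using \<theta> \<rho> d0 True s by (intro divide_right_mono add_mono mult_left_mono oub) auto
      also have "\<dots> = (\<rho> * K \<rho> + \<theta> * K \<theta>) / d * ?a" by (simp add: algebra_simps add_divide_distrib)
      also have "\<dots> \<le> C * ?a" using a0 by (intro mult_right_mono) (simp_all add: C_def)
      finally show ?thesis by (simp add: xx)
    next
      \<comment> \<open>Near the diagonal the uniform bound suffices: t - s < 2 makes 3/(1 + (t -
        s)) at least 1.\<close>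
      case False
      have "\<bar>covX (X s) t\<bar> \<le> L2norm (X s) * cX" using s by (intro covX_bound XS) auto
      also have "\<dots> \<le> cX * cX" using cX s by (intro mult_right_mono L2norm_X) auto
      also have "\<dots> \<le> (3 * cX\<^sup>2) * (1 / (1 + (t - s)))"
      proof -
        have "1 \<le> 3 * (1 / (1 + (t - s)))" using s False by (simp add: field_simps)
        from mult_left_mono[OF this, of "cX * cX"] show ?thesis by (simp add: power2_eq_square mult_ac)
      qed
      also have "\<dots> \<le> C * ?a" using C' s by (intro mult_mono) (auto simp: C_def)
      finally show ?thesis by (simp add: xx)
    qed
  qed
qed

end

section \<open>The limit of the second moments\<close>

lemma uniform_Cauchy_limit_at_top:
  fixes f e :: "real \<Rightarrow> real"
  assumes b: "\<And>u t. u \<ge> 0 \<Longrightarrow> t \<ge> 0 \<Longrightarrow> \<bar>f (u + t) - f t\<bar> \<le> e t" and e: "(e \<longlongrightarrow> 0) at_top"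
  shows "\<exists>L. (f \<longlongrightarrow> L) at_top"
proof -
  have en: "(\<lambda>n. e (real n)) \<longlonglongrightarrow> 0" by (rule filterlim_compose[OF e filterlim_real_sequentially])
  have "Cauchy (\<lambda>n. f (real n))"
  proof (rule CauchyI')
    fix \<epsilon> :: real assume "\<epsilon> > 0"
    then have "eventually (\<lambda>n. e (real n) < \<epsilon>) sequentially" using en by (rule order_tendstoD(2)[rotated])
    then obtain N where N: "\<And>n. n \<ge> N \<Longrightarrow> e (real n) < \<epsilon>" unfolding eventually_sequentially by blast
    show "\<exists>M. \<forall>m\<ge>M. \<forall>n>m. dist (f (real m)) (f (real n)) < \<epsilon>"
    proof (intro exI[of _ N] allI impI)
      fix m n :: nat assume "m \<ge> N" "n > m"
      then show "dist (f (real m)) (f (real n)) < \<epsilon>"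
        using b[of "real n - real m" "real m"] N[of m] by (auto simp: dist_real_def)
    qed
  qed
  then obtain L where L: "(\<lambda>n. f (real n)) \<longlonglongrightarrow> L" using Cauchy_convergent convergentD by blast
  have le: "\<bar>L - f t\<bar> \<le> e t" if t: "t \<ge> 0" for t
  proof -
    obtain N :: nat where N: "real N \<ge> t" using real_arch_simple by blast
    have l: "(\<lambda>n. \<bar>f (real n) - f t\<bar>) \<longlonglongrightarrow> \<bar>L - f t\<bar>" by (intro tendsto_intros L)
    have "\<forall>n\<ge>N. \<bar>f (real n) - f t\<bar> \<le> e t"
    proof (intro allI impI)
      fix n assume "n \<ge> N"
      then show "\<bar>f (real n) - f t\<bar> \<le> e t" using b[of "real n - t" t] N t by simp
    qed
    then show ?thesis by (rule Lim_bounded[OF l])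
  qed
  have "((\<lambda>t. f t - L) \<longlongrightarrow> 0) at_top"
  proof (rule Lim_null_comparison[OF _ e])
    show "\<forall>\<^sub>F t in at_top. norm (f t - L) \<le> e t"
      using eventually_ge_at_top[of 0] by eventually_elim (use le in \<open>simp add: abs_minus_commute\<close>)
  qed
  then show ?thesis using LIM_zero_cancel by blast
qed

context gaussian_space
begin

lemma L2norm_triangle_diff:
  assumes A: "A \<in> S" and B: "B \<in> S"
  shows "\<bar>L2norm A - L2norm B\<bar> \<le> L2norm (\<lambda>\<omega>. A \<omega> - B \<omega>)"
proof -
  have "L2norm A \<le> L2norm (\<lambda>\<omega>. A \<omega> - B \<omega>) + L2norm B"
    using L2norm_add_le[OF diff[OF A B] B] by simp
  moreover have "L2norm B \<le> L2norm (\<lambda>\<omega>. B \<omega> - A \<omega>) + L2norm A"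
    using L2norm_add_le[OF diff[OF B A] A] by simp
  moreover have "L2norm (\<lambda>\<omega>. B \<omega> - A \<omega>) = L2norm (\<lambda>\<omega>. A \<omega> - B \<omega>)"
    using L2norm_scale[of "-1" "\<lambda>\<omega>. A \<omega> - B \<omega>"] by simp
  ultimately show ?thesis by linarith
qed

lemma L2norm_continuous:
  assumes Y: "process Y"
  shows "continuous_on {0..} (\<lambda>t. L2norm (Y t))"
proof (rule continuous_on_sequentiallyI)
  fix u :: "nat \<Rightarrow> real" and a assume u: "\<forall>n. u n \<in> {0..}" "a \<in> {0..}" "u \<longlonglongrightarrow> a"
  have uS: "Y (u n) \<in> S" "Y a \<in> S" for n using u processD(1)[OF Y] by auto
  have "(\<lambda>n. expectation (\<lambda>\<omega>. (Y (u n) \<omega> - Y a \<omega>)\<^sup>2)) \<longlonglongrightarrow> 0"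
  proof (rule AE_limit_L2[OF uS])
    show "AE \<omega> in M. (\<lambda>n. Y (u n) \<omega>) \<longlonglongrightarrow> Y a \<omega>"
      using u by (intro AE_I2 continuous_on_tendsto_compose[OF processD(2)[OF Y]]) auto
  qed
  then have "(\<lambda>n. L2norm (\<lambda>\<omega>. Y (u n) \<omega> - Y a \<omega>)) \<longlonglongrightarrow> 0"
    unfolding L2norm_def using tendsto_real_sqrt by fastforce
  then have "(\<lambda>n. L2norm (Y (u n)) - L2norm (Y a)) \<longlonglongrightarrow> 0"
    by (rule Lim_null_comparison[rotated]) (simp add: L2norm_triangle_diff uS)
  then show "(\<lambda>n. L2norm (Y (u n))) \<longlonglongrightarrow> L2norm (Y a)" by (rule LIM_zero_cancel)
qed

text \<open>Second moments of such combinations depend on the driving process only through its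
  covariance, so W may be exchanged for its increments after a fixed time.\<close>

lemma second_moment_ou_comb:
  assumes Y: "process Y" and Y': "process Y'" and t: "t \<ge> 0"
    and eq: "\<And>q s. 0 \<le> q \<Longrightarrow> 0 \<le> s \<Longrightarrow> expectation (\<lambda>\<omega>. Y q \<omega> * Y s \<omega>) = expectation (\<lambda>\<omega>. Y' q \<omega> * Y' s \<omega>)"
  shows "expectation (\<lambda>\<omega>. (a * ou \<kappa> (\<lambda>s. Y s \<omega>) t + b * ou \<mu> (\<lambda>s. Y s \<omega>) t)\<^sup>2)
    = expectation (\<lambda>\<omega>. (a * ou \<kappa> (\<lambda>s. Y' s \<omega>) t + b * ou \<mu> (\<lambda>s. Y' s \<omega>) t)\<^sup>2)"
proof -
  have e: "expectation (\<lambda>\<omega>. ou \<kappa> (\<lambda>s. Y s \<omega>) t * ou \<mu> (\<lambda>s. Y s \<omega>) t)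
    = expectation (\<lambda>\<omega>. ou \<kappa> (\<lambda>s. Y' s \<omega>) t * ou \<mu> (\<lambda>s. Y' s \<omega>) t)" for \<kappa> \<mu>
    unfolding cov_ou_ou[OF Y t] cov_ou_ou[OF Y' t] by (intro ou_cong t eq)
  have s: "expectation (\<lambda>\<omega>. (a * ou \<kappa> (\<lambda>s. U s \<omega>) t + b * ou \<mu> (\<lambda>s. U s \<omega>) t)\<^sup>2)
      = a\<^sup>2 * expectation (\<lambda>\<omega>. ou \<kappa> (\<lambda>s. U s \<omega>) t * ou \<kappa> (\<lambda>s. U s \<omega>) t)
      + 2 * a * b * expectation (\<lambda>\<omega>. ou \<kappa> (\<lambda>s. U s \<omega>) t * ou \<mu> (\<lambda>s. U s \<omega>) t)
      + b\<^sup>2 * expectation (\<lambda>\<omega>. ou \<mu> (\<lambda>s. U s \<omega>) t * ou \<mu> (\<lambda>s. U s \<omega>) t)" if U: "process U" for U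
  proof -
    have i: "integrable M (\<lambda>\<omega>. ou \<kappa> (\<lambda>s. U s \<omega>) t * ou \<mu> (\<lambda>s. U s \<omega>) t)" for \<kappa> \<mu>
      by (intro prod_integrable processD(1)[OF process_ou[OF U]] t)
    have "expectation (\<lambda>\<omega>. (a * ou \<kappa> (\<lambda>s. U s \<omega>) t + b * ou \<mu> (\<lambda>s. U s \<omega>) t)\<^sup>2)
      = expectation (\<lambda>\<omega>. a\<^sup>2 * (ou \<kappa> (\<lambda>s. U s \<omega>) t * ou \<kappa> (\<lambda>s. U s \<omega>) t)
        + 2 * a * b * (ou \<kappa> (\<lambda>s. U s \<omega>) t * ou \<mu> (\<lambda>s. U s \<omega>) t)
        + b\<^sup>2 * (ou \<mu> (\<lambda>s. U s \<omega>) t * ou \<mu> (\<lambda>s. U s \<omega>) t))"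
      by (intro Bochner_Integration.integral_cong refl) (simp add: power2_eq_square algebra_simps)
    then show ?thesis using i by simp
  qed
  show ?thesis unfolding s[OF Y] s[OF Y'] e ..
qed

end

context fbm_ou
begin

lemma W_shift_cov:
  assumes "u \<ge> 0" "q \<ge> 0" "s \<ge> 0"
  shows "expectation (\<lambda>\<omega>. (W (u + q) \<omega> - W u \<omega>) * (W (u + s) \<omega> - W u \<omega>)) = expectation (\<lambda>\<omega>. W q \<omega> * W s \<omega>)"
proof -
  have "expectation (\<lambda>\<omega>. (W (u + q) \<omega> - W u \<omega>) * (W (u + s) \<omega> - W u \<omega>))
    = (fbm_cov H (u + q) (u + s) - fbm_cov H u (u + s)) - (fbm_cov H (u + q) u - fbm_cov H u u)"
    using assms by (subst expectation_diff_right) (auto intro!: diff WS simp: expectation_diff_left WS W_cov)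
  also have "\<dots> = fbm_cov H q s" using assms by (simp add: fbm_cov_def field_simps)
  finally show ?thesis using assms by (simp add: W_cov)
qed

lemma L2norm_ou_W: "\<kappa> > 0 \<Longrightarrow> t \<ge> 0 \<Longrightarrow> L2norm (\<lambda>\<omega>. ou \<kappa> (\<lambda>s. W s \<omega>) t) \<le> 1 + 1 / \<kappa>"
  by (intro L2norm_dual' cov_ou_W_bound processD(1)[OF process_ou[OF W]]) auto

text \<open>By \<open>ou_flow\<close>, X (u + t) is the response to the increments after u plus
  values at time u that are damped exponentially in t. The former has the second moment of X t
  because W has stationary increments.\<close>

lemma L2norm_X_Cauchy:
  assumes u: "u \<ge> 0" and t: "t \<ge> 0"
  shows "\<bar>L2norm (X (u + t)) - L2norm (X t)\<bar> \<le> ((\<rho> + 1) * exp (- \<rho> * t) + (\<theta> + 1) * exp (- \<theta> * t)) / \<bar>\<rho> - \<theta>\<bar>"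
proof -
  define W' where "W' s \<omega> = W (u + s) \<omega> - W u \<omega>" for s \<omega>
  have W': "process W'" unfolding process_def W'_def[abs_def]
    using u by (auto intro!: diff WS continuous_intros continuous_on_compose2[OF processD(2)[OF W]])
  define a b where "a = \<rho> / (\<rho> - \<theta>)" and "b = - \<theta> / (\<rho> - \<theta>)"
  define U where "U = (\<lambda>\<omega>. a * ou \<rho> (\<lambda>s. W' s \<omega>) t + b * ou \<theta> (\<lambda>s. W' s \<omega>) t)"
  have US: "U \<in> S" unfolding U_def by (intro add scale processD(1)[OF process_ou[OF W']] t)
  have Xab: "X t \<omega> = a * ou \<rho> (\<lambda>s. W s \<omega>) t + b * ou \<theta> (\<lambda>s. W s \<omega>) t" if "t \<ge> 0" for t \<omega>
    unfolding X_decomp[OF that] a_def b_def by (simp add: diff_divide_distrib)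
  have "expectation (\<lambda>\<omega>. (U \<omega>)\<^sup>2) = expectation (\<lambda>\<omega>. (X t \<omega>)\<^sup>2)"
    unfolding U_def Xab[OF t]
    by (rule second_moment_ou_comb[OF W' W t]) (use W_shift_cov[OF u] in \<open>simp add: W'_def\<close>)
  then have UX: "L2norm U = L2norm (X t)" by (simp add: L2norm_def)
  have XuS: "X (u + t) \<in> S" using u t by (intro XS) auto
  have ouS: "(\<lambda>\<omega>. ou \<kappa> (\<lambda>s. W s \<omega>) u) \<in> S" for \<kappa> by (rule processD(1)[OF process_ou[OF W] u])
  have fl: "ou \<kappa> (\<lambda>s. W s \<omega>) (u + t) = ou \<kappa> (\<lambda>s. W' s \<omega>) t + exp (- \<kappa> * t) * ou \<kappa> (\<lambda>s. W s \<omega>) u" if "\<kappa> > 0" for \<kappa> \<omega>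
    unfolding W'_def using that u t by (intro ou_flow processD(2)[OF W]) auto
  have "X (u + t) \<omega> - U \<omega> = (a * exp (- \<rho> * t)) * ou \<rho> (\<lambda>s. W s \<omega>) u + (b * exp (- \<theta> * t)) * ou \<theta> (\<lambda>s. W s \<omega>) u" for \<omega>
  proof -
    have ut: "u + t \<ge> 0" using u t by simp
    show ?thesis unfolding U_def Xab[OF ut] fl[OF \<theta>] fl[OF \<rho>] by (simp add: algebra_simps)
  qed
  then have "L2norm (\<lambda>\<omega>. X (u + t) \<omega> - U \<omega>)
    = L2norm (\<lambda>\<omega>. (a * exp (- \<rho> * t)) * ou \<rho> (\<lambda>s. W s \<omega>) u + (b * exp (- \<theta> * t)) * ou \<theta> (\<lambda>s. W s \<omega>) u)" by simp
  also have "\<dots> \<le> \<bar>a * exp (- \<rho> * t)\<bar> * L2norm (\<lambda>\<omega>. ou \<rho> (\<lambda>s. W s \<omega>) u) + \<bar>b * exp (- \<theta> * t)\<bar> * L2norm (\<lambda>\<omega>. ou \<theta> (\<lambda>s. W s \<omega>) u)"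
    using L2norm_add_le[OF scale[OF ouS] scale[OF ouS]] by (simp add: L2norm_scale)
  also have "\<dots> \<le> \<bar>a * exp (- \<rho> * t)\<bar> * (1 + 1 / \<rho>) + \<bar>b * exp (- \<theta> * t)\<bar> * (1 + 1 / \<theta>)"
    by (intro add_mono mult_left_mono L2norm_ou_W \<theta> \<rho> u) auto
  also have "\<dots> = ((\<rho> + 1) * exp (- \<rho> * t) + (\<theta> + 1) * exp (- \<theta> * t)) / \<bar>\<rho> - \<theta>\<bar>"
    using \<theta> \<rho> by (simp add: a_def b_def abs_mult add_divide_distrib distrib_left distrib_right)
  finally show ?thesis using L2norm_triangle_diff[OF XuS US] UX by simp
qed

lemma exp_neg_tendsto: "a > 0 \<Longrightarrow> ((\<lambda>t. exp (- a * t)) \<longlongrightarrow> 0) at_top" for a :: real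
  by (rule filterlim_compose[OF exp_at_bot])
    (simp add: filterlim_uminus_at_bot filterlim_tendsto_pos_mult_at_top[OF tendsto_const] filterlim_ident)

text \<open>The value is positive since H < 1, and it is the same at every time t: this is the lower
  bound that keeps X from degenerating.\<close>

lemma second_difference_W:
  assumes t: "t \<ge> 0"
  shows "expectation (\<lambda>\<omega>. (W (t + 2) \<omega> - 2 * W (t + 1) \<omega> + W t \<omega>)\<^sup>2) = 4 - 2 powr (2 * H)"
proof -
  let ?A = "W (t + 2)" and ?B = "W (t + 1)" and ?C = "W t"
  have S3: "?A \<in> S" "?B \<in> S" "?C \<in> S" using t by (auto intro!: WS)
  note i = prod_integrable[OF S3(1) S3(1)] prod_integrable[OF S3(1) S3(2)] prod_integrable[OF S3(1) S3(3)]
    prod_integrable[OF S3(2) S3(2)] prod_integrable[OF S3(2) S3(3)] prod_integrable[OF S3(3) S3(3)]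
  have "expectation (\<lambda>\<omega>. (?A \<omega> - 2 * ?B \<omega> + ?C \<omega>)\<^sup>2)
    = expectation (\<lambda>\<omega>. ?A \<omega> * ?A \<omega> - 4 * (?A \<omega> * ?B \<omega>) + 2 * (?A \<omega> * ?C \<omega>) + 4 * (?B \<omega> * ?B \<omega>) - 4 * (?B \<omega> * ?C \<omega>) + ?C \<omega> * ?C \<omega>)"
    by (intro Bochner_Integration.integral_cong refl) (simp add: power2_eq_square algebra_simps)
  also have "\<dots> = fbm_cov H (t+2) (t+2) - 4 * fbm_cov H (t+2) (t+1) + 2 * fbm_cov H (t+2) t
     + 4 * fbm_cov H (t+1) (t+1) - 4 * fbm_cov H (t+1) t + fbm_cov H t t"
    using t i by (simp add: W_cov)
  also have "\<dots> = 4 - 2 powr (2 * H)" unfolding fbm_cov_def by (simp add: field_simps)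
  finally show ?thesis .
qed

text \<open>If X is small in norm from time t on, so is a second difference of W. Each of the two
  equations is inverted by one unit difference, which replaces the integral from 0 by one over a
  unit interval and costs a factor 2 + \<theta> or 2 + \<rho>.\<close>

lemma X_nondegenerate:
  assumes t: "t \<ge> 0" and e: "e \<ge> 0" and b: "\<And>r. r \<ge> t \<Longrightarrow> L2norm (X r) \<le> e"
  shows "sqrt (4 - 2 powr (2 * H)) \<le> (2 + \<rho>) * (2 + \<theta>) * e"
proof -
  define Z where "Z \<omega> = W (t + 2) \<omega> - 2 * W (t + 1) \<omega> + W t \<omega>" for \<omega>
  have S3: "W (t + 2) \<in> S" "W (t + 1) \<in> S" "W t \<in> S" using t by (auto intro!: WS)
  have Z: "Z \<in> S" unfolding Z_def[abs_def] by (intro add diff scale S3)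
  let ?n = "L2norm Z"
  have n: "?n = sqrt (4 - 2 powr (2 * H))" unfolding L2norm_def Z_def second_difference_W[OF t] ..
  have xb: "\<bar>covX Z r\<bar> \<le> ?n * e" if "r \<ge> t" for r
  proof -
    have "\<bar>covX Z r\<bar> \<le> ?n * L2norm (X r)" unfolding covX_def using that t by (intro Cauchy_Schwarz_L2norm Z XS) auto
    also have "\<dots> \<le> ?n * e" using b[OF that] by (intro mult_left_mono L2norm_nonneg)
    finally show ?thesis .
  qed
  have vb: "\<bar>covV Z (s + 1) - covV Z s\<bar> \<le> ?n * ((2 + \<theta>) * e)" if s: "s \<ge> t" for s
  proof -
    have I: "\<bar>integral {0..s + 1} (covX Z) - integral {0..s} (covX Z)\<bar> \<le> ?n * e * (s + 1 - s)"
      by (rule integral_diff_bound[OF cov_cont(3)[OF Z]]) (use s t xb in auto)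
    have "\<theta> * \<bar>integral {0..s + 1} (covX Z) - integral {0..s} (covX Z)\<bar> \<le> \<theta> * (?n * e)"
      using I \<theta> by (intro mult_left_mono) auto
    then have I': "\<bar>\<theta> * (integral {0..s + 1} (covX Z) - integral {0..s} (covX Z))\<bar> \<le> \<theta> * (?n * e)"
      using \<theta> by (simp add: abs_mult)
    have "covV Z (s + 1) - covV Z s = covX Z (s + 1) - covX Z s + \<theta> * (integral {0..s + 1} (covX Z) - integral {0..s} (covX Z))"
      using covX_eq[OF Z, of "s + 1"] covX_eq[OF Z, of s] s t by (simp add: algebra_simps)
    then have "\<bar>covV Z (s + 1) - covV Z s\<bar> \<le> ?n * e + ?n * e + \<theta> * (?n * e)"
      using I' xb[of "s + 1"] xb[of s] s by linarith
    then show ?thesis by (simp add: algebra_simps)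
  qed
  \<comment> \<open>The integral of covV over the unit interval after s; its change over a unit of
    time is controlled by the unit increments of covV in \<open>vb\<close>.\<close>
  define P where "P s = integral {0..s + 1} (covV Z) - integral {0..s} (covV Z)" for s
  have Pb: "\<bar>P (t + 1) - P t\<bar> \<le> ?n * ((2 + \<theta>) * e) * (t + 1) - ?n * ((2 + \<theta>) * e) * t"
  proof (rule abs_diff_le_deriv)
    note c = integral_continuous[OF cov_cont(2)[OF Z]]
    show "continuous_on {t..t + 1} P" unfolding P_def
      by (intro continuous_intros continuous_on_compose2[OF c] continuous_on_subset[OF c]) (use t in auto)
    fix s assume s: "t < s" "s < t + 1"
    note d = deriv_within_at[OF integral_deriv_within[OF cov_cont(2)[OF Z]]]
    have d1: "((\<lambda>s. integral {0..s} (covV Z)) has_real_derivative covV Z (s + 1)) (at (s + 1))"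
      using s t by (intro d) auto
    have "((\<lambda>s. integral {0..s + 1} (covV Z)) has_real_derivative covV Z (s + 1)) (at s)"
      using DERIV_shift[of "\<lambda>s. integral {0..s} (covV Z)" _ s 1] d1 by simp
    then show "(P has_real_derivative (covV Z (s + 1) - covV Z s)) (at s)"
      unfolding P_def using s t by (intro DERIV_diff d) auto
    show "((\<lambda>s. ?n * ((2 + \<theta>) * e) * s) has_real_derivative ?n * ((2 + \<theta>) * e)) (at s)"
      by (auto intro!: derivative_eq_intros)
    show "\<bar>covV Z (s + 1) - covV Z s\<bar> \<le> ?n * ((2 + \<theta>) * e)" using vb s by simp
  qed (intro continuous_intros | simp)+
  then have "\<rho> * \<bar>P (t + 1) - P t\<bar> \<le> \<rho> * (?n * ((2 + \<theta>) * e))" using \<rho> by (intro mult_left_mono) (auto simp: algebra_simps)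
  then have Pb': "\<bar>\<rho> * (P (t + 1) - P t)\<bar> \<le> \<rho> * (?n * ((2 + \<theta>) * e))" using \<rho> by (simp add: abs_mult)
  have "covW Z (t + 2) - 2 * covW Z (t + 1) + covW Z t = (covV Z (t + 1 + 1) - covV Z (t + 1)) - (covV Z (t + 1) - covV Z t) + \<rho> * (P (t + 1) - P t)"
    using covV_eq[OF Z, of "t + 2"] covV_eq[OF Z, of "t + 1"] covV_eq[OF Z, of t] t by (simp add: P_def algebra_simps)
  then have w: "\<bar>covW Z (t + 2) - 2 * covW Z (t + 1) + covW Z t\<bar> \<le> ?n * ((2 + \<theta>) * e) + ?n * ((2 + \<theta>) * e) + \<rho> * (?n * ((2 + \<theta>) * e))"
  proof -
    have v1: "\<bar>covV Z (t + 1 + 1) - covV Z (t + 1)\<bar> \<le> ?n * ((2 + \<theta>) * e)" by (rule vb) simp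
    have v2: "\<bar>covV Z (t + 1) - covV Z t\<bar> \<le> ?n * ((2 + \<theta>) * e)" by (rule vb) simp
    assume "covW Z (t + 2) - 2 * covW Z (t + 1) + covW Z t = (covV Z (t + 1 + 1) - covV Z (t + 1)) - (covV Z (t + 1) - covV Z t) + \<rho> * (P (t + 1) - P t)"
    then show ?thesis using v1 v2 Pb' by linarith
  qed
  have "expectation (\<lambda>\<omega>. Z \<omega> * Z \<omega>) = expectation (\<lambda>\<omega>. Z \<omega> * W (t + 2) \<omega> - 2 * (Z \<omega> * W (t + 1) \<omega>) + Z \<omega> * W t \<omega>)"
    by (intro Bochner_Integration.integral_cong refl) (simp add: Z_def algebra_simps)
  also have "\<dots> = covW Z (t + 2) - 2 * covW Z (t + 1) + covW Z t"
    unfolding covW_def using prod_integrable[OF Z] S3 by simp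
  finally have "expectation (\<lambda>\<omega>. Z \<omega> * Z \<omega>) \<le> ?n * ((2 + \<rho>) * (2 + \<theta>) * e)"
    using w by (simp add: algebra_simps)
  then have "?n \<le> (2 + \<rho>) * (2 + \<theta>) * e" using \<theta> \<rho> e by (intro L2norm_leI) auto
  then show ?thesis unfolding n .
qed

lemma second_moment_X_limit:
  "\<exists>\<eta>>0. ((\<lambda>t. expectation (\<lambda>\<omega>. (X t \<omega>)\<^sup>2)) \<longlongrightarrow> \<eta>) at_top"
proof -
  let ?e = "\<lambda>t. ((\<rho> + 1) * exp (- \<rho> * t) + (\<theta> + 1) * exp (- \<theta> * t)) / \<bar>\<rho> - \<theta>\<bar>"
  have "(?e \<longlongrightarrow> ((\<rho> + 1) * 0 + (\<theta> + 1) * 0) / \<bar>\<rho> - \<theta>\<bar>) at_top"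
    using \<theta>\<rho> by (intro tendsto_intros exp_neg_tendsto \<theta> \<rho>) auto
  then have e: "(?e \<longlongrightarrow> 0) at_top" by simp
  obtain L where L: "((\<lambda>t. L2norm (X t)) \<longlongrightarrow> L) at_top"
    using uniform_Cauchy_limit_at_top[OF L2norm_X_Cauchy e] by auto
  have L0: "L \<ge> 0" by (rule tendsto_lowerbound[OF L]) (auto simp: L2norm_nonneg)
  have "L \<noteq> 0"
  proof
    assume l: "L = 0"
    define c where "c = sqrt (4 - 2 powr (2 * H))"
    have "2 powr (2 * H) < 2 powr 2" using H by (intro powr_less_mono) auto
    then have c: "c > 0" by (simp add: c_def)
    \<comment> \<open>Half of the smallest value that \<open>X_nondegenerate\<close>
      permits.\<close>
    define e where "e = c / (2 * ((2 + \<rho>) * (2 + \<theta>)))"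
    have e: "e > 0" using c \<theta> \<rho> by (simp add: e_def)
    have "eventually (\<lambda>t. L2norm (X t) < e) at_top" using L e l by (intro order_tendstoD) auto
    then obtain t0 where t0: "\<And>t. t \<ge> t0 \<Longrightarrow> L2norm (X t) < e" unfolding eventually_at_top_linorder by blast
    have "c \<le> (2 + \<rho>) * (2 + \<theta>) * e"
      unfolding c_def using e t0 by (intro X_nondegenerate[of "max 0 t0"]) (auto intro: less_imp_le)
    also have "\<dots> = c / 2" using \<theta> \<rho> by (simp add: e_def)
    finally show False using c by simp
  qed
  then have "L\<^sup>2 > 0" by simp
  moreover have "((\<lambda>t. expectation (\<lambda>\<omega>. (X t \<omega>)\<^sup>2)) \<longlongrightarrow> L\<^sup>2) at_top"
    unfolding L2norm_square[symmetric] by (intro tendsto_intros L)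
  ultimately show ?thesis by blast
qed

end

section \<open>The quadratic functional behind the Skorohod integral\<close>

lemma integral_square_le:
  fixes f :: "real \<Rightarrow> real"
  assumes T: "T \<ge> 0" and f: "continuous_on {0..T} f"
  shows "(integral {0..T} f)\<^sup>2 \<le> T * integral {0..T} (\<lambda>t. (f t)\<^sup>2)"
proof (cases "T = 0")
  case False
  define a where "a = integral {0..T} f / T"
  have i: "f integrable_on {0..T}" "(\<lambda>t. (f t)\<^sup>2) integrable_on {0..T}"
    by (intro integrable_continuous_real continuous_intros f)+
  have "0 \<le> integral {0..T} (\<lambda>t. (f t - a)\<^sup>2)"
    by (intro Henstock_Kurzweil_Integration.integral_nonneg integrable_continuous_real continuous_intros f) auto
  also have "integral {0..T} (\<lambda>t. (f t - a)\<^sup>2) = integral {0..T} (\<lambda>t. (f t)\<^sup>2 - (2 * a) * f t + a\<^sup>2)"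
    by (intro integral_cong) (simp add: power2_diff)
  also have "\<dots> = integral {0..T} (\<lambda>t. (f t)\<^sup>2) - (2 * a) * integral {0..T} f + a\<^sup>2 * T"
    using i T by (subst Henstock_Kurzweil_Integration.integral_add, auto intro!: integrable_diff integrable_on_mult_right simp del: mult.assoc)
      (subst Henstock_Kurzweil_Integration.integral_diff, auto intro!: integrable_on_mult_right)
  also have "\<dots> = integral {0..T} (\<lambda>t. (f t)\<^sup>2) - (integral {0..T} f)\<^sup>2 / T"
    using False by (simp add: a_def power2_eq_square)
  finally show ?thesis using False T by (simp add: field_simps)
qed simp

context fbm_ou
begin

text \<open>The time integral of X (\<open>Sig_integral\<close>). Read off from V = X + \<theta>
  \<integral>X, it lies in \<open>S\<close> and its norm stays bounded in time.\<close>

definition Sig :: "real \<Rightarrow> 'a \<Rightarrow> real" where "Sig t \<omega> = (V t \<omega> - X t \<omega>) / \<theta>"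

lemma SigS: "t \<ge> 0 \<Longrightarrow> Sig t \<in> S"
  using scale[OF diff[OF VS XS], of t t "1 / \<theta>"] by (simp add: Sig_def[abs_def])

lemma Sig_integral: "t \<ge> 0 \<Longrightarrow> Sig t \<omega> = integral {0..t} (\<lambda>s. X s \<omega>)"
  using ou_eq[OF processD(2)[OF process_V], of t \<theta> \<omega>] \<theta> by (simp add: Sig_def X_def[abs_def] field_simps)

lemma L2norm_Sig:
  assumes t: "t \<ge> 0"
  shows "L2norm (Sig t) \<le> (cV + cX) / \<theta>"
proof -
  have "L2norm (Sig t) = L2norm (\<lambda>\<omega>. (1 / \<theta>) * (V t \<omega> + (-1) * X t \<omega>))" by (simp add: Sig_def[abs_def])
  also have "\<dots> = 1 / \<theta> * L2norm (\<lambda>\<omega>. V t \<omega> + (-1) * X t \<omega>)" unfolding L2norm_scale using \<theta> by simp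
  also have "\<dots> \<le> 1 / \<theta> * (L2norm (V t) + L2norm (\<lambda>\<omega>. (-1) * X t \<omega>))"
    using \<theta> by (intro mult_left_mono L2norm_add_le VS scale XS t) auto
  also have "\<dots> \<le> 1 / \<theta> * (cV + cX)"
    unfolding L2norm_scale using \<theta> L2norm_V[OF t] L2norm_X[OF t] by (intro mult_left_mono) auto
  finally show ?thesis by simp
qed

text \<open>The integral of X V is eliminated because X times \<integral>X is the derivative of
  (\<integral>X)^2 / 2. What is left are squares of elements of \<open>S\<close> and a time integral
  of such squares, for which \<open>iexp_mean\<close> is explicit; the last summand has bounded
  mean.\<close>

definition chaos :: "real \<Rightarrow> 'a \<Rightarrow> real" where
  "chaos T \<omega> = (X T \<omega>)\<^sup>2 / 2 + (\<theta> + \<rho>) * integral {0..T} (\<lambda>t. (X t \<omega>)\<^sup>2) + \<rho> * \<theta> / 2 * (Sig T \<omega>)\<^sup>2"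

definition skor :: "real \<Rightarrow> 'a \<Rightarrow> real" where "skor T \<omega> = chaos T \<omega> - expectation (chaos T)"

lemma X_cont: "continuous_on {0..} (\<lambda>t. X t \<omega>)" by (rule processD(2)[OF process_X])
lemma V_cont: "continuous_on {0..} (\<lambda>t. V t \<omega>)" by (rule processD(2)[OF process_V])

text \<open>Pathwise, \<open>\<theta> \<integral>X\<^sup>2 + \<rho> \<integral>XV\<close> is rewritten with \<open>V = X + \<theta> \<integral>X\<close>.\<close>

lemma chaos_eq:
  assumes T: "T \<ge> 0"
  shows "chaos T \<omega> = (X T \<omega>)\<^sup>2 / 2 + \<theta> * integral {0..T} (\<lambda>t. (X t \<omega>)\<^sup>2) + \<rho> * integral {0..T} (\<lambda>t. X t \<omega> * V t \<omega>)"
proof -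
  have d: "((\<lambda>t. (integral {0..t} (\<lambda>s. X s \<omega>))\<^sup>2 / 2) has_real_derivative X t \<omega> * Sig t \<omega>) (at t within {0..})" if "t \<ge> 0" for t
    unfolding Sig_integral[OF that]
    by (rule derivative_eq_intros integral_deriv_within[OF X_cont that] refl | simp)+
  have i1: "integral {0..T} (\<lambda>t. X t \<omega> * Sig t \<omega>) = (Sig T \<omega>)\<^sup>2 / 2"
    using FTC_halfline[OF d T] T by (simp add: Sig_integral)
  have "integral {0..T} (\<lambda>t. X t \<omega> * V t \<omega>) = integral {0..T} (\<lambda>t. (X t \<omega>)\<^sup>2 + \<theta> * (X t \<omega> * Sig t \<omega>))"
    using \<theta> by (intro integral_cong) (simp add: Sig_def field_simps power2_eq_square)
  also have "\<dots> = integral {0..T} (\<lambda>t. (X t \<omega>)\<^sup>2) + integral {0..T} (\<lambda>t. \<theta> * (X t \<omega> * Sig t \<omega>))"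
    unfolding Sig_def using \<theta>
    by (intro Henstock_Kurzweil_Integration.integral_add integrable_continuous_real continuous_intros
        continuous_on_subset[OF X_cont] continuous_on_subset[OF V_cont]) auto
  also have "integral {0..T} (\<lambda>t. \<theta> * (X t \<omega> * Sig t \<omega>)) = \<theta> * ((Sig T \<omega>)\<^sup>2 / 2)"
    using i1 by simp
  finally show ?thesis by (simp add: chaos_def algebra_simps)
qed

lemma X_sq_le: "t \<ge> 0 \<Longrightarrow> expectation (\<lambda>\<omega>. (X t \<omega>)\<^sup>2) \<le> cX\<^sup>2"
  using L2norm_X[of t] L2norm_nonneg cX power_mono[of "L2norm (X t)" cX 2] by (simp add: L2norm_square)

lemma X_meas: "t \<ge> 0 \<Longrightarrow> X t \<in> borel_measurable M" using meas XS by blast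

lemma integral_X_sq:
  assumes "T \<ge> 0"
  shows "integrable M (\<lambda>\<omega>. integral {0..T} (\<lambda>t. (X t \<omega>)\<^sup>2))"
    "(\<lambda>t. expectation (\<lambda>\<omega>. (X t \<omega>)\<^sup>2)) integrable_on {0..T}"
    "expectation (\<lambda>\<omega>. integral {0..T} (\<lambda>t. (X t \<omega>)\<^sup>2)) = integral {0..T} (\<lambda>t. expectation (\<lambda>\<omega>. (X t \<omega>)\<^sup>2))"
proof -
  have c: "continuous_on {0..} (\<lambda>t. (X t \<omega>)\<^sup>2)" for \<omega> by (intro continuous_intros X_cont)
  have m: "(\<lambda>\<omega>. (X t \<omega>)\<^sup>2) \<in> borel_measurable M" if "t \<ge> 0" for t using X_meas[OF that] by measurable
  have b: "expectation (\<lambda>\<omega>. norm ((X t \<omega>)\<^sup>2)) \<le> cX\<^sup>2" if "0 \<le> t" "t \<le> T" for t using X_sq_le[OF that(1)] by simp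
  note r = expectation_integral_process[where Y="\<lambda>t \<omega>. (X t \<omega>)\<^sup>2" and T=T, OF c m square_integrable[OF XS] b]
  show "integrable M (\<lambda>\<omega>. integral {0..T} (\<lambda>t. (X t \<omega>)\<^sup>2))"
    "(\<lambda>t. expectation (\<lambda>\<omega>. (X t \<omega>)\<^sup>2)) integrable_on {0..T}"
    "expectation (\<lambda>\<omega>. integral {0..T} (\<lambda>t. (X t \<omega>)\<^sup>2)) = integral {0..T} (\<lambda>t. expectation (\<lambda>\<omega>. (X t \<omega>)\<^sup>2))"
    using r by auto
qed

text \<open>Fubini moves the weight exp (i Z) inside the time integral, where
  \<open>iexp_mean_product\<close> applies at each time.\<close>

lemma iexp_mean_integral_X_sq:
  assumes T: "T \<ge> 0" and Z: "Z \<in> S"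
  shows "iexp_mean Z (\<lambda>\<omega>. integral {0..T} (\<lambda>t. (X t \<omega>)\<^sup>2))
    = of_real (expectation (\<lambda>\<omega>. integral {0..T} (\<lambda>t. (X t \<omega>)\<^sup>2)) - integral {0..T} (\<lambda>t. (covX Z t)\<^sup>2)) * iexp_mean Z (\<lambda>_. 1)"
proof -
  note [measurable] = meas[OF Z]
  define Y where "Y t \<omega> = iexp (Z \<omega>) * complex_of_real ((X t \<omega>)\<^sup>2)" for t \<omega>
  have c: "continuous_on {0..} (\<lambda>t. Y t \<omega>)" for \<omega> unfolding Y_def by (intro continuous_intros X_cont)
  have m: "Y t \<in> borel_measurable M" if "t \<ge> 0" for t
    unfolding Y_def[abs_def] using X_meas[OF that] by measurable
  have i: "integrable M (Y t)" if "0 \<le> t" "t \<le> T" for t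
    unfolding Y_def[abs_def] using square_integrable[OF XS] that by (intro iexp_integrable) auto
  have b: "expectation (\<lambda>\<omega>. norm (Y t \<omega>)) \<le> cX\<^sup>2" if "0 \<le> t" "t \<le> T" for t
    using X_sq_le[OF that(1)] by (simp add: Y_def norm_mult norm_power)
  note r = expectation_integral_process[where Y=Y and T=T, OF c m i b]
  have "iexp_mean Z (\<lambda>\<omega>. integral {0..T} (\<lambda>t. (X t \<omega>)\<^sup>2)) = expectation (\<lambda>\<omega>. integral {0..T} (\<lambda>t. Y t \<omega>))"
    unfolding iexp_mean_def
  proof (intro Bochner_Integration.integral_cong refl)
    fix \<omega>
    have "(\<lambda>t. (X t \<omega>)\<^sup>2) integrable_on {0..T}"
      by (intro integrable_continuous_real continuous_intros continuous_on_subset[OF X_cont]) auto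
    then have "((\<lambda>t. iexp (Z \<omega>) * complex_of_real ((X t \<omega>)\<^sup>2)) has_integral iexp (Z \<omega>) * complex_of_real (integral {0..T} (\<lambda>t. (X t \<omega>)\<^sup>2))) {0..T}"
      by (intro has_integral_mult_right has_integral_of_real integrable_integral)
    then show "iexp (Z \<omega>) * complex_of_real (integral {0..T} (\<lambda>t. (X t \<omega>)\<^sup>2)) = integral {0..T} (\<lambda>t. Y t \<omega>)"
      unfolding Y_def by (rule integral_unique[symmetric])
  qed
  also have "\<dots> = integral {0..T} (\<lambda>t. expectation (Y t))" using r by simp
  also have "\<dots> = integral {0..T} (\<lambda>t. complex_of_real (expectation (\<lambda>\<omega>. (X t \<omega>)\<^sup>2) - (covX Z t)\<^sup>2) * iexp_mean Z (\<lambda>_. 1))"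
  proof (rule integral_cong)
    fix t assume t: "t \<in> {0..T}"
    have "expectation (Y t) = iexp_mean Z (\<lambda>\<omega>. X t \<omega> * X t \<omega>)" unfolding iexp_mean_def Y_def power2_eq_square ..
    also have "\<dots> = of_real (expectation (\<lambda>\<omega>. X t \<omega> * X t \<omega>) - expectation (\<lambda>\<omega>. X t \<omega> * Z \<omega>) * expectation (\<lambda>\<omega>. X t \<omega> * Z \<omega>)) * iexp_mean Z (\<lambda>_. 1)"
      using t by (intro iexp_mean_product XS Z) auto
    finally show "expectation (Y t) = complex_of_real (expectation (\<lambda>\<omega>. (X t \<omega>)\<^sup>2) - (covX Z t)\<^sup>2) * iexp_mean Z (\<lambda>_. 1)"
      by (simp add: covX_def power2_eq_square mult.commute)
  qed
  also have "\<dots> = of_real (integral {0..T} (\<lambda>t. expectation (\<lambda>\<omega>. (X t \<omega>)\<^sup>2)) - integral {0..T} (\<lambda>t. (covX Z t)\<^sup>2)) * iexp_mean Z (\<lambda>_. 1)"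
  proof (rule integral_unique)
    have "(\<lambda>t. (covX Z t)\<^sup>2) integrable_on {0..T}"
      by (intro integrable_continuous_real continuous_intros continuous_on_subset[OF cov_cont(3)[OF Z]]) auto
    then show "((\<lambda>t. complex_of_real (expectation (\<lambda>\<omega>. (X t \<omega>)\<^sup>2) - (covX Z t)\<^sup>2) * iexp_mean Z (\<lambda>_. 1)) has_integral
        of_real (integral {0..T} (\<lambda>t. expectation (\<lambda>\<omega>. (X t \<omega>)\<^sup>2)) - integral {0..T} (\<lambda>t. (covX Z t)\<^sup>2)) * iexp_mean Z (\<lambda>_. 1)) {0..T}"
      using integral_X_sq(2)[OF T]
      by (intro has_integral_mult_left has_integral_of_real has_integral_diff integrable_integral)
  qed
  finally show ?thesis unfolding integral_X_sq(3)[OF T] .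
qed

lemma chaos_integrable:
  assumes T: "T \<ge> 0"
  shows "integrable M (chaos T)"
  unfolding chaos_def[abs_def] using square_integrable[OF XS[OF T]] square_integrable[OF SigS[OF T]] integral_X_sq(1)[OF T]
  by simp

lemma expectation_chaos:
  assumes T: "T \<ge> 0"
  shows "expectation (chaos T) = expectation (\<lambda>\<omega>. (X T \<omega>)\<^sup>2) / 2
     + (\<theta> + \<rho>) * integral {0..T} (\<lambda>t. expectation (\<lambda>\<omega>. (X t \<omega>)\<^sup>2)) + \<rho> * \<theta> / 2 * expectation (\<lambda>\<omega>. (Sig T \<omega>)\<^sup>2)"
  unfolding chaos_def[abs_def] integral_X_sq(3)[OF T, symmetric]
  using square_integrable[OF XS[OF T]] square_integrable[OF SigS[OF T]] integral_X_sq(1)[OF T]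
  by simp

text \<open>The chain rule is applied to covariances. Under the weight exp (i Z),
  \<open>skor T\<close> acts as minus \<open>A T\<close>, the same quadratic expression in the
  covariances with \<open>Z\<close>, since centring removes the means. Their driver covW Z has the
  derivative \<open>r\<close>, so A' = r covX Z by calculus, and \<open>A T\<close> is the
  covariance of \<open>Z\<close> with the integral of r X.\<close>

lemma iexp_mean_skor:
  assumes T: "T \<ge> 0" and Z: "Z \<in> S" and r: "continuous_on {0..} r"
    and d: "\<And>t. t \<ge> 0 \<Longrightarrow> (covW Z has_real_derivative r t) (at t within {0..})"
  shows "iexp_mean Z (skor T) = \<i> * iexp_mean Z (\<lambda>\<omega>. integral {0..T} (\<lambda>t. r t * X t \<omega>))"
proof -
  let ?p = "iexp_mean Z (\<lambda>_. 1)"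
  let ?x = "covX Z" and ?v = "covV Z"
  define Ix where "Ix t = integral {0..t} ?x" for t
  define Iv where "Iv t = integral {0..t} ?v" for t
  \<comment> \<open>covX Z is written out through the two equations in the first summand, which
    makes every ingredient differentiable.\<close>
  define A where "A t = (covW Z t - \<rho> * Iv t - \<theta> * Ix t)\<^sup>2 / 2 + (\<theta> + \<rho>) * integral {0..t} (\<lambda>t. (?x t)\<^sup>2) + \<rho> * \<theta> / 2 * (Ix t)\<^sup>2" for t
  have xe: "?x t = covW Z t - \<rho> * Iv t - \<theta> * Ix t" and ve: "?v t = ?x t + \<theta> * Ix t" if "t \<ge> 0" for t
    using covX_eq[OF Z that] covV_eq[OF Z that] by (simp_all add: Ix_def Iv_def)
  have Ad: "(A has_real_derivative r t * ?x t) (at t within {0..})" if t: "t \<ge> 0" for t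
  proof -
    have d1: "(Ix has_real_derivative ?x t) (at t within {0..})" unfolding Ix_def[abs_def]
      by (rule integral_deriv_within[OF cov_cont(3)[OF Z] t])
    have d2: "(Iv has_real_derivative ?v t) (at t within {0..})" unfolding Iv_def[abs_def]
      by (rule integral_deriv_within[OF cov_cont(2)[OF Z] t])
    have d3: "((\<lambda>t. integral {0..t} (\<lambda>t. (?x t)\<^sup>2)) has_real_derivative (?x t)\<^sup>2) (at t within {0..})"
      by (rule integral_deriv_within[OF _ t]) (intro continuous_intros cov_cont(3)[OF Z])
    show ?thesis unfolding A_def[abs_def]
      apply (rule derivative_eq_intros d1 d2 d3 d[OF t] refl | simp)+
      unfolding xe[OF t, symmetric] ve[OF t]
      apply (simp add: power2_eq_square algebra_simps)
      done
  qed
  have W00: "covW Z 0 = 0" by (simp add: covW_def W0)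
  have FT: "integral {0..T} (\<lambda>t. r t * ?x t) = A T"
    using FTC_halfline[OF Ad T] by (simp add: A_def Ix_def Iv_def W00)
  have SigZ: "expectation (\<lambda>\<omega>. Sig T \<omega> * Z \<omega>) = Ix T"
  proof -
    have "expectation (\<lambda>\<omega>. Sig T \<omega> * Z \<omega>) = expectation (\<lambda>\<omega>. (1 / \<theta>) * (Z \<omega> * (V T \<omega> - X T \<omega>)))"
      by (intro Bochner_Integration.integral_cong refl) (simp add: Sig_def)
    also have "\<dots> = (1 / \<theta>) * (?v T - ?x T)"
      using expectation_diff_right[OF Z VS[OF T] XS[OF T]] by (simp add: covV_def covX_def)
    also have "\<dots> = Ix T" using ve[OF T] \<theta> by simp
    finally show ?thesis .
  qed
  have XZ: "expectation (\<lambda>\<omega>. X T \<omega> * Z \<omega>) = ?x T" by (simp add: covX_def mult.commute)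
  have AT: "A T = (?x T)\<^sup>2 / 2 + (\<theta> + \<rho>) * integral {0..T} (\<lambda>t. (?x t)\<^sup>2) + \<rho> * \<theta> / 2 * (Ix T)\<^sup>2"
    unfolding A_def xe[OF T] ..
  have mZ: "Z \<in> borel_measurable M" by (rule meas[OF Z])
  have e: "skor T = (\<lambda>\<omega>. (1/2) * (X T \<omega> * X T \<omega>) + ((\<theta> + \<rho>) * integral {0..T} (\<lambda>t. (X t \<omega>)\<^sup>2)
      + (\<rho> * \<theta> / 2 * (Sig T \<omega> * Sig T \<omega>) + (- expectation (chaos T)) * 1)))"
    by (auto simp: skor_def chaos_def fun_eq_iff power2_eq_square)
  have i1: "integrable M (\<lambda>\<omega>. X T \<omega> * X T \<omega>)" "integrable M (\<lambda>\<omega>. Sig T \<omega> * Sig T \<omega>)"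
    by (intro prod_integrable XS SigS T)+
  have "iexp_mean Z (skor T) = of_real (1/2) * iexp_mean Z (\<lambda>\<omega>. X T \<omega> * X T \<omega>)
     + (of_real (\<theta> + \<rho>) * iexp_mean Z (\<lambda>\<omega>. integral {0..T} (\<lambda>t. (X t \<omega>)\<^sup>2))
     + (of_real (\<rho> * \<theta> / 2) * iexp_mean Z (\<lambda>\<omega>. Sig T \<omega> * Sig T \<omega>) + of_real (- expectation (chaos T)) * ?p))"
  proof -
    have a1: "iexp_mean Z (skor T) = iexp_mean Z (\<lambda>\<omega>. (1/2) * (X T \<omega> * X T \<omega>))
      + iexp_mean Z (\<lambda>\<omega>. (\<theta> + \<rho>) * integral {0..T} (\<lambda>t. (X t \<omega>)\<^sup>2) + (\<rho> * \<theta> / 2 * (Sig T \<omega> * Sig T \<omega>) + (- expectation (chaos T)) * 1))"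
      unfolding e by (rule iexp_mean_add[OF mZ]) (use i1 integral_X_sq(1)[OF T] in auto)
    have a2: "iexp_mean Z (\<lambda>\<omega>. (\<theta> + \<rho>) * integral {0..T} (\<lambda>t. (X t \<omega>)\<^sup>2) + (\<rho> * \<theta> / 2 * (Sig T \<omega> * Sig T \<omega>) + (- expectation (chaos T)) * 1))
      = iexp_mean Z (\<lambda>\<omega>. (\<theta> + \<rho>) * integral {0..T} (\<lambda>t. (X t \<omega>)\<^sup>2)) + iexp_mean Z (\<lambda>\<omega>. \<rho> * \<theta> / 2 * (Sig T \<omega> * Sig T \<omega>) + (- expectation (chaos T)) * 1)"
      by (rule iexp_mean_add[OF mZ]) (use i1 integral_X_sq(1)[OF T] in auto)
    have a3: "iexp_mean Z (\<lambda>\<omega>. \<rho> * \<theta> / 2 * (Sig T \<omega> * Sig T \<omega>) + (- expectation (chaos T)) * 1)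
      = iexp_mean Z (\<lambda>\<omega>. \<rho> * \<theta> / 2 * (Sig T \<omega> * Sig T \<omega>)) + iexp_mean Z (\<lambda>\<omega>. (- expectation (chaos T)) * 1)"
      by (rule iexp_mean_add[OF mZ]) (use i1 in auto)
    show ?thesis unfolding a1 a2 a3 iexp_mean_scale ..
  qed
  also have "\<dots> = - of_real (A T) * ?p"
    unfolding iexp_mean_product[OF XS[OF T] XS[OF T] Z] iexp_mean_product[OF SigS[OF T] SigS[OF T] Z]
      iexp_mean_integral_X_sq[OF T Z] expectation_chaos[OF T] integral_X_sq(3)[OF T] SigZ XZ AT
    unfolding power2_eq_square by (simp add: algebra_simps)
  finally have 1: "iexp_mean Z (skor T) = - of_real (A T) * ?p" .
  have rT: "continuous_on {0..T} r" by (rule continuous_on_subset[OF r]) auto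
  have "expectation (\<lambda>\<omega>. integral {0..T} (\<lambda>t. r t * X t \<omega>) * Z \<omega>) = A T"
    using process_integral(2)[OF process_X T rT Z] FT by (simp add: mult.commute covX_def)
  then have "iexp_mean Z (\<lambda>\<omega>. integral {0..T} (\<lambda>t. r t * X t \<omega>)) = \<i> * of_real (A T) * ?p"
    using iexp_mean_linear[OF process_integral(1)[OF process_X T rT] Z] by simp
  then show ?thesis using 1 by (simp add: mult.assoc[symmetric])
qed

text \<open>Cauchy-Schwarz in time reduces the square of the integral of X^2 to fourth moments,
  which are bounded uniformly in time.\<close>

lemma skor_square_integrable:
  assumes T: "T \<ge> 0"
  shows "skor T \<in> borel_measurable M" "integrable M (\<lambda>\<omega>. (skor T \<omega>)\<^sup>2)"
proof -
  have m[measurable]: "chaos T \<in> borel_measurable M" using chaos_integrable[OF T] by auto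
  show sm: "skor T \<in> borel_measurable M" unfolding skor_def[abs_def] by measurable
  have [measurable]: "X T \<in> borel_measurable M" "Sig T \<in> borel_measurable M" using meas XS SigS T by auto
  let ?I = "\<lambda>\<omega>. integral {0..T} (\<lambda>t. (X t \<omega>)\<^sup>2)"
  have Im[measurable]: "?I \<in> borel_measurable M" using integral_X_sq(1)[OF T] by auto
  have X4: "integrable M (\<lambda>\<omega>. (X t \<omega>) ^ 4)" "expectation (\<lambda>\<omega>. (X t \<omega>) ^ 4) \<le> 3 * (cX\<^sup>2)\<^sup>2" if "t \<ge> 0" for t
  proof -
    show "integrable M (\<lambda>\<omega>. (X t \<omega>) ^ 4)" using gaussian_rv_moments(1)[OF gaussian[OF XS[OF that]]] .
    have "expectation (\<lambda>\<omega>. (X t \<omega>) ^ 4) = 3 * (expectation (\<lambda>\<omega>. (X t \<omega>)\<^sup>2))\<^sup>2"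
      using gaussian_rv_moments(2)[OF gaussian[OF XS[OF that]], of 2] by (simp add: fact_numeral)
    also have "\<dots> \<le> 3 * (cX\<^sup>2)\<^sup>2" using X_sq_le[OF that] by (intro mult_left_mono power_mono) auto
    finally show "expectation (\<lambda>\<omega>. (X t \<omega>) ^ 4) \<le> 3 * (cX\<^sup>2)\<^sup>2" .
  qed
  have I4: "integrable M (\<lambda>\<omega>. integral {0..T} (\<lambda>t. (X t \<omega>) ^ 4))"
  proof (rule expectation_integral_process(1)[where Y="\<lambda>t \<omega>. (X t \<omega>) ^ 4" and C="3 * (cX\<^sup>2)\<^sup>2"])
    show "continuous_on {0..} (\<lambda>t. (X t \<omega>) ^ 4)" for \<omega> by (intro continuous_intros X_cont)
    show "(\<lambda>\<omega>. (X t \<omega>) ^ 4) \<in> borel_measurable M" if "t \<ge> 0" for t using X_meas[OF that] by measurable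
    show "expectation (\<lambda>\<omega>. norm ((X t \<omega>) ^ 4)) \<le> 3 * (cX\<^sup>2)\<^sup>2" if "0 \<le> t" for t using X4[OF that] by (simp add: norm_power)
  qed (use X4 in auto)
  have i2: "integrable M (\<lambda>\<omega>. (?I \<omega>)\<^sup>2)"
  proof (rule Bochner_Integration.integrable_bound[of _ "\<lambda>\<omega>. T * integral {0..T} (\<lambda>t. (X t \<omega>) ^ 4)"])
    show "integrable M (\<lambda>\<omega>. T * integral {0..T} (\<lambda>t. (X t \<omega>) ^ 4))" using I4 by simp
    have "(?I \<omega>)\<^sup>2 \<le> T * integral {0..T} (\<lambda>t. (X t \<omega>) ^ 4)" for \<omega>
    proof -
      have "(?I \<omega>)\<^sup>2 \<le> T * integral {0..T} (\<lambda>t. ((X t \<omega>)\<^sup>2)\<^sup>2)"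
        by (intro integral_square_le T continuous_intros continuous_on_subset[OF X_cont]) auto
      then show ?thesis by (simp add: power_mult[symmetric])
    qed
    note le = this
    have "norm ((?I \<omega>)\<^sup>2) \<le> norm (T * integral {0..T} (\<lambda>t. (X t \<omega>) ^ 4))" for \<omega>
    proof -
      have "norm ((?I \<omega>)\<^sup>2) = (?I \<omega>)\<^sup>2" by simp
      also have "\<dots> \<le> T * integral {0..T} (\<lambda>t. (X t \<omega>) ^ 4)" by (rule le)
      also have "\<dots> \<le> norm (T * integral {0..T} (\<lambda>t. (X t \<omega>) ^ 4))" unfolding real_norm_def by (rule abs_ge_self)
      finally show ?thesis .
    qed
    then show "AE \<omega> in M. norm ((?I \<omega>)\<^sup>2) \<le> norm (T * integral {0..T} (\<lambda>t. (X t \<omega>) ^ 4))" by simp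
  qed simp
  have s4: "integrable M (\<lambda>\<omega>. ((Y \<omega>)\<^sup>2)\<^sup>2)" if "Y \<in> S" for Y
    using gaussian_rv_moments(1)[OF gaussian[OF that], of 4] by (simp add: power_mult[symmetric])
  have sI: "integrable M (\<lambda>\<omega>. (c * F \<omega>)\<^sup>2)" if "integrable M (\<lambda>\<omega>. (F \<omega>)\<^sup>2)" for F :: "'a \<Rightarrow> real" and c
    using that by (simp add: power_mult_distrib)
  have "integrable M (\<lambda>\<omega>. (1/2 * (X T \<omega>)\<^sup>2 + ((\<theta> + \<rho>) * ?I \<omega> + (\<rho> * \<theta> / 2 * (Sig T \<omega>)\<^sup>2 + (- expectation (chaos T)))))\<^sup>2)"
    by (intro second_moment_add_le(2) sI s4 XS SigS T i2) measurable
  moreover have "skor T \<omega> = 1/2 * (X T \<omega>)\<^sup>2 + ((\<theta> + \<rho>) * ?I \<omega> + (\<rho> * \<theta> / 2 * (Sig T \<omega>)\<^sup>2 + (- expectation (chaos T))))" for \<omega>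
    by (simp add: skor_def chaos_def)
  ultimately show "integrable M (\<lambda>\<omega>. (skor T \<omega>)\<^sup>2)" by simp
qed

end

section \<open>The divergence operator\<close>

lemma std_normal_iexp_moment:
  "(CLINT u|std_normal_distribution. iexp (u * z)) = of_real (exp (- z\<^sup>2 / 2))"
  "(CLINT u|std_normal_distribution. \<i> * of_real u * iexp (u * z)) = of_real (- z * exp (- z\<^sup>2 / 2))"
proof -
  interpret N: real_distribution std_normal_distribution by (rule real_dist_normal_dist)
  have c: "(CLINT u|std_normal_distribution. iexp (z * u)) = of_real (exp (- z\<^sup>2 / 2))" for z
    using char_std_normal_distribution by (simp add: char_def fun_eq_iff)
  show "(CLINT u|std_normal_distribution. iexp (u * z)) = of_real (exp (- z\<^sup>2 / 2))"
    using c[of z] by (simp add: mult.commute)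
  have i: "integrable std_normal_distribution (\<lambda>u. u :: real)"
    using integrable_std_normal_distribution_moment[of 1] by simp
  have q: "N.iexp_mean (\<lambda>u. z * u) (\<lambda>_. 1) = of_real (exp (- z\<^sup>2 / 2))" for z
    unfolding N.iexp_mean_def using c[of z] by simp
  \<comment> \<open>The second identity is the first one differentiated in \<open>z\<close>; the
    derivative of \<open>f\<close> at 0 is matched with
    \<open>iexp_mean_diff_quotient\<close>.\<close>
  define f where "f t = exp (- (z + t)\<^sup>2 / 2)" for t
  have "DERIV f 0 :> - z * exp (- z\<^sup>2 / 2)"
    unfolding f_def by (auto intro!: derivative_eq_intros)
  note tendsto_of_real[OF DERIV_sequence[OF this], where 'a=complex]
  moreover have "complex_of_real (f t) = N.iexp_mean (\<lambda>u. z * u + t * u) (\<lambda>_. 1)" for t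
    using q[of "z + t"] by (simp add: f_def distrib_right)
  moreover have "complex_of_real (f 0) = N.iexp_mean (\<lambda>u. z * u) (\<lambda>_. 1)" unfolding q by (simp add: f_def)
  ultimately have "(\<lambda>n. of_nat (Suc n) * (N.iexp_mean (\<lambda>u. z * u + inverse (real (Suc n)) * u) (\<lambda>_. 1) - N.iexp_mean (\<lambda>u. z * u) (\<lambda>_. 1)))
      \<longlonglongrightarrow> of_real (- z * exp (- z\<^sup>2 / 2))"
    by (simp del: of_nat_Suc)
  moreover have "(\<lambda>n. of_nat (Suc n) * (N.iexp_mean (\<lambda>u. z * u + inverse (real (Suc n)) * u) (\<lambda>_. 1) - N.iexp_mean (\<lambda>u. z * u) (\<lambda>_. 1)))
      \<longlonglongrightarrow> \<i> * N.iexp_mean (\<lambda>u. z * u) (\<lambda>u. u * 1)"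
  proof (rule N.iexp_mean_diff_quotient[of "\<lambda>u. z * u" "\<lambda>u. u" "\<lambda>_. 1"])
    show "integrable std_normal_distribution (\<lambda>u. u * 1 :: real)" using i by simp
  qed simp_all
  ultimately have "\<i> * N.iexp_mean (\<lambda>u. z * u) (\<lambda>u. u * 1) = of_real (- z * exp (- z\<^sup>2 / 2))"
    by (rule LIMSEQ_unique[rotated])
  moreover have "(CLINT u|std_normal_distribution. \<i> * of_real u * iexp (u * z)) = (CLINT u|std_normal_distribution. \<i> * (iexp (z * u) * of_real (u * 1)))"
    by (intro Bochner_Integration.integral_cong refl) (simp add: mult_ac)
  ultimately show "(CLINT u|std_normal_distribution. \<i> * of_real u * iexp (u * z)) = of_real (- z * exp (- z\<^sup>2 / 2))"
    unfolding N.iexp_mean_def by simp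
qed

lemma std_normal_density_tendsto_0:
  "(std_normal_density \<longlongrightarrow> 0) at_top" "(std_normal_density \<longlongrightarrow> 0) at_bot"
proof -
  have "filterlim (\<lambda>x::real. (1 / 2) * x\<^sup>2) at_top at_top"
    by (rule filterlim_tendsto_pos_mult_at_top[OF tendsto_const]) (auto intro: filterlim_pow_at_top filterlim_ident)
  then have "filterlim (\<lambda>x::real. - (x\<^sup>2 / 2)) at_bot at_top"
    by (simp add: filterlim_uminus_at_bot)
  then have t: "((\<lambda>x::real. (1 / sqrt (2 * pi)) * exp (- (x\<^sup>2 / 2))) \<longlongrightarrow> (1 / sqrt (2 * pi)) * 0) at_top"
    by (intro tendsto_mult_left filterlim_compose[OF exp_at_bot])
  then show 1: "(std_normal_density \<longlongrightarrow> 0) at_top"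
    by (simp add: std_normal_density_def[abs_def])
  have "((\<lambda>x. std_normal_density (- x)) \<longlongrightarrow> 0) at_top" using 1 by (simp add: std_normal_density_def[abs_def])
  then show "(std_normal_density \<longlongrightarrow> 0) at_bot" by (simp add: filterlim_at_bot_mirror)
qed

lemma std_normal_density_deriv:
  "(std_normal_density has_real_derivative - z * std_normal_density z) (at z)"
proof -
  have "((\<lambda>x. c * exp (- x\<^sup>2 / 2)) has_real_derivative - z * (c * exp (- z\<^sup>2 / 2))) (at z)" for c
    by (auto intro!: derivative_eq_intros)
  then show ?thesis unfolding std_normal_density_def[abs_def] .
qed

lemma std_normal_bounded_integrable:
  fixes h :: "real \<Rightarrow> complex"
  assumes [measurable]: "h \<in> borel_measurable borel" and b: "\<And>x. cmod (h x) \<le> C"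
  shows "integrable lborel (\<lambda>x. std_normal_density x *\<^sub>R h x)"
    and "integrable lborel (\<lambda>x. (x * std_normal_density x) *\<^sub>R h x)"
proof -
  show "integrable lborel (\<lambda>x. std_normal_density x *\<^sub>R h x)"
  proof (rule Bochner_Integration.integrable_bound[of _ "\<lambda>x. std_normal_density x * C"])
    show "AE x in lborel. norm (std_normal_density x *\<^sub>R h x) \<le> norm (std_normal_density x * C)"
    proof (rule AE_I2)
      fix x show "norm (std_normal_density x *\<^sub>R h x) \<le> norm (std_normal_density x * C)"
        using order_trans[OF b[of x] abs_ge_self[of C]] by (simp add: abs_mult mult_left_mono)
    qed
  qed auto
  show "integrable lborel (\<lambda>x. (x * std_normal_density x) *\<^sub>R h x)"
  proof (rule Bochner_Integration.integrable_bound[of _ "\<lambda>x. (std_normal_density x * \<bar>x\<bar> ^ 1) * C"])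
    show "integrable lborel (\<lambda>x. (std_normal_density x * \<bar>x\<bar> ^ 1) * C)"
      by (intro integrable_mult_left integrable_std_normal_moment_abs)
    show "AE x in lborel. norm ((x * std_normal_density x) *\<^sub>R h x) \<le> norm ((std_normal_density x * \<bar>x\<bar> ^ 1) * C)"
    proof (rule AE_I2)
      fix x show "norm ((x * std_normal_density x) *\<^sub>R h x) \<le> norm ((std_normal_density x * \<bar>x\<bar> ^ 1) * C)"
        using mult_left_mono[OF order_trans[OF b[of x] abs_ge_self[of C]], of "\<bar>x\<bar> * std_normal_density x"]
        by (simp add: abs_mult mult_ac)
    qed
  qed auto
qed

text \<open>Stein's identity: the derivative of the density times \<open>h\<close> integrates to 0
  over the line, since the density tends to 0 at both ends and \<open>h\<close> is bounded.\<close>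

lemma std_normal_stein:
  fixes h h' :: "real \<Rightarrow> complex"
  assumes d: "\<And>x. (h has_vector_derivative h' x) (at x)" and c: "continuous_on UNIV h'"
    and b: "\<And>x. cmod (h x) \<le> C" "\<And>x. cmod (h' x) \<le> C"
  shows "(\<integral>x. (x * std_normal_density x) *\<^sub>R h x \<partial>lborel) = (\<integral>x. std_normal_density x *\<^sub>R h' x \<partial>lborel)"
proof -
  have hc: "continuous_on UNIV h"
    using has_vector_derivative_continuous[OF d] by (auto intro: continuous_at_imp_continuous_on)
  have [measurable]: "h \<in> borel_measurable borel" "h' \<in> borel_measurable borel"
    using hc c by (auto intro: borel_measurable_continuous_onI)
  define F where "F x = std_normal_density x *\<^sub>R h x" for x
  define f where "f x = std_normal_density x *\<^sub>R h' x + (- x * std_normal_density x) *\<^sub>R h x" for x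
  have sd: "continuous_on UNIV std_normal_density"
    unfolding std_normal_density_def[abs_def] by (intro continuous_intros) auto
  note i = std_normal_bounded_integrable[of h C] std_normal_bounded_integrable[of h' C]
  have F: "(F has_vector_derivative f x) (at x)" for x
    unfolding F_def[abs_def] f_def
    by (rule has_vector_derivative_scaleR[OF std_normal_density_deriv d])
  have fi: "integrable lborel f" unfolding f_def[abs_def] using i b by simp
  have lim: "(F \<longlongrightarrow> 0) G" if G: "(std_normal_density \<longlongrightarrow> 0) G" for G
  proof (rule Lim_null_comparison)
    have "norm (F x) \<le> std_normal_density x * C" for x unfolding F_def using b(1)[of x] by (simp add: mult_left_mono)
    then show "\<forall>\<^sub>F x in G. norm (F x) \<le> std_normal_density x * C" by simp
    show "((\<lambda>x. std_normal_density x * C) \<longlongrightarrow> 0) G" using tendsto_mult_right[OF G, of C] by simp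
  qed
  have "(LBINT x=-\<infinity>..\<infinity>. f x) = 0 - 0"
  proof (rule interval_integral_FTC_integrable[where F=F])
    show "isCont f x" for x
      using sd hc c unfolding f_def[abs_def]
      by (intro continuous_intros) (auto simp: continuous_on_eq_continuous_at)
    show "set_integrable lborel (einterval (- \<infinity>) \<infinity>) f" using fi by (simp add: set_integrable_def)
    show "((F \<circ> real_of_ereal) \<longlongrightarrow> 0) (at_right (- \<infinity>))" "((F \<circ> real_of_ereal) \<longlongrightarrow> 0) (at_left \<infinity>)"
      unfolding ereal_tendsto_simps using lim std_normal_density_tendsto_0 by auto
  qed (use F in auto)
  then have "(\<integral>x. f x \<partial>lborel) = 0"
    by (simp add: interval_lebesgue_integral_def set_lebesgue_integral_def)
  then have "(\<integral>x. std_normal_density x *\<^sub>R h' x \<partial>lborel) + (\<integral>x. (- x * std_normal_density x) *\<^sub>R h x \<partial>lborel) = 0"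
    unfolding f_def[abs_def] using i b by simp
  then show ?thesis by simp
qed

text \<open>Gaussian smoothing in the variable \<open>y\<close> with kernel centred at \<open>b\<close>: Fourier inversion of the
  kernel reduces the claim to the hypothesis, an integration by parts moves the derivative onto
  \<open>\<Psi>\<close>, and then the width of the kernel tends to zero.\<close>

lemma (in prob_space) fourier_extension:
  fixes b g :: "'a \<Rightarrow> real" and \<Phi> \<Psi> \<Psi>' :: "real \<Rightarrow> 'a \<Rightarrow> complex"
  assumes bm[measurable]: "b \<in> borel_measurable M"
    and \<Phi>m[measurable]: "(\<lambda>(\<omega>, y). \<Phi> y \<omega>) \<in> borel_measurable (M \<Otimes>\<^sub>M lborel)"
    and \<Psi>m[measurable]: "(\<lambda>(\<omega>, y). \<Psi> y \<omega>) \<in> borel_measurable (M \<Otimes>\<^sub>M lborel)"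
    and \<Psi>'m[measurable]: "(\<lambda>(\<omega>, y). \<Psi>' y \<omega>) \<in> borel_measurable (M \<Otimes>\<^sub>M lborel)"
    and g: "integrable M g"
    and bd: "\<And>y \<omega>. cmod (\<Phi> y \<omega>) \<le> g \<omega>" "\<And>y \<omega>. cmod (\<Psi> y \<omega>) \<le> g \<omega>" "\<And>y \<omega>. cmod (\<Psi>' y \<omega>) \<le> g \<omega>"
    and c\<Phi>: "\<And>\<omega>. continuous_on UNIV (\<lambda>y. \<Phi> y \<omega>)" and c\<Psi>': "\<And>\<omega>. continuous_on UNIV (\<lambda>y. \<Psi>' y \<omega>)"
    and d: "\<And>y \<omega>. ((\<lambda>y. \<Psi> y \<omega>) has_vector_derivative \<Psi>' y \<omega>) (at y)"
    and hyp: "\<And>\<eta> y. (CLINT \<omega>|M. iexp (\<eta> * b \<omega>) * (\<Phi> y \<omega> - \<i> * of_real \<eta> * \<Psi> y \<omega>)) = 0"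
  shows "(CLINT \<omega>|M. \<Phi> (b \<omega>) \<omega> - \<Psi>' (b \<omega>) \<omega>) = 0"
proof -
  interpret N: real_distribution std_normal_distribution by (rule real_dist_normal_dist)
  have [measurable]: "g \<in> borel_measurable M" using g by auto
  have g0: "g \<omega> \<ge> 0" for \<omega> using order_trans[OF norm_ge_zero bd(1)] .
  have [measurable]: "\<Phi> y \<in> borel_measurable M" "\<Psi> y \<in> borel_measurable M" "\<Psi>' y \<in> borel_measurable M" for y
    using measurable_compose[OF measurable_Pair2'[of y lborel M] \<Phi>m] measurable_compose[OF measurable_Pair2'[of y lborel M] \<Psi>m]
      measurable_compose[OF measurable_Pair2'[of y lborel M] \<Psi>'m] by simp_all
  have c\<Psi>: "continuous_on UNIV (\<lambda>y. \<Psi> y \<omega>)" for \<omega>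
    using has_vector_derivative_continuous[OF d] by (auto intro: continuous_at_imp_continuous_on)
  define z where "z \<sigma> y \<omega> = (b \<omega> - y) / \<sigma>" for \<sigma> y \<omega>
  \<comment> \<open>The hypothesis is averaged over the frequency u/\<sigma> with u standard normal;
    by \<open>std_normal_iexp_moment\<close> the average of the characters is a Gaussian kernel of
    width \<sigma> in b - y.\<close>
  have step1: "(CLINT \<omega>|M. exp (- (z \<sigma> y \<omega>)\<^sup>2 / 2) *\<^sub>R (\<Phi> y \<omega> + (z \<sigma> y \<omega> / \<sigma>) *\<^sub>R \<Psi> y \<omega>)) = 0" if \<sigma>: "\<sigma> > 0" for \<sigma> y
  proof -
    interpret P: pair_sigma_finite std_normal_distribution M ..
    define G where "G u \<omega> = iexp (u * z \<sigma> y \<omega>) * (\<Phi> y \<omega> - \<i> * of_real (u / \<sigma>) * \<Psi> y \<omega>)" for u \<omega>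
    have Gm[measurable]: "(\<lambda>(u, \<omega>). G u \<omega>) \<in> borel_measurable (std_normal_distribution \<Otimes>\<^sub>M M)"
      unfolding G_def z_def by measurable
    have Gb: "cmod (G u \<omega>) \<le> (1 + \<bar>u\<bar> / \<sigma>) * g \<omega>" for u \<omega>
    proof -
      have "cmod (G u \<omega>) \<le> cmod (\<Phi> y \<omega>) + \<bar>u\<bar> / \<sigma> * cmod (\<Psi> y \<omega>)"
        unfolding G_def norm_mult using norm_triangle_ineq4[of "\<Phi> y \<omega>" "\<i> * of_real (u / \<sigma>) * \<Psi> y \<omega>"] \<sigma>
        by (simp add: norm_mult norm_divide)
      also have "\<dots> \<le> g \<omega> + \<bar>u\<bar> / \<sigma> * g \<omega>" using bd \<sigma> by (intro add_mono mult_left_mono) auto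
      finally show ?thesis by (simp add: distrib_right)
    qed
    have Gi: "integrable M (G u)" for u
    proof (rule Bochner_Integration.integrable_bound[of _ "\<lambda>\<omega>. (1 + \<bar>u\<bar> / \<sigma>) * g \<omega>"])
      show "AE \<omega> in M. norm (G u \<omega>) \<le> norm ((1 + \<bar>u\<bar> / \<sigma>) * g \<omega>)"
        using order_trans[OF Gb abs_ge_self] by simp
    qed (use g in \<open>auto simp: G_def z_def\<close>)
    have iu: "integrable std_normal_distribution (\<lambda>u. \<bar>u\<bar>)"
      using integrable_std_normal_distribution_moment[of 1] by (auto intro: integrable_abs)
    have GI: "integrable (std_normal_distribution \<Otimes>\<^sub>M M) (\<lambda>(u, \<omega>). G u \<omega>)"
    proof (rule P.Fubini_integrable[OF Gm])
      show "integrable std_normal_distribution (\<lambda>u. \<integral>\<omega>. norm (case (u, \<omega>) of (u, \<omega>) \<Rightarrow> G u \<omega>) \<partial>M)"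
      proof (rule Bochner_Integration.integrable_bound[of _ "\<lambda>u. (1 + \<bar>u\<bar> / \<sigma>) * expectation g"])
        show "integrable std_normal_distribution (\<lambda>u. (1 + \<bar>u\<bar> / \<sigma>) * expectation g)" using iu by simp
        show "AE u in std_normal_distribution. norm (\<integral>\<omega>. norm (case (u, \<omega>) of (u, \<omega>) \<Rightarrow> G u \<omega>) \<partial>M) \<le> norm ((1 + \<bar>u\<bar> / \<sigma>) * expectation g)"
        proof (rule AE_I2)
          fix u
          have "(\<integral>\<omega>. norm (G u \<omega>) \<partial>M) \<le> (\<integral>\<omega>. (1 + \<bar>u\<bar> / \<sigma>) * g \<omega> \<partial>M)"
            using g Gi Gb by (intro integral_mono) auto
          then show "norm (\<integral>\<omega>. norm (case (u, \<omega>) of (u, \<omega>) \<Rightarrow> G u \<omega>) \<partial>M) \<le> norm ((1 + \<bar>u\<bar> / \<sigma>) * expectation g)"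
            by (auto intro: order_trans[OF _ abs_ge_self])
        qed
        show "(\<lambda>u. \<integral>\<omega>. norm (case (u, \<omega>) of (u, \<omega>) \<Rightarrow> G u \<omega>) \<partial>M) \<in> borel_measurable std_normal_distribution"
          by measurable
      qed
    qed (use Gi in simp)
    have G0: "(\<integral>\<omega>. G u \<omega> \<partial>M) = 0" for u
    proof -
      have "G u \<omega> = iexp (- u * y / \<sigma>) * (iexp ((u / \<sigma>) * b \<omega>) * (\<Phi> y \<omega> - \<i> * of_real (u / \<sigma>) * \<Psi> y \<omega>))" for \<omega>
        unfolding G_def z_def mult.assoc[symmetric] exp_add[symmetric] by (simp add: algebra_simps diff_divide_distrib)
      then have "(\<integral>\<omega>. G u \<omega> \<partial>M) = iexp (- u * y / \<sigma>) * (CLINT \<omega>|M. iexp ((u / \<sigma>) * b \<omega>) * (\<Phi> y \<omega> - \<i> * of_real (u / \<sigma>) * \<Psi> y \<omega>))"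
        by simp
      then show ?thesis unfolding hyp by simp
    qed
    have inner: "(\<integral>u. G u \<omega> \<partial>std_normal_distribution) = exp (- (z \<sigma> y \<omega>)\<^sup>2 / 2) *\<^sub>R (\<Phi> y \<omega> + (z \<sigma> y \<omega> / \<sigma>) *\<^sub>R \<Psi> y \<omega>)" for \<omega>
    proof -
      let ?z = "z \<sigma> y \<omega>"
      have i1: "integrable std_normal_distribution (\<lambda>u. iexp (u * ?z))"
        by (rule N.integrable_const_bound[of _ 1]) auto
      have i2: "integrable std_normal_distribution (\<lambda>u. \<i> * of_real u * iexp (u * ?z))"
        by (rule Bochner_Integration.integrable_bound[OF iu]) (auto simp: norm_mult)
      have "(\<integral>u. G u \<omega> \<partial>std_normal_distribution) = (\<integral>u. iexp (u * ?z) * \<Phi> y \<omega> - (\<i> * of_real u * iexp (u * ?z)) * (\<Psi> y \<omega> / \<sigma>) \<partial>std_normal_distribution)"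
        by (intro Bochner_Integration.integral_cong refl) (simp add: G_def algebra_simps)
      also have "\<dots> = (\<integral>u. iexp (u * ?z) \<partial>std_normal_distribution) * \<Phi> y \<omega> - (\<integral>u. \<i> * of_real u * iexp (u * ?z) \<partial>std_normal_distribution) * (\<Psi> y \<omega> / \<sigma>)"
        using i1 i2 by (subst Bochner_Integration.integral_diff) auto
      also have "\<dots> = exp (- ?z\<^sup>2 / 2) *\<^sub>R (\<Phi> y \<omega> + (?z / \<sigma>) *\<^sub>R \<Psi> y \<omega>)"
        unfolding std_normal_iexp_moment by (simp add: scaleR_conv_of_real algebra_simps)
      finally show ?thesis .
    qed
    have "(\<integral>\<omega>. (\<integral>u. G u \<omega> \<partial>std_normal_distribution) \<partial>M) = (\<integral>u. (\<integral>\<omega>. G u \<omega> \<partial>M) \<partial>std_normal_distribution)"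
      by (rule P.Fubini_integral[OF GI])
    then show ?thesis unfolding inner G0 by simp
  qed
  \<comment> \<open>Integrating over y and substituting y = b + \<sigma> x leaves x \<Psi> /
    \<sigma> against the normal density, and Stein's identity replaces it by \<Psi>'.\<close>
  have step2: "(CLINT \<omega>|M. (CLINT x|lborel. std_normal_density x *\<^sub>R (\<Phi> (b \<omega> + \<sigma> * x) \<omega> - \<Psi>' (b \<omega> + \<sigma> * x) \<omega>))) = 0"
    if \<sigma>: "\<sigma> > 0" for \<sigma>
  proof -
    interpret P: pair_sigma_finite M lborel ..
    define F where "F \<omega> y = std_normal_density (z \<sigma> y \<omega>) *\<^sub>R (\<Phi> y \<omega> + (z \<sigma> y \<omega> / \<sigma>) *\<^sub>R \<Psi> y \<omega>)" for \<omega> y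
    have Fm[measurable]: "(\<lambda>(\<omega>, y). F \<omega> y) \<in> borel_measurable (M \<Otimes>\<^sub>M lborel)"
      unfolding F_def z_def by measurable
    have Fz: "F \<omega> (b \<omega> + \<sigma> * x) = std_normal_density x *\<^sub>R \<Phi> (b \<omega> + \<sigma> * x) \<omega> - (1 / \<sigma>) *\<^sub>R ((x * std_normal_density x) *\<^sub>R \<Psi> (b \<omega> + \<sigma> * x) \<omega>)" for \<omega> x
      using \<sigma> by (simp add: F_def z_def std_normal_density_def scaleR_right_diff_distrib mult.commute)
    have mm: "(\<lambda>x. \<Phi> (b \<omega> + \<sigma> * x) \<omega>) \<in> borel_measurable borel" "(\<lambda>x. \<Psi> (b \<omega> + \<sigma> * x) \<omega>) \<in> borel_measurable borel"
       "(\<lambda>x. \<Psi>' (b \<omega> + \<sigma> * x) \<omega>) \<in> borel_measurable borel" for \<omega>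
      by (intro borel_measurable_continuous_onI continuous_on_compose2[OF c\<Phi>] continuous_on_compose2[OF c\<Psi>]
          continuous_on_compose2[OF c\<Psi>'] continuous_intros; simp)+
    note i\<Phi> = std_normal_bounded_integrable(1)[OF mm(1) bd(1)]
    note i\<Psi> = std_normal_bounded_integrable(2)[OF mm(2) bd(2)]
    note i\<Psi>' = std_normal_bounded_integrable(1)[OF mm(3) bd(3)]
    have Fzi: "integrable lborel (\<lambda>x. F \<omega> (b \<omega> + \<sigma> * x))" for \<omega>
      unfolding Fz using i\<Phi> i\<Psi> by (intro Bochner_Integration.integrable_diff integrable_scaleR_right) auto
    have Fi: "integrable lborel (F \<omega>)" for \<omega>
      using Fzi[of \<omega>] \<sigma> lborel_integrable_real_affine_iff[of \<sigma> "F \<omega>" "b \<omega>"] by simp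
    have Fint: "(\<integral>y. F \<omega> y \<partial>lborel) = \<sigma> *\<^sub>R (CLINT x|lborel. std_normal_density x *\<^sub>R (\<Phi> (b \<omega> + \<sigma> * x) \<omega> - \<Psi>' (b \<omega> + \<sigma> * x) \<omega>))" for \<omega>
    proof -
      have "(\<integral>y. F \<omega> y \<partial>lborel) = \<sigma> *\<^sub>R (\<integral>x. F \<omega> (b \<omega> + \<sigma> * x) \<partial>lborel)"
        using \<sigma> lborel_integral_real_affine[of \<sigma> "F \<omega>" "b \<omega>"] by simp
      also have "(\<integral>x. F \<omega> (b \<omega> + \<sigma> * x) \<partial>lborel) = (CLINT x|lborel. std_normal_density x *\<^sub>R \<Phi> (b \<omega> + \<sigma> * x) \<omega>)
         - (1 / \<sigma>) *\<^sub>R (CLINT x|lborel. (x * std_normal_density x) *\<^sub>R \<Psi> (b \<omega> + \<sigma> * x) \<omega>)"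
        unfolding Fz Bochner_Integration.integral_diff[OF i\<Phi> integrable_scaleR_right[OF i\<Psi>]] integral_scaleR_right ..
      also have "(CLINT x|lborel. (x * std_normal_density x) *\<^sub>R \<Psi> (b \<omega> + \<sigma> * x) \<omega>)
         = (CLINT x|lborel. std_normal_density x *\<^sub>R (\<sigma> *\<^sub>R \<Psi>' (b \<omega> + \<sigma> * x) \<omega>))"
      proof (rule std_normal_stein[where C="(1 + \<sigma>) * g \<omega>"])
        show "((\<lambda>x. \<Psi> (b \<omega> + \<sigma> * x) \<omega>) has_vector_derivative \<sigma> *\<^sub>R \<Psi>' (b \<omega> + \<sigma> * x) \<omega>) (at x)" for x
        proof -
          have "((\<lambda>x. b \<omega> + \<sigma> * x) has_vector_derivative \<sigma>) (at x)"
            unfolding has_real_derivative_iff_has_vector_derivative[symmetric] by (auto intro!: derivative_eq_intros)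
          from vector_diff_chain_at[OF this d[of \<omega> "b \<omega> + \<sigma> * x"]] show ?thesis by (simp add: o_def)
        qed
        show "continuous_on UNIV (\<lambda>x. \<sigma> *\<^sub>R \<Psi>' (b \<omega> + \<sigma> * x) \<omega>)"
          by (intro continuous_intros continuous_on_compose2[OF c\<Psi>']) auto
        show "cmod (\<Psi> (b \<omega> + \<sigma> * x) \<omega>) \<le> (1 + \<sigma>) * g \<omega>" for x
          using bd(2)[of "b \<omega> + \<sigma> * x" \<omega>] g0[of \<omega>] \<sigma> by (simp add: distrib_right add_increasing2)
        show "cmod (\<sigma> *\<^sub>R \<Psi>' (b \<omega> + \<sigma> * x) \<omega>) \<le> (1 + \<sigma>) * g \<omega>" for x
          using mult_left_mono[OF bd(3)[of "b \<omega> + \<sigma> * x" \<omega>], of \<sigma>] g0[of \<omega>] \<sigma> by (simp add: distrib_right add_increasing)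
      qed
      also have "(CLINT x|lborel. std_normal_density x *\<^sub>R (\<sigma> *\<^sub>R \<Psi>' (b \<omega> + \<sigma> * x) \<omega>)) = \<sigma> *\<^sub>R (CLINT x|lborel. std_normal_density x *\<^sub>R \<Psi>' (b \<omega> + \<sigma> * x) \<omega>)"
        by (simp only: scaleR_left_commute[of _ \<sigma>] integral_scaleR_right)
      also have "(1 / \<sigma>) *\<^sub>R \<dots> = (CLINT x|lborel. std_normal_density x *\<^sub>R \<Psi>' (b \<omega> + \<sigma> * x) \<omega>)"
        using \<sigma> by simp
      finally show ?thesis
        by (simp only: scaleR_right_diff_distrib Bochner_Integration.integral_diff[OF i\<Phi> i\<Psi>'])
    qed
    define \<kappa> where "\<kappa> = \<sigma> * (\<integral>x. std_normal_density x + (std_normal_density x * \<bar>x\<bar> ^ 1) / \<sigma> \<partial>lborel)"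
    have ki: "integrable lborel (\<lambda>x. std_normal_density x + (std_normal_density x * \<bar>x\<bar> ^ 1) / \<sigma>)"
      by (intro Bochner_Integration.integrable_add integrable_divide integrable_std_normal_moment_abs) auto
    have FI: "integrable (M \<Otimes>\<^sub>M lborel) (\<lambda>(\<omega>, y). F \<omega> y)"
    proof (rule P.Fubini_integrable[OF Fm])
      show "integrable M (\<lambda>\<omega>. \<integral>y. norm (case (\<omega>, y) of (\<omega>, y) \<Rightarrow> F \<omega> y) \<partial>lborel)"
      proof (rule Bochner_Integration.integrable_bound[of _ "\<lambda>\<omega>. \<kappa> * g \<omega>"])
        show "AE \<omega> in M. norm (\<integral>y. norm (case (\<omega>, y) of (\<omega>, y) \<Rightarrow> F \<omega> y) \<partial>lborel) \<le> norm (\<kappa> * g \<omega>)"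
        proof (rule AE_I2)
          fix \<omega>
          have "(\<integral>y. norm (F \<omega> y) \<partial>lborel) = \<sigma> * (\<integral>x. norm (F \<omega> (b \<omega> + \<sigma> * x)) \<partial>lborel)"
            using \<sigma> lborel_integral_real_affine[of \<sigma> "\<lambda>y. norm (F \<omega> y)" "b \<omega>"] by simp
          also have "\<dots> \<le> \<sigma> * (\<integral>x. (std_normal_density x + (std_normal_density x * \<bar>x\<bar> ^ 1) / \<sigma>) * g \<omega> \<partial>lborel)"
          proof (intro mult_left_mono integral_mono)
            fix x
            have "norm (F \<omega> (b \<omega> + \<sigma> * x)) \<le> std_normal_density x * cmod (\<Phi> (b \<omega> + \<sigma> * x) \<omega>) + (std_normal_density x * \<bar>x\<bar>) / \<sigma> * cmod (\<Psi> (b \<omega> + \<sigma> * x) \<omega>)"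
              unfolding Fz by (rule order_trans[OF norm_triangle_ineq4]) (use \<sigma> in \<open>simp add: abs_mult mult_ac\<close>)
            also have "\<dots> \<le> std_normal_density x * g \<omega> + (std_normal_density x * \<bar>x\<bar>) / \<sigma> * g \<omega>"
              using bd \<sigma> by (intro add_mono mult_left_mono) auto
            finally show "norm (F \<omega> (b \<omega> + \<sigma> * x)) \<le> (std_normal_density x + (std_normal_density x * \<bar>x\<bar> ^ 1) / \<sigma>) * g \<omega>"
              by (simp add: distrib_right)
          qed (use Fzi ki \<sigma> in auto)
          also have "\<dots> = \<kappa> * g \<omega>" unfolding \<kappa>_def by simp
          finally show "norm (\<integral>y. norm (case (\<omega>, y) of (\<omega>, y) \<Rightarrow> F \<omega> y) \<partial>lborel) \<le> norm (\<kappa> * g \<omega>)"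
            by (auto intro: order_trans[OF _ abs_ge_self])
        qed
        show "(\<lambda>\<omega>. \<integral>y. norm (case (\<omega>, y) of (\<omega>, y) \<Rightarrow> F \<omega> y) \<partial>lborel) \<in> borel_measurable M"
          by measurable
      qed (use g in simp)
    qed (use Fi in simp)
    have F0: "(\<integral>\<omega>. F \<omega> y \<partial>M) = 0" for y
    proof -
      have "F \<omega> y = (1 / sqrt (2 * pi)) *\<^sub>R (exp (- (z \<sigma> y \<omega>)\<^sup>2 / 2) *\<^sub>R (\<Phi> y \<omega> + (z \<sigma> y \<omega> / \<sigma>) *\<^sub>R \<Psi> y \<omega>))" for \<omega>
        unfolding F_def std_normal_density_def by simp
      then have "(\<integral>\<omega>. F \<omega> y \<partial>M) = (1 / sqrt (2 * pi)) *\<^sub>R (CLINT \<omega>|M. exp (- (z \<sigma> y \<omega>)\<^sup>2 / 2) *\<^sub>R (\<Phi> y \<omega> + (z \<sigma> y \<omega> / \<sigma>) *\<^sub>R \<Psi> y \<omega>))"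
        by (simp only: integral_scaleR_right)
      then show ?thesis unfolding step1[OF \<sigma>] by simp
    qed
    have "(\<integral>y. (\<integral>\<omega>. F \<omega> y \<partial>M) \<partial>lborel) = (\<integral>\<omega>. (\<integral>y. F \<omega> y \<partial>lborel) \<partial>M)"
      by (rule P.Fubini_integral[OF FI])
    then have "\<sigma> *\<^sub>R (CLINT \<omega>|M. (CLINT x|lborel. std_normal_density x *\<^sub>R (\<Phi> (b \<omega> + \<sigma> * x) \<omega> - \<Psi>' (b \<omega> + \<sigma> * x) \<omega>))) = 0"
      unfolding F0 Fint by simp
    then show ?thesis using \<sigma> by simp
  qed
  \<comment> \<open>The width 1/(n + 1) now tends to 0, and dominated convergence with the bound 2 g
    evaluates the integrand at y = b.\<close>
  define R where "R y \<omega> = \<Phi> y \<omega> - \<Psi>' y \<omega>" for y \<omega>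
  have Rc: "continuous_on UNIV (\<lambda>y. R y \<omega>)" for \<omega> unfolding R_def by (intro continuous_intros c\<Phi> c\<Psi>')
  have Rb: "cmod (R y \<omega>) \<le> 2 * g \<omega>" for y \<omega>
    unfolding R_def using norm_triangle_ineq4[of "\<Phi> y \<omega>" "\<Psi>' y \<omega>"] bd(1)[of y \<omega>] bd(3)[of y \<omega>] by linarith
  have Rm[measurable]: "(\<lambda>(\<omega>, y). R y \<omega>) \<in> borel_measurable (M \<Otimes>\<^sub>M lborel)"
    unfolding R_def using \<Phi>m \<Psi>'m by (simp add: case_prod_beta')
  define s where "s n = inverse (real (Suc n))" for n
  have sn: "s n > 0" for n by (simp add: s_def)
  have sl: "s \<longlonglongrightarrow> 0" unfolding s_def[abs_def] by (rule LIMSEQ_inverse_real_of_nat)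
  define I where "I n \<omega> = (CLINT x|lborel. std_normal_density x *\<^sub>R R (b \<omega> + s n * x) \<omega>)" for n \<omega>
  have Rxm: "(\<lambda>x. R (b \<omega> + s n * x) \<omega>) \<in> borel_measurable borel" for \<omega> n
    by (intro borel_measurable_continuous_onI continuous_on_compose2[OF Rc] continuous_intros) auto
  have Il: "(\<lambda>n. I n \<omega>) \<longlonglongrightarrow> R (b \<omega>) \<omega>" for \<omega>
  proof -
    have "(\<lambda>n. I n \<omega>) \<longlonglongrightarrow> (CLINT x|lborel. std_normal_density x *\<^sub>R R (b \<omega>) \<omega>)"
      unfolding I_def
    proof (rule integral_dominated_convergence[where w="\<lambda>x. std_normal_density x * (2 * g \<omega>)"])
      show "AE x in lborel. (\<lambda>n. std_normal_density x *\<^sub>R R (b \<omega> + s n * x) \<omega>) \<longlonglongrightarrow> std_normal_density x *\<^sub>R R (b \<omega>) \<omega>"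
      proof (rule AE_I2)
        fix x
        have "(\<lambda>n. b \<omega> + s n * x) \<longlonglongrightarrow> b \<omega> + 0 * x" by (intro tendsto_intros sl)
        then have "(\<lambda>n. R (b \<omega> + s n * x) \<omega>) \<longlonglongrightarrow> R (b \<omega>) \<omega>"
          by (intro continuous_on_tendsto_compose[OF Rc]) auto
        then show "(\<lambda>n. std_normal_density x *\<^sub>R R (b \<omega> + s n * x) \<omega>) \<longlonglongrightarrow> std_normal_density x *\<^sub>R R (b \<omega>) \<omega>"
          by (intro tendsto_intros)
      qed
      show "AE x in lborel. norm (std_normal_density x *\<^sub>R R (b \<omega> + s n * x) \<omega>) \<le> std_normal_density x * (2 * g \<omega>)" for n
        using Rb by (auto intro!: mult_left_mono)
      show "(\<lambda>x. std_normal_density x *\<^sub>R R (b \<omega> + s n * x) \<omega>) \<in> borel_measurable lborel" for n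
        using Rxm by measurable
    qed auto
    moreover have "(CLINT x|lborel. std_normal_density x *\<^sub>R R (b \<omega>) \<omega>) = R (b \<omega>) \<omega>"
      by (subst integral_scaleR_left) auto
    ultimately show ?thesis by simp
  qed
  have Ib: "cmod (I n \<omega>) \<le> 2 * g \<omega>" for n \<omega>
  proof -
    have "cmod (I n \<omega>) \<le> (\<integral>x. std_normal_density x * (2 * g \<omega>) \<partial>lborel)"
      unfolding I_def
    proof (rule order_trans[OF integral_norm_bound integral_mono])
      show "integrable lborel (\<lambda>x. cmod (std_normal_density x *\<^sub>R R (b \<omega> + s n * x) \<omega>))"
        by (intro integrable_norm std_normal_bounded_integrable(1)[OF Rxm Rb])
      show "cmod (std_normal_density x *\<^sub>R R (b \<omega> + s n * x) \<omega>) \<le> std_normal_density x * (2 * g \<omega>)" for x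
        using Rb by (auto intro!: mult_left_mono)
    qed auto
    then show ?thesis by simp
  qed
  have Im[measurable]: "I n \<in> borel_measurable M" for n
  proof -
    have "(\<lambda>p. R (b (fst p) + s n * snd p) (fst p)) \<in> borel_measurable (M \<Otimes>\<^sub>M lborel)"
    proof -
      have "(\<lambda>p. (fst p, b (fst p) + s n * snd p)) \<in> M \<Otimes>\<^sub>M lborel \<rightarrow>\<^sub>M M \<Otimes>\<^sub>M lborel" by measurable
      from measurable_compose[OF this Rm] show ?thesis by simp
    qed
    then have [measurable]: "(\<lambda>(\<omega>, x). R (b \<omega> + s n * x) \<omega>) \<in> borel_measurable (M \<Otimes>\<^sub>M lborel)" by (simp add: case_prod_beta')
    show ?thesis unfolding I_def[abs_def] by measurable
  qed
  have Rbm: "(\<lambda>\<omega>. R (b \<omega>) \<omega>) \<in> borel_measurable M"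
    by (rule borel_measurable_LIMSEQ_metric[OF Im Il])
  have "(\<lambda>n. CLINT \<omega>|M. I n \<omega>) \<longlonglongrightarrow> (CLINT \<omega>|M. R (b \<omega>) \<omega>)"
    by (rule integral_dominated_convergence[where w="\<lambda>\<omega>. 2 * g \<omega>"]) (use g Il Ib Rbm in auto)
  moreover have "(CLINT \<omega>|M. I n \<omega>) = 0" for n
    using step2[OF sn[of n]] unfolding I_def R_def .
  ultimately have "(CLINT \<omega>|M. R (b \<omega>) \<omega>) = 0" by (simp add: LIMSEQ_const_iff)
  then show ?thesis unfolding R_def .
qed

section \<open>From characters to bounded smooth test functions\<close>

definition C1b :: "nat \<Rightarrow> ((nat \<Rightarrow> real) \<Rightarrow> real) \<Rightarrow> (nat \<Rightarrow> (nat \<Rightarrow> real) \<Rightarrow> real) \<Rightarrow> bool" where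
  "C1b k f f' \<longleftrightarrow> (\<forall>x y. (\<forall>i<k. x i = y i) \<longrightarrow> f x = f y) \<and> continuous_on UNIV f \<and> bounded (range f) \<and>
     (\<forall>i<k. continuous_on UNIV (f' i) \<and> bounded (range (f' i)) \<and>
        (\<forall>x. ((\<lambda>h. f (x(i := h))) has_real_derivative f' i x) (at (x i))))"

lemma Cb_smooth_C1b:
  assumes "Cb_smooth m f"
  shows "C1b m f (\<lambda>i. partial_deriv i f)"
proof -
  have l: "continuous_on UNIV g \<and> bounded (range g) \<and> (\<forall>i<m. \<forall>x. (\<lambda>h. g (x(i := h))) differentiable at (x i))"
    if "is \<in> lists {..<m}" "g = foldr partial_deriv is f" for "is" g
    using assms that unfolding Cb_smooth_def Let_def by blast
  have f: "continuous_on UNIV f" "bounded (range f)" "\<And>i x. i < m \<Longrightarrow> (\<lambda>h. f (x(i := h))) differentiable at (x i)"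
    using l[of "[]" f] by auto
  have p: "continuous_on UNIV (partial_deriv i f)" "bounded (range (partial_deriv i f))" if "i < m" for i
    using l[of "[i]" "partial_deriv i f"] that by auto
  have "((\<lambda>h. f (x(i := h))) has_real_derivative partial_deriv i f x) (at (x i))" if "i < m" for i x
    using f(3)[OF that, of x] unfolding partial_deriv_def
    by (simp add: DERIV_deriv_iff_real_differentiable)
  then show ?thesis using assms f p unfolding C1b_def Cb_smooth_def by auto
qed

lemma continuous_on_fun_upd_const: "continuous_on UNIV (\<lambda>x::nat \<Rightarrow> real. x(k := y))"
proof (rule continuous_on_coordinatewise_then_product)
  show "continuous_on UNIV (\<lambda>x. (x(k := y)) i)" for i
    by (cases "i = k") (auto intro: continuous_on_product_coordinates)
qed

lemma continuous_on_fun_upd_value: "continuous_on UNIV (\<lambda>y. (x :: nat \<Rightarrow> real)(k := y))"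
proof (rule continuous_on_coordinatewise_then_product)
  show "continuous_on UNIV (\<lambda>y. (x(k := y)) i)" for i
    by (cases "i = k") auto
qed

text \<open>\<open>C1b\<close> carries the derivatives as separate data, so freezing a coordinate
  only restricts them. This is the passage to fewer variables in the induction of
  \<open>trig_to_C1b\<close>.\<close>

lemma C1b_freeze:
  assumes "C1b (Suc k) f f'"
  shows "C1b k (\<lambda>x. f (x(k := y))) (\<lambda>i x. f' i (x(k := y)))"
proof -
  have dep: "f x = f z" if "\<forall>i<Suc k. x i = z i" for x z using assms that unfolding C1b_def by blast
  have f: "continuous_on UNIV f" "bounded (range f)" using assms unfolding C1b_def by auto
  have f': "continuous_on UNIV (f' i)" "bounded (range (f' i))" if "i < Suc k" for i using assms that unfolding C1b_def by auto
  have d: "((\<lambda>h. f (x(i := h))) has_real_derivative f' i x) (at (x i))" if "i < Suc k" for i x using assms that unfolding C1b_def by auto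
  have cc: "continuous_on UNIV (\<lambda>x. g (x(k := y)))" if "continuous_on UNIV g" for g :: "(nat \<Rightarrow> real) \<Rightarrow> real"
    by (rule continuous_on_compose2[OF that continuous_on_fun_upd_const]) simp
  have bb: "bounded (range (\<lambda>x. g (x(k := y))))" if "bounded (range g)" for g :: "(nat \<Rightarrow> real) \<Rightarrow> real"
    by (rule bounded_subset[OF that]) auto
  have "((\<lambda>h. f ((x(i := h))(k := y))) has_real_derivative f' i (x(k := y))) (at (x i))" if "i < k" for i x
  proof -
    have "((\<lambda>h. f ((x(k := y))(i := h))) has_real_derivative f' i (x(k := y))) (at ((x(k := y)) i))"
      by (rule d) (use that in simp)
    then show ?thesis using that by (simp add: fun_upd_twist[of i k])
  qed
  moreover have "f (x(k := y)) = f (z(k := y))" if "\<forall>i<k. x i = z i" for x z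
    by (rule dep) (use that in \<open>auto simp: less_Suc_eq\<close>)
  ultimately show ?thesis using f f' cc bb unfolding C1b_def by auto
qed

lemma C1b_bound:
  assumes "C1b k f f'"
  obtains C where "C \<ge> 0" "\<And>x. \<bar>f x\<bar> \<le> C" "\<And>i x. i < k \<Longrightarrow> \<bar>f' i x\<bar> \<le> C"
proof -
  have "\<forall>i. \<exists>c. i < k \<longrightarrow> (\<forall>x. \<bar>f' i x\<bar> \<le> c)"
    using assms unfolding C1b_def bounded_iff by (auto simp: real_norm_def)
  from choice[OF this] obtain c where c: "\<And>i x. i < k \<Longrightarrow> \<bar>f' i x\<bar> \<le> c i" by blast
  obtain c0 where c0: "\<And>x. \<bar>f x\<bar> \<le> c0" using assms unfolding C1b_def bounded_iff by auto
  have c0': "c0 \<ge> 0" using c0[of undefined] by linarith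
  have ci: "c i \<ge> 0" if "i < k" for i using c[OF that, of undefined] by linarith
  have s: "(\<Sum>i<k. c i) \<ge> 0" using ci by (intro sum_nonneg) auto
  show thesis
  proof (rule that[of "c0 + (\<Sum>i<k. c i)"])
    show "c0 + (\<Sum>i<k. c i) \<ge> 0" using c0' s by simp
    show "\<bar>f x\<bar> \<le> c0 + (\<Sum>i<k. c i)" for x using c0[of x] s by linarith
    show "\<bar>f' i x\<bar> \<le> c0 + (\<Sum>i<k. c i)" if "i < k" for i x
    proof -
      have "c i \<le> (\<Sum>i<k. c i)" by (rule member_le_sum) (use that ci in auto)
      then show ?thesis using c[OF that, of x] c0' by linarith
    qed
  qed
qed

context prob_space
begin

text \<open>Coordinates are converted one at a time. After k steps the test function is a C1b
  function of the first k coordinates times a character in the others;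
  \<open>fourier_extension\<close> in the variable \<open>b k\<close> turns the character in the
  next coordinate into an arbitrary C1b dependence.\<close>

lemma trig_to_C1b:
  fixes b :: "nat \<Rightarrow> 'a \<Rightarrow> real" and G :: "'a \<Rightarrow> real" and K :: "nat \<Rightarrow> 'a \<Rightarrow> real"
  assumes bm[measurable]: "\<And>i. b i \<in> borel_measurable M"
    and G: "integrable M G" and K: "\<And>j. j < m \<Longrightarrow> integrable M (K j)"
    and hyp: "\<And>\<xi>. iexp_mean (\<lambda>\<omega>. \<Sum>j<m. \<xi> j * b j \<omega>) G = (\<Sum>j<m. \<i> * of_real (\<xi> j) * iexp_mean (\<lambda>\<omega>. \<Sum>j<m. \<xi> j * b j \<omega>) (K j))"
    and f: "C1b m f f'"
  shows "expectation (\<lambda>\<omega>. f (\<lambda>i. b i \<omega>) * G \<omega>) = (\<Sum>j<m. expectation (\<lambda>\<omega>. f' j (\<lambda>i. b i \<omega>) * K j \<omega>))"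
proof -
  have [measurable]: "G \<in> borel_measurable M" using G by auto
  have Km[measurable]: "\<And>j. j < m \<Longrightarrow> K j \<in> borel_measurable M" using K by auto
  define \<beta> where "\<beta> \<omega> = (\<lambda>i. b i \<omega>)" for \<omega>
  have \<beta>m[measurable]: "\<beta> \<in> borel_measurable M"
    unfolding \<beta>_def[abs_def] by (rule measurable_coordinatewise_then_product) measurable
  have cm: "(\<lambda>\<omega>. g (\<beta> \<omega>)) \<in> borel_measurable M" if "continuous_on UNIV g" for g :: "(nat \<Rightarrow> real) \<Rightarrow> real"
    using measurable_compose[OF \<beta>m borel_measurable_continuous_onI[OF that]] .
  have cmk: "(\<lambda>p. g ((\<beta> (fst p))(k := snd p))) \<in> borel_measurable (M \<Otimes>\<^sub>M lborel)"
    if "continuous_on UNIV g" for g :: "(nat \<Rightarrow> real) \<Rightarrow> real" and k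
  proof -
    have "(\<lambda>p. (\<beta> (fst p))(k := snd p)) \<in> borel_measurable (M \<Otimes>\<^sub>M lborel)"
    proof (rule measurable_coordinatewise_then_product)
      fix i show "(\<lambda>p. ((\<beta> (fst p))(k := snd p)) i) \<in> borel_measurable (M \<Otimes>\<^sub>M lborel)"
        by (cases "i = k") (simp_all add: \<beta>_def)
    qed
    from measurable_compose[OF this borel_measurable_continuous_onI[OF that]] show ?thesis .
  qed
  define E where "E k \<xi> \<omega> = iexp (\<Sum>j\<in>{k..<m}. \<xi> j * b j \<omega>)" for k \<xi> \<omega>
  have Em[measurable]: "E k \<xi> \<in> borel_measurable M" for k \<xi> unfolding E_def[abs_def] by measurable
  have E1: "cmod (E k \<xi> \<omega>) = 1" for k \<xi> \<omega> unfolding E_def by simp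
  \<comment> \<open>The factor of \<open>K j\<close>: a partial derivative in a converted
    coordinate, and in the others i \<xi>_j times the function, which stems from differentiating the
    character.\<close>
  define tm where "tm k f f' \<xi> j x = (if j < k then complex_of_real (f' j x) else \<i> * of_real (\<xi> j) * of_real (f x))"
    for k and f :: "(nat \<Rightarrow> real) \<Rightarrow> real" and f' :: "nat \<Rightarrow> (nat \<Rightarrow> real) \<Rightarrow> real" and \<xi> :: "nat \<Rightarrow> real" and j x
  define A where "A k f f' \<xi> \<omega> = E k \<xi> \<omega> * (of_real (f (\<beta> \<omega>)) * of_real (G \<omega>) - (\<Sum>j<m. tm k f f' \<xi> j (\<beta> \<omega>) * of_real (K j \<omega>)))"
    for k f f' \<xi> \<omega>
  have main: "k \<le> m \<longrightarrow> (\<forall>f f' \<xi>. C1b k f f' \<longrightarrow> (CLINT \<omega>|M. A k f f' \<xi> \<omega>) = 0)" for k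
  proof (induction k)
    case 0
    show ?case
    proof (intro impI allI)
      fix f f' \<xi> assume f: "C1b 0 f f'"
      define c where "c = f (\<lambda>_. 0)"
      have fc: "f x = c" for x using f unfolding C1b_def c_def by blast
      let ?Z = "\<lambda>\<omega>. \<Sum>j<m. \<xi> j * b j \<omega>"
      have Zm: "?Z \<in> borel_measurable M" by measurable
      have EZ: "E 0 \<xi> \<omega> = iexp (?Z \<omega>)" for \<omega> unfolding E_def by (simp add: atLeast0LessThan)
      have "A 0 f f' \<xi> \<omega> = of_real c * (iexp (?Z \<omega>) * of_real (G \<omega>)) - (\<Sum>j<m. of_real c * (\<i> * of_real (\<xi> j)) * (iexp (?Z \<omega>) * of_real (K j \<omega>)))" for \<omega>
        unfolding A_def EZ tm_def by (simp add: fc right_diff_distrib sum_distrib_left mult_ac)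
      then have "(CLINT \<omega>|M. A 0 f f' \<xi> \<omega>) = (CLINT \<omega>|M. of_real c * (iexp (?Z \<omega>) * of_real (G \<omega>)) - (\<Sum>j<m. of_real c * (\<i> * of_real (\<xi> j)) * (iexp (?Z \<omega>) * of_real (K j \<omega>))))"
        by (simp only:)
      also have "\<dots> = of_real c * iexp_mean ?Z G - (\<Sum>j<m. of_real c * (\<i> * of_real (\<xi> j)) * iexp_mean ?Z (K j))"
        unfolding iexp_mean_def using iexp_integrable[OF Zm G] iexp_integrable[OF Zm K]
        by (subst Bochner_Integration.integral_diff) (auto intro!: Bochner_Integration.integrable_sum simp: Bochner_Integration.integral_sum)
      also have "\<dots> = 0" unfolding hyp by (simp add: sum_distrib_left mult_ac)
      finally show "(CLINT \<omega>|M. A 0 f f' \<xi> \<omega>) = 0" .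
    qed
  next
    case (Suc k)
    show ?case
    proof (intro impI allI)
      assume km: "Suc k \<le> m"
      fix f f' \<xi> assume f: "C1b (Suc k) f f'"
      have IH: "(CLINT \<omega>|M. A k g g' \<zeta> \<omega>) = 0" if "C1b k g g'" for g g' \<zeta>
        using Suc.IH km that by simp
      obtain C where C: "C \<ge> 0" "\<And>x. \<bar>f x\<bar> \<le> C" "\<And>i x. i < Suc k \<Longrightarrow> \<bar>f' i x\<bar> \<le> C"
        using C1b_bound[OF f] by blast
      have fc: "continuous_on UNIV f" and f'c: "\<And>i. i < Suc k \<Longrightarrow> continuous_on UNIV (f' i)"
        and fd: "\<And>i x. i < Suc k \<Longrightarrow> ((\<lambda>h. f (x(i := h))) has_real_derivative f' i x) (at (x i))"
        using f unfolding C1b_def by auto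
      define J where "J = {..<m} - {k}"
      define e where "e = E (Suc k) \<xi>"
      define u where "u y \<omega> = (\<beta> \<omega>)(k := y)" for y \<omega>
      \<comment> \<open>\<open>\<Phi>\<close> collects all terms but the one with
        \<open>K k\<close>. That one is \<open>\<Psi>\<close>, to be differentiated in coordinate k,
        which is kept as the free variable y.\<close>
      define \<Phi> where "\<Phi> y \<omega> = e \<omega> * (of_real (f (u y \<omega>)) * of_real (G \<omega>) - (\<Sum>j\<in>J. tm k f f' \<xi> j (u y \<omega>) * of_real (K j \<omega>)))" for y \<omega>
      define \<Psi> where "\<Psi> y \<omega> = e \<omega> * (of_real (f (u y \<omega>)) * of_real (K k \<omega>))" for y \<omega>
      define \<Psi>' where "\<Psi>' y \<omega> = e \<omega> * (of_real (f' k (u y \<omega>)) * of_real (K k \<omega>))" for y \<omega>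
      define g where "g \<omega> = C * \<bar>G \<omega>\<bar> + (\<Sum>j<m. C * (1 + \<bar>\<xi> j\<bar>) * \<bar>K j \<omega>\<bar>)" for \<omega>
      have km': "k < m" using km by simp
      have e1: "cmod (e \<omega>) = 1" for \<omega> unfolding e_def by (rule E1)
      have em[measurable]: "e \<in> borel_measurable M" unfolding e_def by (rule Em)
      have tmb: "cmod (tm k f f' \<xi> j x) \<le> C * (1 + \<bar>\<xi> j\<bar>)" for j x
      proof (cases "j < k")
        case True
        have "C * 1 \<le> C * (1 + \<bar>\<xi> j\<bar>)" using C(1) by (intro mult_left_mono) auto
        then show ?thesis using True C(3)[of j x] by (simp add: tm_def)
      next
        case False
        have "\<bar>\<xi> j\<bar> * \<bar>f x\<bar> \<le> (1 + \<bar>\<xi> j\<bar>) * C" using C by (intro mult_mono) auto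
        then show ?thesis using False by (simp add: tm_def norm_mult mult.commute)
      qed
      have uc: "continuous_on UNIV (\<lambda>y. h (u y \<omega>))" if "continuous_on UNIV h" for h :: "(nat \<Rightarrow> real) \<Rightarrow> real" and \<omega>
        unfolding u_def by (rule continuous_on_compose2[OF that continuous_on_fun_upd_value]) simp
      have tmc: "continuous_on UNIV (\<lambda>y. tm k f f' \<xi> j (u y \<omega>))" for j \<omega>
      proof (cases "j < k")
        case True
        then show ?thesis unfolding tm_def using uc[OF f'c[of j], of \<omega>] by (simp add: continuous_on_of_real)
      next
        case False
        then show ?thesis unfolding tm_def using uc[OF fc, of \<omega>] by (simp add: continuous_on_mult_left continuous_on_of_real)
      qed
      have um: "(\<lambda>p. h (u (snd p) (fst p))) \<in> borel_measurable (M \<Otimes>\<^sub>M lborel)" if "continuous_on UNIV h" for h :: "(nat \<Rightarrow> real) \<Rightarrow> real"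
        unfolding u_def by (rule cmk[OF that])
      have tmm: "(\<lambda>p. tm k f f' \<xi> j (u (snd p) (fst p))) \<in> borel_measurable (M \<Otimes>\<^sub>M lborel)" for j
      proof (cases "j < k")
        case True
        then show ?thesis unfolding tm_def using um[OF f'c[of j]] by simp
      next
        case False
        then show ?thesis unfolding tm_def using um[OF fc] by simp
      qed
      have Kk: "integrable M (K k)" "K k \<in> borel_measurable M" using K Km km' by auto
      have gterm: "C * \<bar>K j \<omega>\<bar> \<le> g \<omega>" if "j < m" for j \<omega>
      proof -
        have "C * \<bar>K j \<omega>\<bar> \<le> C * (1 + \<bar>\<xi> j\<bar>) * \<bar>K j \<omega>\<bar>" using C(1) by (intro mult_right_mono) (auto simp: distrib_left)
        also have "\<dots> \<le> (\<Sum>j<m. C * (1 + \<bar>\<xi> j\<bar>) * \<bar>K j \<omega>\<bar>)"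
          by (rule member_le_sum[of j "{..<m}" "\<lambda>j. C * (1 + \<bar>\<xi> j\<bar>) * \<bar>K j \<omega>\<bar>"]) (use that C(1) in auto)
        also have "\<dots> \<le> g \<omega>" unfolding g_def using C(1) by simp
        finally show ?thesis .
      qed
      have zero: "(CLINT \<omega>|M. \<Phi> (b k \<omega>) \<omega> - \<Psi>' (b k \<omega>) \<omega>) = 0"
      proof (rule fourier_extension[where g=g and \<Psi>=\<Psi>])
        show "b k \<in> borel_measurable M" by simp
        have Jm: "K j \<in> borel_measurable M" if "j \<in> J" for j using Km that by (simp add: J_def)
        show "(\<lambda>(\<omega>, y). \<Phi> y \<omega>) \<in> borel_measurable (M \<Otimes>\<^sub>M lborel)"
          unfolding \<Phi>_def case_prod_beta'
          by (intro borel_measurable_times borel_measurable_diff borel_measurable_sum tmm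
              measurable_compose[OF um[OF fc] borel_measurable_of_real] measurable_compose[OF measurable_fst em]
              measurable_compose[OF measurable_compose[OF measurable_fst Jm] borel_measurable_of_real]) measurable
        show "(\<lambda>(\<omega>, y). \<Psi> y \<omega>) \<in> borel_measurable (M \<Otimes>\<^sub>M lborel)" "(\<lambda>(\<omega>, y). \<Psi>' y \<omega>) \<in> borel_measurable (M \<Otimes>\<^sub>M lborel)"
          unfolding \<Psi>_def \<Psi>'_def case_prod_beta'
          by (intro borel_measurable_times measurable_compose[OF um[OF fc] borel_measurable_of_real] measurable_compose[OF um[OF f'c[of k]] borel_measurable_of_real]
              measurable_compose[OF measurable_fst em] measurable_compose[OF measurable_compose[OF measurable_fst Kk(2)] borel_measurable_of_real]; simp)+
        show "integrable M g" unfolding g_def[abs_def] using G K by (intro Bochner_Integration.integrable_add Bochner_Integration.integrable_sum) auto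
        show "cmod (\<Phi> y \<omega>) \<le> g \<omega>" for y \<omega>
        proof -
          have "cmod (\<Phi> y \<omega>) \<le> cmod (of_real (f (u y \<omega>)) * of_real (G \<omega>)) + cmod (\<Sum>j\<in>J. tm k f f' \<xi> j (u y \<omega>) * of_real (K j \<omega>))"
            unfolding \<Phi>_def norm_mult e1 by (simp only: mult_1 norm_mult[symmetric]) (rule norm_triangle_ineq4)
          also have "\<dots> \<le> C * \<bar>G \<omega>\<bar> + (\<Sum>j\<in>J. C * (1 + \<bar>\<xi> j\<bar>) * \<bar>K j \<omega>\<bar>)"
            using C(2) tmb by (intro add_mono sum_norm_le) (auto simp: norm_mult intro!: mult_right_mono)
          also have "\<dots> \<le> g \<omega>" unfolding g_def J_def using C(1) by (intro add_left_mono sum_mono2) auto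
          finally show ?thesis .
        qed
        show "cmod (\<Psi> y \<omega>) \<le> g \<omega>" for y \<omega>
        proof -
          have "cmod (\<Psi> y \<omega>) = \<bar>f (u y \<omega>)\<bar> * \<bar>K k \<omega>\<bar>" unfolding \<Psi>_def norm_mult e1 by simp
          also have "\<dots> \<le> C * \<bar>K k \<omega>\<bar>" using C(2) by (intro mult_right_mono) auto
          finally show ?thesis using gterm[OF km', of \<omega>] by linarith
        qed
        show "cmod (\<Psi>' y \<omega>) \<le> g \<omega>" for y \<omega>
        proof -
          have "cmod (\<Psi>' y \<omega>) = \<bar>f' k (u y \<omega>)\<bar> * \<bar>K k \<omega>\<bar>" unfolding \<Psi>'_def norm_mult e1 by simp
          also have "\<dots> \<le> C * \<bar>K k \<omega>\<bar>" using C(3)[of k] by (intro mult_right_mono) auto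
          finally show ?thesis using gterm[OF km', of \<omega>] by linarith
        qed
        show "continuous_on UNIV (\<lambda>y. \<Phi> y \<omega>)" for \<omega>
          unfolding \<Phi>_def by (intro continuous_intros tmc uc fc)
        show "continuous_on UNIV (\<lambda>y. \<Psi>' y \<omega>)" for \<omega>
          unfolding \<Psi>'_def by (intro continuous_intros uc f'c) simp
        show "((\<lambda>y. \<Psi> y \<omega>) has_vector_derivative \<Psi>' y \<omega>) (at y)" for y \<omega>
        proof -
          have "((\<lambda>h. f ((u y \<omega>)(k := h))) has_real_derivative f' k (u y \<omega>)) (at ((u y \<omega>) k))" by (rule fd) simp
          then have "((\<lambda>h. f (u h \<omega>)) has_real_derivative f' k (u y \<omega>)) (at y)" by (simp add: u_def)
          from has_vector_derivative_of_real[OF this, where 'a=complex]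
          have "((\<lambda>h. complex_of_real (f (u h \<omega>))) has_vector_derivative of_real (f' k (u y \<omega>))) (at y)" .
          then show ?thesis unfolding \<Psi>_def \<Psi>'_def
            by (intro has_vector_derivative_mult_right has_vector_derivative_mult_left)
        qed
        fix \<eta> y :: real
        \<comment> \<open>With coordinate k frozen at y and given the frequency \<eta>, the
          induction hypothesis for k becomes the hypothesis of
          \<open>fourier_extension\<close>.\<close>
        have "A k (\<lambda>x. f (x(k := y))) (\<lambda>i x. f' i (x(k := y))) (\<xi>(k := \<eta>)) \<omega> = iexp (\<eta> * b k \<omega>) * (\<Phi> y \<omega> - \<i> * of_real \<eta> * \<Psi> y \<omega>)" for \<omega>
        proof -
          have s1: "(\<Sum>j\<in>{k..<m}. (\<xi>(k := \<eta>)) j * b j \<omega>) = \<eta> * b k \<omega> + (\<Sum>j\<in>{Suc k..<m}. \<xi> j * b j \<omega>)"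
            using km' by (subst sum.atLeast_Suc_lessThan) (auto intro!: sum.cong)
          have s2: "E k (\<xi>(k := \<eta>)) \<omega> = iexp (\<eta> * b k \<omega>) * e \<omega>"
            unfolding E_def s1 e_def by (simp add: exp_add distrib_left)
          have "(\<Sum>j<m. tm k (\<lambda>x. f (x(k := y))) (\<lambda>i x. f' i (x(k := y))) (\<xi>(k := \<eta>)) j (\<beta> \<omega>) * of_real (K j \<omega>))
            = \<i> * of_real \<eta> * of_real (f (u y \<omega>)) * of_real (K k \<omega>) + (\<Sum>j\<in>J. tm k f f' \<xi> j (u y \<omega>) * of_real (K j \<omega>))"
          proof -
            have "(\<Sum>j\<in>J. tm k (\<lambda>x. f (x(k := y))) (\<lambda>i x. f' i (x(k := y))) (\<xi>(k := \<eta>)) j (\<beta> \<omega>) * of_real (K j \<omega>))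
              = (\<Sum>j\<in>J. tm k f f' \<xi> j (u y \<omega>) * of_real (K j \<omega>))"
              by (intro sum.cong refl) (simp add: tm_def u_def J_def)
            then show ?thesis
              using sum.remove[of "{..<m}" k "\<lambda>j. tm k (\<lambda>x. f (x(k := y))) (\<lambda>i x. f' i (x(k := y))) (\<xi>(k := \<eta>)) j (\<beta> \<omega>) * of_real (K j \<omega>)"] km'
              by (simp add: J_def[symmetric]) (simp add: tm_def u_def)
          qed
          then show ?thesis unfolding A_def s2 \<Phi>_def \<Psi>_def by (simp add: u_def algebra_simps)
        qed
        then show "(CLINT \<omega>|M. iexp (\<eta> * b k \<omega>) * (\<Phi> y \<omega> - \<i> * of_real \<eta> * \<Psi> y \<omega>)) = 0"
          using IH[OF C1b_freeze[OF f, of y], of "\<xi>(k := \<eta>)"] by simp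
      qed
      have "A (Suc k) f f' \<xi> \<omega> = \<Phi> (b k \<omega>) \<omega> - \<Psi>' (b k \<omega>) \<omega>" for \<omega>
      proof -
        have u: "u (b k \<omega>) \<omega> = \<beta> \<omega>" by (auto simp: u_def \<beta>_def)
        have "(\<Sum>j<m. tm (Suc k) f f' \<xi> j (\<beta> \<omega>) * of_real (K j \<omega>)) = of_real (f' k (\<beta> \<omega>)) * of_real (K k \<omega>) + (\<Sum>j\<in>J. tm k f f' \<xi> j (\<beta> \<omega>) * of_real (K j \<omega>))"
        proof -
          have "(\<Sum>j\<in>J. tm (Suc k) f f' \<xi> j (\<beta> \<omega>) * of_real (K j \<omega>)) = (\<Sum>j\<in>J. tm k f f' \<xi> j (\<beta> \<omega>) * of_real (K j \<omega>))"
            by (intro sum.cong refl) (simp add: tm_def J_def less_Suc_eq)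
          then show ?thesis
            using sum.remove[of "{..<m}" k "\<lambda>j. tm (Suc k) f f' \<xi> j (\<beta> \<omega>) * of_real (K j \<omega>)"] km'
            by (simp add: J_def[symmetric]) (simp add: tm_def)
        qed
        then show ?thesis unfolding A_def \<Phi>_def \<Psi>'_def u e_def by (simp add: algebra_simps)
      qed
      then show "(CLINT \<omega>|M. A (Suc k) f f' \<xi> \<omega>) = 0" using zero by simp
    qed
  qed
  obtain C where C: "C \<ge> 0" "\<And>x. \<bar>f x\<bar> \<le> C" "\<And>i x. i < m \<Longrightarrow> \<bar>f' i x\<bar> \<le> C"
    using C1b_bound[OF f] by blast
  have bi: "integrable M (\<lambda>\<omega>. h (\<beta> \<omega>) * F \<omega>)" if h: "continuous_on UNIV h" "\<And>x. \<bar>h x\<bar> \<le> C" and F: "integrable M F" for h F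
  proof (rule Bochner_Integration.integrable_bound[of _ "\<lambda>\<omega>. C * F \<omega>"])
    show "AE \<omega> in M. norm (h (\<beta> \<omega>) * F \<omega>) \<le> norm (C * F \<omega>)"
      using h(2) C(1) by (auto simp: abs_mult intro!: mult_right_mono)
    show "(\<lambda>\<omega>. h (\<beta> \<omega>) * F \<omega>) \<in> borel_measurable M"
      using cm[OF h(1)] F by measurable
  qed (use F in simp)
  have fi: "integrable M (\<lambda>\<omega>. f (\<beta> \<omega>) * G \<omega>)" using f C by (intro bi G) (auto simp: C1b_def)
  have f'i: "integrable M (\<lambda>\<omega>. f' j (\<beta> \<omega>) * K j \<omega>)" if "j < m" for j
    using f C(3)[OF that] that by (intro bi K) (auto simp: C1b_def)
  have "A m f f' (\<lambda>_. 0) \<omega> = of_real (f (\<beta> \<omega>) * G \<omega> - (\<Sum>j<m. f' j (\<beta> \<omega>) * K j \<omega>))" for \<omega>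
    unfolding A_def E_def by (auto simp: tm_def intro!: sum.cong)
  moreover have "(CLINT \<omega>|M. A m f f' (\<lambda>_. 0) \<omega>) = 0" using main[of m] f by simp
  ultimately have "complex_of_real (expectation (\<lambda>\<omega>. f (\<beta> \<omega>) * G \<omega> - (\<Sum>j<m. f' j (\<beta> \<omega>) * K j \<omega>))) = 0"
    by (simp only: integral_complex_of_real)
  then have "expectation (\<lambda>\<omega>. f (\<beta> \<omega>) * G \<omega> - (\<Sum>j<m. f' j (\<beta> \<omega>) * K j \<omega>)) = 0" by simp
  moreover have "expectation (\<lambda>\<omega>. f (\<beta> \<omega>) * G \<omega> - (\<Sum>j<m. f' j (\<beta> \<omega>) * K j \<omega>))
      = expectation (\<lambda>\<omega>. f (\<beta> \<omega>) * G \<omega>) - expectation (\<lambda>\<omega>. \<Sum>j<m. f' j (\<beta> \<omega>) * K j \<omega>)"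
    by (rule Bochner_Integration.integral_diff[OF fi Bochner_Integration.integrable_sum[OF f'i]]) simp
  moreover have "expectation (\<lambda>\<omega>. \<Sum>j<m. f' j (\<beta> \<omega>) * K j \<omega>) = (\<Sum>j<m. expectation (\<lambda>\<omega>. f' j (\<beta> \<omega>) * K j \<omega>))"
    by (rule Bochner_Integration.integral_sum[OF f'i]) simp
  ultimately show ?thesis unfolding \<beta>_def by simp
qed

end

section \<open>Cylindrical test functions determine a random variable\<close>

definition logistic :: "real \<Rightarrow> real" where "logistic x = 1 / (1 + exp (- x))"

lemma logistic_range: "0 < logistic x" "logistic x < 1"
  by (simp_all add: logistic_def add_pos_pos)

lemma logistic_deriv: "(logistic has_real_derivative logistic x * (1 - logistic x)) (at x)"
proof -
  have "1 + exp (- x) > 0" by (simp add: add_pos_pos)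
  then show ?thesis unfolding logistic_def[abs_def]
    by (auto intro!: derivative_eq_intros simp: field_simps power2_eq_square)
qed

lemma logistic_at_top: "(logistic \<longlongrightarrow> 1) at_top"
proof -
  have "((\<lambda>x::real. exp (- x)) \<longlongrightarrow> 0) at_top"
    by (rule filterlim_compose[OF exp_at_bot]) (simp add: filterlim_uminus_at_bot filterlim_ident)
  then have "((\<lambda>x::real. 1 / (1 + exp (- x))) \<longlongrightarrow> 1 / (1 + 0)) at_top" by (intro tendsto_intros) auto
  then show ?thesis by (simp add: logistic_def[abs_def])
qed

lemma logistic_at_bot: "(logistic \<longlongrightarrow> 0) at_bot"
proof -
  have e: "logistic x = exp x / (1 + exp x)" for x
  proof -
    have "1 + exp (- x) = (1 + exp x) / exp x" by (simp add: exp_minus field_simps)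
    then show ?thesis by (simp add: logistic_def)
  qed
  have "((\<lambda>x::real. exp x / (1 + exp x)) \<longlongrightarrow> 0 / (1 + 0)) at_bot" by (intro tendsto_intros exp_at_bot) auto
  then show ?thesis by (simp add: e[abs_def])
qed

text \<open>Since logistic' = logistic (1 - logistic), polynomials in logistic functions are closed
  under differentiation; \<open>[:0, 1, -1:]\<close> is y - y^2. Their products over coordinates are
  therefore bounded with all derivatives, and steep ones approximate indicators.\<close>

definition logistic_prod :: "nat \<Rightarrow> (nat \<Rightarrow> real poly) \<Rightarrow> (nat \<Rightarrow> real) \<Rightarrow> (nat \<Rightarrow> real) \<Rightarrow> (nat \<Rightarrow> real) \<Rightarrow> real" where
  "logistic_prod m p c d x = (\<Prod>i<m. poly (p i) (logistic (c i * x i + d i)))"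

lemma logistic_prod_deriv:
  assumes i: "i < m"
  shows "((\<lambda>h. logistic_prod m p c d (x(i := h))) has_real_derivative
    logistic_prod m (p(i := smult (c i) (pderiv (p i) * [:0, 1, -1:]))) c d x) (at (x i))"
proof -
  let ?q = "p(i := smult (c i) (pderiv (p i) * [:0, 1, -1:]))"
  let ?s = "\<lambda>h. logistic (c i * h + d i)"
  define R where "R = (\<Prod>j\<in>{..<m} - {i}. poly (p j) (logistic (c j * x j + d j)))"
  have e: "logistic_prod m p c d (x(i := h)) = poly (p i) (?s h) * R" for h
    unfolding logistic_prod_def R_def using i
    by (subst prod.remove[of _ i]) (auto intro!: prod.cong)
  have e': "logistic_prod m ?q c d x = poly (smult (c i) (pderiv (p i) * [:0, 1, -1:])) (?s (x i)) * R"
    unfolding logistic_prod_def R_def using i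
    by (subst prod.remove[of _ i]) (auto intro!: prod.cong)
  have "((\<lambda>h. c i * h + d i) has_real_derivative c i) (at (x i))" by (auto intro!: derivative_eq_intros)
  from DERIV_chain2[OF logistic_deriv this]
  have s: "(?s has_real_derivative ?s (x i) * (1 - ?s (x i)) * c i) (at (x i))" .
  from DERIV_chain2[OF poly_DERIV s]
  have "((\<lambda>h. poly (p i) (?s h)) has_real_derivative poly (pderiv (p i)) (?s (x i)) * (?s (x i) * (1 - ?s (x i)) * c i)) (at (x i))" .
  from DERIV_cmult_right[OF this, of R]
  have "((\<lambda>h. poly (p i) (?s h) * R) has_real_derivative poly (pderiv (p i)) (?s (x i)) * (?s (x i) * (1 - ?s (x i)) * c i) * R) (at (x i))" .
  then show ?thesis unfolding e e' by (simp add: algebra_simps)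
qed

lemma logistic_continuous: "continuous_on A logistic"
  by (rule DERIV_continuous_on[of _ _ "\<lambda>x. logistic x * (1 - logistic x)"]) (rule DERIV_subset[OF logistic_deriv], simp)

lemma logistic_prod_continuous: "continuous_on UNIV (logistic_prod m p c d)"
  unfolding logistic_prod_def[abs_def]
  by (intro continuous_intros continuous_on_compose2[OF logistic_continuous[of UNIV]] continuous_on_product_coordinates) auto

lemma logistic_prod_bounded: "bounded (range (logistic_prod m p c d))"
proof -
  have "\<exists>C. \<forall>y\<in>{0..1}. \<bar>poly q y\<bar> \<le> C" for q :: "real poly"
  proof -
    have "compact ((\<lambda>y. poly q y) ` {0..1})" by (intro compact_continuous_image continuous_intros) auto
    then have "bounded ((\<lambda>y. poly q y) ` {0..1})" by (rule compact_imp_bounded)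
    then show ?thesis by (auto simp: bounded_iff)
  qed
  then have "\<forall>i. \<exists>C. \<forall>y\<in>{0..1}. \<bar>poly (p i) y\<bar> \<le> C" by blast
  from choice[OF this] obtain C where C: "\<And>i y. y \<in> {0..1} \<Longrightarrow> \<bar>poly (p i) y\<bar> \<le> C i" by blast
  have "\<bar>logistic_prod m p c d x\<bar> \<le> (\<Prod>i<m. C i)" for x
    unfolding logistic_prod_def abs_prod
    by (intro prod_mono conjI C) (auto intro: less_imp_le logistic_range)
  then show ?thesis by (auto simp: bounded_iff)
qed

lemma logistic_prod_partial:
  assumes "i < m"
  shows "partial_deriv i (logistic_prod m p c d) = logistic_prod m (p(i := smult (c i) (pderiv (p i) * [:0, 1, -1:]))) c d"
  unfolding partial_deriv_def using DERIV_imp_deriv[OF logistic_prod_deriv[OF assms]] by blast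

lemma Cb_smooth_logistic_prod: "Cb_smooth m (logistic_prod m p c d)"
proof -
  have ex: "\<exists>q. foldr partial_deriv is (logistic_prod m p c d) = logistic_prod m q c d" if "is \<in> lists {..<m}" for "is"
    using that
  proof (induction "is")
    case (Cons i "is")
    then obtain q where "foldr partial_deriv is (logistic_prod m p c d) = logistic_prod m q c d" by auto
    moreover have "i < m" using Cons by simp
    ultimately have "foldr partial_deriv (i # is) (logistic_prod m p c d)
      = logistic_prod m (q(i := smult (c i) (pderiv (q i) * [:0, 1, -1:]))) c d"
      using logistic_prod_partial[of i m q c d] by simp
    then show ?case by (intro exI[of _ "q(i := smult (c i) (pderiv (q i) * [:0, 1, -1:]))"])
  qed auto
  have dep: "logistic_prod m p c d x = logistic_prod m p c d y" if "\<forall>i<m. x i = y i" for x y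
    unfolding logistic_prod_def using that by (intro prod.cong) auto
  have "let g = foldr partial_deriv is (logistic_prod m p c d) in continuous_on UNIV g \<and> bounded (range g) \<and>
        (\<forall>i<m. \<forall>x. (\<lambda>h. g (x(i := h))) differentiable at (x i))" if isl: "is \<in> lists {..<m}" for "is"
  proof -
    obtain q where q: "foldr partial_deriv is (logistic_prod m p c d) = logistic_prod m q c d" using ex[OF isl] by blast
    show ?thesis unfolding q Let_def
      using logistic_prod_continuous logistic_prod_bounded logistic_prod_deriv real_differentiable_def by blast
  qed
  then show ?thesis unfolding Cb_smooth_def using dep by blast
qed

text \<open>The shift sqrt n makes the limit 1 also at x = a, where the unshifted functions would
  stay at 1/2; for x > a it is negligible against n (x - a).\<close>

lemma logistic_indicator_limit:
  "(\<lambda>n. logistic (- real n * x + (real n * a + sqrt (real n)))) \<longlonglongrightarrow> (if x \<le> a then 1 else 0)"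
proof (cases "x \<le> a")
  case True
  have "filterlim (\<lambda>n. - real n * x + (real n * a + sqrt (real n))) at_top sequentially"
  proof (rule filterlim_at_top_mono)
    show "filterlim (\<lambda>n. sqrt (real n)) at_top sequentially"
      by (rule filterlim_compose[OF sqrt_at_top filterlim_real_sequentially])
    show "\<forall>\<^sub>F n in sequentially. sqrt (real n) \<le> - real n * x + (real n * a + sqrt (real n))"
      using True by (auto intro!: always_eventually mult_left_mono)
  qed
  from filterlim_compose[OF logistic_at_top this] show ?thesis using True by simp
next
  case False
  have "filterlim (\<lambda>n. sqrt (real n) * (- 1 + (x - a) * sqrt (real n))) at_top sequentially"
  proof (rule filterlim_at_top_mult_at_top)
    show s: "filterlim (\<lambda>n. sqrt (real n)) at_top sequentially"
      by (rule filterlim_compose[OF sqrt_at_top filterlim_real_sequentially])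
    have "filterlim (\<lambda>n. (x - a) * sqrt (real n)) at_top sequentially"
      by (rule filterlim_tendsto_pos_mult_at_top[OF tendsto_const _ s]) (use False in simp)
    from filterlim_tendsto_add_at_top[OF tendsto_const[of "- 1"] this]
    show "filterlim (\<lambda>n. - 1 + (x - a) * sqrt (real n)) at_top sequentially" .
  qed
  moreover have "- real n * x + (real n * a + sqrt (real n)) = - (sqrt (real n) * (- 1 + (x - a) * sqrt (real n)))" for n
    by (simp add: algebra_simps)
  ultimately have "filterlim (\<lambda>n. - real n * x + (real n * a + sqrt (real n))) at_bot sequentially"
    by (simp add: filterlim_uminus_at_bot)
  from filterlim_compose[OF logistic_at_bot this] show ?thesis using False by simp
qed

text \<open>Products of logistic functions approximate indicators of cylinder sets, so
  \<open>D\<close> integrates to 0 over an intersection-stable generator, hence over the generated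
  sigma-field by Dynkin's theorem, and over every event by completion.\<close>

lemma (in prob_space) zero_of_cylindrical:
  fixes B :: "real \<Rightarrow> 'a \<Rightarrow> real" and D :: "'a \<Rightarrow> real"
  assumes gen: "generated_by_process M B"
    and B: "\<And>t. t \<ge> 0 \<Longrightarrow> B t \<in> borel_measurable M" and D: "integrable M D"
    and z: "\<And>m f \<tau>. Cb_smooth m f \<Longrightarrow> (\<And>i. i < m \<Longrightarrow> 0 \<le> \<tau> i) \<Longrightarrow> expectation (\<lambda>\<omega>. cylindrical B f \<tau> \<omega> * D \<omega>) = 0"
  shows "AE \<omega> in M. D \<omega> = 0"
proof -
  have Dm[measurable]: "D \<in> borel_measurable M" using D by auto
  define cyl where "cyl m \<tau> a = {\<omega> \<in> space M. \<forall>i<m. B (\<tau> i) \<omega> \<le> a i}" for m :: nat and \<tau> a :: "nat \<Rightarrow> real"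
  define P where "P = {cyl m \<tau> a | m \<tau> a. \<forall>i<m. 0 \<le> \<tau> i}"
  have cylm: "cyl m \<tau> a \<in> sets M" if "\<forall>i<m. 0 \<le> \<tau> i" for m \<tau> a
  proof -
    have "{\<omega> \<in> space M. B (\<tau> i) \<omega> \<le> a i} \<in> sets M" if "i < m" for i
    proof -
      have [measurable]: "B (\<tau> i) \<in> borel_measurable M" using B \<open>\<forall>i<m. 0 \<le> \<tau> i\<close> that by auto
      show ?thesis by measurable
    qed
    then have "{\<omega> \<in> space M. \<forall>i\<in>{..<m}. B (\<tau> i) \<omega> \<le> a i} \<in> sets M"
      by (intro sets.sets_Collect_finite_All) auto
    moreover have "cyl m \<tau> a = {\<omega> \<in> space M. \<forall>i\<in>{..<m}. B (\<tau> i) \<omega> \<le> a i}" unfolding cyl_def by auto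
    ultimately show ?thesis by (simp only:)
  qed

  have Psub: "P \<subseteq> Pow (space M)" unfolding P_def cyl_def by auto
  have iI: "integrable M (\<lambda>\<omega>. indicator A \<omega> * D \<omega>)" if "A \<in> sets M" for A
    using integrable_mult_indicator[OF that D] by simp
  have cyl0: "expectation (\<lambda>\<omega>. indicator (cyl m \<tau> a) \<omega> * D \<omega>) = 0" if \<tau>: "\<forall>i<m. 0 \<le> \<tau> i" for m \<tau> a
  proof -
    define F where "F n \<omega> = (\<Prod>i<m. logistic (- real n * B (\<tau> i) \<omega> + (real n * a i + sqrt (real n))))" for n \<omega>
    have Fc: "F n \<omega> = cylindrical B (logistic_prod m (\<lambda>_. [:0, 1:]) (\<lambda>_. - real n) (\<lambda>i. real n * a i + sqrt (real n))) \<tau> \<omega>" for n \<omega>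
      by (simp add: F_def cylindrical_def logistic_prod_def)
    have F0: "expectation (\<lambda>\<omega>. F n \<omega> * D \<omega>) = 0" for n
      unfolding Fc by (rule z[OF Cb_smooth_logistic_prod[of m]]) (use \<tau> in auto)
    have Fb: "0 \<le> F n \<omega>" "F n \<omega> \<le> 1" for n \<omega>
      unfolding F_def using less_imp_le[OF logistic_range(1)] less_imp_le[OF logistic_range(2)]
      by (auto intro!: prod_nonneg prod_le_1)
    have [measurable]: "F n \<in> borel_measurable M" for n
      unfolding F_def[abs_def]
    proof (rule borel_measurable_prod)
      fix i assume "i \<in> {..<m}"
      then have [measurable]: "B (\<tau> i) \<in> borel_measurable M" using B \<tau> by auto
      show "(\<lambda>\<omega>. logistic (- real n * B (\<tau> i) \<omega> + (real n * a i + sqrt (real n)))) \<in> borel_measurable M"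
        unfolding logistic_def by measurable
    qed
    have l: "(\<lambda>n. F n \<omega>) \<longlonglongrightarrow> indicator (cyl m \<tau> a) \<omega>" if "\<omega> \<in> space M" for \<omega>
    proof -
      have "(\<lambda>n. F n \<omega>) \<longlonglongrightarrow> (\<Prod>i<m. if B (\<tau> i) \<omega> \<le> a i then 1 else 0)"
        unfolding F_def by (intro tendsto_prod logistic_indicator_limit)
      also have "(\<Prod>i<m. if B (\<tau> i) \<omega> \<le> a i then 1 else 0 :: real) = indicator (cyl m \<tau> a) \<omega>"
        using that by (auto simp: cyl_def indicator_def not_le)
      finally show ?thesis .
    qed
    have "(\<lambda>n. expectation (\<lambda>\<omega>. F n \<omega> * D \<omega>)) \<longlonglongrightarrow> expectation (\<lambda>\<omega>. indicator (cyl m \<tau> a) \<omega> * D \<omega>)"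
    proof (rule integral_dominated_convergence[where w="\<lambda>\<omega>. \<bar>D \<omega>\<bar>"])
      show "AE \<omega> in M. (\<lambda>n. F n \<omega> * D \<omega>) \<longlonglongrightarrow> indicator (cyl m \<tau> a) \<omega> * D \<omega>"
        by (intro AE_I2 tendsto_mult_right l)
      show "AE \<omega> in M. norm (F n \<omega> * D \<omega>) \<le> \<bar>D \<omega>\<bar>" for n
        using Fb by (auto simp: abs_mult intro!: mult_left_le_one_le)
      show "(\<lambda>\<omega>. indicator (cyl m \<tau> a) \<omega> * D \<omega>) \<in> borel_measurable M"
        using cylm[OF \<tau>] by measurable
    qed (use D in auto)
    then show ?thesis unfolding F0 by (simp add: LIMSEQ_const_iff)
  qed
  \<comment> \<open>Two lists of conditions are concatenated: indices from \<open>m1\<close> on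
    refer to the second list. Times may repeat.\<close>
  have Int: "Int_stable P"
  proof (rule Int_stableI)
    fix A1 A2 assume "A1 \<in> P" "A2 \<in> P"
    then obtain m1 \<tau>1 a1 m2 \<tau>2 a2 where 1: "A1 = cyl m1 \<tau>1 a1" "\<forall>i<m1. 0 \<le> \<tau>1 i" and 2: "A2 = cyl m2 \<tau>2 a2" "\<forall>i<m2. 0 \<le> \<tau>2 i"
      unfolding P_def by blast
    define \<tau> where "\<tau> i = (if i < m1 then \<tau>1 i else \<tau>2 (i - m1))" for i
    define a where "a i = (if i < m1 then a1 i else a2 (i - m1))" for i
    have "A1 \<inter> A2 = cyl (m1 + m2) \<tau> a"
    proof (intro set_eqI iffI)
      fix \<omega> assume \<omega>: "\<omega> \<in> A1 \<inter> A2"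
      then show "\<omega> \<in> cyl (m1 + m2) \<tau> a" unfolding 1 2 cyl_def \<tau>_def a_def by auto
    next
      fix \<omega> assume \<omega>: "\<omega> \<in> cyl (m1 + m2) \<tau> a"
      have "B (\<tau>1 i) \<omega> \<le> a1 i" if "i < m1" for i
        using \<omega> that unfolding cyl_def \<tau>_def a_def by (auto dest: spec[of _ i])
      moreover have "B (\<tau>2 i) \<omega> \<le> a2 i" if "i < m2" for i
        using \<omega> that unfolding cyl_def \<tau>_def a_def by (auto dest: spec[of _ "m1 + i"])
      ultimately show "\<omega> \<in> A1 \<inter> A2" using \<omega> unfolding 1 2 cyl_def by auto
    qed
    moreover have "\<forall>i<m1 + m2. 0 \<le> \<tau> i" using 1(2) 2(2) unfolding \<tau>_def by auto
    ultimately show "A1 \<inter> A2 \<in> P" unfolding P_def by blast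
  qed
  have sigma0: "A \<in> sets M \<and> expectation (\<lambda>\<omega>. indicator A \<omega> * D \<omega>) = 0" if "A \<in> sigma_sets (space M) P" for A
    using Int Psub that
  proof (induction rule: sigma_sets_induct_disjoint)
    case (basic A)
    then show ?case using cyl0 cylm unfolding P_def by auto
  next
    case (compl A)
    have "cyl 0 (\<lambda>_. 0) (\<lambda>_. 0) = space M" by (simp add: cyl_def)
    then have sp: "expectation (\<lambda>\<omega>. indicator (space M) \<omega> * D \<omega>) = 0" using cyl0[of 0 "\<lambda>_. 0" "\<lambda>_. 0"] by simp
    have "expectation (\<lambda>\<omega>. indicator (space M - A) \<omega> * D \<omega>) = expectation (\<lambda>\<omega>. indicator (space M) \<omega> * D \<omega> - indicator A \<omega> * D \<omega>)"
      using compl sets.sets_into_space[of A M] by (intro Bochner_Integration.integral_cong) (auto simp: indicator_def)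
    also have "\<dots> = 0" using compl sp iI[of "space M"] iI[of A] by simp
    finally show ?case using compl by auto
  next
    case (union A)
    have s: "\<Union>(range A) \<in> sets M" using union by auto
    have "(LINT \<omega>:(\<Union>i. A i)|M. D \<omega>) = (\<Sum>i. (LINT \<omega>:(A i)|M. D \<omega>))"
    proof (rule lebesgue_integral_countable_add)
      show "\<And>i j. i \<noteq> j \<Longrightarrow> A i \<inter> A j = {}" using union(1) by (auto simp: disjoint_family_on_def)
      show "set_integrable M (\<Union>i. A i) D" unfolding set_integrable_def using iI[OF s] by simp
    qed (use union in auto)
    then show ?case using s union by (simp add: set_lebesgue_integral_def)
  qed simp
  let ?G = "{B t -` A \<inter> space M | t A. 0 \<le> t \<and> A \<in> sets borel}"
  define F where "F = sigma (space M) ?G"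
  have Gsub: "?G \<subseteq> Pow (space M)" by auto
  have sF: "sets F = sigma_sets (space M) ?G" "space F = space M"
    unfolding F_def using Gsub by (auto simp: sets_measure_of space_measure_of)
  have "?G \<subseteq> sigma_sets (space M) P"
  proof
    fix E assume "E \<in> ?G"
    then obtain t A where E: "E = B t -` A \<inter> space M" "0 \<le> t" "A \<in> sets borel" by blast
    define N where "N = sigma (space M) P"
    have N: "sets N = sigma_sets (space M) P" "space N = space M"
      unfolding N_def using Psub by (auto simp: sets_measure_of space_measure_of)
    have "B t \<in> borel_measurable N"
    proof (rule borel_measurableI_le)
      fix y
      have "{\<omega> \<in> space N. B t \<omega> \<le> y} = cyl 1 (\<lambda>_. t) (\<lambda>_. y)" by (auto simp: N cyl_def)
      moreover have "cyl 1 (\<lambda>_. t) (\<lambda>_. y) \<in> P" unfolding P_def using E(2) by blast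
      ultimately show "{\<omega> \<in> space N. B t \<omega> \<le> y} \<in> sets N" unfolding N by (simp add: sigma_sets.Basic)
    qed
    then show "E \<in> sigma_sets (space M) P" using measurable_sets[of "B t" N borel A] E N by simp
  qed
  then have Gs: "sigma_sets (space M) ?G \<subseteq> sigma_sets (space M) P" by (rule sigma_sets_mono)
  have F0: "A \<in> sets M" "expectation (\<lambda>\<omega>. indicator A \<omega> * D \<omega>) = 0" if "A \<in> sets F" for A
    using sigma0[OF subsetD[OF Gs that[unfolded sF(1)]]] by blast+
  have sub: "subalgebra M F" unfolding subalgebra_def using F0(1) sF(2) by blast
  \<comment> \<open>An event of \<open>M\<close> is one of the generated sigma-field together with a
    part of a null set, which does not affect the integral.\<close>
  have all0: "expectation (\<lambda>\<omega>. indicator A \<omega> * D \<omega>) = 0" if A: "A \<in> sets M" for A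
  proof -
    have "A \<in> sets (completion (restr_to_subalg M F))"
      using gen A unfolding generated_by_process_def F_def by (simp only:)
    then obtain S' N N' where S: "A = S' \<union> N" "N \<subseteq> N'" "N' \<in> null_sets (restr_to_subalg M F)" "S' \<in> sets (restr_to_subalg M F)"
      by (rule sets_completionE)
    have N': "N' \<in> null_sets M" using S(3) null_sets_restr_to_subalg[OF sub] by auto
    have S': "S' \<in> sets F" using S(4) sets_restr_to_subalg[OF sub] by simp
    have S'M: "S' \<in> sets M" using F0(1)[OF S'] .
    have "expectation (\<lambda>\<omega>. indicator A \<omega> * D \<omega>) = expectation (\<lambda>\<omega>. indicator S' \<omega> * D \<omega>)"
    proof (rule integral_cong_AE)
      show "AE \<omega> in M. indicator A \<omega> * D \<omega> = indicator S' \<omega> * D \<omega>"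
        using AE_not_in[OF N'] by eventually_elim (use S in \<open>auto simp: indicator_def\<close>)
    qed (use A S'M in measurable)
    then show ?thesis using F0(2)[OF S'] by simp
  qed
  have "AE \<omega> in M. D \<omega> = (\<lambda>_. 0) \<omega>"
  proof (rule density_unique_real[OF D])
    fix A assume "A \<in> sets M"
    then show "(LINT \<omega>:A|M. D \<omega>) = (LINT \<omega>:A|M. 0)" using all0 by (simp add: set_lebesgue_integral_def)
  qed simp
  then show ?thesis by simp
qed

text \<open>Completeness transfers measurability along almost sure equality; this is how the pairing
  \<open>H_inner\<close> with a Malliavin derivative is seen to be a random variable.\<close>

lemma (in complete_measure) borel_measurable_AE_cong:
  fixes f g :: "'a \<Rightarrow> real"
  assumes f: "f \<in> borel_measurable M" and e: "AE x in M. f x = g x"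
  shows "g \<in> borel_measurable M"
proof (rule borel_measurableI_le)
  fix y
  show "{x \<in> space M. g x \<le> y} \<in> sets M"
  proof (rule in_sets_AE)
    show "{x \<in> space M. f x \<le> y} \<in> sets M" using f by measurable
    show "AE x in M. x \<in> {x \<in> space M. f x \<le> y} \<longleftrightarrow> x \<in> {x \<in> space M. g x \<le> y}"
      using e by eventually_elim auto
  qed auto
qed

lemma C1b_bound_ex:
  assumes "C1b k f f'"
  shows "\<exists>C. (\<forall>x. \<bar>f x\<bar> \<le> C) \<and> (\<forall>i<k. \<forall>x. \<bar>f' i x\<bar> \<le> C)"
proof (rule C1b_bound[OF assms])
  fix C assume "C \<ge> 0" "\<And>x. \<bar>f x\<bar> \<le> C" "\<And>i x. i < k \<Longrightarrow> \<bar>f' i x\<bar> \<le> C"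
  then show ?thesis by (intro exI[of _ C]) auto
qed

section \<open>The inner product of step functions\<close>

definition riesz :: "real \<Rightarrow> real \<Rightarrow> real \<Rightarrow> real" where
  "riesz H \<tau> t = (sgn t * \<bar>t\<bar> powr (2 * H - 1) + sgn (\<tau> - t) * \<bar>\<tau> - t\<bar> powr (2 * H - 1)) / (2 * H - 1)"

lemma fbm_cov'_riesz: "1/2 < H \<Longrightarrow> fbm_cov' H \<tau> t = H * (2 * H - 1) * riesz H \<tau> t"
  by (simp add: fbm_cov'_def riesz_def)

text \<open>The integrand is singular at s = t. Its primitive is continuous there because 2 H - 1 >
  0, so the fundamental theorem applies with one exceptional point.\<close>

lemma riesz_integral:
  assumes H: "1/2 < H" and \<tau>: "\<tau> \<ge> 0"
  shows "((\<lambda>s. \<bar>t - s\<bar> powr (2 * H - 2)) has_integral riesz H \<tau> t) {0..\<tau>}"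
proof -
  define F where "F s = sgn (s - t) * \<bar>s - t\<bar> powr (2 * H - 1) / (2 * H - 1)" for s
  have "((\<lambda>s. \<bar>t - s\<bar> powr (2 * H - 2)) has_integral F \<tau> - F 0) {0..\<tau>}"
  proof (rule fundamental_theorem_of_calculus_interior_strong[where S="{t}", OF _ \<tau>])
    show "continuous_on {0..\<tau>} F"
      unfolding F_def using H
      by (intro continuous_intros continuous_on_compose2[OF continuous_sgn_abs_powr[of "2 * H" UNIV]]) auto
    fix s assume "s \<in> {0<..<\<tau>} - {t}"
    then have ne: "s \<noteq> t" by simp
    have "((\<lambda>s. sgn (s - t) * \<bar>s - t\<bar> powr (2 * H - 1) / (2 * H - 1)) has_real_derivative \<bar>t - s\<bar> powr (2 * H - 2)) (at s)"
    proof (cases "s > t")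
      case True
      have "((\<lambda>s. s - t) has_real_derivative 1) (at s)" by (auto intro!: derivative_eq_intros)
      from DERIV_chain2[OF has_real_derivative_powr[of "s - t" "2 * H - 1"] this] True
      have "((\<lambda>s. (s - t) powr (2 * H - 1) / (2 * H - 1)) has_real_derivative (2 * H - 1) * (s - t) powr (2 * H - 1 - 1) * 1 / (2 * H - 1)) (at s)"
        by (intro DERIV_cdivide) simp
      moreover have "eventually (\<lambda>s. (s - t) powr (2 * H - 1) / (2 * H - 1) = sgn (s - t) * \<bar>s - t\<bar> powr (2 * H - 1) / (2 * H - 1)) (nhds s)"
        by (rule eventually_mono[OF eventually_nhds_in_open[of "{t<..}" s]]) (use True in auto)
      ultimately show ?thesis using True H by (subst DERIV_cong_ev[OF refl _ refl, symmetric]) auto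
    next
      case False
      then have lt: "t - s > 0" using ne by simp
      have "((\<lambda>s. t - s) has_real_derivative -1) (at s)" by (auto intro!: derivative_eq_intros)
      from DERIV_minus[OF DERIV_chain2[OF has_real_derivative_powr[OF lt, of "2 * H - 1"] this]]
      have "((\<lambda>s. - ((t - s) powr (2 * H - 1)) / (2 * H - 1)) has_real_derivative - ((2 * H - 1) * (t - s) powr (2 * H - 1 - 1) * -1) / (2 * H - 1)) (at s)"
        by (rule DERIV_cdivide)
      moreover have "eventually (\<lambda>s. - ((t - s) powr (2 * H - 1)) / (2 * H - 1) = sgn (s - t) * \<bar>s - t\<bar> powr (2 * H - 1) / (2 * H - 1)) (nhds s)"
        by (rule eventually_mono[OF eventually_nhds_in_open[of "{..<t}" s]]) (use lt in \<open>auto simp: abs_minus_commute\<close>)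
      ultimately show ?thesis using lt H by (subst DERIV_cong_ev[OF refl _ refl, symmetric]) auto
    qed
    then show "(F has_vector_derivative \<bar>t - s\<bar> powr (2 * H - 2)) (at s)"
      unfolding F_def by (simp add: has_real_derivative_iff_has_vector_derivative)
  qed simp
  moreover have "F \<tau> - F 0 = riesz H \<tau> t"
    by (simp add: F_def riesz_def add_divide_distrib sgn_minus)
  ultimately show ?thesis by simp
qed

lemma riesz_nn_integral:
  assumes H: "1/2 < H" and \<tau>: "\<tau> \<ge> 0"
  shows "(\<integral>\<^sup>+s. ennreal (indicator {0..\<tau>} s * \<bar>t - s\<bar> powr (2 * H - 2)) \<partial>lborel) = ennreal (riesz H \<tau> t)"
    and "integrable lborel (\<lambda>s. indicator {0..\<tau>} s * \<bar>t - s\<bar> powr (2 * H - 2))"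
    and "(LBINT s. indicator {0..\<tau>} s * \<bar>t - s\<bar> powr (2 * H - 2)) = riesz H \<tau> t"
    and "0 \<le> riesz H \<tau> t"
proof -
  show n: "(\<integral>\<^sup>+s. ennreal (indicator {0..\<tau>} s * \<bar>t - s\<bar> powr (2 * H - 2)) \<partial>lborel) = ennreal (riesz H \<tau> t)"
  proof (rule nn_integral_has_integral_lborel)
    have "(\<lambda>s. indicator {0..\<tau>} s * \<bar>t - s\<bar> powr (2 * H - 2)) = (\<lambda>s. if s \<in> {0..\<tau>} then \<bar>t - s\<bar> powr (2 * H - 2) else 0)"
      by (auto simp: indicator_def)
    then show "((\<lambda>s. indicator {0..\<tau>} s * \<bar>t - s\<bar> powr (2 * H - 2)) has_integral riesz H \<tau> t) UNIV"
      using riesz_integral[OF H \<tau>, of t] by (simp only: has_integral_restrict_UNIV)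
  qed auto
  show "integrable lborel (\<lambda>s. indicator {0..\<tau>} s * \<bar>t - s\<bar> powr (2 * H - 2))"
    by (rule integrableI_nonneg) (use n in auto)
  show r0: "0 \<le> riesz H \<tau> t"
    by (rule has_integral_nonneg[OF riesz_integral[OF H \<tau>]]) simp
  show "(LBINT s. indicator {0..\<tau>} s * \<bar>t - s\<bar> powr (2 * H - 2)) = riesz H \<tau> t"
    using n r0 by (subst integral_eq_nn_integral) auto
qed

lemma riesz_le:
  assumes H: "1/2 < H" and t: "0 \<le> t" "t \<le> T"
  shows "riesz H T t \<le> 2 * T powr (2 * H - 1) / (2 * H - 1)"
proof -
  have "sgn t * \<bar>t\<bar> powr (2 * H - 1) \<le> T powr (2 * H - 1)" using t H by (auto simp: sgn_if intro!: powr_mono2)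
  moreover have "sgn (T - t) * \<bar>T - t\<bar> powr (2 * H - 1) \<le> T powr (2 * H - 1)" using t H by (auto simp: sgn_if intro!: powr_mono2)
  ultimately show ?thesis unfolding riesz_def using H by (intro divide_right_mono) auto
qed

text \<open>|a b| \<le> (a^2 + b^2) / 2 and the symmetry of the kernel reduce the double integral to
  one of \<phi>^2 against the Riesz potential of \<open>{0..T}\<close>, which is bounded by
  \<open>riesz_le\<close>.\<close>

lemma abs_H_norm_sq_le:
  fixes \<phi> :: "real \<Rightarrow> real"
  assumes H: "1/2 < H" "H < 1" and T: "T \<ge> 0" and m[measurable]: "\<phi> \<in> borel_measurable borel"
  shows "abs_H_norm_sq H (\<lambda>t. indicator {0..T} t * \<phi> t)
    \<le> ennreal (H * (2 * H - 1)) * (ennreal (2 * T powr (2 * H - 1) / (2 * H - 1)) * (\<integral>\<^sup>+t. ennreal (indicator {0..T} t * (\<phi> t)\<^sup>2) \<partial>lborel))"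
proof -
  let ?k = "\<lambda>t s. \<bar>t - s\<bar> powr (2 * H - 2)"
  let ?I = "\<lambda>t :: real. indicator {0..T} t :: real"
  define C where "C = 2 * T powr (2 * H - 1) / (2 * H - 1)"
  have C: "C \<ge> 0" using H by (simp add: C_def)
  have am: "a * b \<le> (a\<^sup>2 + b\<^sup>2) / 2" for a b :: real
    using sum_squares_bound[of a b] by simp
  have A: "(\<integral>\<^sup>+t. \<integral>\<^sup>+s. ennreal (?I t * ?I s * (\<phi> t)\<^sup>2 * ?k t s / 2) \<partial>lborel \<partial>lborel) \<le> ennreal (C / 2) * (\<integral>\<^sup>+t. ennreal (?I t * (\<phi> t)\<^sup>2) \<partial>lborel)"
  proof -
    have "(\<integral>\<^sup>+s. ennreal (?I t * ?I s * (\<phi> t)\<^sup>2 * ?k t s / 2) \<partial>lborel) \<le> ennreal (C / 2) * ennreal (?I t * (\<phi> t)\<^sup>2)" for t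
    proof (cases "t \<in> {0..T}")
      case True
      have "(\<integral>\<^sup>+s. ennreal (?I t * ?I s * (\<phi> t)\<^sup>2 * ?k t s / 2) \<partial>lborel) = (\<integral>\<^sup>+s. ennreal ((\<phi> t)\<^sup>2 / 2) * ennreal (?I s * ?k t s) \<partial>lborel)"
        using True by (intro nn_integral_cong) (simp add: ennreal_mult[symmetric] mult_ac)
      also have "\<dots> = ennreal ((\<phi> t)\<^sup>2 / 2) * ennreal (riesz H T t)"
        by (subst nn_integral_cmult) (auto simp: riesz_nn_integral(1)[OF H(1) T])
      also have "\<dots> \<le> ennreal ((\<phi> t)\<^sup>2 / 2) * ennreal C"
        using True riesz_le[OF H(1)] by (intro mult_left_mono ennreal_leI) (auto simp: C_def)
      also have "\<dots> = ennreal (C / 2) * ennreal (?I t * (\<phi> t)\<^sup>2)"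
        using True C by (simp add: ennreal_mult[symmetric] mult_ac)
      finally show ?thesis .
    qed simp
    then have "(\<integral>\<^sup>+t. \<integral>\<^sup>+s. ennreal (?I t * ?I s * (\<phi> t)\<^sup>2 * ?k t s / 2) \<partial>lborel \<partial>lborel) \<le> (\<integral>\<^sup>+t. ennreal (C / 2) * ennreal (?I t * (\<phi> t)\<^sup>2) \<partial>lborel)"
      by (intro nn_integral_mono)
    then show ?thesis by (subst (asm) nn_integral_cmult) auto
  qed

  have B: "(\<integral>\<^sup>+t. \<integral>\<^sup>+s. ennreal (?I t * ?I s * (\<phi> s)\<^sup>2 * ?k t s / 2) \<partial>lborel \<partial>lborel)
      = (\<integral>\<^sup>+t. \<integral>\<^sup>+s. ennreal (?I t * ?I s * (\<phi> t)\<^sup>2 * ?k t s / 2) \<partial>lborel \<partial>lborel)"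
  proof -
    have "(\<integral>\<^sup>+t. \<integral>\<^sup>+s. ennreal (?I t * ?I s * (\<phi> s)\<^sup>2 * ?k t s / 2) \<partial>lborel \<partial>lborel)
      = (\<integral>\<^sup>+s. \<integral>\<^sup>+t. ennreal (?I t * ?I s * (\<phi> s)\<^sup>2 * ?k t s / 2) \<partial>lborel \<partial>lborel)"
      by (rule lborel_pair.Fubini') measurable
    also have "\<dots> = (\<integral>\<^sup>+t. \<integral>\<^sup>+s. ennreal (?I t * ?I s * (\<phi> t)\<^sup>2 * ?k t s / 2) \<partial>lborel \<partial>lborel)"
    proof (intro nn_integral_cong arg_cong[of _ _ ennreal])
      fix x y :: real
      have "\<bar>y - x\<bar> = \<bar>x - y\<bar>" by (rule abs_minus_commute)
      then show "?I y * ?I x * (\<phi> x)\<^sup>2 * ?k y x / 2 = ?I x * ?I y * (\<phi> x)\<^sup>2 * ?k x y / 2"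
        by (simp only: mult.commute[of "?I y"])
    qed
    finally show ?thesis .
  qed
  have "(\<integral>\<^sup>+ t\<in>{0..}. (\<integral>\<^sup>+ s\<in>{0..}. ennreal (\<bar>?I s * \<phi> s\<bar> * \<bar>?I t * \<phi> t\<bar> * ?k t s) \<partial>lborel) \<partial>lborel)
    \<le> (\<integral>\<^sup>+t. \<integral>\<^sup>+s. ennreal (?I t * ?I s * (\<phi> t)\<^sup>2 * ?k t s / 2) + ennreal (?I t * ?I s * (\<phi> s)\<^sup>2 * ?k t s / 2) \<partial>lborel \<partial>lborel)"
  proof -
    have 1: "ennreal (\<bar>?I s * \<phi> s\<bar> * \<bar>?I t * \<phi> t\<bar> * ?k t s) * indicator {0..} s \<le>
        ennreal (?I t * ?I s * (\<phi> t)\<^sup>2 * ?k t s / 2) + ennreal (?I t * ?I s * (\<phi> s)\<^sup>2 * ?k t s / 2)" for t s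
    proof (cases "t \<in> {0..T} \<and> s \<in> {0..T}")
      case True
      have "\<bar>\<phi> s\<bar> * \<bar>\<phi> t\<bar> * ?k t s \<le> (\<bar>\<phi> s\<bar>\<^sup>2 + \<bar>\<phi> t\<bar>\<^sup>2) / 2 * ?k t s"
        by (intro mult_right_mono am) auto
      then have "\<bar>\<phi> s\<bar> * \<bar>\<phi> t\<bar> * ?k t s \<le> (\<phi> t)\<^sup>2 * ?k t s / 2 + (\<phi> s)\<^sup>2 * ?k t s / 2"
        by (simp add: field_simps)
      then show ?thesis using True by (simp add: ennreal_plus[symmetric] ennreal_leI del: ennreal_plus)
    qed auto
    have "(\<integral>\<^sup>+ s\<in>{0..}. ennreal (\<bar>?I s * \<phi> s\<bar> * \<bar>?I t * \<phi> t\<bar> * ?k t s) \<partial>lborel) * indicator {0..} t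
      \<le> (\<integral>\<^sup>+s. ennreal (?I t * ?I s * (\<phi> t)\<^sup>2 * ?k t s / 2) + ennreal (?I t * ?I s * (\<phi> s)\<^sup>2 * ?k t s / 2) \<partial>lborel)" for t
    proof -
      have "(\<integral>\<^sup>+ s\<in>{0..}. ennreal (\<bar>?I s * \<phi> s\<bar> * \<bar>?I t * \<phi> t\<bar> * ?k t s) \<partial>lborel) * indicator {0..} t
        \<le> (\<integral>\<^sup>+ s\<in>{0..}. ennreal (\<bar>?I s * \<phi> s\<bar> * \<bar>?I t * \<phi> t\<bar> * ?k t s) \<partial>lborel)"
        by (simp add: indicator_def)
      also have "\<dots> \<le> (\<integral>\<^sup>+s. ennreal (?I t * ?I s * (\<phi> t)\<^sup>2 * ?k t s / 2) + ennreal (?I t * ?I s * (\<phi> s)\<^sup>2 * ?k t s / 2) \<partial>lborel)"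
        by (intro nn_integral_mono 1)
      finally show ?thesis .
    qed
    then show ?thesis by (intro nn_integral_mono)
  qed
  also have "\<dots> = (\<integral>\<^sup>+t. \<integral>\<^sup>+s. ennreal (?I t * ?I s * (\<phi> t)\<^sup>2 * ?k t s / 2) \<partial>lborel \<partial>lborel)
      + (\<integral>\<^sup>+t. \<integral>\<^sup>+s. ennreal (?I t * ?I s * (\<phi> s)\<^sup>2 * ?k t s / 2) \<partial>lborel \<partial>lborel)"
    by (simp add: nn_integral_add)
  also have "\<dots> \<le> ennreal (C / 2) * (\<integral>\<^sup>+t. ennreal (?I t * (\<phi> t)\<^sup>2) \<partial>lborel) + ennreal (C / 2) * (\<integral>\<^sup>+t. ennreal (?I t * (\<phi> t)\<^sup>2) \<partial>lborel)"
    unfolding B by (intro add_mono A)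
  also have "\<dots> = ennreal C * (\<integral>\<^sup>+t. ennreal (?I t * (\<phi> t)\<^sup>2) \<partial>lborel)"
  proof -
    have "ennreal (C / 2) + ennreal (C / 2) = ennreal C"
      using C by (subst ennreal_plus[symmetric]) (auto simp del: ennreal_plus)
    then show ?thesis by (simp add: distrib_right[symmetric])
  qed
  finally show ?thesis unfolding abs_H_norm_sq_def C_def by (rule mult_left_mono) simp
qed

text \<open>The inner integral over \<open>{0..\<tau> i}\<close> is a Riesz potential, hence a
  multiple of \<open>fbm_cov'\<close>. The pairing with a Malliavin derivative thus takes the form
  that \<open>iexp_mean_skor\<close> delivers.\<close>

lemma H_inner_indicator_sum:
  fixes a :: "nat \<Rightarrow> real"
  assumes H: "1/2 < H" and T: "T \<ge> 0" and c: "continuous_on {0..} \<psi>" and \<tau>: "\<And>i. i < m \<Longrightarrow> \<tau> i \<ge> 0"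
  shows "H_inner H (\<lambda>s. \<Sum>i<m. a i * indicator {0..\<tau> i} s) (\<lambda>t. indicator {0..T} t * \<psi> t)
    = (\<Sum>i<m. a i * integral {0..T} (\<lambda>t. fbm_cov' H (\<tau> i) t * \<psi> t))"
proof -
  let ?k = "\<lambda>t s. \<bar>t - s\<bar> powr (2 * H - 2)"
  have inner: "(LBINT s:{0..}. (\<Sum>i<m. a i * indicator {0..\<tau> i} s) * x * ?k t s) = x * (\<Sum>i<m. a i * riesz H (\<tau> i) t)" for x t
  proof -
    have "(LBINT s:{0..}. (\<Sum>i<m. a i * indicator {0..\<tau> i} s) * x * ?k t s) = (LBINT s. (\<Sum>i<m. (x * a i) * (indicator {0..\<tau> i} s * ?k t s)))"
      unfolding set_lebesgue_integral_def
    proof (intro Bochner_Integration.integral_cong refl)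
      fix s :: real
      show "indicator {0..} s *\<^sub>R ((\<Sum>i<m. a i * indicator {0..\<tau> i} s) * x * ?k t s) = (\<Sum>i<m. (x * a i) * (indicator {0..\<tau> i} s * ?k t s))"
      proof (cases "s \<ge> 0")
        case True
        then have "indicator {0..} s = (1 :: real)" by simp
        then show ?thesis unfolding sum_distrib_right scaleR_sum_right
          by (intro sum.cong refl) (simp only: mult_ac scaleR_one)
      next
        case False
        then show ?thesis by simp
      qed
    qed
    also have "\<dots> = (\<Sum>i<m. (x * a i) * riesz H (\<tau> i) t)"
      using riesz_nn_integral(2)[OF H \<tau>] riesz_nn_integral(3)[OF H \<tau>]
      by (subst Bochner_Integration.integral_sum) auto
    finally show ?thesis by (simp add: sum_distrib_left mult_ac)
  qed
  have cc: "continuous_on {0..T} (\<lambda>t. fbm_cov' H (\<tau> i) t * \<psi> t)" for i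
    by (intro continuous_intros fbm_cov'_continuous H continuous_on_subset[OF c]) auto
  have "H_inner H (\<lambda>s. \<Sum>i<m. a i * indicator {0..\<tau> i} s) (\<lambda>t. indicator {0..T} t * \<psi> t)
    = (LBINT t. \<Sum>i<m. a i * (indicator {0..T} t *\<^sub>R (fbm_cov' H (\<tau> i) t * \<psi> t)))"
    unfolding H_inner_def inner unfolding set_lebesgue_integral_def integral_mult_right_zero[symmetric]
    by (intro Bochner_Integration.integral_cong refl)
      (auto simp: fbm_cov'_riesz[OF H] sum_distrib_left indicator_def intro!: sum.cong)
  also have "\<dots> = (\<Sum>i<m. a i * (LBINT t. indicator {0..T} t *\<^sub>R (fbm_cov' H (\<tau> i) t * \<psi> t)))"
    using integral_eq_set_lebesgue(2)[OF cc] by (subst Bochner_Integration.integral_sum) auto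
  finally show ?thesis unfolding integral_eq_set_lebesgue(1)[OF cc] .
qed

section \<open>Identification of the Skorohod integral\<close>

context fbm_ou
begin

text \<open>For a combination Z of values of W the driver covW Z is a combination of functions
  \<open>fbm_cov\<close>, differentiable with derivative the same combination of
  \<open>fbm_cov'\<close>, so \<open>iexp_mean_skor\<close> yields the duality against
  characters.\<close>

lemma iexp_mean_skor_combination:
  fixes m :: nat
  assumes T: "T \<ge> 0" and \<tau>: "\<And>i. i < m \<Longrightarrow> \<tau> i \<ge> 0"
  shows "iexp_mean (\<lambda>\<omega>. \<Sum>j<m. \<xi> j * W (\<tau> j) \<omega>) (skor T)
    = (\<Sum>j<m. \<i> * of_real (\<xi> j) * iexp_mean (\<lambda>\<omega>. \<Sum>j<m. \<xi> j * W (\<tau> j) \<omega>) (\<lambda>\<omega>. integral {0..T} (\<lambda>t. fbm_cov' H (\<tau> j) t * X t \<omega>)))"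
proof -
  define Z where "Z \<omega> = (\<Sum>j<m. \<xi> j * W (\<tau> j) \<omega>)" for \<omega>
  have Z: "Z \<in> S" unfolding Z_def[abs_def] using \<tau> by (intro sum scale WS) auto
  define r where "r t = (\<Sum>j<m. \<xi> j * fbm_cov' H (\<tau> j) t)" for t
  let ?K = "\<lambda>j \<omega>. integral {0..T} (\<lambda>t. fbm_cov' H (\<tau> j) t * X t \<omega>)"
  have rc: "continuous_on {0..} r" unfolding r_def by (intro continuous_intros fbm_cov'_continuous H)
  have wZ: "covW Z t = (\<Sum>j<m. \<xi> j * fbm_cov H (\<tau> j) t)" if t: "t \<ge> 0" for t
  proof -
    have "covW Z t = expectation (\<lambda>\<omega>. \<Sum>j<m. \<xi> j * (W (\<tau> j) \<omega> * W t \<omega>))"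
      unfolding covW_def Z_def sum_distrib_right by (simp add: mult.assoc)
    also have "\<dots> = (\<Sum>j<m. \<xi> j * expectation (\<lambda>\<omega>. W (\<tau> j) \<omega> * W t \<omega>))"
      using \<tau> t by (subst Bochner_Integration.integral_sum) (auto intro!: prod_integrable WS)
    finally show ?thesis using \<tau> t by (simp add: W_cov)
  qed
  have d: "(covW Z has_real_derivative r t) (at t within {0..})" if t: "t \<ge> 0" for t
  proof -
    have "((\<lambda>t. \<Sum>j<m. \<xi> j * fbm_cov H (\<tau> j) t) has_real_derivative r t) (at t within {0..})"
      unfolding r_def by (intro DERIV_sum DERIV_cmult fbm_cov_deriv H t)
    then show ?thesis
      by (rule has_field_derivative_transform_within[where d=1]) (use t wZ in auto)
  qed
  have fc: "continuous_on {0..T} (fbm_cov' H (\<tau> j))" for j by (rule fbm_cov'_continuous[OF H(1)])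
  have KS: "?K j \<in> S" for j by (rule process_integral(1)[OF process_X T fc])
  have "integral {0..T} (\<lambda>t. r t * X t \<omega>) = (\<Sum>j<m. \<xi> j * ?K j \<omega>)" for \<omega>
  proof -
    have "integral {0..T} (\<lambda>t. r t * X t \<omega>) = integral {0..T} (\<lambda>t. \<Sum>j<m. \<xi> j * (fbm_cov' H (\<tau> j) t * X t \<omega>))"
      unfolding r_def sum_distrib_right by (simp add: mult.assoc)
    also have "\<dots> = (\<Sum>j<m. integral {0..T} (\<lambda>t. \<xi> j * (fbm_cov' H (\<tau> j) t * X t \<omega>)))"
      by (intro Henstock_Kurzweil_Integration.integral_sum integrable_continuous_real continuous_intros fc continuous_on_subset[OF X_cont]) auto
    finally show ?thesis by simp
  qed
  then have "iexp_mean Z (skor T) = \<i> * iexp_mean Z (\<lambda>\<omega>. \<Sum>j<m. \<xi> j * ?K j \<omega>)"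
    using iexp_mean_skor[OF T Z rc d] by simp
  also have "iexp_mean Z (\<lambda>\<omega>. \<Sum>j<m. \<xi> j * ?K j \<omega>) = (\<Sum>j<m. of_real (\<xi> j) * iexp_mean Z (?K j))"
  proof -
    have "iexp_mean Z (\<lambda>\<omega>. \<Sum>j<n. \<xi> j * ?K j \<omega>) = (\<Sum>j<n. of_real (\<xi> j) * iexp_mean Z (?K j))" for n
    proof (induction n)
      case (Suc n)
      have "iexp_mean Z (\<lambda>\<omega>. (\<Sum>j<n. \<xi> j * ?K j \<omega>) + \<xi> n * ?K n \<omega>) = iexp_mean Z (\<lambda>\<omega>. \<Sum>j<n. \<xi> j * ?K j \<omega>) + iexp_mean Z (\<lambda>\<omega>. \<xi> n * ?K n \<omega>)"
        by (intro iexp_mean_add meas Z integrable sum scale KS)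
      then show ?case using Suc by (simp add: iexp_mean_scale)
    qed (simp add: iexp_mean_def)
    then show ?thesis .
  qed
  finally show ?thesis unfolding Z_def by (simp add: sum_distrib_left mult_ac)
qed

text \<open>The duality against characters is carried over to smooth test functions by
  \<open>trig_to_C1b\<close>, and \<open>H_inner_indicator_sum\<close> reads the result as the
  pairing with the Malliavin derivative. All is shown for W and X and transferred to B and Y along
  almost sure equality.\<close>

lemma skor_divergence:
  assumes cm: "complete_measure M" and T: "T \<ge> 0"
    and BW: "AE \<omega> in M. \<forall>t\<ge>0. B t \<omega> = W t \<omega>" and YX: "AE \<omega> in M. \<forall>t\<ge>0. Y t \<omega> = X t \<omega>"
  shows "is_divergence M H B (\<lambda>t \<omega>. indicator {0..T} t * Y t \<omega>) (skor T)"
proof -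
  interpret complete_measure M by fact
  note XJ[measurable] = measurable_continuous_process[OF X_cont X_meas]
  have XJb: "(\<lambda>t. X (max 0 t) \<omega>) \<in> borel_measurable borel" for \<omega>
  proof -
    have "continuous_on UNIV (\<lambda>t. X (max 0 t) \<omega>)"
      by (rule continuous_on_compose2[OF X_cont]) (auto intro!: continuous_intros)
    then show ?thesis by (rule borel_measurable_continuous_onI)
  qed
  have L2: "L2_abs_H M H (\<lambda>t \<omega>. indicator {0..T} t * Y t \<omega>)"
    unfolding L2_abs_H_def
  proof (intro exI[of _ "\<lambda>t \<omega>. indicator {0..T} t * X (max 0 t) \<omega>"] conjI)
    show "(\<lambda>(t, \<omega>). indicator {0..T} t * X (max 0 t) \<omega>) \<in> borel_measurable (lborel \<Otimes>\<^sub>M M)" by measurable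
    show "AE \<omega> in M. AE t in lborel. 0 \<le> t \<longrightarrow> indicator {0..T} t * X (max 0 t) \<omega> = indicator {0..T} t * Y t \<omega>"
      using YX by eventually_elim auto
    let ?C = "ennreal (H * (2 * H - 1)) * ennreal (2 * T powr (2 * H - 1) / (2 * H - 1))"
    have pc: "continuous_on {0..T} (\<lambda>t. (X t \<omega>)\<^sup>2)" for \<omega>
      by (intro continuous_intros continuous_on_subset[OF X_cont]) auto
    have I: "(\<integral>\<^sup>+t. ennreal (indicator {0..T} t * (X (max 0 t) \<omega>)\<^sup>2) \<partial>lborel) = ennreal (integral {0..T} (\<lambda>t. (X t \<omega>)\<^sup>2))" for \<omega>
    proof -
      have "(\<integral>\<^sup>+t. ennreal (indicator {0..T} t * (X (max 0 t) \<omega>)\<^sup>2) \<partial>lborel) = (\<integral>\<^sup>+t. ennreal (indicator {0..T} t *\<^sub>R (X t \<omega>)\<^sup>2) \<partial>lborel)"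
        by (intro nn_integral_cong) (auto simp: indicator_def max_def)
      also have "\<dots> = ennreal (\<integral>t. indicator {0..T} t *\<^sub>R (X t \<omega>)\<^sup>2 \<partial>lborel)"
        by (rule nn_integral_eq_integral[OF integral_eq_set_lebesgue(2)[OF pc]]) simp
      finally show ?thesis unfolding integral_eq_set_lebesgue(1)[OF pc] .
    qed
    have Ipos: "0 \<le> integral {0..T} (\<lambda>t. (X t \<omega>)\<^sup>2)" for \<omega>
      by (intro Henstock_Kurzweil_Integration.integral_nonneg integrable_continuous_real pc) simp
    have "(\<integral>\<^sup>+ \<omega>. abs_H_norm_sq H (\<lambda>t. indicator {0..T} t * X (max 0 t) \<omega>) \<partial>M) \<le> (\<integral>\<^sup>+ \<omega>. ?C * ennreal (integral {0..T} (\<lambda>t. (X t \<omega>)\<^sup>2)) \<partial>M)"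
      using abs_H_norm_sq_le[OF H T XJb] unfolding I by (intro nn_integral_mono) (simp add: mult.assoc)
    also have "\<dots> = ?C * (\<integral>\<^sup>+ \<omega>. ennreal (integral {0..T} (\<lambda>t. (X t \<omega>)\<^sup>2)) \<partial>M)"
      using integral_X_sq(1)[OF T] by (intro nn_integral_cmult) auto
    also have "\<dots> = ?C * ennreal (expectation (\<lambda>\<omega>. integral {0..T} (\<lambda>t. (X t \<omega>)\<^sup>2)))"
      using integral_X_sq(1)[OF T] Ipos by (simp add: nn_integral_eq_integral)
    also have "\<dots> < \<infinity>" by (simp add: ennreal_mult_less_top)
    finally show "(\<integral>\<^sup>+ \<omega>. abs_H_norm_sq H (\<lambda>t. indicator {0..T} t * X (max 0 t) \<omega>) \<partial>M) < \<infinity>" .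
  qed
  have id: "expectation (\<lambda>\<omega>. cylindrical B f \<tau> \<omega> * skor T \<omega>) =
        expectation (\<lambda>\<omega>. H_inner H (\<lambda>s. malliavin_deriv B m f \<tau> s \<omega>) (\<lambda>t. indicator {0..T} t * Y t \<omega>))"
    if f: "Cb_smooth m f" and \<tau>: "\<forall>i<m. 0 \<le> \<tau> i" for m f \<tau>
  proof -
    have F: "C1b m f (\<lambda>i. partial_deriv i f)" by (rule Cb_smooth_C1b[OF f])
    \<comment> \<open>From index m on the times are unrestricted and may be negative, so those
      coordinates are replaced by 0; the test function does not depend on them.\<close>
    define b where "b i = (if i < m then W (\<tau> i) else (\<lambda>_. 0))" for i
    have bm[measurable]: "b i \<in> borel_measurable M" for i unfolding b_def using \<tau> meas[OF WS] by auto
    let ?\<beta> = "\<lambda>\<omega> i. b i \<omega>"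
    define K where "K j \<omega> = integral {0..T} (\<lambda>t. fbm_cov' H (\<tau> j) t * X t \<omega>)" for j \<omega>
    have fc: "continuous_on {0..T} (fbm_cov' H (\<tau> j))" for j by (rule fbm_cov'_continuous[OF H(1)])
    have KS: "K j \<in> S" for j unfolding K_def[abs_def] by (rule process_integral(1)[OF process_X T fc])
    have sb: "(\<Sum>j<m. \<xi> j * b j \<omega>) = (\<Sum>j<m. \<xi> j * W (\<tau> j) \<omega>)" for \<xi> \<omega>
      by (intro sum.cong) (auto simp: b_def)
    have si: "Bochner_Integration.integrable M (skor T)"
      using square_integrable_mult[of "\<lambda>_. 1" "skor T"] skor_square_integrable[OF T] by simp
    have E: "expectation (\<lambda>\<omega>. f (?\<beta> \<omega>) * skor T \<omega>) = (\<Sum>j<m. expectation (\<lambda>\<omega>. partial_deriv j f (?\<beta> \<omega>) * K j \<omega>))"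
    proof (rule trig_to_C1b[OF bm si _ _ F])
      show "Bochner_Integration.integrable M (K j)" for j by (rule integrable[OF KS])
      show "iexp_mean (\<lambda>\<omega>. \<Sum>j<m. \<xi> j * b j \<omega>) (skor T) = (\<Sum>j<m. \<i> * of_real (\<xi> j) * iexp_mean (\<lambda>\<omega>. \<Sum>j<m. \<xi> j * b j \<omega>) (K j))" for \<xi>
        unfolding sb K_def[abs_def] using \<tau> by (intro iexp_mean_skor_combination T) auto
    qed
    have \<beta>m: "?\<beta> \<in> borel_measurable M" by (rule measurable_coordinatewise_then_product) measurable
    have fm[measurable]: "(\<lambda>\<omega>. f (?\<beta> \<omega>)) \<in> borel_measurable M"
      using F unfolding C1b_def by (intro measurable_compose[OF \<beta>m] borel_measurable_continuous_onI) auto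
    have pm[measurable]: "(\<lambda>\<omega>. partial_deriv j f (?\<beta> \<omega>)) \<in> borel_measurable M" if "j < m" for j
      using F that unfolding C1b_def by (intro measurable_compose[OF \<beta>m] borel_measurable_continuous_onI) auto
    have Km[measurable]: "K j \<in> borel_measurable M" for j by (rule meas[OF KS])
    have sm[measurable]: "skor T \<in> borel_measurable M" by (rule skor_square_integrable(1)[OF T])
    have pi: "Bochner_Integration.integrable M (\<lambda>\<omega>. partial_deriv j f (?\<beta> \<omega>) * K j \<omega>)" if j: "j < m" for j
    proof -
      obtain C where C: "\<And>i x. i < m \<Longrightarrow> \<bar>partial_deriv i f x\<bar> \<le> C"
        using C1b_bound_ex[OF F] by blast
      show ?thesis
      proof (rule Bochner_Integration.integrable_bound[of _ "\<lambda>\<omega>. C * K j \<omega>"])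
        have "\<bar>partial_deriv j f (?\<beta> \<omega>)\<bar> \<le> \<bar>C\<bar>" for \<omega> by (rule order_trans[OF C[OF j] abs_ge_self])
        then show "AE \<omega> in M. norm (partial_deriv j f (?\<beta> \<omega>) * K j \<omega>) \<le> norm (C * K j \<omega>)"
          by (auto simp: abs_mult intro!: mult_right_mono)
      qed (use integrable[OF KS] pm[OF j] in auto)
    qed
    have fB: "AE \<omega> in M. cylindrical B g \<tau> \<omega> = g (?\<beta> \<omega>)" if "\<And>x y. (\<forall>i<m. x i = y i) \<Longrightarrow> g x = g y" for g
      using BW
    proof eventually_elim
      case (elim \<omega>)
      show ?case unfolding cylindrical_def by (rule that) (use elim \<tau> in \<open>auto simp: b_def\<close>)
    qed
    have depf: "f x = f y" if "\<forall>i<m. x i = y i" for x y using F that unfolding C1b_def by blast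
    have depp: "partial_deriv j f x = partial_deriv j f y" if "\<forall>i<m. x i = y i" "j < m" for x y j
    proof -
      have "f (x(j := h)) = f (y(j := h))" for h by (rule depf) (use that in auto)
      then show ?thesis unfolding partial_deriv_def using that by simp
    qed
    have L: "AE \<omega> in M. f (?\<beta> \<omega>) * skor T \<omega> = cylindrical B f \<tau> \<omega> * skor T \<omega>"
    proof -
      have "AE \<omega> in M. cylindrical B f \<tau> \<omega> = f (?\<beta> \<omega>)" by (rule fB) (rule depf)
      then show ?thesis by eventually_elim simp
    qed
    have pB: "AE \<omega> in M. \<forall>j\<in>{..<m}. cylindrical B (partial_deriv j f) \<tau> \<omega> = partial_deriv j f (?\<beta> \<omega>)"
    proof (rule AE_finite_allI)
      show "AE \<omega> in M. cylindrical B (partial_deriv j f) \<tau> \<omega> = partial_deriv j f (?\<beta> \<omega>)" if "j \<in> {..<m}" for j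
        by (rule fB) (rule depp, assumption, use that in simp)
    qed simp
    have R: "AE \<omega> in M. (\<Sum>j<m. partial_deriv j f (?\<beta> \<omega>) * K j \<omega>) = H_inner H (\<lambda>s. malliavin_deriv B m f \<tau> s \<omega>) (\<lambda>t. indicator {0..T} t * Y t \<omega>)"
      using pB YX
    proof eventually_elim
      case (elim \<omega>)
      have e1: "malliavin_deriv B m f \<tau> s \<omega> = (\<Sum>i<m. partial_deriv i f (?\<beta> \<omega>) * indicator {0..\<tau> i} s)" for s
        unfolding malliavin_deriv_def using elim by (intro sum.cong) auto
      have e2: "indicator {0..T} t * Y t \<omega> = indicator {0..T} t * X t \<omega>" for t
        using elim by (auto simp: indicator_def)
      show ?case unfolding e1 e2 K_def
        using H_inner_indicator_sum[OF H(1) T X_cont, of m \<tau> "\<lambda>i. partial_deriv i f (?\<beta> \<omega>)" \<omega>] \<tau> by simp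
    qed
    have sumM: "(\<lambda>\<omega>. \<Sum>j<m. partial_deriv j f (?\<beta> \<omega>) * K j \<omega>) \<in> borel_measurable M"
      by (intro borel_measurable_sum borel_measurable_times pm Km) auto
    have "expectation (\<lambda>\<omega>. cylindrical B f \<tau> \<omega> * skor T \<omega>) = expectation (\<lambda>\<omega>. f (?\<beta> \<omega>) * skor T \<omega>)"
    proof (rule integral_cong_AE)
      show "(\<lambda>\<omega>. cylindrical B f \<tau> \<omega> * skor T \<omega>) \<in> borel_measurable M"
        by (rule borel_measurable_AE_cong[OF _ L]) measurable
      show "AE \<omega> in M. cylindrical B f \<tau> \<omega> * skor T \<omega> = f (?\<beta> \<omega>) * skor T \<omega>" using L by eventually_elim (simp only:)
    qed measurable
    also have "\<dots> = expectation (\<lambda>\<omega>. \<Sum>j<m. partial_deriv j f (?\<beta> \<omega>) * K j \<omega>)"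
      unfolding E using pi by (subst Bochner_Integration.integral_sum) auto
    also have "\<dots> = expectation (\<lambda>\<omega>. H_inner H (\<lambda>s. malliavin_deriv B m f \<tau> s \<omega>) (\<lambda>t. indicator {0..T} t * Y t \<omega>))"
      by (rule integral_cong_AE[OF sumM borel_measurable_AE_cong[OF sumM R] R])
    finally show ?thesis .
  qed
  show ?thesis unfolding is_divergence_def using L2 skor_square_integrable[OF T] id by blast
qed

text \<open>\<open>skor T\<close> witnesses existence, so the chosen variable is a divergence as
  well. Both have the same expectation against every cylindrical function, and
  \<open>zero_of_cylindrical\<close> makes the difference vanish.\<close>

lemma skorohod_integral_skor:
  assumes cm: "complete_measure M" and gen: "generated_by_process M B" and T: "T \<ge> 0"
    and Bm: "\<And>t. t \<ge> 0 \<Longrightarrow> B t \<in> borel_measurable M"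
    and BW: "AE \<omega> in M. \<forall>t\<ge>0. B t \<omega> = W t \<omega>" and YX: "AE \<omega> in M. \<forall>t\<ge>0. Y t \<omega> = X t \<omega>"
  shows "AE \<omega> in M. skorohod_integral M H B T Y \<omega> = skor T \<omega>"
proof -
  define G where "G = skorohod_integral M H B T Y"
  note sd = skor_divergence[OF cm T BW YX]
  have G: "is_divergence M H B (\<lambda>t \<omega>. indicator {0..T} t * Y t \<omega>) G"
    unfolding G_def skorohod_integral_def by (rule someI[where P="is_divergence M H B (\<lambda>t \<omega>. indicator {0..T} t * Y t \<omega>)", OF sd])
  have int: "Bochner_Integration.integrable M F" if "F \<in> borel_measurable M" "Bochner_Integration.integrable M (\<lambda>\<omega>. (F \<omega>)\<^sup>2)" for F :: "'a \<Rightarrow> real"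
    using square_integrable_mult[of "\<lambda>_. 1" F] that by simp
  have Gi: "Bochner_Integration.integrable M G" and si: "Bochner_Integration.integrable M (skor T)"
    using G sd unfolding is_divergence_def by (auto intro: int)
  have "AE \<omega> in M. G \<omega> - skor T \<omega> = 0"
  proof (rule zero_of_cylindrical[OF gen Bm])
    show "Bochner_Integration.integrable M (\<lambda>\<omega>. G \<omega> - skor T \<omega>)" using Gi si by simp
    fix m f \<tau> assume f: "Cb_smooth m f" and \<tau>: "\<And>i. i < m \<Longrightarrow> 0 \<le> (\<tau> i :: real)"
    have F: "C1b m f (\<lambda>i. partial_deriv i f)" by (rule Cb_smooth_C1b[OF f])
    obtain C where C: "\<And>x. \<bar>f x\<bar> \<le> C" using C1b_bound_ex[OF F] by blast
    have cylm: "cylindrical B f \<tau> \<in> borel_measurable M"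
    proof -
      have "(\<lambda>\<omega> i. if i < m then B (\<tau> i) \<omega> else 0) \<in> borel_measurable M"
      proof (rule measurable_coordinatewise_then_product)
        show "(\<lambda>\<omega>. if i < m then B (\<tau> i) \<omega> else 0) \<in> borel_measurable M" for i
          using Bm[OF \<tau>] by (cases "i < m") auto
      qed
      then have "(\<lambda>\<omega>. f (\<lambda>i. if i < m then B (\<tau> i) \<omega> else 0)) \<in> borel_measurable M"
        using F unfolding C1b_def by (elim measurable_compose) (auto intro: borel_measurable_continuous_onI)
      moreover have "f (\<lambda>i. if i < m then B (\<tau> i) \<omega> else 0) = cylindrical B f \<tau> \<omega>" for \<omega>
        unfolding cylindrical_def using F unfolding C1b_def by auto
      ultimately show ?thesis by simp
    qed
    have ci: "Bochner_Integration.integrable M (\<lambda>\<omega>. cylindrical B f \<tau> \<omega> * F \<omega>)" if "Bochner_Integration.integrable M F" for F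
    proof (rule Bochner_Integration.integrable_bound[of _ "\<lambda>\<omega>. C * F \<omega>"])
      have "\<bar>f x\<bar> \<le> \<bar>C\<bar>" for x by (rule order_trans[OF C abs_ge_self])
      then show "AE \<omega> in M. norm (cylindrical B f \<tau> \<omega> * F \<omega>) \<le> norm (C * F \<omega>)"
        by (auto simp: abs_mult cylindrical_def intro!: mult_right_mono)
    qed (use that cylm in auto)
    have div: "expectation (\<lambda>\<omega>. cylindrical B f \<tau> \<omega> * F \<omega>) = expectation (\<lambda>\<omega>. H_inner H (\<lambda>s. malliavin_deriv B m f \<tau> s \<omega>) (\<lambda>t. indicator {0..T} t * Y t \<omega>))"
      if "is_divergence M H B (\<lambda>t \<omega>. indicator {0..T} t * Y t \<omega>) F" for F
    proof -
      have "Cb_smooth m f \<and> (\<forall>i<m. 0 \<le> \<tau> i)" using f \<tau> by blast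
      with that[unfolded is_divergence_def] show ?thesis by blast
    qed
    have "expectation (\<lambda>\<omega>. cylindrical B f \<tau> \<omega> * G \<omega>) = expectation (\<lambda>\<omega>. cylindrical B f \<tau> \<omega> * skor T \<omega>)"
      by (rule trans[OF div[OF G] div[OF sd, symmetric]])
    then show "expectation (\<lambda>\<omega>. cylindrical B f \<tau> \<omega> * (G \<omega> - skor T \<omega>)) = 0"
      using ci[OF Gi] ci[OF si] by (simp add: right_diff_distrib)
  qed
  then show ?thesis unfolding G_def by simp
qed

end

section \<open>Ergodicity and path regularity\<close>

text \<open>The sum of all \<open>Y n\<close> has finite expectation and is therefore finite almost
  surely, which forces its terms to 0.\<close>

lemma (in prob_space) AE_tendsto_0_of_summable_expectation:
  fixes Y :: "nat \<Rightarrow> 'a \<Rightarrow> real"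
  assumes i: "\<And>n. integrable M (Y n)" and nn: "\<And>n \<omega>. 0 \<le> Y n \<omega>"
    and le: "\<And>n. expectation (Y n) \<le> b n" and b: "summable b"
  shows "AE \<omega> in M. (\<lambda>n. Y n \<omega>) \<longlonglongrightarrow> 0"
proof -
  have s: "summable (\<lambda>n. expectation (Y n))"
    by (rule summable_comparison_test'[OF b]) (use le nn in \<open>auto simp: integral_nonneg\<close>)
  have "(\<integral>\<^sup>+\<omega>. (\<Sum>n. ennreal (Y n \<omega>)) \<partial>M) = (\<Sum>n. \<integral>\<^sup>+\<omega>. ennreal (Y n \<omega>) \<partial>M)"
    by (rule nn_integral_suminf) (use i in auto)
  also have "\<dots> = (\<Sum>n. ennreal (expectation (Y n)))"
    by (simp add: nn_integral_eq_integral[OF i] nn)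
  also have "\<dots> = ennreal (\<Sum>n. expectation (Y n))"
    by (rule suminf_ennreal2) (use s nn in \<open>auto intro: integral_nonneg\<close>)
  finally have "(\<integral>\<^sup>+\<omega>. (\<Sum>n. ennreal (Y n \<omega>)) \<partial>M) \<noteq> \<infinity>" by simp
  then have "AE \<omega> in M. (\<Sum>n. ennreal (Y n \<omega>)) \<noteq> \<infinity>"
    by (intro nn_integral_PInf_AE) (use i in measurable)
  then show ?thesis
  proof eventually_elim
    case (elim \<omega>)
    have "summable (\<lambda>n. Y n \<omega>)" using elim nn by (intro summable_suminf_not_top) auto
    then show ?case by (rule summable_LIMSEQ_zero)
  qed
qed

section \<open>Dyadic chaining\<close>

lemma nat_floor_double:
  fixes u :: real
  assumes "u \<ge> 0"
  shows "nat \<lfloor>2 * u\<rfloor> = 2 * nat \<lfloor>u\<rfloor> \<or> nat \<lfloor>2 * u\<rfloor> = Suc (2 * nat \<lfloor>u\<rfloor>)"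
  using assms by linarith

lemma nat_floor_adjacent:
  fixes u v :: real
  assumes "0 \<le> u" "u \<le> v" "v \<le> u + 1"
  shows "nat \<lfloor>v\<rfloor> = nat \<lfloor>u\<rfloor> \<or> nat \<lfloor>v\<rfloor> = Suc (nat \<lfloor>u\<rfloor>)"
  using assms by linarith

text \<open>The dyadic truncations of t converge to t. From one level to the next they stay or move
  by one interval of the finer level, so the increments are bounded by a geometric series.\<close>

lemma dyadic_approx:
  fixes x :: "real \<Rightarrow> real" and N :: nat
  assumes x: "continuous_on {0..} x" and t: "0 \<le> t" "t \<le> real N" and r: "0 \<le> r" "r < 1" and A: "A \<ge> 0"
    and incr: "\<And>j i. i < N * 2 ^ j \<Longrightarrow> \<bar>x (real (Suc i) / 2 ^ j) - x (real i / 2 ^ j)\<bar> \<le> A * r ^ j"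
  shows "\<bar>x t - x (real (nat \<lfloor>2 ^ j * t\<rfloor>) / 2 ^ j)\<bar> \<le> A * r ^ j / (1 - r)"
proof -
  define k where "k j = nat \<lfloor>2 ^ j * t\<rfloor>" for j
  define d where "d j = real (k j) / 2 ^ j" for j
  have k_le: "real (k j) \<le> 2 ^ j * t" for j unfolding k_def using t by simp
  have k_le': "k j \<le> N * 2 ^ j" for j
  proof -
    have "2 ^ j * t \<le> 2 ^ j * real N" using t by simp
    then have "real (k j) \<le> 2 ^ j * real N" using k_le[of j] by linarith
    then have "real (k j) \<le> real (N * 2 ^ j)" by (simp add: mult.commute)
    then show ?thesis by (simp only: of_nat_le_iff)
  qed
  have step: "\<bar>x (d (Suc j)) - x (d j)\<bar> \<le> A * r ^ j" for j
  proof -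
    have "2 ^ Suc j * t = 2 * (2 ^ j * t)" by simp
    then have c: "k (Suc j) = 2 * k j \<or> k (Suc j) = Suc (2 * k j)"
      unfolding k_def by (simp only:) (rule nat_floor_double, use t in simp)
    have dj: "d j = real (2 * k j) / 2 ^ Suc j" by (simp add: d_def)
    have "\<bar>x (d (Suc j)) - x (d j)\<bar> \<le> A * r ^ Suc j"
    proof (cases "k (Suc j) = 2 * k j")
      case True
      then show ?thesis using r A unfolding dj d_def by simp
    next
      case False
      then have e: "k (Suc j) = Suc (2 * k j)" using c by simp
      then have "2 * k j < N * 2 ^ Suc j" using k_le'[of "Suc j"] by simp
      from incr[OF this] show ?thesis unfolding dj d_def e by simp
    qed
    also have "\<dots> \<le> A * r ^ j" using A r by (intro mult_left_mono power_decreasing) auto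
    finally show ?thesis .
  qed
  have tel: "\<bar>x (d (j + n)) - x (d j)\<bar> \<le> A * (r ^ j - r ^ (j + n)) / (1 - r)" for n
  proof (induction n)
    case (Suc n)
    have "\<bar>x (d (j + Suc n)) - x (d j)\<bar> \<le> \<bar>x (d (Suc (j + n))) - x (d (j + n))\<bar> + \<bar>x (d (j + n)) - x (d j)\<bar>" by simp
    also have "\<dots> \<le> A * r ^ (j + n) + A * (r ^ j - r ^ (j + n)) / (1 - r)" by (intro add_mono step Suc)
    also have "\<dots> = A * (r ^ j - r ^ (j + Suc n)) / (1 - r)" using r by (simp add: field_simps)
    finally show ?case .
  qed simp
  have "(\<lambda>n. d n) \<longlonglongrightarrow> t"
  proof (rule tendsto_sandwich[of "\<lambda>n. t - (1/2) ^ n" d sequentially "\<lambda>_. t"])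
    have "t - (1/2) ^ n \<le> d n" for n
    proof -
      have "2 ^ n * t - 1 \<le> real (k n)" unfolding k_def using t by linarith
      then have "(2 ^ n * t - 1) / 2 ^ n \<le> real (k n) / 2 ^ n" by (intro divide_right_mono) auto
      then show ?thesis by (simp add: d_def diff_divide_distrib power_one_over)
    qed
    then show "\<forall>\<^sub>F n in sequentially. t - (1/2) ^ n \<le> d n" by simp
    show "\<forall>\<^sub>F n in sequentially. d n \<le> t" using k_le by (simp add: d_def field_simps)
    have "(\<lambda>n. t - (1/2) ^ n) \<longlonglongrightarrow> t - 0" by (intro tendsto_intros LIMSEQ_power_zero) simp
    then show "(\<lambda>n. t - (1/2) ^ n) \<longlonglongrightarrow> t" by simp
  qed simp
  then have "(\<lambda>n. d (j + n)) \<longlonglongrightarrow> t" by (subst add.commute) (rule LIMSEQ_ignore_initial_segment)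
  then have "(\<lambda>n. x (d (j + n))) \<longlonglongrightarrow> x t"
    by (rule continuous_on_tendsto_compose[OF x]) (use t in \<open>auto simp: d_def\<close>)
  then have "(\<lambda>n. \<bar>x (d (j + n)) - x (d j)\<bar>) \<longlonglongrightarrow> \<bar>x t - x (d j)\<bar>" by (intro tendsto_intros)
  moreover have "(\<lambda>n. A * (r ^ j - r ^ j * r ^ n) / (1 - r)) \<longlonglongrightarrow> A * (r ^ j - r ^ j * 0) / (1 - r)"
    using r by (intro tendsto_intros LIMSEQ_realpow_zero) auto
  ultimately have "\<bar>x t - x (d j)\<bar> \<le> A * (r ^ j - r ^ j * 0) / (1 - r)"
    by (rule LIMSEQ_le) (use tel in \<open>auto simp: power_add\<close>)
  then show ?thesis by (simp add: d_def k_def)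
qed

text \<open>The constant is quantified outside the path, the factor \<open>A\<close> and the horizon
  \<open>N\<close>, so that one constant serves all paths and all times.\<close>

lemma dyadic_Hoelder:
  "\<exists>c\<ge>0. \<forall>x A s t. \<forall>N :: nat. continuous_on {0..} x \<longrightarrow> A \<ge> 0 \<longrightarrow> 0 \<le> s \<longrightarrow> s \<le> t \<longrightarrow> t \<le> s + 1 \<longrightarrow> t \<le> real N \<longrightarrow>
    (\<forall>j i. i < N * 2 ^ j \<longrightarrow> \<bar>x (real (Suc i) / 2 ^ j) - x (real i / 2 ^ j)\<bar> \<le> A * (1 / 2 ^ j) powr (1/4)) \<longrightarrow>
    \<bar>x t - x s :: real\<bar> \<le> c * A * (t - s) powr (1/4)"
proof -
  define r :: real where "r = (1/2) powr (1/4)"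
  have r: "0 \<le> r" "r < 1"
    unfolding r_def using powr_less_mono2[of "1/4" "1/2" "1::real"] by auto
  have rj: "(1 / 2 ^ j) powr (1/4) = r ^ j" for j
  proof -
    have "(1 / 2 ^ j) powr (1/4) = ((1/2::real) powr real j) powr (1/4)" by (subst powr_realpow) (auto simp: power_one_over)
    also have "\<dots> = ((1/2) powr (1/4)) powr real j" by (simp only: powr_powr mult.commute)
    also have "\<dots> = r ^ j" unfolding r_def by (rule powr_realpow) simp
    finally show ?thesis .
  qed
  \<comment> \<open>The two chains from s and t to level j cost 1/(1 - r) each and the step between
    neighbours costs 1; the outer factor 2 comes from \<open>rj'\<close>.\<close>
  define c where "c = 2 * (2 / (1 - r) + 1)"
  have c0: "c \<ge> 0" using r by (simp add: c_def)
  have main: "\<bar>x t - x s\<bar> \<le> c * A * (t - s) powr (1/4)"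
    if x: "continuous_on {0..} x" and A: "A \<ge> 0" and st: "0 \<le> s" "s \<le> t" "t \<le> s + 1" "t \<le> real N"
      and incr: "\<And>j i. i < N * 2 ^ j \<Longrightarrow> \<bar>x (real (Suc i) / 2 ^ j) - x (real i / 2 ^ j)\<bar> \<le> A * (1 / 2 ^ j) powr (1/4)"
    for x :: "real \<Rightarrow> real" and A s t and N :: nat
  proof (cases "s = t")
    case False
    have "\<exists>j. (1/2) ^ j < t - s" using st False by (intro real_arch_pow_inv) auto
    then obtain j0 where "(1/2) ^ j0 < t - s" by blast
    moreover have "(1/2::real) ^ Suc j0 \<le> (1/2) ^ j0" by simp
    ultimately have ex: "(1/2) ^ Suc j0 < t - s" by linarith
    \<comment> \<open>The level with 1/2^(j+1) < t - s \<le> 1/2^j: the truncations of s and t at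
      this level are equal or adjacent.\<close>
    define j where "j = (LEAST j. (1/2) ^ Suc j < t - s)"
    have j1: "(1/2) ^ Suc j < t - s" unfolding j_def by (rule LeastI[of _ j0]) (rule ex)
    have j2: "t - s \<le> (1/2) ^ j"
    proof (cases j)
      case 0 then show ?thesis using st by simp
    next
      case (Suc i)
      then have "\<not> (1/2) ^ Suc i < t - s" using not_less_Least[of i "\<lambda>j. (1/2) ^ Suc j < t - s"] by (simp add: j_def)
      then show ?thesis using Suc by simp
    qed
    define d where "d u = real (nat \<lfloor>2 ^ j * u\<rfloor>) / 2 ^ j" for u :: real
    have a: "\<bar>x u - x (d u)\<bar> \<le> A * r ^ j / (1 - r)" if "0 \<le> u" "u \<le> real N" for u
      unfolding d_def by (rule dyadic_approx[OF x that r A]) (use incr in \<open>simp add: rj\<close>)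
    have "2 ^ j * (t - s) \<le> 2 ^ j * (1/2) ^ j" using j2 by (intro mult_left_mono) auto
    then have "2 ^ j * t \<le> 2 ^ j * s + 1" by (simp add: right_diff_distrib power_one_over)
    then have ca: "nat \<lfloor>2 ^ j * t\<rfloor> = nat \<lfloor>2 ^ j * s\<rfloor> \<or> nat \<lfloor>2 ^ j * t\<rfloor> = Suc (nat \<lfloor>2 ^ j * s\<rfloor>)"
      using st by (intro nat_floor_adjacent) auto
    have b: "\<bar>x (d t) - x (d s)\<bar> \<le> A * r ^ j"
    proof (cases "nat \<lfloor>2 ^ j * t\<rfloor> = nat \<lfloor>2 ^ j * s\<rfloor>")
      case True
      then show ?thesis using A r by (simp add: d_def)
    next
      case False
      then have e: "nat \<lfloor>2 ^ j * t\<rfloor> = Suc (nat \<lfloor>2 ^ j * s\<rfloor>)" using ca by simp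
      have "2 ^ j * t \<le> 2 ^ j * real N" using st by simp
      moreover have "real (nat \<lfloor>2 ^ j * t\<rfloor>) \<le> 2 ^ j * t" using st by simp
      ultimately have "real (nat \<lfloor>2 ^ j * t\<rfloor>) \<le> 2 ^ j * real N" by linarith
      then have "real (nat \<lfloor>2 ^ j * t\<rfloor>) \<le> real (N * 2 ^ j)" by (simp only: of_nat_mult of_nat_power of_nat_numeral mult.commute)
      then have "nat \<lfloor>2 ^ j * s\<rfloor> < N * 2 ^ j" unfolding e by (simp only: of_nat_le_iff Suc_le_eq)
      from incr[OF this] show ?thesis unfolding d_def e rj by simp
    qed
    have rj': "r ^ j \<le> 2 * (t - s) powr (1/4)"
    proof -
      have "r ^ j = (2 * (1/2) ^ Suc j) powr (1/4)" unfolding rj[symmetric] by (simp add: power_one_over)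
      also have "\<dots> \<le> (2 * (t - s)) powr (1/4)" using j1 by (intro powr_mono2) auto
      also have "\<dots> = 2 powr (1/4) * (t - s) powr (1/4)" by (rule powr_mult)
      also have "\<dots> \<le> 2 powr 1 * (t - s) powr (1/4)" by (intro mult_right_mono powr_mono) auto
      finally show ?thesis by simp
    qed
    have "\<bar>x t - x s\<bar> \<le> \<bar>x t - x (d t)\<bar> + \<bar>x s - x (d s)\<bar> + \<bar>x (d t) - x (d s)\<bar>" by simp
    also have "\<dots> \<le> A * r ^ j / (1 - r) + A * r ^ j / (1 - r) + A * r ^ j"
      using st by (intro add_mono a b) auto
    also have "\<dots> = (A * (2 / (1 - r) + 1)) * r ^ j" by (simp add: algebra_simps)
    also have "\<dots> \<le> (A * (2 / (1 - r) + 1)) * (2 * (t - s) powr (1/4))"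
      using A r rj' by (intro mult_left_mono mult_nonneg_nonneg add_nonneg_nonneg) auto
    finally show ?thesis unfolding c_def by (simp only: mult_ac)
  qed simp
  show ?thesis
  proof (intro exI[of _ c] conjI c0 allI impI)
    fix x :: "real \<Rightarrow> real" and A s t and N :: nat
    assume "continuous_on {0..} x" "A \<ge> 0" "0 \<le> s" "s \<le> t" "t \<le> s + 1" "t \<le> real N"
      "\<forall>j i. i < N * 2 ^ j \<longrightarrow> \<bar>x (real (Suc i) / 2 ^ j) - x (real i / 2 ^ j)\<bar> \<le> A * (1 / 2 ^ j) powr (1/4)"
    then show "\<bar>x t - x s\<bar> \<le> c * A * (t - s) powr (1/4)" by (intro main) blast+
  qed
qed

section \<open>Averages over grids\<close>

lemma sum_inverse_square_le:
  assumes D: "\<Delta> > (0::real)"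
  shows "(\<Sum>i<n. 1 / (1 + real i * \<Delta>)\<^sup>2) \<le> 1 + 1 / \<Delta>"
proof -
  \<comment> \<open>The negative term is the end of a telescoping sum and strengthens the claim for
    the induction: 1/(u + \<Delta>)^2 is compared with 1/(u (u + \<Delta>)), a difference of two
    consecutive such terms.\<close>
  have "(\<Sum>i<Suc n. 1 / (1 + real i * \<Delta>)\<^sup>2) \<le> 1 + 1 / \<Delta> - 1 / (\<Delta> * (1 + real n * \<Delta>))" for n
  proof (induction n)
    case (Suc n)
    define u where "u = 1 + real n * \<Delta>"
    have u: "u > 0" using D by (simp add: u_def add_pos_nonneg)
    have e: "1 + real (Suc n) * \<Delta> = u + \<Delta>" by (simp add: u_def algebra_simps)
    have "1 / (u + \<Delta>)\<^sup>2 \<le> 1 / (u * (u + \<Delta>))"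
      unfolding power2_eq_square using u D by (intro divide_left_mono mult_right_mono) auto
    also have "1 / (u * (u + \<Delta>)) = 1 / (\<Delta> * u) - 1 / (\<Delta> * (u + \<Delta>))"
    proof -
      have gen: "1 / (\<Delta> * u) - 1 / (\<Delta> * v) = (v - u) / \<Delta> / (u * v)" if "v > 0" for v
        using u D that by (simp add: field_simps)
      show ?thesis using gen[of "u + \<Delta>"] u D by simp
    qed
    finally have "1 / (u + \<Delta>)\<^sup>2 \<le> 1 / (\<Delta> * u) - 1 / (\<Delta> * (u + \<Delta>))" .
    then show ?case using Suc unfolding sum.lessThan_Suc[of _ "Suc n"] e u_def[symmetric] by linarith
  qed simp
  moreover have "(\<Sum>i<n. 1 / (1 + real i * \<Delta>)\<^sup>2) \<le> (\<Sum>i<Suc n. 1 / (1 + real i * \<Delta>)\<^sup>2)" by simp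
  moreover have "1 / (\<Delta> * (1 + real n * \<Delta>)) \<ge> 0" using D by simp
  ultimately show ?thesis by (smt (verit))
qed

text \<open>The terms in i alone and in j alone contribute n (1 + 1/\<Delta>) each; the term in |i -
  j| is summed on both sides of i, which gives twice that.\<close>

lemma double_sum_inverse_square_le:
  assumes D: "\<Delta> > (0::real)"
  shows "(\<Sum>i<n. \<Sum>j<n. 1 / (1 + real i * \<Delta>)\<^sup>2 + 1 / (1 + real j * \<Delta>)\<^sup>2 + 1 / (1 + \<bar>real i - real j\<bar> * \<Delta>)\<^sup>2)
    \<le> 4 * (real n * (1 + 1 / \<Delta>))"
proof -
  let ?g = "\<lambda>i::nat. 1 / (1 + real i * \<Delta>)\<^sup>2"
  note le = sum_inverse_square_le[OF D]
  have "(\<Sum>j<n. 1 / (1 + \<bar>real i - real j\<bar> * \<Delta>)\<^sup>2) \<le> 2 * (1 + 1 / \<Delta>)" if i: "i < n" for i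
  proof -
    have "0 \<le> Suc i" "Suc i \<le> n" using i by auto
    from sum.atLeastLessThan_concat[OF this, of "\<lambda>j. 1 / (1 + \<bar>real i - real j\<bar> * \<Delta>)\<^sup>2"]
    have "(\<Sum>j<n. 1 / (1 + \<bar>real i - real j\<bar> * \<Delta>)\<^sup>2)
      = (\<Sum>j<Suc i. 1 / (1 + \<bar>real i - real j\<bar> * \<Delta>)\<^sup>2) + (\<Sum>j=Suc i..<n. 1 / (1 + \<bar>real i - real j\<bar> * \<Delta>)\<^sup>2)"
      by (simp only: atLeast0LessThan)
    also have "(\<Sum>j<Suc i. 1 / (1 + \<bar>real i - real j\<bar> * \<Delta>)\<^sup>2) = (\<Sum>j<Suc i. ?g j)"
      by (rule sum.reindex_bij_witness[of _ "\<lambda>j. i - j" "\<lambda>j. i - j"]) (auto simp: of_nat_diff)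
    also have "(\<Sum>j=Suc i..<n. 1 / (1 + \<bar>real i - real j\<bar> * \<Delta>)\<^sup>2) = (\<Sum>j\<in>{1..<n - i}. ?g j)"
      by (rule sum.reindex_bij_witness[of _ "\<lambda>j. i + j" "\<lambda>j. j - i"]) (auto simp: of_nat_diff)
    finally have e: "(\<Sum>j<n. 1 / (1 + \<bar>real i - real j\<bar> * \<Delta>)\<^sup>2) = (\<Sum>j<Suc i. ?g j) + (\<Sum>j\<in>{1..<n - i}. ?g j)" .
    have "(\<Sum>j\<in>{1..<n - i}. ?g j) \<le> (\<Sum>j<n - i. ?g j)" by (intro sum_mono2) auto
    then show ?thesis unfolding e mult_2 using le[of "Suc i"] le[of "n - i"] by linarith
  qed
  then have "(\<Sum>i<n. \<Sum>j<n. 1 / (1 + \<bar>real i - real j\<bar> * \<Delta>)\<^sup>2) \<le> (\<Sum>i<n. 2 * (1 + 1 / \<Delta>))" by (intro sum_mono) auto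
  also have "(\<Sum>i<n. 2 * (1 + 1 / \<Delta>)) = 2 * (real n * (1 + 1 / \<Delta>))" by (simp only: sum_constant card_lessThan mult.left_commute)
  finally have "(\<Sum>i<n. \<Sum>j<n. 1 / (1 + \<bar>real i - real j\<bar> * \<Delta>)\<^sup>2) \<le> 2 * (real n * (1 + 1 / \<Delta>))" .
  moreover have "real n * (\<Sum>i<n. ?g i) \<le> real n * (1 + 1 / \<Delta>)" by (intro mult_left_mono le) auto
  moreover have "(\<Sum>i<n. \<Sum>j<n. ?g i) = real n * (\<Sum>i<n. ?g i)" by (simp only: sum_constant card_lessThan sum_distrib_left)
  moreover have "(\<Sum>i<n. \<Sum>j<n. ?g j) = real n * (\<Sum>i<n. ?g i)" by (simp only: sum_constant card_lessThan)
  ultimately show ?thesis unfolding sum.distrib by linarith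
qed

text \<open>Cesaro averages along an arbitrary grid: off a bounded set \<open>f\<close> is within \<open>\<epsilon>\<close> of its limit, and on
  it \<open>f\<close> is dominated by a multiple of \<open>(1 + t)\<^sup>-\<^sup>2\<close>.\<close>

lemma Cesaro_grid:
  fixes f :: "real \<Rightarrow> real"
  assumes f: "(f \<longlongrightarrow> \<eta>) at_top" and b: "\<And>t. t \<ge> 0 \<Longrightarrow> \<bar>f t\<bar> \<le> C"
    and k: "\<And>n. k n \<ge> (1::nat)" and D: "\<And>n. \<Delta> n > 0"
    and l: "(\<lambda>n. 1 / real (k n) + 1 / (real (k n) * \<Delta> n)) \<longlonglongrightarrow> 0"
  shows "(\<lambda>n. (\<Sum>i<k n. f (real i * \<Delta> n)) / real (k n)) \<longlonglongrightarrow> \<eta>"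
proof (rule LIMSEQ_I)
  fix e :: real assume e: "e > 0"
  then have "\<forall>\<^sub>F t in at_top. dist (f t) \<eta> < e / 2" using f by (auto dest: tendstoD[of _ _ _ "e / 2"])
  then obtain t1 where t1: "\<And>t. t \<ge> t1 \<Longrightarrow> \<bar>f t - \<eta>\<bar> < e / 2"
    unfolding eventually_at_top_linorder dist_real_def by blast
  define t0 where "t0 = max t1 0"
  have C0: "C \<ge> 0" using b[of 0] by simp
  define K where "K = (C + \<bar>\<eta>\<bar>) * (1 + t0)\<^sup>2"
  have K0: "K \<ge> 0" using C0 by (simp add: K_def)
  have pt: "\<bar>f t - \<eta>\<bar> \<le> e / 2 + K * (1 / (1 + t)\<^sup>2)" if t: "t \<ge> 0" for t
  proof (cases "t \<ge> t0")
    case True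
    then have "\<bar>f t - \<eta>\<bar> < e / 2" using t1[of t] by (simp add: t0_def)
    moreover have "K * (1 / (1 + t)\<^sup>2) \<ge> 0" using K0 by simp
    ultimately show ?thesis by linarith
  next
    case False
    then have "(1 + t)\<^sup>2 \<le> (1 + t0)\<^sup>2" using t by (intro power_mono) auto
    then have "1 \<le> (1 + t0)\<^sup>2 * (1 / (1 + t)\<^sup>2)" using t by (simp add: field_simps)
    then have "(C + \<bar>\<eta>\<bar>) * 1 \<le> (C + \<bar>\<eta>\<bar>) * ((1 + t0)\<^sup>2 * (1 / (1 + t)\<^sup>2))" using C0 by (intro mult_left_mono) auto
    then show ?thesis using b[OF t] e by (simp add: K_def mult.assoc)
  qed
  have avg: "\<bar>(\<Sum>i<m. f (real i * d)) / real m - \<eta>\<bar> \<le> e / 2 + K * (1 / real m + 1 / (real m * d))"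
    if m: "m \<ge> 1" and d: "d > 0" for m :: nat and d
  proof -
    have "(\<Sum>i<m. f (real i * d)) / real m - \<eta> = (\<Sum>i<m. f (real i * d) - \<eta>) / real m"
      using m by (simp add: sum_subtractf diff_divide_distrib)
    moreover have "\<bar>\<Sum>i<m. f (real i * d) - \<eta>\<bar> \<le> (\<Sum>i<m. e / 2 + K * (1 / (1 + real i * d)\<^sup>2))"
      by (rule order_trans[OF sum_abs]) (intro sum_mono pt, use d in auto)
    moreover have "(\<Sum>i<m. e / 2 + K * (1 / (1 + real i * d)\<^sup>2)) = real m * (e / 2) + K * (\<Sum>i<m. 1 / (1 + real i * d)\<^sup>2)"
      by (simp add: sum.distrib sum_distrib_left)
    moreover have "K * (\<Sum>i<m. 1 / (1 + real i * d)\<^sup>2) \<le> K * (1 + 1 / d)"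
      by (intro mult_left_mono sum_inverse_square_le d K0)
    ultimately have "\<bar>(\<Sum>i<m. f (real i * d)) / real m - \<eta>\<bar> \<le> (real m * (e / 2) + K * (1 + 1 / d)) / real m"
      using m by (simp add: abs_divide divide_right_mono)
    also have "(real m * (e / 2) + K * (1 + 1 / d)) / real m = e / 2 + K * (1 / real m + 1 / (real m * d))"
      using m d by (simp add: field_simps)
    finally show ?thesis .
  qed
  have "(\<lambda>n. K * (1 / real (k n) + 1 / (real (k n) * \<Delta> n))) \<longlonglongrightarrow> K * 0" by (intro tendsto_intros l)
  then have "\<forall>\<^sub>F n in sequentially. K * (1 / real (k n) + 1 / (real (k n) * \<Delta> n)) < e / 2"
    by (rule order_tendstoD) (use e in simp)
  then obtain n0 where n0: "\<And>n. n \<ge> n0 \<Longrightarrow> K * (1 / real (k n) + 1 / (real (k n) * \<Delta> n)) < e / 2"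
    unfolding eventually_sequentially by blast
  have "norm ((\<Sum>i<k n. f (real i * \<Delta> n)) / real (k n) - \<eta>) < e" if "n \<ge> n0" for n
    unfolding real_norm_def using avg[OF k[of n] D[of n]] n0[OF that] by linarith
  then show "\<exists>n0. \<forall>n\<ge>n0. norm ((\<Sum>i<k n. f (real i * \<Delta> n)) / real (k n) - \<eta>) < e" by blast
qed

text \<open>L'Hospital's rule in the form where only the denominator has to tend to
  infinity.\<close>

lemma Cesaro_integral:
  fixes f :: "real \<Rightarrow> real"
  assumes f: "(f \<longlongrightarrow> \<eta>) at_top" and c: "continuous_on {0..} f"
  shows "((\<lambda>T. integral {0..T} f / T) \<longlongrightarrow> \<eta>) at_top"
proof (rule lhospital_at_top_at_top[where f'=f and g'="\<lambda>_. 1"])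
  show "\<forall>\<^sub>F T in at_top. ((\<lambda>T. integral {0..T} f) has_real_derivative f T) (at T)"
  proof (rule eventually_mono[OF eventually_gt_at_top[of 0]])
    fix T :: real assume T: "T > 0"
    have "((\<lambda>u. integral {0..u} f) has_real_derivative f T) (at T within {0..T + 1})"
      by (rule integral_has_real_derivative) (use T in \<open>auto intro: continuous_on_subset[OF c]\<close>)
    then show "((\<lambda>T. integral {0..T} f) has_real_derivative f T) (at T)"
      using T by (simp add: at_within_interior[of T "{0..T + 1}"])
  qed
  show "filterlim (\<lambda>x::real. x) at_top at_top" by (rule filterlim_ident)
qed (use f in auto)

lemma riemann_sum_compare:
  fixes x :: "real \<Rightarrow> real"
  assumes x: "continuous_on {0..} x" and n: "n \<ge> 1" and D: "0 < \<Delta>"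
    and b: "\<And>t. 0 \<le> t \<Longrightarrow> t \<le> real n * \<Delta> \<Longrightarrow> \<bar>x t\<bar> \<le> L"
    and h: "\<And>s t. 0 \<le> s \<Longrightarrow> s \<le> t \<Longrightarrow> t \<le> s + \<Delta> \<Longrightarrow> t \<le> real n * \<Delta> \<Longrightarrow> \<bar>x t - x s\<bar> \<le> h"
  shows "\<bar>(\<Sum>i<n. (x (real i * \<Delta>))\<^sup>2) / real n - integral {0..real n * \<Delta>} (\<lambda>t. (x t)\<^sup>2) / (real n * \<Delta>)\<bar> \<le> 2 * L * h"
proof -
  have L0: "L \<ge> 0" using b[of 0] D by simp
  have xc: "continuous_on {a..c} (\<lambda>t. (x t)\<^sup>2)" if "a \<ge> 0" for a c
    by (intro continuous_on_power continuous_on_subset[OF x]) (use that in auto)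
  have step: "\<bar>(x (real i * \<Delta>))\<^sup>2 * \<Delta> - integral {real i * \<Delta>..real (Suc i) * \<Delta>} (\<lambda>t. (x t)\<^sup>2)\<bar> \<le> 2 * L * h * \<Delta>" if i: "i < n" for i
  proof -
    let ?a = "real i * \<Delta>" and ?c = "real (Suc i) * \<Delta>"
    have ac: "?a \<le> ?c" "?c = ?a + \<Delta>" using D by (auto simp: algebra_simps)
    have a0: "0 \<le> ?a" using D by simp
    have "real (Suc i) \<le> real n" using i by simp
    then have cn: "?c \<le> real n * \<Delta>" using D by (intro mult_right_mono) auto
    have i1: "(\<lambda>t. (x t)\<^sup>2) integrable_on {?a..?c}" by (intro integrable_continuous_interval xc a0)
    have e: "(x ?a)\<^sup>2 * \<Delta> = integral {?a..?c} (\<lambda>t. (x ?a)\<^sup>2)" using ac by simp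
    have e2: "(x ?a)\<^sup>2 * \<Delta> - integral {?a..?c} (\<lambda>t. (x t)\<^sup>2) = integral {?a..?c} (\<lambda>t. (x ?a)\<^sup>2 - (x t)\<^sup>2)"
      unfolding e using i1 by (intro integral_diff[symmetric]) auto
    have "norm (integral {?a..?c} (\<lambda>t. (x ?a)\<^sup>2 - (x t)\<^sup>2)) \<le> (2 * L * h) * (?c - ?a)"
    proof (rule integral_bound[OF ac(1)])
      show "continuous_on {?a..?c} (\<lambda>t. (x ?a)\<^sup>2 - (x t)\<^sup>2)" by (intro continuous_intros xc a0)
      fix t assume t: "t \<in> {?a..?c}"
      have f1: "\<bar>x ?a\<bar> \<le> L" "\<bar>x t\<bar> \<le> L" "\<bar>x t - x ?a\<bar> \<le> h"
        using t ac cn a0 order_trans[OF a0, of t] by (auto intro!: b h)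
      have "\<bar>x ?a + x t\<bar> \<le> 2 * L" "\<bar>x ?a - x t\<bar> \<le> h" using f1 by auto
      then have "\<bar>x ?a + x t\<bar> * \<bar>x ?a - x t\<bar> \<le> (2 * L) * h" using L0 by (intro mult_mono) auto
      moreover have "(x ?a)\<^sup>2 - (x t)\<^sup>2 = (x ?a + x t) * (x ?a - x t)" by (simp add: power2_eq_square algebra_simps)
      ultimately show "norm ((x ?a)\<^sup>2 - (x t)\<^sup>2) \<le> 2 * L * h" by (simp add: abs_mult)
    qed
    then show ?thesis unfolding e2 using ac by simp
  qed
  have "(\<Sum>i<n. (x (real i * \<Delta>))\<^sup>2) * \<Delta> - integral {0..real n * \<Delta>} (\<lambda>t. (x t)\<^sup>2)
    = (\<Sum>i<n. (x (real i * \<Delta>))\<^sup>2 * \<Delta> - integral {real i * \<Delta>..real (Suc i) * \<Delta>} (\<lambda>t. (x t)\<^sup>2))"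
    using D by (simp add: integral_sum_steps[OF less_imp_le xc] sum_subtractf sum_distrib_right)
  moreover have "\<bar>\<Sum>i<n. (x (real i * \<Delta>))\<^sup>2 * \<Delta> - integral {real i * \<Delta>..real (Suc i) * \<Delta>} (\<lambda>t. (x t)\<^sup>2)\<bar> \<le> (\<Sum>i<n. 2 * L * h * \<Delta>)"
    by (rule order_trans[OF sum_abs]) (intro sum_mono step, simp)
  ultimately have "\<bar>(\<Sum>i<n. (x (real i * \<Delta>))\<^sup>2) * \<Delta> - integral {0..real n * \<Delta>} (\<lambda>t. (x t)\<^sup>2)\<bar> \<le> 2 * L * h * (real n * \<Delta>)"
    by (simp add: mult_ac)
  moreover have "(\<Sum>i<n. (x (real i * \<Delta>))\<^sup>2) / real n - integral {0..real n * \<Delta>} (\<lambda>t. (x t)\<^sup>2) / (real n * \<Delta>)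
    = ((\<Sum>i<n. (x (real i * \<Delta>))\<^sup>2) * \<Delta> - integral {0..real n * \<Delta>} (\<lambda>t. (x t)\<^sup>2)) / (real n * \<Delta>)"
    using n D by (simp add: field_simps)
  ultimately show ?thesis using n D by (simp add: abs_divide pos_divide_le_eq)
qed

section \<open>Regularity and growth of the paths of X\<close>

context gaussian_space
begin

lemma even_moment_le:
  assumes Y: "Y \<in> S" and le: "expectation (\<lambda>\<omega>. (Y \<omega>)\<^sup>2) \<le> v"
  shows "expectation (\<lambda>\<omega>. Y \<omega> ^ (2 * k)) \<le> fact (2 * k) / (2 ^ k * fact k) * v ^ k"
  unfolding gaussian_rv_moments(2)[OF gaussian[OF Y]] by (intro mult_left_mono power_mono le) auto

end

context fbm_ou
begin

text \<open>Only the exponent 1/2 < H of the increments is kept; combined with high moments it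
  leaves ample room for the Hoelder exponent 1/4.\<close>

lemma dyadic_increment_moment:
  "expectation (\<lambda>\<omega>. (X (real (Suc i) / 2 ^ j) \<omega> - X (real i / 2 ^ j) \<omega>)\<^sup>2) \<le> cI\<^sup>2 / 2 ^ j"
proof -
  let ?s = "real i / 2 ^ j" and ?t = "real (Suc i) / 2 ^ j"
  have d: "?t - ?s = 1 / 2 ^ j" by (simp add: diff_divide_distrib[symmetric])
  have l1: "(1::real) / 2 ^ j \<le> 1" by simp
  have "L2norm (\<lambda>\<omega>. X ?t \<omega> - X ?s \<omega>) \<le> cI * (1 / 2 ^ j) powr H"
  proof -
    have "?t \<le> ?s + 1" "?s \<le> ?t" "0 \<le> ?s" using d l1 zero_less_divide_1_iff[of "2 ^ j :: real"] by (linarith, simp add: divide_right_mono, simp)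
    then show ?thesis unfolding d[symmetric] by (intro X_increment) auto
  qed
  also have "\<dots> \<le> cI * (1 / 2 ^ j) powr (1/2)" using H cI by (intro mult_left_mono powr_mono') auto
  finally have "(L2norm (\<lambda>\<omega>. X ?t \<omega> - X ?s \<omega>))\<^sup>2 \<le> (cI * (1 / 2 ^ j) powr (1/2))\<^sup>2"
    by (intro power_mono L2norm_nonneg)
  also have "\<dots> = cI\<^sup>2 / 2 ^ j" by (simp add: power_mult_distrib powr_half_sqrt)
  finally show ?thesis by (simp add: L2norm_square)
qed

lemma dyadic_increment_integrable:
  "Bochner_Integration.integrable M (\<lambda>\<omega>. (X (real (Suc i) / 2 ^ j) \<omega> - X (real i / 2 ^ j) \<omega>) ^ k)"
  by (rule gaussian_rv_moments(1)[OF gaussian]) (intro diff XS, auto)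

text \<open>A bound by K \<ge> 1 forces each increment below K (N + 1)^(1/24) 2^(-j/4), since 24/96
  = 1/4 and 4/96 = 1/24. The 96th power keeps the growth exponent small.\<close>

definition dyadic_energy :: "nat \<Rightarrow> nat \<Rightarrow> 'a \<Rightarrow> real" where
  "dyadic_energy N j \<omega> = (\<Sum>i<N * 2 ^ j. 2 ^ (24 * j) * (X (real (Suc i) / 2 ^ j) \<omega> - X (real i / 2 ^ j) \<omega>) ^ 96) / real (Suc N) ^ 4"

lemma dyadic_energy_nonneg: "dyadic_energy N j \<omega> \<ge> 0"
  unfolding dyadic_energy_def by (intro divide_nonneg_nonneg sum_nonneg mult_nonneg_nonneg) auto

lemma dyadic_energy_integrable: "Bochner_Integration.integrable M (dyadic_energy N j)"
  unfolding dyadic_energy_def[abs_def]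
  by (intro integrable_divide Bochner_Integration.integrable_sum integrable_mult_right dyadic_increment_integrable)

text \<open>There are N 2^j increments, the weight is 2^(24 j) and the 96th moments are of order
  2^(-48 j), which leaves 2^(-23 j); the division by (N + 1)^4 leaves (N + 1)^(-3).\<close>

lemma expectation_dyadic_energy:
  "\<exists>c\<ge>0. \<forall>N j. expectation (dyadic_energy N j) \<le> c * (1 / real (Suc N) ^ 3) * (1 / real (Suc j) ^ 3)"
proof -
  define g where "g = (\<lambda>k. fact (2 * k) / (2 ^ k * fact k) :: real)"
  define c where "c = g 48 * (cI\<^sup>2) ^ 48"
  have c0: "c \<ge> 0" unfolding c_def g_def by (intro mult_nonneg_nonneg divide_nonneg_nonneg) auto
  have "expectation (dyadic_energy N j) \<le> c * (1 / real (Suc N) ^ 3) * (1 / real (Suc j) ^ 3)" for N j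
  proof -
    let ?D = "\<lambda>i \<omega>. X (real (Suc i) / 2 ^ j) \<omega> - X (real i / 2 ^ j) \<omega>"
    have m: "expectation (\<lambda>\<omega>. ?D i \<omega> ^ 96) \<le> c / (2 ^ j) ^ 48" for i
    proof -
      have S: "(\<lambda>\<omega>. ?D i \<omega>) \<in> S" by (intro diff XS) auto
      have "expectation (\<lambda>\<omega>. ?D i \<omega> ^ (2 * 48)) \<le> g 48 * (cI\<^sup>2 / 2 ^ j) ^ 48"
        unfolding g_def by (rule even_moment_le[OF S dyadic_increment_moment])
      also have "\<dots> = c / (2 ^ j) ^ 48" unfolding c_def power_divide by (simp only: times_divide_eq_right)
      finally show ?thesis by (simp only: mult_numeral_1 numeral_times_numeral semiring_norm)
    qed
    have "expectation (dyadic_energy N j) = (\<Sum>i<N * 2 ^ j. 2 ^ (24 * j) * expectation (\<lambda>\<omega>. ?D i \<omega> ^ 96)) / real (Suc N) ^ 4"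
      unfolding dyadic_energy_def[abs_def] using dyadic_increment_integrable
      by (simp only: integral_divide_zero Bochner_Integration.integral_sum integral_mult_right_zero integrable_mult_right)
    also have "\<dots> \<le> (\<Sum>i<N * 2 ^ j. 2 ^ (24 * j) * (c / (2 ^ j) ^ 48)) / real (Suc N) ^ 4"
      by (intro divide_right_mono sum_mono mult_left_mono m) auto
    also have "\<dots> = (real N / real (Suc N) ^ 4) * (c * (1 / (2 ^ j) ^ 23))"
    proof -
      have e: "(2::real) ^ (24 * j) = (2 ^ j) ^ 24" by (simp add: power_mult mult.commute)
      define x :: real where "x = 2 ^ j"
      have "x \<noteq> 0" by (simp add: x_def)
      have gen: "x * (y * (c / (x * (y * z)))) = c * (1 / z)" if "x \<noteq> 0" "y \<noteq> 0" "z \<noteq> 0" for y z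
        using that by (simp add: field_simps)
      have x48: "x ^ 48 = x * (x ^ 24 * x ^ 23)" by (simp flip: power_add power_Suc)
      have "x * (x ^ 24 * (c / x ^ 48)) = c * (1 / x ^ 23)"
        unfolding x48 by (rule gen) (use \<open>x \<noteq> 0\<close> in auto)
      then show ?thesis unfolding e sum_constant card_lessThan of_nat_mult of_nat_power of_nat_numeral x_def[symmetric]
        by (simp only: mult.assoc times_divide_eq_left)
    qed
    also have "\<dots> \<le> (1 / real (Suc N) ^ 3) * (c * (1 / real (Suc j) ^ 3))"
    proof (intro mult_mono mult_left_mono c0)
      have "real N / real (Suc N) ^ 4 \<le> real (Suc N) / real (Suc N) ^ 4" by (intro divide_right_mono) auto
      also have "\<dots> = 1 / real (Suc N) ^ 3" by (simp add: power4_eq_xxxx power3_eq_cube)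
      finally show "real N / real (Suc N) ^ 4 \<le> 1 / real (Suc N) ^ 3" .
      have "Suc j \<le> 2 ^ j" by (induction j) auto
      then have "real (Suc j) \<le> real (2 ^ j)" by (simp only: of_nat_le_iff)
      then have "real (Suc j) ^ 3 \<le> (2 ^ j) ^ 3" by (intro power_mono) auto
      also have "\<dots> \<le> ((2 ^ j) ^ 23 :: real)" by (intro power_increasing) auto
      finally show "1 / (2 ^ j) ^ 23 \<le> 1 / real (Suc j) ^ 3" by (intro divide_left_mono) auto
    qed (use c0 in auto)
    finally show ?thesis by (simp only: mult_ac)
  qed
  then show ?thesis using c0 by blast
qed

text \<open>Two indices are reduced to one: \<open>Y L\<close> collects the energies whose larger
  index is L, a row and a column, together with the value at time L. Its expectations are summable,
  so it almost surely tends to 0 and in particular is bounded.\<close>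

lemma dyadic_energy_bounded:
  "AE \<omega> in M. \<exists>K\<ge>1. \<forall>N j. dyadic_energy N j \<omega> \<le> K \<and> X (real N) \<omega> ^ 96 \<le> K * real (Suc N) ^ 2"
proof -
  obtain c where c: "c \<ge> 0" and le: "\<And>N j. expectation (dyadic_energy N j) \<le> c * (1 / real (Suc N) ^ 3) * (1 / real (Suc j) ^ 3)"
    using expectation_dyadic_energy by blast
  define g where "g = (\<lambda>k. fact (2 * k) / (2 ^ k * fact k) :: real)"
  define e where "e = g 48 * (cX\<^sup>2) ^ 48"
  define Y where "Y L \<omega> = (\<Sum>j\<le>L. dyadic_energy L j \<omega>) + (\<Sum>N\<le>L. dyadic_energy N L \<omega>) + X (real L) \<omega> ^ 96 / real (Suc L) ^ 2" for L \<omega>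
  have Xi: "Bochner_Integration.integrable M (\<lambda>\<omega>. X (real L) \<omega> ^ 96)" for L
    by (rule gaussian_rv_moments(1)[OF gaussian[OF XS]]) simp
  have Xm: "expectation (\<lambda>\<omega>. X (real L) \<omega> ^ 96) \<le> e" for L
  proof -
    have "expectation (\<lambda>\<omega>. X (real L) \<omega> ^ (2 * 48)) \<le> e"
      unfolding e_def g_def by (rule even_moment_le[OF XS X_sq_le]) auto
    then show ?thesis by (simp only: mult_numeral_1 numeral_times_numeral semiring_norm)
  qed
  have nn: "Y L \<omega> \<ge> 0" for L \<omega>
    unfolding Y_def by (intro add_nonneg_nonneg sum_nonneg dyadic_energy_nonneg divide_nonneg_nonneg) auto
  have "AE \<omega> in M. (\<lambda>L. Y L \<omega>) \<longlonglongrightarrow> 0"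
  proof (rule AE_tendsto_0_of_summable_expectation)
    show "Bochner_Integration.integrable M (Y L)" for L
      unfolding Y_def[abs_def] by (intro Bochner_Integration.integrable_add Bochner_Integration.integrable_sum integrable_divide Xi dyadic_energy_integrable)
    show "Y L \<omega> \<ge> 0" for L \<omega> by (rule nn)
    show "expectation (Y L) \<le> (2 * c + e) * inverse (real (Suc L) ^ 2)" for L
    proof -
      have b: "(\<Sum>j\<le>L. c * (1 / real (Suc L) ^ 3) * (1 / real (Suc j) ^ 3)) \<le> c * inverse (real (Suc L) ^ 2)"
      proof -
        have "(\<Sum>j\<le>L. c * (1 / real (Suc L) ^ 3) * (1 / real (Suc j) ^ 3)) \<le> (\<Sum>j\<le>L. c * (1 / real (Suc L) ^ 3) * 1)"
          by (intro sum_mono mult_left_mono mult_nonneg_nonneg c) auto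
        also have "\<dots> = c * inverse (real (Suc L) ^ 2)"
        proof -
          define y where "y = real (Suc L)"
          have "y \<noteq> 0" by (simp add: y_def)
          then show ?thesis unfolding sum_constant card_atMost y_def[symmetric] by (simp add: field_simps power2_eq_square power3_eq_cube)
        qed
        finally show ?thesis .
      qed
      have "expectation (Y L) = (\<Sum>j\<le>L. expectation (dyadic_energy L j)) + (\<Sum>N\<le>L. expectation (dyadic_energy N L)) + expectation (\<lambda>\<omega>. X (real L) \<omega> ^ 96) / real (Suc L) ^ 2"
        unfolding Y_def[abs_def] using dyadic_energy_integrable Xi
        by (simp only: Bochner_Integration.integral_add Bochner_Integration.integral_sum integral_divide_zero
            Bochner_Integration.integrable_add Bochner_Integration.integrable_sum integrable_divide)
      also have "\<dots> \<le> (\<Sum>j\<le>L. c * (1 / real (Suc L) ^ 3) * (1 / real (Suc j) ^ 3)) + (\<Sum>N\<le>L. c * (1 / real (Suc L) ^ 3) * (1 / real (Suc N) ^ 3)) + e / real (Suc L) ^ 2"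
      proof (intro add_mono sum_mono divide_right_mono Xm le)
        show "expectation (dyadic_energy N L) \<le> c * (1 / real (Suc L) ^ 3) * (1 / real (Suc N) ^ 3)" for N
          using le[of N L] by (simp only: mult_ac)
      qed auto
      also have "\<dots> \<le> c * inverse (real (Suc L) ^ 2) + c * inverse (real (Suc L) ^ 2) + e * inverse (real (Suc L) ^ 2)"
        by (intro add_mono b) (simp add: divide_inverse)
      finally show ?thesis by (simp add: algebra_simps)
    qed
    have "summable (\<lambda>L. inverse (real (Suc L) ^ 2))"
      using inverse_power_summable[of 2, where 'a=real] by (subst summable_Suc_iff) auto
    then show "summable (\<lambda>L. (2 * c + e) * inverse (real (Suc L) ^ 2))" by (rule summable_mult)
  qed
  then show ?thesis
  proof eventually_elim
    case (elim \<omega>)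
    then have "Bseq (\<lambda>L. Y L \<omega>)" by (intro convergent_imp_Bseq convergentI)
    then obtain K where K: "\<And>L. \<bar>Y L \<omega>\<bar> \<le> K" unfolding Bseq_def by auto
    have s0: "(\<Sum>j\<le>L. dyadic_energy L j \<omega>) \<ge> 0" "(\<Sum>N\<le>L. dyadic_energy N L \<omega>) \<ge> 0" "X (real L) \<omega> ^ 96 / real (Suc L) ^ 2 \<ge> 0" for L
      by (intro sum_nonneg dyadic_energy_nonneg divide_nonneg_nonneg; simp)+
    have 1: "dyadic_energy N j \<omega> \<le> max K 1" for N j
    proof (cases "j \<le> N")
      case True
      have "dyadic_energy N j \<omega> \<le> (\<Sum>j\<le>N. dyadic_energy N j \<omega>)"
        by (rule member_le_sum) (use True dyadic_energy_nonneg in auto)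
      then show ?thesis using s0(2,3)[of N] K[of N] unfolding Y_def by linarith
    next
      case False
      have "dyadic_energy N j \<omega> \<le> (\<Sum>N\<le>j. dyadic_energy N j \<omega>)"
        by (rule member_le_sum[of N "{..j}" "\<lambda>N. dyadic_energy N j \<omega>"]) (use False dyadic_energy_nonneg in auto)
      then show ?thesis using s0(1,3)[of j] K[of j] unfolding Y_def by linarith
    qed
    have 2: "X (real N) \<omega> ^ 96 \<le> max K 1 * real (Suc N) ^ 2" for N
    proof -
      have "X (real N) \<omega> ^ 96 / real (Suc N) ^ 2 \<le> max K 1" using s0(1,2)[of N] K[of N] unfolding Y_def by linarith
      then show ?thesis by (simp only: pos_divide_le_eq zero_less_power of_nat_0_less_iff zero_less_Suc)
    qed
    show ?case by (intro exI[of _ "max K 1"] conjI allI 1 2) simp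
  qed
qed

text \<open>The 96th root; \<open>K \<ge> 1\<close> allows \<open>K\<close> in place of its
  root.\<close>

lemma power_96_le_imp:
  fixes d K u :: real
  assumes le: "d ^ 96 \<le> K * u ^ 4 * v ^ 24" and K: "K \<ge> 1" and u: "u > 0" and v: "v > 0"
  shows "\<bar>d\<bar> \<le> K * u powr (1/24) * v powr (1/4)"
proof -
  have p: "(x powr a) ^ n = x powr (a * real n)" if "x > 0" for x a :: real and n :: nat
    using that by (simp add: powr_power mult.commute)
  have "(u powr (1/24)) ^ 96 = u powr (real 4)" "(v powr (1/4)) ^ 96 = v powr (real 24)"
    unfolding p[OF u] p[OF v] by simp_all
  then have e: "(u powr (1/24)) ^ 96 = u ^ 4" "(v powr (1/4)) ^ 96 = v ^ 24"
    unfolding powr_realpow[OF u] powr_realpow[OF v] by auto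
  have "\<bar>d\<bar> ^ 96 \<le> K * u ^ 4 * v ^ 24" using le by simp
  also have "\<dots> \<le> K ^ 96 * u ^ 4 * v ^ 24"
    using K u v power_increasing[of 1 96 K] by (intro mult_right_mono) auto
  also have "\<dots> = (K * u powr (1/24) * v powr (1/4)) ^ 96" unfolding power_mult_distrib e ..
  finally have le': "\<bar>d\<bar> ^ 96 \<le> (K * u powr (1/24) * v powr (1/4)) ^ 96" .
  have "(K * u powr (1/24) * v powr (1/4)) ^ 96 < \<bar>d\<bar> ^ 96" if "K * u powr (1/24) * v powr (1/4) < \<bar>d\<bar>"
    by (rule power_strict_mono[OF that]) (use K in auto)
  then show ?thesis using le' by linarith
qed

text \<open>One random constant bounds the dyadic increments on all horizons at once. Chaining turns
  this into a Hoelder bound, and the growth bound follows from the value at the integer below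
  t.\<close>

lemma X_Hoelder:
  "AE \<omega> in M. \<exists>K\<ge>0. \<forall>s t. 0 \<le> s \<longrightarrow> s \<le> t \<longrightarrow> t \<le> s + 1 \<longrightarrow>
     \<bar>X t \<omega>\<bar> \<le> K * (1 + t) powr (1/24) \<and> \<bar>X t \<omega> - X s \<omega>\<bar> \<le> K * (1 + t) powr (1/24) * (t - s) powr (1/4)"
  using dyadic_energy_bounded
proof eventually_elim
  case (elim \<omega>)
  then obtain K where K: "K \<ge> 1" and de: "\<And>N j. dyadic_energy N j \<omega> \<le> K" and XN: "\<And>N. X (real N) \<omega> ^ 96 \<le> K * real (Suc N) ^ 2"
    by blast
  obtain c where c: "c \<ge> 0" and hoelder: "\<And>x A s t (N :: nat). continuous_on {0..} x \<Longrightarrow> A \<ge> 0 \<Longrightarrow> 0 \<le> s \<Longrightarrow> s \<le> t \<Longrightarrow> t \<le> s + 1 \<Longrightarrow> t \<le> real N \<Longrightarrow>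
    (\<And>j i. i < N * 2 ^ j \<Longrightarrow> \<bar>x (real (Suc i) / 2 ^ j) - x (real i / 2 ^ j)\<bar> \<le> A * (1 / 2 ^ j) powr (1/4)) \<Longrightarrow>
    \<bar>x t - x s :: real\<bar> \<le> c * A * (t - s) powr (1/4)"
    using dyadic_Hoelder by metis
  define a where "a u = u powr (1/24)" for u :: real
  have inc: "\<bar>X (real (Suc i) / 2 ^ j) \<omega> - X (real i / 2 ^ j) \<omega>\<bar> \<le> K * a (real (Suc N)) * (1 / 2 ^ j) powr (1/4)"
    if i: "i < N * 2 ^ j" for i j N
  proof -
    let ?D = "\<lambda>i. X (real (Suc i) / 2 ^ j) \<omega> - X (real i / 2 ^ j) \<omega>"
    have "2 ^ (24 * j) * ?D i ^ 96 \<le> (\<Sum>i<N * 2 ^ j. 2 ^ (24 * j) * ?D i ^ 96)"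
      by (rule member_le_sum) (use i in auto)
    also have "\<dots> \<le> K * real (Suc N) ^ 4"
      using de[of N j] unfolding dyadic_energy_def by (simp only: pos_divide_le_eq zero_less_power of_nat_0_less_iff zero_less_Suc)
    finally have "2 ^ (24 * j) * ?D i ^ 96 \<le> K * real (Suc N) ^ 4" .
    then have "(1 / 2 ^ (24 * j)) * (2 ^ (24 * j) * ?D i ^ 96) \<le> (1 / 2 ^ (24 * j)) * (K * real (Suc N) ^ 4)" by (intro mult_left_mono) auto
    moreover have "(1 / 2 ^ (24 * j)) * (2 ^ (24 * j) * ?D i ^ 96) = ?D i ^ 96" by simp
    moreover have "(1 / 2 ^ (24 * j)) = (1 / 2 ^ j :: real) ^ 24" by (simp add: power_divide power_mult[symmetric] mult.commute)
    ultimately have "?D i ^ 96 \<le> K * real (Suc N) ^ 4 * (1 / 2 ^ j) ^ 24" by (simp only: mult_ac)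
    then show ?thesis unfolding a_def by (rule power_96_le_imp) (use K in auto)
  qed
  have a_mono: "a u \<le> a v" if "0 \<le> u" "u \<le> v" for u v unfolding a_def using that by (intro powr_mono2) auto
  have a0: "a u \<ge> 0" for u by (simp add: a_def)
  have H: "\<bar>X t \<omega> - X s \<omega>\<bar> \<le> 2 * c * K * a (1 + t) * (t - s) powr (1/4)" if st: "0 \<le> s" "s \<le> t" "t \<le> s + 1" for s t
  proof -
    \<comment> \<open>The smallest integer horizon that contains t; N + 1 \<le> 2 (1 + t) turns its
      growth factor into one in t.\<close>
    define N where "N = nat \<lceil>t\<rceil>"
    have N: "t \<le> real N" "real N \<le> t + 1" unfolding N_def using st by linarith+
    have "a (real (Suc N)) \<le> a (2 * (1 + t))" using st N by (intro a_mono) auto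
    also have "\<dots> = 2 powr (1/24) * a (1 + t)" unfolding a_def by (rule powr_mult)
    also have "\<dots> \<le> 2 powr 1 * a (1 + t)" by (intro mult_right_mono powr_mono a0) auto
    finally have aN: "a (real (Suc N)) \<le> 2 * a (1 + t)" by simp
    have "\<bar>X t \<omega> - X s \<omega>\<bar> \<le> c * (K * a (real (Suc N))) * (t - s) powr (1/4)"
      by (rule hoelder[OF X_cont _ st N(1)]) (use K a0 inc in auto)
    also have "\<dots> \<le> c * (K * (2 * a (1 + t))) * (t - s) powr (1/4)"
      using c K aN by (intro mult_right_mono mult_left_mono) auto
    finally show ?thesis by (simp only: mult_ac)
  qed
  have G: "\<bar>X t \<omega>\<bar> \<le> (K + 2 * c * K) * a (1 + t)" if t: "0 \<le> t" for t
  proof -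
    define N where "N = nat \<lfloor>t\<rfloor>"
    have N: "real N \<le> t" "t \<le> real N + 1" unfolding N_def using t by linarith+
    have "X (real N) \<omega> ^ 96 \<le> K * real (Suc N) ^ 4 * 1 ^ 24"
    proof -
      have "real (Suc N) ^ 2 \<le> real (Suc N) ^ 4" by (intro power_increasing) auto
      then have "K * real (Suc N) ^ 2 \<le> K * real (Suc N) ^ 4" using K by (intro mult_left_mono) auto
      then show ?thesis using XN[of N] by simp
    qed
    then have "\<bar>X (real N) \<omega>\<bar> \<le> K * a (real (Suc N)) * 1 powr (1/4)" unfolding a_def by (rule power_96_le_imp) (use K in auto)
    also have "\<dots> \<le> K * a (1 + t)" using K N a_mono[of "real (Suc N)" "1 + t"] by simp
    finally have 1: "\<bar>X (real N) \<omega>\<bar> \<le> K * a (1 + t)" .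
    have "\<bar>X t \<omega> - X (real N) \<omega>\<bar> \<le> 2 * c * K * a (1 + t) * (t - real N) powr (1/4)" by (rule H) (use N in auto)
    also have "\<dots> \<le> 2 * c * K * a (1 + t) * 1"
      using N c K a0 powr_mono2[of "1/4" "t - real N" 1] by (intro mult_left_mono mult_nonneg_nonneg) auto
    finally show ?thesis using 1 by (simp add: distrib_right)
  qed
  have "2 * c * K * a (1 + t) * (t - s) powr (1/4) \<le> (K + 2 * c * K) * a (1 + t) * (t - s) powr (1/4)" for s t
    using K a0 by (intro mult_right_mono) auto
  then have "\<bar>X t \<omega> - X s \<omega>\<bar> \<le> (K + 2 * c * K) * a (1 + t) * (t - s) powr (1/4)" if "0 \<le> s" "s \<le> t" "t \<le> s + 1" for s t
    using H[OF that] order_trans by blast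
  then show ?case using G K c unfolding a_def by (intro exI[of _ "K + 2 * c * K"]) auto
qed

end

section \<open>Ergodic averages\<close>

lemma le_imp_tendsto_0:
  fixes f g :: "'b \<Rightarrow> real"
  assumes "\<forall>\<^sub>F x in F. \<bar>f x\<bar> \<le> g x" "(g \<longlongrightarrow> 0) F"
  shows "(f \<longlongrightarrow> 0) F"
  by (rule Lim_null_comparison[OF _ assms(2)]) (use assms(1) in simp)

lemma powr_one_plus_le:
  fixes u a :: real
  assumes "u \<ge> 1" "0 \<le> a" "a \<le> 1"
  shows "(1 + u) powr a \<le> 2 * u powr a"
proof -
  have "(1 + u) powr a \<le> (2 * u) powr a" using assms by (intro powr_mono2) auto
  also have "\<dots> = 2 powr a * u powr a" by (rule powr_mult)
  also have "\<dots> \<le> 2 powr 1 * u powr a" using assms by (intro mult_right_mono powr_mono) auto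
  finally show ?thesis by simp
qed

context fbm_ou
begin

text \<open>The square of a covariance of order 1/|t - s| is summable: along a grid of step \<Delta>
  each row of squares sums to order 1 + 1/\<Delta>, so the n^2 pairs contribute only n (1 +
  1/\<Delta>), and the boundary terms have the same order. Division by n^2 and squaring give the
  rate.\<close>

lemma fourth_moment_grid:
  "\<exists>C\<ge>0. \<forall>n \<Delta>. n \<ge> 1 \<longrightarrow> \<Delta> > 0 \<longrightarrow>
     expectation (\<lambda>\<omega>. (wick_square_sum {..<n} (\<lambda>i. X (real i * \<Delta>)) \<omega> / real n) ^ 4) \<le> C * (1 / real n + 1 / (real n * \<Delta>))\<^sup>2"
proof -
  obtain C where C: "C \<ge> 0" and dec: "\<And>s t. 0 \<le> s \<Longrightarrow> s \<le> t \<Longrightarrow>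
   \<bar>expectation (\<lambda>\<omega>. X s \<omega> * X t \<omega>)\<bar> \<le> C * (1 / (1 + s) + 1 / (1 + (t - s)))"
    using cov_X_decay by blast
  have sq: "(expectation (\<lambda>\<omega>. X s \<omega> * X t \<omega>))\<^sup>2 \<le> 2 * C\<^sup>2 * (1 / (1 + s)\<^sup>2 + 1 / (1 + (t - s))\<^sup>2)" if "0 \<le> s" "s \<le> t" for s t
  proof -
    have "(expectation (\<lambda>\<omega>. X s \<omega> * X t \<omega>))\<^sup>2 \<le> (C * (1 / (1 + s) + 1 / (1 + (t - s))))\<^sup>2"
      using dec[OF that] by (intro abs_le_square_iff[THEN iffD1] order_trans[OF _ abs_ge_self])
    also have "\<dots> \<le> C\<^sup>2 * (2 * ((1 / (1 + s))\<^sup>2 + (1 / (1 + (t - s)))\<^sup>2))"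
      unfolding power_mult_distrib using sum_squares_bound[of "1 / (1 + s)" "1 / (1 + (t - s))"]
      by (intro mult_left_mono) (auto simp: power2_sum)
    also have "\<dots> = 2 * C\<^sup>2 * (1 / (1 + s)\<^sup>2 + 1 / (1 + (t - s))\<^sup>2)"
      unfolding power_divide power_one by (simp only: mult_ac)
    finally show ?thesis .
  qed
  have sq': "(expectation (\<lambda>\<omega>. X s \<omega> * X t \<omega>))\<^sup>2 \<le> 2 * C\<^sup>2 * (1 / (1 + s)\<^sup>2 + 1 / (1 + t)\<^sup>2 + 1 / (1 + \<bar>s - t\<bar>)\<^sup>2)" if "0 \<le> s" "0 \<le> t" for s t
  proof (cases "s \<le> t")
    case True
    have "2 * C\<^sup>2 * (1 / (1 + s)\<^sup>2 + 1 / (1 + (t - s))\<^sup>2) \<le> 2 * C\<^sup>2 * (1 / (1 + s)\<^sup>2 + 1 / (1 + t)\<^sup>2 + 1 / (1 + \<bar>s - t\<bar>)\<^sup>2)"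
      using True by (intro mult_left_mono) auto
    then show ?thesis using sq[OF that(1) True] by linarith
  next
    case False
    have "2 * C\<^sup>2 * (1 / (1 + t)\<^sup>2 + 1 / (1 + (s - t))\<^sup>2) \<le> 2 * C\<^sup>2 * (1 / (1 + s)\<^sup>2 + 1 / (1 + t)\<^sup>2 + 1 / (1 + \<bar>s - t\<bar>)\<^sup>2)"
      using False by (intro mult_left_mono) auto
    moreover have "expectation (\<lambda>\<omega>. X s \<omega> * X t \<omega>) = expectation (\<lambda>\<omega>. X t \<omega> * X s \<omega>)" by (simp only: mult.commute)
    ultimately show ?thesis using sq[of t s] that False by simp
  qed
  define K where "K = 60 * (8 * C\<^sup>2)\<^sup>2"
  have "expectation (\<lambda>\<omega>. (wick_square_sum {..<n} (\<lambda>i. X (real i * \<Delta>)) \<omega> / real n) ^ 4) \<le> K * (1 / real n + 1 / (real n * \<Delta>))\<^sup>2"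
    if n: "n \<ge> 1" and D: "\<Delta> > 0" for n \<Delta>
  proof -
    let ?R = "\<Sum>i<n. \<Sum>j<n. (expectation (\<lambda>\<omega>. X (real i * \<Delta>) \<omega> * X (real j * \<Delta>) \<omega>))\<^sup>2"
    have "?R \<le> (\<Sum>i<n. \<Sum>j<n. 2 * C\<^sup>2 * (1 / (1 + real i * \<Delta>)\<^sup>2 + 1 / (1 + real j * \<Delta>)\<^sup>2 + 1 / (1 + \<bar>real i - real j\<bar> * \<Delta>)\<^sup>2))"
    proof (intro sum_mono)
      fix i j :: nat
      have "\<bar>real i * \<Delta> - real j * \<Delta>\<bar> = \<bar>real i - real j\<bar> * \<Delta>"
        using D by (simp add: left_diff_distrib[symmetric] abs_mult)
      then show "(expectation (\<lambda>\<omega>. X (real i * \<Delta>) \<omega> * X (real j * \<Delta>) \<omega>))\<^sup>2 \<le> 2 * C\<^sup>2 * (1 / (1 + real i * \<Delta>)\<^sup>2 + 1 / (1 + real j * \<Delta>)\<^sup>2 + 1 / (1 + \<bar>real i - real j\<bar> * \<Delta>)\<^sup>2)"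
        using sq'[of "real i * \<Delta>" "real j * \<Delta>"] D by simp
    qed
    also have "\<dots> = 2 * C\<^sup>2 * (\<Sum>i<n. \<Sum>j<n. 1 / (1 + real i * \<Delta>)\<^sup>2 + 1 / (1 + real j * \<Delta>)\<^sup>2 + 1 / (1 + \<bar>real i - real j\<bar> * \<Delta>)\<^sup>2)"
      by (simp only: sum_distrib_left)
    also have "\<dots> \<le> 2 * C\<^sup>2 * (4 * (real n * (1 + 1 / \<Delta>)))"
      by (intro mult_left_mono double_sum_inverse_square_le D) auto
    finally have R: "?R \<le> 8 * C\<^sup>2 * (real n * (1 + 1 / \<Delta>))" by simp
    have R0: "?R \<ge> 0" by (intro sum_nonneg) auto
    have "expectation (\<lambda>\<omega>. (wick_square_sum {..<n} (\<lambda>i. X (real i * \<Delta>)) \<omega> / real n) ^ 4)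
      = expectation (\<lambda>\<omega>. wick_square_sum {..<n} (\<lambda>i. X (real i * \<Delta>)) \<omega> ^ 4) / real n ^ 4"
      by (simp add: power_divide)
    also have "\<dots> \<le> 60 * ?R\<^sup>2 / real n ^ 4"
      by (intro divide_right_mono fourth_moment_wick_square_sum XS) (use D in auto)
    also have "\<dots> \<le> 60 * (8 * C\<^sup>2 * (real n * (1 + 1 / \<Delta>)))\<^sup>2 / real n ^ 4"
      by (intro divide_right_mono mult_left_mono power_mono R R0) auto
    also have "\<dots> = K * (real n * (1 + 1 / \<Delta>) / (real n)\<^sup>2)\<^sup>2"
      by (simp add: K_def power_mult_distrib power_divide flip: power_mult)
    also have "real n * (1 + 1 / \<Delta>) / (real n)\<^sup>2 = 1 / real n + 1 / (real n * \<Delta>)"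
      using n D by (simp add: power2_eq_square add_divide_distrib)
    finally show ?thesis .
  qed
  then show ?thesis by (intro exI[of _ K]) (auto simp: K_def)
qed

lemma second_moment_cont: "continuous_on {0..} (\<lambda>t. expectation (\<lambda>\<omega>. (X t \<omega>)\<^sup>2))"
proof -
  have "continuous_on {0..} (\<lambda>t. (L2norm (X t))\<^sup>2)"
    by (intro continuous_on_power L2norm_continuous process_X)
  then show ?thesis by (simp add: L2norm_square)
qed

text \<open>Fourth moments handle the fluctuation around the mean, Cesaro averaging the mean itself.
  The number of points and the step are separate sequences, since the lemma serves both the time
  average and the grid with enlarged step.\<close>

lemma ergodic_grid:
  assumes \<eta>: "((\<lambda>t. expectation (\<lambda>\<omega>. (X t \<omega>)\<^sup>2)) \<longlongrightarrow> \<eta>) at_top"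
    and k: "\<And>n. k n \<ge> (1::nat)" and D: "\<And>n. \<Delta> n > 0"
    and s: "summable (\<lambda>n. (1 / real (k n) + 1 / (real (k n) * \<Delta> n))\<^sup>2)"
  shows "AE \<omega> in M. (\<lambda>n. (\<Sum>i<k n. (X (real i * \<Delta> n) \<omega>)\<^sup>2) / real (k n)) \<longlonglongrightarrow> \<eta>"
proof -
  define Y where "Y n = wick_square_sum {..<k n} (\<lambda>i. X (real i * \<Delta> n))" for n
  obtain C where C: "C \<ge> 0" and le: "\<And>n \<Delta>. n \<ge> 1 \<Longrightarrow> \<Delta> > 0 \<Longrightarrow>
     expectation (\<lambda>\<omega>. (wick_square_sum {..<n} (\<lambda>i. X (real i * \<Delta>)) \<omega> / real n) ^ 4) \<le> C * (1 / real n + 1 / (real n * \<Delta>))\<^sup>2"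
    using fourth_moment_grid by blast
  have "(\<lambda>n. sqrt ((1 / real (k n) + 1 / (real (k n) * \<Delta> n))\<^sup>2)) \<longlonglongrightarrow> sqrt 0"
    by (intro tendsto_intros summable_LIMSEQ_zero s)
  moreover have "1 / real (k n) + 1 / (real (k n) * \<Delta> n) \<ge> 0" for n using D[of n] by simp
  ultimately have l: "(\<lambda>n. 1 / real (k n) + 1 / (real (k n) * \<Delta> n)) \<longlonglongrightarrow> 0" by simp
  have m: "(\<lambda>n. (\<Sum>i<k n. expectation (\<lambda>\<omega>. (X (real i * \<Delta> n) \<omega>)\<^sup>2)) / real (k n)) \<longlonglongrightarrow> \<eta>"
    by (rule Cesaro_grid[OF \<eta> _ k D l]) (use X_sq_le in auto)
  have "AE \<omega> in M. (\<lambda>n. (Y n \<omega> / real (k n)) ^ 4) \<longlonglongrightarrow> 0"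
  proof (rule AE_tendsto_0_of_summable_expectation)
    have "Y n \<in> all_moments" for n unfolding Y_def by (rule wick_square_sum_moments) (use D[of n] XS in auto)
    then show "Bochner_Integration.integrable M (\<lambda>\<omega>. (Y n \<omega> / real (k n)) ^ 4)" for n
      unfolding power_divide by (intro integrable_divide all_moments_power)
    show "expectation (\<lambda>\<omega>. (Y n \<omega> / real (k n)) ^ 4) \<le> C * (1 / real (k n) + 1 / (real (k n) * \<Delta> n))\<^sup>2" for n
      unfolding Y_def by (rule le[OF k D])
    show "summable (\<lambda>n. C * (1 / real (k n) + 1 / (real (k n) * \<Delta> n))\<^sup>2)" by (rule summable_mult[OF s])
  qed auto
  then show ?thesis
  proof eventually_elim
    case (elim \<omega>)
    have "(\<lambda>n. root 4 ((Y n \<omega> / real (k n)) ^ 4)) \<longlonglongrightarrow> root 4 0" by (intro tendsto_intros elim)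
    moreover have "root 4 (y ^ 4) = \<bar>y\<bar>" for y :: real
      using real_root_power_cancel[of 4 "\<bar>y\<bar>"] by simp
    ultimately have "(\<lambda>n. \<bar>Y n \<omega> / real (k n)\<bar>) \<longlonglongrightarrow> 0" by simp
    then have "(\<lambda>n. Y n \<omega> / real (k n)) \<longlonglongrightarrow> 0" by (rule tendsto_rabs_zero_cancel)
    from tendsto_add[OF this m] show ?case
      unfolding Y_def wick_square_sum_def by (simp add: sum_subtractf diff_divide_distrib)
  qed
qed

definition Hoelder_path :: "real \<Rightarrow> 'a \<Rightarrow> bool" where
  "Hoelder_path K \<omega> \<longleftrightarrow> K \<ge> 0 \<and> (\<forall>s t. 0 \<le> s \<longrightarrow> s \<le> t \<longrightarrow> t \<le> s + 1 \<longrightarrow>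
     \<bar>X t \<omega>\<bar> \<le> K * (1 + t) powr (1/24) \<and> \<bar>X t \<omega> - X s \<omega>\<bar> \<le> K * (1 + t) powr (1/24) * (t - s) powr (1/4))"

text \<open>The bound on X and its modulus of continuity each carry the growth factor with exponent
  1/24, so the comparison of squares has the exponent 1/12.\<close>

lemma grid_compare:
  assumes K: "Hoelder_path K \<omega>" and n: "n \<ge> 1" and D: "0 < \<Delta>" "\<Delta> \<le> 1"
  shows "\<bar>(\<Sum>i<n. (X (real i * \<Delta>) \<omega>)\<^sup>2) / real n - integral {0..real n * \<Delta>} (\<lambda>t. (X t \<omega>)\<^sup>2) / (real n * \<Delta>)\<bar>
    \<le> 2 * K\<^sup>2 * (1 + real n * \<Delta>) powr (1/12) * \<Delta> powr (1/4)"
proof -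
  let ?T = "real n * \<Delta>"
  have K0: "K \<ge> 0" using K by (simp add: Hoelder_path_def)
  have mono: "(1 + t) powr (1/24) \<le> (1 + ?T) powr (1/24)" if "0 \<le> t" "t \<le> ?T" for t using that by (intro powr_mono2) auto
  have "\<bar>(\<Sum>i<n. (X (real i * \<Delta>) \<omega>)\<^sup>2) / real n - integral {0..?T} (\<lambda>t. (X t \<omega>)\<^sup>2) / ?T\<bar>
    \<le> 2 * (K * (1 + ?T) powr (1/24)) * (K * (1 + ?T) powr (1/24) * \<Delta> powr (1/4))"
  proof (rule riemann_sum_compare[OF X_cont n D(1)])
    fix t assume t: "0 \<le> t" "t \<le> ?T"
    have "\<bar>X t \<omega>\<bar> \<le> K * (1 + t) powr (1/24)" using K t unfolding Hoelder_path_def by (auto dest: spec[of _ t])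
    also have "\<dots> \<le> K * (1 + ?T) powr (1/24)" by (intro mult_left_mono mono t K0)
    finally show "\<bar>X t \<omega>\<bar> \<le> K * (1 + ?T) powr (1/24)" .
  next
    fix s t assume st: "0 \<le> s" "s \<le> t" "t \<le> s + \<Delta>" "t \<le> ?T"
    have "\<bar>X t \<omega> - X s \<omega>\<bar> \<le> K * (1 + t) powr (1/24) * (t - s) powr (1/4)"
      using K st D unfolding Hoelder_path_def by auto
    also have "\<dots> \<le> K * (1 + ?T) powr (1/24) * \<Delta> powr (1/4)"
      using K0 st mono[of t] by (intro mult_mono mult_left_mono powr_mono2) auto
    finally show "\<bar>X t \<omega> - X s \<omega>\<bar> \<le> K * (1 + ?T) powr (1/24) * \<Delta> powr (1/4)" .
  qed
  also have "\<dots> = 2 * K\<^sup>2 * ((1 + ?T) powr (1/24) * (1 + ?T) powr (1/24)) * \<Delta> powr (1/4)"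
    by (simp only: power2_eq_square mult_ac)
  also have "(1 + ?T) powr (1/24) * (1 + ?T) powr (1/24) = (1 + ?T) powr (1/12)"
    by (simp flip: powr_add)
  finally show ?thesis .
qed

text \<open>At integer times the time average is compared with ever finer grids, to which
  \<open>ergodic_grid\<close> applies; monotonicity of the integral of X^2 bridges the gaps between
  integers.\<close>

lemma ergodic_integral:
  assumes \<eta>: "((\<lambda>t. expectation (\<lambda>\<omega>. (X t \<omega>)\<^sup>2)) \<longlongrightarrow> \<eta>) at_top"
  shows "AE \<omega> in M. ((\<lambda>T. integral {0..T} (\<lambda>t. (X t \<omega>)\<^sup>2) / T) \<longlongrightarrow> \<eta>) at_top"
proof -
  \<comment> \<open>(n + 1)^2 points with step 1/(n + 1) cover a length n + 1: the moment bounds are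
    of order 1/n^2 and the discretisation error is of order n^(1/12 - 1/4).\<close>
  define k where "k n = (Suc n)\<^sup>2" for n
  define D where "D n = 1 / real (Suc n)" for n
  have kD: "real (k n) * D n = real (Suc n)" for n
    unfolding k_def D_def power2_eq_square of_nat_mult by simp
  have "summable (\<lambda>n. (1 / real (k n) + 1 / (real (k n) * D n))\<^sup>2)"
  proof (rule summable_comparison_test')
    show "summable (\<lambda>n. 4 * inverse (real (Suc n) ^ 2))"
      using inverse_power_summable[of 2, where 'a=real] by (intro summable_mult) (subst summable_Suc_iff, auto)
    fix n :: nat
    have "Suc n \<le> k n" by (simp add: k_def power2_eq_square)
    then have "1 / real (k n) \<le> 1 / real (Suc n)" by (intro frac_le) auto
    then have "(1 / real (k n) + 1 / (real (k n) * D n))\<^sup>2 \<le> (2 * (1 / real (Suc n)))\<^sup>2"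
      unfolding kD by (intro power_mono) (linarith, simp)
    also have "\<dots> = 4 * inverse (real (Suc n) ^ 2)" by (simp add: power_mult_distrib divide_inverse power_inverse)
    finally show "norm ((1 / real (k n) + 1 / (real (k n) * D n))\<^sup>2) \<le> 4 * inverse (real (Suc n) ^ 2)" by simp
  qed
  then have erg: "AE \<omega> in M. (\<lambda>n. (\<Sum>i<k n. (X (real i * D n) \<omega>)\<^sup>2) / real (k n)) \<longlonglongrightarrow> \<eta>"
    by (intro ergodic_grid[OF \<eta>]) (auto simp: k_def D_def)
  show ?thesis using erg X_Hoelder
  proof eventually_elim
    case (elim \<omega>)
    then obtain K where K: "Hoelder_path K \<omega>" unfolding Hoelder_path_def by blast
    define J where "J T = integral {0..T} (\<lambda>t. (X t \<omega>)\<^sup>2)" for T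
    have "(\<lambda>n. (\<Sum>i<k n. (X (real i * D n) \<omega>)\<^sup>2) / real (k n) - J (real (Suc n)) / real (Suc n)) \<longlonglongrightarrow> 0"
    proof (rule le_imp_tendsto_0[OF always_eventually[OF allI]])
      fix n
      let ?u = "real (Suc n)"
      have "\<bar>(\<Sum>i<k n. (X (real i * D n) \<omega>)\<^sup>2) / real (k n) - J ?u / ?u\<bar> \<le> 2 * K\<^sup>2 * (1 + ?u) powr (1/12) * D n powr (1/4)"
        unfolding J_def kD[symmetric] by (rule grid_compare[OF K]) (auto simp: k_def D_def)
      also have "\<dots> \<le> 2 * K\<^sup>2 * (2 * ?u powr (1/12)) * D n powr (1/4)"
        by (intro mult_right_mono mult_left_mono powr_one_plus_le) auto
      also have "D n powr (1/4) = ?u powr (-(1/4))" by (simp add: D_def powr_divide powr_minus_divide)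
      also have "2 * K\<^sup>2 * (2 * ?u powr (1/12)) * ?u powr (-(1/4)) = 4 * K\<^sup>2 * (?u powr (1/12) * ?u powr (-(1/4)))" by simp
      also have "?u powr (1/12) * ?u powr (-(1/4)) = ?u powr (-(1/6))" by (simp flip: powr_add)
      finally show "\<bar>(\<Sum>i<k n. (X (real i * D n) \<omega>)\<^sup>2) / real (k n) - J ?u / ?u\<bar> \<le> 4 * K\<^sup>2 * ?u powr (-(1/6))" .
    next
      have "(\<lambda>n. real (Suc n) powr (-(1/6))) \<longlonglongrightarrow> 0"
        by (rule tendsto_neg_powr[OF _ filterlim_compose[OF filterlim_real_sequentially filterlim_Suc]]) simp
      then show "(\<lambda>n. 4 * K\<^sup>2 * real (Suc n) powr (-(1/6))) \<longlonglongrightarrow> 0" by (rule tendsto_mult_right_zero)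
    qed
    from tendsto_diff[OF elim(1) this] have "(\<lambda>n. J (real (Suc n)) / real (Suc n)) \<longlonglongrightarrow> \<eta>" by simp
    then have JN: "(\<lambda>n. J (real n) / real n) \<longlonglongrightarrow> \<eta>" by (subst (asm) filterlim_sequentially_Suc[of "\<lambda>n. J (real n) / real n"])
    have r1: "(\<lambda>n. real n / (real n + 1)) \<longlonglongrightarrow> 1" and r2: "(\<lambda>n. (real n + 1) / real n) \<longlonglongrightarrow> 1"
      using LIMSEQ_n_over_Suc_n LIMSEQ_Suc_n_over_n by (simp_all add: add.commute)
    have l1: "(\<lambda>n. J (real n) / real n * (real n / (real n + 1))) \<longlonglongrightarrow> \<eta> * 1" by (intro tendsto_mult JN r1)
    have "(\<lambda>n. J (real n + 1) / (real n + 1)) \<longlonglongrightarrow> \<eta>"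
      using JN[THEN LIMSEQ_Suc] by (simp add: add.commute)
    then have l2: "(\<lambda>n. J (real n + 1) / (real n + 1) * ((real n + 1) / real n)) \<longlonglongrightarrow> \<eta> * 1" by (intro tendsto_mult r2)
    \<comment> \<open>The values of \<open>J\<close> at the integers N \<le> T and N + 1 enclose
      \<open>J T\<close>, and the ratio of these integers tends to 1.\<close>
    define N where "N T = nat \<lfloor>T\<rfloor>" for T :: real
    have fN: "filterlim N at_top at_top" unfolding N_def
      by (rule filterlim_compose[OF filterlim_nat_sequentially filterlim_floor_sequentially])
    have Jm: "J s \<le> J t" if "0 \<le> s" "s \<le> t" for s t unfolding J_def
      by (rule integral_subset_le) (use that in \<open>auto intro!: integrable_continuous_interval continuous_on_power continuous_on_subset[OF X_cont]\<close>)
    have J0: "J t \<ge> 0" for t unfolding J_def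
      by (cases "t \<ge> 0") (auto intro!: integral_nonneg integrable_continuous_interval continuous_on_power continuous_on_subset[OF X_cont])
    show ?case unfolding J_def[symmetric]
    proof (rule tendsto_sandwich)
      show "((\<lambda>T. J (real (N T)) / real (N T) * (real (N T) / (real (N T) + 1))) \<longlongrightarrow> \<eta>) at_top"
        using filterlim_compose[OF l1 fN] by simp
      show "((\<lambda>T. J (real (N T) + 1) / (real (N T) + 1) * ((real (N T) + 1) / real (N T))) \<longlongrightarrow> \<eta>) at_top"
        using filterlim_compose[OF l2 fN] by simp
      show "\<forall>\<^sub>F T in at_top. J (real (N T)) / real (N T) * (real (N T) / (real (N T) + 1)) \<le> J T / T"
      proof (rule eventually_mono[OF eventually_ge_at_top[of 1]])
        fix T :: real assume T: "T \<ge> 1"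
        have N: "real (N T) \<le> T" "T \<le> real (N T) + 1" "real (N T) \<ge> 1" unfolding N_def using T le_nat_floor[of 1 T] by (linarith, linarith, simp)
        have "J (real (N T)) / (real (N T) + 1) \<le> J T / T"
          using N T J0 by (intro frac_le Jm) auto
        then show "J (real (N T)) / real (N T) * (real (N T) / (real (N T) + 1)) \<le> J T / T" using N by simp
      qed
      show "\<forall>\<^sub>F T in at_top. J T / T \<le> J (real (N T) + 1) / (real (N T) + 1) * ((real (N T) + 1) / real (N T))"
      proof (rule eventually_mono[OF eventually_ge_at_top[of 1]])
        fix T :: real assume T: "T \<ge> 1"
        have N: "real (N T) \<le> T" "T \<le> real (N T) + 1" "real (N T) \<ge> 1" unfolding N_def using T le_nat_floor[of 1 T] by (linarith, linarith, simp)
        have "J T / T \<le> J (real (N T) + 1) / real (N T)"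
          using N T J0 by (intro frac_le Jm) auto
        then show "J T / T \<le> J (real (N T) + 1) / (real (N T) + 1) * ((real (N T) + 1) / real (N T))" using N by simp
      qed
    qed
  qed
qed

end

context fbm_ou
begin

text \<open>If \<open>n\<Delta>\<^sub>n \<ge> n\<^sup>3\<^sup>/\<^sup>5\<close> the fourth moments of the centred averages are summable. Otherwise
  \<open>\<Delta>\<^sub>n \<le> n\<^sup>-\<^sup>2\<^sup>/\<^sup>5\<close>, so the average is close to the time average by Hoelder continuity. The first
  case is applied to the grid with step \<open>max \<Delta>\<^sub>n n\<^sup>-\<^sup>2\<^sup>/\<^sup>5\<close>.\<close>

lemma grid_average_limit:
  assumes \<eta>: "((\<lambda>t. expectation (\<lambda>\<omega>. (X t \<omega>)\<^sup>2)) \<longlongrightarrow> \<eta>) at_top"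
    and D: "\<And>n. n \<ge> 1 \<Longrightarrow> \<Delta> n > 0" and T: "filterlim (\<lambda>n. real n * \<Delta> n) at_top sequentially"
  shows "AE \<omega> in M. (\<lambda>n. (\<Sum>i<n. (X (real i * \<Delta> n) \<omega>)\<^sup>2) / real n) \<longlonglongrightarrow> \<eta>"
proof -
  \<comment> \<open>With the exponent 2/5 the enlarged grid has length at least n^(3/5), so the
    squared rates are of order n^(-6/5) and summable; in the other case the comparison error is of
    order n^(1/20 - 1/10).\<close>
  define d where "d n = max (\<Delta> n) (real n powr (-(2/5)))" for n
  have d0: "d (Suc n) > 0" for n unfolding d_def by (simp add: less_max_iff_disj D)
  have pw: "real (Suc n) * real (Suc n) powr (-(2/5)) = real (Suc n) powr (3/5)" for n
    using powr_add[of "real (Suc n)" 1 "-(2/5)"] by simp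
  have nd: "real (Suc n) powr (3/5) \<le> real (Suc n) * d (Suc n)" for n
    unfolding pw[symmetric] d_def by (intro mult_left_mono) auto
  have "summable (\<lambda>n. (1 / real (Suc n) + 1 / (real (Suc n) * d (Suc n)))\<^sup>2)"
  proof (rule summable_comparison_test')
    have "summable (\<lambda>n. real n powr (-(6/5)))" by (subst summable_real_powr_iff) simp
    then have "summable (\<lambda>n. real (Suc n) powr (-(6/5)))" by (subst summable_Suc_iff)
    then show "summable (\<lambda>n. 4 * real (Suc n) powr (-(6/5)))" by (rule summable_mult)
    fix n :: nat
    define y where "y = real (Suc n)"
    have y: "y \<ge> 1" by (simp add: y_def)
    have "y powr (3/5) \<le> y powr 1" using y by (intro powr_mono) auto
    then have "1 / y \<le> 1 / y powr (3/5)" using y by (intro frac_le) auto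
    moreover have "1 / (y * d (Suc n)) \<le> 1 / y powr (3/5)" using nd[of n] y unfolding y_def[symmetric] by (intro frac_le) auto
    ultimately have "(1 / y + 1 / (y * d (Suc n)))\<^sup>2 \<le> (2 * (1 / y powr (3/5)))\<^sup>2"
      using y d0[of n] by (intro power_mono) auto
    also have "\<dots> = 4 * (y powr (-(3/5)))\<^sup>2" unfolding powr_minus_divide power_mult_distrib by simp
    also have "(y powr (-(3/5)))\<^sup>2 = y powr (-(6/5))" unfolding power2_eq_square by (simp flip: powr_add)
    finally show "norm ((1 / real (Suc n) + 1 / (real (Suc n) * d (Suc n)))\<^sup>2) \<le> 4 * real (Suc n) powr (-(6/5))"
      unfolding y_def by simp
  qed
  then have erg: "AE \<omega> in M. (\<lambda>n. (\<Sum>i<Suc n. (X (real i * d (Suc n)) \<omega>)\<^sup>2) / real (Suc n)) \<longlonglongrightarrow> \<eta>"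
    by (intro ergodic_grid[OF \<eta>] d0) auto
  show ?thesis using erg ergodic_integral[OF \<eta>] X_Hoelder
  proof eventually_elim
    case (elim \<omega>)
    then obtain K where K: "Hoelder_path K \<omega>" unfolding Hoelder_path_def by blast
    define q where "q e n = (\<Sum>i<n. (X (real i * e n) \<omega>)\<^sup>2) / real n" for e :: "nat \<Rightarrow> real" and n
    define J where "J T = integral {0..T} (\<lambda>t. (X t \<omega>)\<^sup>2) / T" for T
    have q: "(\<lambda>n. q d n) \<longlonglongrightarrow> \<eta>" unfolding q_def
      by (rule filterlim_sequentially_Suc[THEN iffD1]) (use elim(1) in simp)
    have J: "(\<lambda>n. J (real n * \<Delta> n)) \<longlonglongrightarrow> \<eta>" unfolding J_def by (rule filterlim_compose[OF elim(2) T])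
    \<comment> \<open>Which case applies may change with n, so both are put into one bound: q
      \<Delta> n either equals the average over the enlarged grid or is close to the time
      average.\<close>
    have le: "\<bar>q \<Delta> n - \<eta>\<bar> \<le> \<bar>q d n - \<eta>\<bar> + \<bar>J (real n * \<Delta> n) - \<eta>\<bar> + 4 * K\<^sup>2 * real n powr (-(1/20))" if n: "n \<ge> 1" for n
    proof (cases "\<Delta> n \<ge> real n powr (-(2/5))")
      case True
      then have "d n = \<Delta> n" by (simp add: d_def)
      then have "q d n = q \<Delta> n" by (simp add: q_def)
      moreover have "4 * K\<^sup>2 * real n powr (-(1/20)) \<ge> 0" by simp
      ultimately show ?thesis by linarith
    next
      case False
      define y where "y = real n"
      have y: "y \<ge> 1" using n by (simp add: y_def)
      have Dy: "\<Delta> n \<le> y powr (-(2/5))" using False by (simp add: y_def)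
      have "y powr (-(2/5)) \<le> y powr 0" using y by (intro powr_mono) auto
      then have D1: "\<Delta> n \<le> 1" using Dy y by simp
      have "y * \<Delta> n \<le> y * y powr (-(2/5))" using Dy y by (intro mult_left_mono) auto
      also have "\<dots> = y powr (3/5)" using powr_add[of y 1 "-(2/5)"] y by simp
      finally have Ty: "y * \<Delta> n \<le> y powr (3/5)" .
      have y35: "y powr (3/5) \<ge> 1" using y ge_one_powr_ge_zero by simp
      have "\<bar>q \<Delta> n - J (y * \<Delta> n)\<bar> \<le> 2 * K\<^sup>2 * (1 + y * \<Delta> n) powr (1/12) * \<Delta> n powr (1/4)"
        unfolding q_def J_def y_def by (rule grid_compare[OF K n D[OF n] D1])
      also have "\<dots> \<le> 2 * K\<^sup>2 * (1 + y powr (3/5)) powr (1/12) * (y powr (-(2/5))) powr (1/4)"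
        using Ty Dy y D[OF n] by (intro mult_mono mult_left_mono powr_mono2 mult_nonneg_nonneg add_nonneg_nonneg) auto
      also have "\<dots> \<le> 2 * K\<^sup>2 * (2 * (y powr (3/5)) powr (1/12)) * (y powr (-(2/5))) powr (1/4)"
        using y35 by (intro mult_right_mono mult_left_mono powr_one_plus_le) auto
      also have "\<dots> = 4 * K\<^sup>2 * (y powr (1/20) * y powr (-(1/10)))" by (simp add: powr_powr)
      also have "y powr (1/20) * y powr (-(1/10)) = y powr (-(1/20))" by (simp flip: powr_add)
      finally show ?thesis unfolding y_def by linarith
    qed
    have "(\<lambda>n. q \<Delta> n - \<eta>) \<longlonglongrightarrow> 0"
    proof (rule le_imp_tendsto_0)
      show "\<forall>\<^sub>F n in sequentially. \<bar>q \<Delta> n - \<eta>\<bar> \<le> \<bar>q d n - \<eta>\<bar> + \<bar>J (real n * \<Delta> n) - \<eta>\<bar> + 4 * K\<^sup>2 * real n powr (-(1/20))"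
        by (rule eventually_mono[OF eventually_ge_at_top[of 1] le])
      have "(\<lambda>n. real n powr (-(1/20))) \<longlonglongrightarrow> 0" by (rule tendsto_neg_powr[OF _ filterlim_real_sequentially]) simp
      then have "(\<lambda>n. \<bar>q d n - \<eta>\<bar> + \<bar>J (real n * \<Delta> n) - \<eta>\<bar> + 4 * K\<^sup>2 * real n powr (-(1/20))) \<longlonglongrightarrow> \<bar>\<eta> - \<eta>\<bar> + \<bar>\<eta> - \<eta>\<bar> + 4 * K\<^sup>2 * 0"
        by (intro tendsto_intros q J)
      then show "(\<lambda>n. \<bar>q d n - \<eta>\<bar> + \<bar>J (real n * \<Delta> n) - \<eta>\<bar> + 4 * K\<^sup>2 * real n powr (-(1/20))) \<longlonglongrightarrow> 0" by simp
    qed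
    then show ?case unfolding q_def by (rule LIM_zero_cancel)
  qed
qed

text \<open>The growth exponent 1/24 of the paths is far below 1/2.\<close>

lemma X_square_over_time: "AE \<omega> in M. ((\<lambda>T. (X T \<omega>)\<^sup>2 / T) \<longlongrightarrow> 0) at_top"
  using X_Hoelder
proof eventually_elim
  case (elim \<omega>)
  then obtain K where K: "Hoelder_path K \<omega>" unfolding Hoelder_path_def by blast
  then have K0: "K \<ge> 0" by (simp add: Hoelder_path_def)
  show ?case
  proof (rule le_imp_tendsto_0)
    show "\<forall>\<^sub>F T in at_top. \<bar>(X T \<omega>)\<^sup>2 / T\<bar> \<le> 4 * K\<^sup>2 * T powr (-(11/12))"
    proof (rule eventually_mono[OF eventually_ge_at_top[of 1]])
      fix T :: real assume T: "T \<ge> 1"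
      have "\<bar>X T \<omega>\<bar> \<le> K * (1 + T) powr (1/24)" using K T unfolding Hoelder_path_def by (auto dest: spec[of _ T])
      also have "\<dots> \<le> K * (2 * T powr (1/24))" using K0 T by (intro mult_left_mono powr_one_plus_le) auto
      finally have "\<bar>X T \<omega>\<bar>\<^sup>2 \<le> (K * (2 * T powr (1/24)))\<^sup>2" by (intro power_mono) auto
      also have "\<dots> = 4 * K\<^sup>2 * (T powr (1/24) * T powr (1/24))" by (simp add: power2_eq_square)
      also have "T powr (1/24) * T powr (1/24) = T powr (1/12)" by (simp flip: powr_add)
      finally have "(X T \<omega>)\<^sup>2 / T \<le> 4 * K\<^sup>2 * T powr (1/12) / T" using T by (simp add: divide_right_mono)
      also have "\<dots> = 4 * K\<^sup>2 * T powr (-(11/12))" using T powr_diff[of T "1/12" 1] by simp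
      finally show "\<bar>(X T \<omega>)\<^sup>2 / T\<bar> \<le> 4 * K\<^sup>2 * T powr (-(11/12))" using T by simp
    qed
    have "((\<lambda>T::real. T powr (-(11/12))) \<longlongrightarrow> 0) at_top" by (rule tendsto_neg_powr[OF _ filterlim_ident]) simp
    then show "((\<lambda>T. 4 * K\<^sup>2 * T powr (-(11/12))) \<longlongrightarrow> 0) at_top" by (rule tendsto_mult_right_zero)
  qed
qed

text \<open>The second moments of X and of \<integral>X are bounded in T, so after division by T
  only the time integral of E X^2 contributes.\<close>

lemma expectation_chaos_limit:
  assumes \<eta>: "((\<lambda>t. expectation (\<lambda>\<omega>. (X t \<omega>)\<^sup>2)) \<longlongrightarrow> \<eta>) at_top"
  shows "((\<lambda>T. expectation (chaos T) / T) \<longlongrightarrow> (\<theta> + \<rho>) * \<eta>) at_top"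
proof -
  have inv: "((\<lambda>T::real. c / T) \<longlongrightarrow> 0) at_top" for c
    by (rule tendsto_divide_0[OF tendsto_const]) (rule filterlim_at_top_imp_at_infinity[OF filterlim_ident])
  have 1: "((\<lambda>T. expectation (\<lambda>\<omega>. (X T \<omega>)\<^sup>2) / T) \<longlongrightarrow> 0) at_top"
    by (rule le_imp_tendsto_0[OF eventually_mono[OF eventually_gt_at_top[of 0]] inv[of "cX\<^sup>2"]])
      (use X_sq_le in \<open>auto intro: divide_right_mono\<close>)
  have s: "expectation (\<lambda>\<omega>. (Sig T \<omega>)\<^sup>2) \<le> ((cV + cX) / \<theta>)\<^sup>2" if "T \<ge> 0" for T
    unfolding L2norm_square[symmetric] by (intro power_mono L2norm_Sig that L2norm_nonneg)
  have 2: "((\<lambda>T. expectation (\<lambda>\<omega>. (Sig T \<omega>)\<^sup>2) / T) \<longlongrightarrow> 0) at_top"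
    by (rule le_imp_tendsto_0[OF eventually_mono[OF eventually_gt_at_top[of 0]] inv[of "((cV + cX) / \<theta>)\<^sup>2"]])
      (use s in \<open>auto intro: divide_right_mono\<close>)
  have 3: "((\<lambda>T. integral {0..T} (\<lambda>t. expectation (\<lambda>\<omega>. (X t \<omega>)\<^sup>2)) / T) \<longlongrightarrow> \<eta>) at_top"
    by (rule Cesaro_integral[OF \<eta> second_moment_cont])
  have "((\<lambda>T. (expectation (\<lambda>\<omega>. (X T \<omega>)\<^sup>2) / T) / 2 + (\<theta> + \<rho>) * (integral {0..T} (\<lambda>t. expectation (\<lambda>\<omega>. (X t \<omega>)\<^sup>2)) / T)
      + \<rho> * \<theta> / 2 * (expectation (\<lambda>\<omega>. (Sig T \<omega>)\<^sup>2) / T)) \<longlongrightarrow> 0 / 2 + (\<theta> + \<rho>) * \<eta> + \<rho> * \<theta> / 2 * 0) at_top"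
    by (intro tendsto_intros 1 2 3) simp
  moreover have "\<forall>\<^sub>F T in at_top. (expectation (\<lambda>\<omega>. (X T \<omega>)\<^sup>2) / T) / 2 + (\<theta> + \<rho>) * (integral {0..T} (\<lambda>t. expectation (\<lambda>\<omega>. (X t \<omega>)\<^sup>2)) / T)
      + \<rho> * \<theta> / 2 * (expectation (\<lambda>\<omega>. (Sig T \<omega>)\<^sup>2) / T) = expectation (chaos T) / T"
    by (rule eventually_mono[OF eventually_gt_at_top[of 0]]) (simp add: expectation_chaos add_divide_distrib)
  ultimately have "((\<lambda>T. expectation (chaos T) / T) \<longlongrightarrow> 0 / 2 + (\<theta> + \<rho>) * \<eta> + \<rho> * \<theta> / 2 * 0) at_top"
    by (rule Lim_transform_eventually)
  then show ?thesis by simp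
qed

text \<open>Divided by T, the difference X^2/2 minus the mean tends to - (\<theta> + \<rho>) \<eta>,
  while the average in the denominator tends to \<eta> > 0; the unknown \<eta> cancels.\<close>

lemma estimator_limit:
  assumes D: "\<And>n. n \<ge> 1 \<Longrightarrow> \<Delta> n > 0" and T: "filterlim (\<lambda>n. real n * \<Delta> n) at_top sequentially"
  shows "AE \<omega> in M. (\<lambda>n. - ((1 / (real n * \<Delta> n)) * ((X (real n * \<Delta> n) \<omega>)\<^sup>2 / 2 - expectation (chaos (real n * \<Delta> n))))
    / ((1 / real n) * (\<Sum>i<n. (X (real i * \<Delta> n) \<omega>)\<^sup>2))) \<longlonglongrightarrow> \<theta> + \<rho>"
proof -
  obtain \<eta> where \<eta>: "\<eta> > 0" "((\<lambda>t. expectation (\<lambda>\<omega>. (X t \<omega>)\<^sup>2)) \<longlongrightarrow> \<eta>) at_top"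
    using second_moment_X_limit by blast
  have "AE \<omega> in M. (\<lambda>n. (\<Sum>i<n. (X (real i * \<Delta> n) \<omega>)\<^sup>2) / real n) \<longlonglongrightarrow> \<eta>" by (rule grid_average_limit[OF \<eta>(2) D T])
  then show ?thesis using X_square_over_time
  proof eventually_elim
    case (elim \<omega>)
    let ?T = "\<lambda>n. real n * \<Delta> n"
    have "(\<lambda>n. - ((X (?T n) \<omega>)\<^sup>2 / ?T n / 2 - expectation (chaos (?T n)) / ?T n) / ((\<Sum>i<n. (X (real i * \<Delta> n) \<omega>)\<^sup>2) / real n))
      \<longlonglongrightarrow> - (0 / 2 - (\<theta> + \<rho>) * \<eta>) / \<eta>"
      using filterlim_compose[OF elim(2) T] filterlim_compose[OF expectation_chaos_limit[OF \<eta>(2)] T] elim(1) \<eta>(1)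
      by (intro tendsto_intros) auto
    moreover have "- ((X (?T n) \<omega>)\<^sup>2 / ?T n / 2 - expectation (chaos (?T n)) / ?T n) / ((\<Sum>i<n. (X (real i * \<Delta> n) \<omega>)\<^sup>2) / real n)
      = - ((1 / ?T n) * ((X (?T n) \<omega>)\<^sup>2 / 2 - expectation (chaos (?T n)))) / ((1 / real n) * (\<Sum>i<n. (X (real i * \<Delta> n) \<omega>)\<^sup>2))" for n
      by (simp add: diff_divide_distrib mult.commute)
    ultimately show ?case using \<eta>(1) by simp
  qed
qed

end

section \<open>Passage to a version with continuous paths\<close>

lemma langevin_eq_ou:
  assumes z: "continuous_on {0..} z" and y: "\<And>t. t \<ge> 0 \<Longrightarrow> y integrable_on {0..t}"
    and e: "\<And>t. t \<ge> 0 \<Longrightarrow> y t = - \<kappa> * integral {0..t} y + z t" and t: "t \<ge> 0"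
  shows "y t = ou \<kappa> z t"
proof -
  \<comment> \<open>About \<open>y\<close> only integrability is assumed; its indefinite integral is
    continuous, and the equation then makes \<open>y\<close> itself continuous.\<close>
  have "continuous_on {0..} (\<lambda>t. integral {0..t} y)"
    unfolding continuous_on_eq_continuous_within
  proof
    fix u :: real assume "u \<in> {0..}"
    then have u: "u \<ge> 0" by simp
    have "at u within {0..} = at u within {0..u + 1}"
      by (rule at_within_nhd[of _ "{..<u + 1}"]) auto
    moreover have "continuous (at u within {0..u + 1}) (\<lambda>t. integral {0..t} y)"
      using indefinite_integral_continuous_1[OF y[of "u + 1"]] u by (simp add: continuous_on_eq_continuous_within)
    ultimately show "continuous (at u within {0..}) (\<lambda>t. integral {0..t} y)" by simp
  qed
  then have "continuous_on {0..} (\<lambda>t. - \<kappa> * integral {0..t} y + z t)" using z by (intro continuous_intros)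
  then have "continuous_on {0..} y" by (rule continuous_on_eq) (use e in auto)
  then show ?thesis by (rule ou_unique_integral[OF z _ _ t]) (use e in fastforce)
qed

lemma centered_gaussian_AE_cong:
  assumes Y: "centered_gaussian M Y" and Z: "Z \<in> borel_measurable M" and e: "AE \<omega> in M. Z \<omega> = Y \<omega>"
  shows "centered_gaussian M Z"
proof -
  have Ym: "Y \<in> borel_measurable M" using Y by (simp add: centered_gaussian_def)
  have "distr M lborel Z = distr M lborel Y" by (rule distr_cong_AE) (use e Ym Z in auto)
  then have "distributed M lborel Z f" if "distributed M lborel Y f" for f using that Z by (simp add: distributed_def)
  moreover have "AE \<omega> in M. Z \<omega> = 0" if "AE \<omega> in M. Y \<omega> = 0" using that e by eventually_elim simp
  ultimately show ?thesis using Y Z unfolding centered_gaussian_def by blast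
qed

theorem theorem12:
  fixes M :: "'a measure" and B V X :: "real \<Rightarrow> 'a \<Rightarrow> real"
    and H \<theta> \<rho> \<alpha> :: real and \<Delta> :: "nat \<Rightarrow> real"
  assumes "prob_space M" and "complete_measure M" and "generated_by_process M B"
    and "1/2 < H" and "H < 1"
    and "fractional_brownian_motion M H B"
    and "\<theta> > 0" and "\<rho> > 0" and "\<theta> \<noteq> \<rho>"
    and "solves_langevin M \<rho> B V"
    and "solves_langevin M \<theta> V X"
    and "\<And>n. n \<ge> 1 \<Longrightarrow> \<Delta> n > 0"
    and "filterlim (\<lambda>n. real n * \<Delta> n) at_top sequentially"
    and "\<alpha> < 1 / H"
    and "\<And>n. n \<ge> 1 \<Longrightarrow> \<Delta> n \<le> real n powr \<alpha>"
  shows "AE \<omega> in M. (\<lambda>n. theta_tilde M H B \<theta> \<rho> V X \<Delta> n \<omega>) \<longlonglongrightarrow> \<theta> + \<rho>"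
proof -
  interpret prob_space M by fact
  note fB = assms(6)[unfolded fractional_brownian_motion_def]
  have Bg: "centered_gaussian M (\<lambda>\<omega>. \<Sum>t\<in>J. c t * B t \<omega>)" if "finite J" "J \<subseteq> {0..}" for J c
    using fB that by blast
  have Bm: "B t \<in> borel_measurable M" if "t \<ge> 0" for t
    using Bg[of "{t}" "\<lambda>_. 1"] that by (simp add: centered_gaussian_def)
  have lV: "AE \<omega> in M. V 0 \<omega> = 0 \<and> (\<forall>t\<ge>0. (\<lambda>s. V s \<omega>) integrable_on {0..t} \<and> V t \<omega> = - \<rho> * integral {0..t} (\<lambda>s. V s \<omega>) + B t \<omega>)"
    using assms(10) by (simp add: solves_langevin_def)
  have lX: "AE \<omega> in M. X 0 \<omega> = 0 \<and> (\<forall>t\<ge>0. (\<lambda>s. X s \<omega>) integrable_on {0..t} \<and> X t \<omega> = - \<theta> * integral {0..t} (\<lambda>s. X s \<omega>) + V t \<omega>)"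
    using assms(11) by (simp add: solves_langevin_def)
  have "AE \<omega> in M. continuous_on {0..} (\<lambda>t. B t \<omega>)" using fB by blast
  \<comment> \<open>B 0 = 0 is read off from the equation for V at time 0, where the integral
    vanishes.\<close>
  then have "AE \<omega> in M. continuous_on {0..} (\<lambda>t. B t \<omega>) \<and> B 0 \<omega> = 0" using lV
  proof eventually_elim
    case (elim \<omega>)
    then have "V 0 \<omega> = - \<rho> * integral {0..0} (\<lambda>s. V s \<omega>) + B 0 \<omega>" by blast
    then show ?case using elim by simp
  qed
  then obtain N where N: "N \<in> sets M" "emeasure M N = 0"
    and good: "\<And>\<omega>. \<omega> \<in> space M - N \<Longrightarrow> continuous_on {0..} (\<lambda>t. B t \<omega>) \<and> B 0 \<omega> = 0"
    by (rule AE_E) blast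
  \<comment> \<open>W vanishes on the null set and at negative times. Thus every path is continuous
    on the half-line and starts at 0, and finite combinations are Gaussian for arbitrary real times,
    as \<open>gaussian_closure\<close> admits them.\<close>
  define W where "W t \<omega> = (if \<omega> \<in> space M - N \<and> t \<ge> 0 then B t \<omega> else 0)" for t \<omega>
  have Wm: "W t \<in> borel_measurable M" for t
  proof (cases "t \<ge> 0")
    case True
    have "(\<lambda>\<omega>. if \<omega> \<in> space M - N then B t \<omega> else 0) \<in> borel_measurable M"
      using N by (intro measurable_If_set Bm True) auto
    then show ?thesis using True by (simp add: W_def[abs_def])
  qed (simp add: W_def[abs_def])
  have "AE \<omega> in M. \<omega> \<notin> N" using N by (intro AE_not_in) (auto simp: null_sets_def)
  then have BW: "AE \<omega> in M. \<forall>t\<ge>0. B t \<omega> = W t \<omega>" using AE_space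
    by eventually_elim (simp add: W_def)
  have lin: "centered_gaussian M (\<lambda>\<omega>. \<Sum>t\<in>J. c t * W t \<omega>)" if J: "finite J" for J c
  proof (rule centered_gaussian_AE_cong)
    show "centered_gaussian M (\<lambda>\<omega>. \<Sum>t\<in>J \<inter> {0..}. c t * B t \<omega>)" by (rule Bg) (use J in auto)
    show "(\<lambda>\<omega>. \<Sum>t\<in>J. c t * W t \<omega>) \<in> borel_measurable M" by (intro borel_measurable_sum borel_measurable_times Wm) auto
    show "AE \<omega> in M. (\<Sum>t\<in>J. c t * W t \<omega>) = (\<Sum>t\<in>J \<inter> {0..}. c t * B t \<omega>)" using BW
    proof eventually_elim
      case (elim \<omega>)
      have "(\<Sum>t\<in>J \<inter> {0..}. c t * B t \<omega>) = (\<Sum>t\<in>J \<inter> {0..}. c t * W t \<omega>)" using elim by (intro sum.cong) auto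
      also have "\<dots> = (\<Sum>t\<in>J. c t * W t \<omega>)" by (rule sum.mono_neutral_left) (use J in \<open>auto simp: W_def\<close>)
      finally show ?case ..
    qed
  qed
  interpret S: gaussian_space M "gaussian_closure M W" by (rule gaussian_space_gaussian_closure[OF lin])
  interpret G: fbm_ou M "gaussian_closure M W" H W \<theta> \<rho>
  proof unfold_locales
    have "continuous_on {0..} (\<lambda>t. W t \<omega>)" for \<omega>
    proof (cases "\<omega> \<in> space M - N")
      case True
      then show ?thesis by (intro continuous_on_eq[OF conjunct1[OF good[OF True]]]) (simp add: W_def)
    next
      case False
      then have "W t \<omega> = 0" for t by (auto simp: W_def)
      then show ?thesis by simp
    qed
    then show "S.process W" unfolding S.process_def using gaussian_closure_base[OF lin] by blast
    show "W 0 \<omega> = 0" for \<omega> using good by (auto simp: W_def)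
    fix t s :: real assume ts: "t \<ge> 0" "s \<ge> 0"
    have "expectation (\<lambda>\<omega>. W t \<omega> * W s \<omega>) = expectation (\<lambda>\<omega>. B t \<omega> * B s \<omega>)"
      by (rule integral_cong_AE) (use BW ts Wm Bm in \<open>auto elim!: eventually_mono\<close>)
    also have "\<dots> = fbm_cov H t s" unfolding fbm_cov_def using fB ts by blast
    finally show "expectation (\<lambda>\<omega>. W t \<omega> * W s \<omega>) = fbm_cov H t s" .
  qed (use assms in auto)
  have VV: "AE \<omega> in M. \<forall>t\<ge>0. V t \<omega> = G.V t \<omega>" using BW lV
  proof eventually_elim
    case (elim \<omega>)
    show ?case
    proof (intro allI impI)
      fix t :: real assume t: "t \<ge> 0"
      show "V t \<omega> = G.V t \<omega>" unfolding G.V_def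
        by (rule langevin_eq_ou[OF S.processD(2)[OF G.W] _ _ t]) (use elim in auto)
    qed
  qed
  have XX: "AE \<omega> in M. \<forall>t\<ge>0. X t \<omega> = G.X t \<omega>" using VV lX
  proof eventually_elim
    case (elim \<omega>)
    show ?case
    proof (intro allI impI)
      fix t :: real assume t: "t \<ge> 0"
      show "X t \<omega> = G.X t \<omega>" unfolding G.X_def
        by (rule langevin_eq_ou[OF G.V_cont _ _ t]) (use elim in auto)
    qed
  qed
  \<comment> \<open>The index 0 is included: there the product is 0 whatever
    \<open>\<Delta> 0\<close> is.\<close>
  have T0: "real n * \<Delta> n \<ge> 0" for n using assms(12)[of n] by (cases "n = 0") auto
  \<comment> \<open>Each Skorohod integral is determined only up to a null set of its own; countably
    many horizons share one.\<close>
  have "AE \<omega> in M. \<forall>n. skorohod_integral M H B (real n * \<Delta> n) X \<omega> = G.skor (real n * \<Delta> n) \<omega>"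
    unfolding AE_all_countable by (intro allI G.skorohod_integral_skor assms T0 Bm BW XX)
  moreover have "AE \<omega> in M. (\<lambda>n. - ((1 / (real n * \<Delta> n)) * ((G.X (real n * \<Delta> n) \<omega>)\<^sup>2 / 2 - expectation (G.chaos (real n * \<Delta> n))))
    / ((1 / real n) * (\<Sum>i<n. (G.X (real i * \<Delta> n) \<omega>)\<^sup>2))) \<longlonglongrightarrow> \<theta> + \<rho>"
    by (rule G.estimator_limit[OF assms(12) assms(13)])
  ultimately show ?thesis using XX VV
  proof eventually_elim
    case (elim \<omega>)
    have "theta_tilde M H B \<theta> \<rho> V X \<Delta> n \<omega> = - ((1 / (real n * \<Delta> n)) * ((G.X (real n * \<Delta> n) \<omega>)\<^sup>2 / 2 - expectation (G.chaos (real n * \<Delta> n))))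
      / ((1 / real n) * (\<Sum>i<n. (G.X (real i * \<Delta> n) \<omega>)\<^sup>2))" for n
    proof -
      let ?T = "real n * \<Delta> n"
      have "integral {0..?T} (\<lambda>t. (X t \<omega>)\<^sup>2) = integral {0..?T} (\<lambda>t. (G.X t \<omega>)\<^sup>2)"
        "integral {0..?T} (\<lambda>t. X t \<omega> * V t \<omega>) = integral {0..?T} (\<lambda>t. G.X t \<omega> * G.V t \<omega>)"
        using elim by (auto intro!: Henstock_Kurzweil_Integration.integral_cong)
      \<comment> \<open>By \<open>chaos_eq\<close> the drift integrals in the integral against X
        cancel those in \<open>skor\<close>, and X^2/2 minus the mean of the chaos remains.\<close>
      then have 1: "skorohod_integral_X M H B \<theta> \<rho> V X ?T \<omega> = (G.X ?T \<omega>)\<^sup>2 / 2 - expectation (G.chaos ?T)"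
        using elim unfolding skorohod_integral_X_def by (simp add: G.skor_def G.chaos_eq[OF T0])
      have "X (real i * \<Delta> n) \<omega> = G.X (real i * \<Delta> n) \<omega>" if "i < n" for i
        using elim assms(12)[of n] that by simp
      then have e: "(\<Sum>i<n. (G.X (real i * \<Delta> n) \<omega>)\<^sup>2) = (\<Sum>i<n. (X (real i * \<Delta> n) \<omega>)\<^sup>2)" by (intro sum.cong) auto
      have 2: "Q_stat \<Delta> X n \<omega> = (1 / real n) * (\<Sum>i<n. (G.X (real i * \<Delta> n) \<omega>)\<^sup>2)"
      proof -
        have "(\<Sum>i=1..n. (X (real (i - 1) * \<Delta> n) \<omega>)\<^sup>2) = (\<Sum>i<n. (X (real i * \<Delta> n) \<omega>)\<^sup>2)"
          by (rule sum.reindex_bij_witness[of _ Suc "\<lambda>i. i - 1"]) auto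
        then show ?thesis unfolding Q_stat_def e by (simp only:)
      qed
      show ?thesis unfolding theta_tilde_def 1 2 ..
    qed
    then show ?case using elim by simp
  qed
qed

end
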